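(* Let $(\mathfrak{g}^{\mathbb{C}},\theta)$ be a $\mathbb{Z}_m$-graded complex semisimple Lie algebra with compatible real structures on $\mathfrak{g}^{\mathbb{C}}$, $G$ and $\widehat{G}$ as described in the context, and real graded components $\mathfrak{g}_i$. Let $\mathfrak{h}$ be a fixed Cartan subspace in $\mathfrak{g}_1$, let $\mathfrak{h}^{\mathbb{C}}\subset\mathfrak{g}_1^{\mathbb{C}}$ be its complex span, and set $\mathcal{N}_0=\mathcal{N}_{\widehat{G}}(\mathfrak{h}^{\mathbb{C}})=\{g\in\widehat{G}\mid g(\mathfrak{h}^{\mathbb{C}})=\mathfrak{h}^{\mathbb{C}}\}$. Then there is a bijection between the $\widehat{G}(\mathbb{R})$-conjugacy classes of Cartan subspaces in $\mathfrak{g}_1$ and the kernel $\ker[\mathrm{H}^1\mathcal{N}_0\to\mathrm{H}^1\widehat{G}]$.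
   Context: $\mathbb{Z}_m=\mathbb{Z}/m\mathbb{Z}$. $\mathfrak{g}^{\mathbb{C}}=\bigoplus_{i\in\mathbb{Z}_m}\mathfrak{g}^{\mathbb{C}}_i$ is a complex semisimple Lie algebra with a $\mathbb{Z}_m$-grading; $\theta$ is the corresponding automorphism of order $m$, $\theta(x)=\omega^i x$ for $x\in\mathfrak{g}^{\mathbb{C}}_i$, with $\omega$ a primitive $m$-th root of unity. $G$ is the identity component of $\mathrm{Aut}(\mathfrak{g}^{\mathbb{C}})$, and $G_0\subset G$ is the connected (reductive) subgroup with Lie algebra $\mathfrak{g}^{\mathbb{C}}_0$; it acts on $\mathfrak{g}^{\mathbb{C}}_1$. $\widehat{G}$ is a reductive complex algebraic group with a surjective morphism $\psi:\widehat{G}\to G_0$ whose differential is an isomorphism onto $\mathfrak{g}_0^{\mathbb{C}}$; $\widehat{G}$ acts on $\mathfrak{g}_1^{\mathbb{C}}$ by $g\cdot x=\psi(g)\cdot x$. Real structure: $\mathfrak{g}$ is a real form of $\mathfrak{g}^{\mathbb{C}}$ with associated conjugation $\sigma$ (conjugate-linear, involutive, preserving the bracket), assumed to leave every $\mathfrak{g}_i^{\mathbb{C}}$ invariant; $\mathfrak{g}_i=(\mathfrak{g}_i^{\mathbb{C}})^\sigma$. It induces an antiregular involution $\sigma$ of $G$ (satisfying $\sigma(\exp(\mathrm{ad}\,x))=\exp(\mathrm{ad}\,\sigma(x))$ for nilpotent $x$), preserving $G_0$. (An involution $\sigma$ of an algebraic group $H$ is antiregular if for every regular function $f$ on $H$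 the function $g\mapsto\overline{f(\sigma(g))}$ is regular.) $\widehat{G}$ is also equipped with an antiregular involution $\sigma$, and $\psi$ commutes with the involutions. $\Gamma=\mathrm{Gal}(\mathbb{C}/\mathbb{R})=\{1,\gamma\}$ acts on all these objects by letting $\gamma$ act as $\sigma$, written ${}^\gamma g$, ${}^\gamma x$. $\widehat{G}(\mathbb{R})=\widehat{G}^\sigma$ acts on $\mathfrak{g}_1$. An element $x$ is semisimple if $\mathrm{ad}\,x$ is. A Cartan subspace of $\mathfrak{g}_1$ (respectively $\mathfrak{g}_1^{\mathbb{C}}$) is a maximal subspace consisting of commuting semisimple elements. Galois cohomology: for a group $\mathcal{G}$ on which $\Gamma$ acts by automorphisms, a cocycle is $g\in\mathcal{G}$ with $g\,{}^\gamma g=1$; cocycles $g_1,g_2$ are equivalent if $g_1=h^{-1}g_2\,{}^\gamma h$ for some $h\in\mathcal{G}$; $\mathrm{H}^1\mathcal{G}$ is the set of equivalence classes. The map $\mathrm{H}^1\mathcal{N}_0\to\mathrm{H}^1\widehat{G}$ is induced by inclusion, and its kernel is the set of classes mapped to the class of $1$. *)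

theory Defs
  imports "HOL-Algebra.Coset" "HOL-Analysis.Abstract_Topological_Spaces"
begin

section \<open>Affine algebraic groups over the complex numbers\<close>

text \<open>
  An affine variety is a set \<open>X\<close> of points together with its algebra \<open>A\<close> of regular functions:
  a finitely generated algebra of complex-valued functions on \<open>X\<close> such that \<open>X\<close> is the set of all
  algebra homomorphisms from \<open>A\<close> to the complex numbers. Functions on \<open>X\<close> are represented by
  elements of \<open>extensional X\<close>.
\<close>

inductive_set generated_algebra :: "'x set \<Rightarrow> ('x \<Rightarrow> complex) set \<Rightarrow> ('x \<Rightarrow> complex) set"
  for X :: "'x set" and S :: "('x \<Rightarrow> complex) set" where
  gen: "f \<in> S \<Longrightarrow> restrict f X \<in> generated_algebra X S"
| const: "(\<lambda>x\<in>X. c) \<in> generated_algebra X S"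
| add: "f \<in> generated_algebra X S \<Longrightarrow> g \<in> generated_algebra X S
    \<Longrightarrow> (\<lambda>x\<in>X. f x + g x) \<in> generated_algebra X S"
| mult: "f \<in> generated_algebra X S \<Longrightarrow> g \<in> generated_algebra X S
    \<Longrightarrow> (\<lambda>x\<in>X. f x * g x) \<in> generated_algebra X S"

definition algebra_character ::
    "'x set \<Rightarrow> ('x \<Rightarrow> complex) set \<Rightarrow> (('x \<Rightarrow> complex) \<Rightarrow> complex) \<Rightarrow> bool" where
  "algebra_character X A \<xi> \<longleftrightarrow>
     (\<forall>c. \<xi> (\<lambda>x\<in>X. c) = c) \<and>
     (\<forall>f\<in>A. \<forall>g\<in>A. \<xi> (\<lambda>x\<in>X. f x + g x) = \<xi> f + \<xi> g) \<and>
     (\<forall>f\<in>A. \<forall>g\<in>A. \<xi> (\<lambda>x\<in>X. f x * g x) = \<xi> f * \<xi> g)"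

definition affine_variety :: "'x set \<Rightarrow> ('x \<Rightarrow> complex) set \<Rightarrow> bool" where
  "affine_variety X A \<longleftrightarrow>
     (\<exists>F. finite F \<and> A = generated_algebra X F) \<and>
     (\<forall>\<xi>. algebra_character X A \<xi> \<longrightarrow> (\<exists>!x. x \<in> X \<and> (\<forall>f\<in>A. \<xi> f = f x)))"

definition regular_map ::
    "'x set \<Rightarrow> ('x \<Rightarrow> complex) set \<Rightarrow> 'y set \<Rightarrow> ('y \<Rightarrow> complex) set \<Rightarrow> ('x \<Rightarrow> 'y) \<Rightarrow> bool" where
  "regular_map X A Y B \<phi> \<longleftrightarrow> \<phi> \<in> X \<rightarrow> Y \<and> (\<forall>f\<in>B. (\<lambda>x\<in>X. f (\<phi> x)) \<in> A)"

text \<open>The regular functions on a product are the finite sums of products \<open>f x * g y\<close>.\<close>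

definition product_algebra ::
    "'x set \<Rightarrow> ('x \<Rightarrow> complex) set \<Rightarrow> 'y set \<Rightarrow> ('y \<Rightarrow> complex) set \<Rightarrow> ('x \<times> 'y \<Rightarrow> complex) set" where
  "product_algebra X A Y B =
     generated_algebra (X \<times> Y) ({\<lambda>p. f (fst p) | f. f \<in> A} \<union> {\<lambda>p. g (snd p) | g. g \<in> B})"

definition zariski :: "'x set \<Rightarrow> ('x \<Rightarrow> complex) set \<Rightarrow> 'x topology" where
  "zariski X A = topology_generated_by {{x \<in> X. f x \<noteq> 0} | f. f \<in> A}"

definition affine_algebraic_group :: "('g, 'b) monoid_scheme \<Rightarrow> ('g \<Rightarrow> complex) set \<Rightarrow> bool" where
  "affine_algebraic_group G A \<longleftrightarrow>
     group G \<and> affine_variety (carrier G) A \<and>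
     regular_map (carrier G \<times> carrier G) (product_algebra (carrier G) A (carrier G) A)
       (carrier G) A (\<lambda>(x, y). x \<otimes>\<^bsub>G\<^esub> y) \<and>
     regular_map (carrier G) A (carrier G) A (\<lambda>x. inv\<^bsub>G\<^esub> x)"

text \<open>
  An element is unipotent if right translation by it is a locally unipotent operator on the
  algebra of regular functions.
\<close>

definition unipotent_element ::
    "('g, 'b) monoid_scheme \<Rightarrow> ('g \<Rightarrow> complex) set \<Rightarrow> 'g \<Rightarrow> bool" where
  "unipotent_element G A u \<longleftrightarrow>
     (\<forall>f\<in>A. \<exists>n::nat. ((\<lambda>h. \<lambda>x\<in>carrier G. h (x \<otimes>\<^bsub>G\<^esub> u) - h x) ^^ n) f = (\<lambda>x\<in>carrier G. 0))"

text \<open>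
  A reductive group is one with trivial unipotent radical; it need not be connected.
\<close>

definition reductive_group :: "('g, 'b) monoid_scheme \<Rightarrow> ('g \<Rightarrow> complex) set \<Rightarrow> bool" where
  "reductive_group G A \<longleftrightarrow>
     affine_algebraic_group G A \<and>
     (\<forall>U. normal U G \<and> closedin (zariski (carrier G) A) U \<and> connectedin (zariski (carrier G) A) U \<and>
          (\<forall>u\<in>U. unipotent_element G A u) \<longrightarrow> U = {\<one>\<^bsub>G\<^esub>})"

definition antiregular_involution ::
    "('g, 'b) monoid_scheme \<Rightarrow> ('g \<Rightarrow> complex) set \<Rightarrow> ('g \<Rightarrow> 'g) \<Rightarrow> bool" where
  "antiregular_involution G A \<tau> \<longleftrightarrow>
     \<tau> \<in> hom G G \<and> (\<forall>g\<in>carrier G. \<tau> (\<tau> g) = g) \<and>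
     (\<forall>f\<in>A. (\<lambda>g\<in>carrier G. cnj (f (\<tau> g))) \<in> A)"

text \<open>
  Tangent vectors at \<open>p\<close> are the point derivations of \<open>A\<close> at \<open>p\<close>; linearity over the complex
  numbers follows from the Leibniz rule, additivity and the vanishing on constants.
\<close>

definition tangent_space ::
    "'x set \<Rightarrow> ('x \<Rightarrow> complex) set \<Rightarrow> 'x \<Rightarrow> (('x \<Rightarrow> complex) \<Rightarrow> complex) set" where
  "tangent_space X A p = {D. D \<in> extensional A \<and>
     (\<forall>c. D (\<lambda>x\<in>X. c) = 0) \<and>
     (\<forall>f\<in>A. \<forall>g\<in>A. D (\<lambda>x\<in>X. f x + g x) = D f + D g) \<and>
     (\<forall>f\<in>A. \<forall>g\<in>A. D (\<lambda>x\<in>X. f x * g x) = D f * g p + f p * D g)}"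

definition differential ::
    "'x set \<Rightarrow> ('y \<Rightarrow> complex) set \<Rightarrow> ('x \<Rightarrow> 'y) \<Rightarrow>
      (('x \<Rightarrow> complex) \<Rightarrow> complex) \<Rightarrow> ('y \<Rightarrow> complex) \<Rightarrow> complex" where
  "differential X B \<phi> D = (\<lambda>f\<in>B. D (\<lambda>x\<in>X. f (\<phi> x)))"


section \<open>Linear groups\<close>

definition general_linear ::
    "(complex \<Rightarrow> 'v::ab_group_add \<Rightarrow> 'v) \<Rightarrow> ('v \<Rightarrow> 'v) monoid" where
  "general_linear sc =
     \<lparr>carrier = {g. Vector_Spaces.linear sc sc g \<and> bij g}, monoid.mult = (\<circ>), one = id\<rparr>"

text \<open>
  Regular functions on a subset \<open>H\<close> of the general linear group: polynomials in the matrix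
  coefficients \<open>g \<mapsto> l (g v)\<close> of \<open>g\<close> and of its inverse (equivalently, in those of \<open>g\<close> and the
  inverse of the determinant), restricted to \<open>H\<close>.
\<close>

definition linear_regular ::
    "(complex \<Rightarrow> 'v::ab_group_add \<Rightarrow> 'v) \<Rightarrow> ('v \<Rightarrow> 'v) set \<Rightarrow> (('v \<Rightarrow> 'v) \<Rightarrow> complex) set" where
  "linear_regular sc H = generated_algebra H
     ({\<lambda>g. l (g v) | l v. Vector_Spaces.linear sc (*) l} \<union>
      {\<lambda>g. l (inv_into UNIV g v) | l v. Vector_Spaces.linear sc (*) l})"

text \<open>
  The Lie algebra of a linear group \<open>H\<close>, as a set of endomorphisms: \<open>T\<close> corresponds to the tangent
  vector at the identity that maps each matrix coefficient \<open>g \<mapsto> l (g v)\<close> to \<open>l (T v)\<close>.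
\<close>

definition linear_group_lie_algebra ::
    "(complex \<Rightarrow> 'v::ab_group_add \<Rightarrow> 'v) \<Rightarrow> ('v \<Rightarrow> 'v) set \<Rightarrow> ('v \<Rightarrow> 'v) set" where
  "linear_group_lie_algebra sc H = {T. Vector_Spaces.linear sc sc T \<and>
     (\<exists>D\<in>tangent_space H (linear_regular sc H) id.
        \<forall>l v. Vector_Spaces.linear sc (*) l \<longrightarrow> D (\<lambda>g\<in>H. l (g v)) = l (T v))}"


section \<open>Semisimple Lie algebras, gradings and real structures\<close>

definition complex_lie_algebra ::
    "(complex \<Rightarrow> 'v::ab_group_add \<Rightarrow> 'v) \<Rightarrow> ('v \<Rightarrow> 'v \<Rightarrow> 'v) \<Rightarrow> bool" where
  "complex_lie_algebra sc br \<longleftrightarrow>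
     vector_space sc \<and>
     (\<exists>B. finite B \<and> module.span sc B = UNIV) \<and>
     (\<forall>x. Vector_Spaces.linear sc sc (\<lambda>y. br x y)) \<and>
     (\<forall>y. Vector_Spaces.linear sc sc (\<lambda>x. br x y)) \<and>
     (\<forall>x. br x x = 0) \<and>
     (\<forall>x y z. br x (br y z) + br y (br z x) + br z (br x y) = 0)"

definition lie_ideal ::
    "(complex \<Rightarrow> 'v::ab_group_add \<Rightarrow> 'v) \<Rightarrow> ('v \<Rightarrow> 'v \<Rightarrow> 'v) \<Rightarrow> 'v set \<Rightarrow> bool" where
  "lie_ideal sc br I \<longleftrightarrow> module.subspace sc I \<and> (\<forall>x. \<forall>y\<in>I. br x y \<in> I)"

definition derived_algebra ::
    "(complex \<Rightarrow> 'v::ab_group_add \<Rightarrow> 'v) \<Rightarrow> ('v \<Rightarrow> 'v \<Rightarrow> 'v) \<Rightarrow> 'v set \<Rightarrow> 'v set" where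
  "derived_algebra sc br I = module.span sc {br x y | x y. x \<in> I \<and> y \<in> I}"

definition solvable_algebra ::
    "(complex \<Rightarrow> 'v::ab_group_add \<Rightarrow> 'v) \<Rightarrow> ('v \<Rightarrow> 'v \<Rightarrow> 'v) \<Rightarrow> 'v set \<Rightarrow> bool" where
  "solvable_algebra sc br I \<longleftrightarrow> (\<exists>n. (derived_algebra sc br ^^ n) I = {0})"

definition semisimple_lie_algebra ::
    "(complex \<Rightarrow> 'v::ab_group_add \<Rightarrow> 'v) \<Rightarrow> ('v \<Rightarrow> 'v \<Rightarrow> 'v) \<Rightarrow> bool" where
  "semisimple_lie_algebra sc br \<longleftrightarrow> complex_lie_algebra sc br \<and>
     (\<forall>I. lie_ideal sc br I \<and> solvable_algebra sc br I \<longrightarrow> I = {0})"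

text \<open>A grading by the integers modulo \<open>m\<close> is encoded as an \<open>m\<close>-periodic family indexed by \<open>int\<close>.\<close>

definition cyclic_grading ::
    "(complex \<Rightarrow> 'v::ab_group_add \<Rightarrow> 'v) \<Rightarrow> ('v \<Rightarrow> 'v \<Rightarrow> 'v) \<Rightarrow> nat \<Rightarrow> (int \<Rightarrow> 'v set) \<Rightarrow> bool" where
  "cyclic_grading sc br m gr \<longleftrightarrow>
     0 < m \<and>
     (\<forall>i. gr (i + int m) = gr i) \<and>
     (\<forall>i. module.subspace sc (gr i)) \<and>
     (\<forall>i j. \<forall>x\<in>gr i. \<forall>y\<in>gr j. br x y \<in> gr (i + j)) \<and>
     (\<forall>x. \<exists>!c. c \<in> (\<Pi>\<^sub>E i\<in>{0..<int m}. gr i) \<and> x = (\<Sum>i\<in>{0..<int m}. c i))"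

definition lie_automorphisms ::
    "(complex \<Rightarrow> 'v::ab_group_add \<Rightarrow> 'v) \<Rightarrow> ('v \<Rightarrow> 'v \<Rightarrow> 'v) \<Rightarrow> ('v \<Rightarrow> 'v) set" where
  "lie_automorphisms sc br =
     {g \<in> carrier (general_linear sc). \<forall>x y. g (br x y) = br (g x) (g y)}"

definition grading_automorphism ::
    "(complex \<Rightarrow> 'v::ab_group_add \<Rightarrow> 'v) \<Rightarrow> ('v \<Rightarrow> 'v \<Rightarrow> 'v) \<Rightarrow> nat \<Rightarrow> (int \<Rightarrow> 'v set) \<Rightarrow>
      complex \<Rightarrow> ('v \<Rightarrow> 'v) \<Rightarrow> bool" where
  "grading_automorphism sc br m gr \<omega> \<theta> \<longleftrightarrow>
     \<omega> ^ m = 1 \<and> (\<forall>k. 0 < k \<and> k < m \<longrightarrow> \<omega> ^ k \<noteq> 1) \<and>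
     \<theta> \<in> lie_automorphisms sc br \<and>
     \<theta> ^^ m = id \<and> (\<forall>k. 0 < k \<and> k < m \<longrightarrow> \<theta> ^^ k \<noteq> id) \<and>
     (\<forall>i. \<forall>x\<in>gr i. \<theta> x = sc (\<omega> powi i) x)"

definition inner_group ::
    "(complex \<Rightarrow> 'v::ab_group_add \<Rightarrow> 'v) \<Rightarrow> ('v \<Rightarrow> 'v \<Rightarrow> 'v) \<Rightarrow> ('v \<Rightarrow> 'v) set" where
  "inner_group sc br =
     connected_component_of_set
       (zariski (lie_automorphisms sc br) (linear_regular sc (lie_automorphisms sc br))) id"

text \<open>The subgroup of \<open>inner_group\<close> with Lie algebra \<open>s\<close>, identified with \<open>ad s\<close>.\<close>

definition connected_subgroup_with_lie_algebra ::
    "(complex \<Rightarrow> 'v::ab_group_add \<Rightarrow> 'v) \<Rightarrow> ('v \<Rightarrow> 'v \<Rightarrow> 'v) \<Rightarrow> 'v set \<Rightarrow> ('v \<Rightarrow> 'v) set \<Rightarrow> bool" where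
  "connected_subgroup_with_lie_algebra sc br s H \<longleftrightarrow>
     H \<subseteq> inner_group sc br \<and>
     subgroup H (general_linear sc) \<and>
     closedin (zariski (inner_group sc br) (linear_regular sc (inner_group sc br))) H \<and>
     connectedin (zariski (inner_group sc br) (linear_regular sc (inner_group sc br))) H \<and>
     linear_group_lie_algebra sc H = br ` s"

definition real_structure ::
    "(complex \<Rightarrow> 'v::ab_group_add \<Rightarrow> 'v) \<Rightarrow> ('v \<Rightarrow> 'v \<Rightarrow> 'v) \<Rightarrow> ('v \<Rightarrow> 'v) \<Rightarrow> bool" where
  "real_structure sc br \<sigma> \<longleftrightarrow>
     (\<forall>x y. \<sigma> (x + y) = \<sigma> x + \<sigma> y) \<and>
     (\<forall>c x. \<sigma> (sc c x) = sc (cnj c) (\<sigma> x)) \<and>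
     (\<forall>x. \<sigma> (\<sigma> x) = x) \<and>
     (\<forall>x y. \<sigma> (br x y) = br (\<sigma> x) (\<sigma> y))"

definition real_points :: "('v \<Rightarrow> 'v) \<Rightarrow> 'v set \<Rightarrow> 'v set" where
  "real_points \<sigma> S = {x \<in> S. \<sigma> x = x}"

definition induced_involution :: "('v \<Rightarrow> 'v) \<Rightarrow> ('v \<Rightarrow> 'v) \<Rightarrow> ('v \<Rightarrow> 'v)" where
  "induced_involution \<sigma> g = \<sigma> \<circ> g \<circ> \<sigma>"

text \<open>
  The data of a covering \<open>\<psi>\<close> of the linear group \<open>H\<close> by a reductive group \<open>Gh\<close> with antiregular
  involution \<open>\<tau>\<close>. The differential is compared with the tangent space of \<open>H\<close> at the identity, which
  \<open>connected_subgroup_with_lie_algebra\<close> identifies with a subalgebra of the given Lie algebra; being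
  the differential of a group homomorphism, it is a Lie algebra isomorphism as soon as it is
  bijective.
\<close>

definition real_reductive_cover ::
    "(complex \<Rightarrow> 'v::ab_group_add \<Rightarrow> 'v) \<Rightarrow> ('v \<Rightarrow> 'v) \<Rightarrow> ('v \<Rightarrow> 'v) set \<Rightarrow>
      ('g, 'b) monoid_scheme \<Rightarrow> ('g \<Rightarrow> complex) set \<Rightarrow> ('g \<Rightarrow> 'g) \<Rightarrow> ('g \<Rightarrow> 'v \<Rightarrow> 'v) \<Rightarrow> bool" where
  "real_reductive_cover sc \<sigma> H Gh A \<tau> \<psi> \<longleftrightarrow>
     reductive_group Gh A \<and>
     antiregular_involution Gh A \<tau> \<and>
     \<psi> \<in> hom Gh (general_linear sc\<lparr>carrier := H\<rparr>) \<and>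
     \<psi> ` carrier Gh = H \<and>
     regular_map (carrier Gh) A H (linear_regular sc H) \<psi> \<and>
     bij_betw (differential (carrier Gh) (linear_regular sc H) \<psi>)
       (tangent_space (carrier Gh) A \<one>\<^bsub>Gh\<^esub>) (tangent_space H (linear_regular sc H) id) \<and>
     (\<forall>g\<in>carrier Gh. \<psi> (\<tau> g) = induced_involution \<sigma> (\<psi> g))"


section \<open>Cartan subspaces\<close>

definition semisimple_element ::
    "(complex \<Rightarrow> 'v::ab_group_add \<Rightarrow> 'v) \<Rightarrow> ('v \<Rightarrow> 'v \<Rightarrow> 'v) \<Rightarrow> 'v \<Rightarrow> bool" where
  "semisimple_element sc br x \<longleftrightarrow>
     (\<exists>B. \<not> module.dependent sc B \<and> module.span sc B = UNIV \<and> (\<forall>v\<in>B. \<exists>c. br x v = sc c v))"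

definition commuting_semisimple_subspace ::
    "(complex \<Rightarrow> 'v::ab_group_add \<Rightarrow> 'v) \<Rightarrow> ('v \<Rightarrow> 'v \<Rightarrow> 'v) \<Rightarrow> 'v set \<Rightarrow> 'v set \<Rightarrow> bool" where
  "commuting_semisimple_subspace sc br W H \<longleftrightarrow>
     module.subspace (\<lambda>r::real. sc (complex_of_real r)) H \<and> H \<subseteq> W \<and>
     (\<forall>x\<in>H. semisimple_element sc br x) \<and> (\<forall>x\<in>H. \<forall>y\<in>H. br x y = 0)"

text \<open>
  Cartan subspaces of a real subspace \<open>W\<close>. Semisimplicity of a real element is tested on the
  complexification, where it means diagonalizability.
\<close>

definition real_cartan_subspace ::
    "(complex \<Rightarrow> 'v::ab_group_add \<Rightarrow> 'v) \<Rightarrow> ('v \<Rightarrow> 'v \<Rightarrow> 'v) \<Rightarrow> 'v set \<Rightarrow> 'v set \<Rightarrow> bool" where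
  "real_cartan_subspace sc br W H \<longleftrightarrow>
     commuting_semisimple_subspace sc br W H \<and>
     (\<forall>H'. commuting_semisimple_subspace sc br W H' \<and> H \<subseteq> H' \<longrightarrow> H' = H)"

definition subspace_normalizer ::
    "('g, 'b) monoid_scheme \<Rightarrow> ('g \<Rightarrow> 'v \<Rightarrow> 'v) \<Rightarrow> 'v set \<Rightarrow> 'g set" where
  "subspace_normalizer G \<psi> H = {g \<in> carrier G. \<psi> g ` H = H}"

text \<open>Classes of members of a family \<open>\<C>\<close> of subsets under a group of real points.\<close>

definition real_conjugacy_classes ::
    "('g, 'b) monoid_scheme \<Rightarrow> ('g \<Rightarrow> 'g) \<Rightarrow> ('g \<Rightarrow> 'v \<Rightarrow> 'v) \<Rightarrow> 'v set set \<Rightarrow> 'v set set set" where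
  "real_conjugacy_classes G \<tau> \<psi> \<C> =
     \<C> // {(H, H'). H \<in> \<C> \<and> H' \<in> \<C> \<and> (\<exists>g\<in>real_points \<tau> (carrier G). H' = \<psi> g ` H)}"


section \<open>Galois cohomology of the complex numbers over the reals\<close>

text \<open>The nontrivial element of the Galois group acts on the group \<open>G\<close> through \<open>\<tau>\<close>.\<close>

definition galois_cocycles :: "('g, 'b) monoid_scheme \<Rightarrow> ('g \<Rightarrow> 'g) \<Rightarrow> 'g set" where
  "galois_cocycles G \<tau> = {g \<in> carrier G. g \<otimes>\<^bsub>G\<^esub> \<tau> g = \<one>\<^bsub>G\<^esub>}"

definition cohomologous :: "('g, 'b) monoid_scheme \<Rightarrow> ('g \<Rightarrow> 'g) \<Rightarrow> ('g \<times> 'g) set" where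
  "cohomologous G \<tau> = {(g1, g2). g1 \<in> galois_cocycles G \<tau> \<and> g2 \<in> galois_cocycles G \<tau> \<and>
     (\<exists>h\<in>carrier G. g1 = inv\<^bsub>G\<^esub> h \<otimes>\<^bsub>G\<^esub> g2 \<otimes>\<^bsub>G\<^esub> \<tau> h)}"

definition galois_H1 :: "('g, 'b) monoid_scheme \<Rightarrow> ('g \<Rightarrow> 'g) \<Rightarrow> 'g set set" where
  "galois_H1 G \<tau> = galois_cocycles G \<tau> // cohomologous G \<tau>"

text \<open>For \<open>N\<close> a stable subgroup of \<open>G\<close>: the map on cohomology induced by inclusion.\<close>

definition H1_inclusion :: "('g, 'b) monoid_scheme \<Rightarrow> ('g \<Rightarrow> 'g) \<Rightarrow> 'g set \<Rightarrow> 'g set" where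
  "H1_inclusion G \<tau> C = cohomologous G \<tau> `` C"

definition H1_kernel :: "('g, 'b) monoid_scheme \<Rightarrow> ('g \<Rightarrow> 'g) \<Rightarrow> 'g set \<Rightarrow> 'g set set" where
  "H1_kernel G \<tau> N =
     {C \<in> galois_H1 (G\<lparr>carrier := N\<rparr>) \<tau>. H1_inclusion G \<tau> C = cohomologous G \<tau> `` {\<one>\<^bsub>G\<^esub>}}"


section \<open>The involution induced on the inner automorphism group\<close>

lemma real_structure_zero:
  assumes "real_structure sc br \<sigma>" shows "\<sigma> 0 = 0"
proof -
  have "\<sigma> (0 + 0) = \<sigma> 0 + \<sigma> 0" using assms unfolding real_structure_def by blast
  thus ?thesis by simp
qed

lemma real_structure_sum:
  assumes "real_structure sc br \<sigma>" shows "\<sigma> (\<Sum>i\<in>I. f i) = (\<Sum>i\<in>I. \<sigma> (f i))"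
proof (induction I rule: infinite_finite_induct)
  case (insert x F)
  then show ?case using assms unfolding real_structure_def by (simp add: insert)
qed (simp_all add: real_structure_zero[OF assms])

text \<open>For nilpotent \<open>ad x\<close> and large \<open>n\<close> the sums below are the exponentials of \<open>ad x\<close> and \<open>ad (\<sigma> x)\<close>.\<close>

lemma induced_involution_exp:
  assumes "real_structure sc br \<sigma>"
  shows "induced_involution \<sigma> (\<lambda>v. \<Sum>k<n. sc (1 / fact k) ((br x ^^ k) v)) =
         (\<lambda>v. \<Sum>k<n. sc (1 / fact k) ((br (\<sigma> x) ^^ k) v))"
proof
  fix v
  have s: "\<sigma> (sc c y) = sc (cnj c) (\<sigma> y)" "\<sigma> (\<sigma> y) = y" "\<sigma> (br y z) = br (\<sigma> y) (\<sigma> z)" for c y z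
    using assms by (auto simp: real_structure_def)
  have p: "\<sigma> ((br x ^^ k) (\<sigma> v)) = (br (\<sigma> x) ^^ k) v" for k
    by (induction k) (simp_all add: s)
  show "induced_involution \<sigma> (\<lambda>v. \<Sum>k<n. sc (1 / fact k) ((br x ^^ k) v)) v =
      (\<Sum>k<n. sc (1 / fact k) ((br (\<sigma> x) ^^ k) v))"
    by (simp add: induced_involution_def real_structure_sum[OF assms] s p)
qed

lemma induced_involution_linear:
  assumes "vector_space sc" "real_structure sc br \<sigma>" "Vector_Spaces.linear sc sc g"
  shows "Vector_Spaces.linear sc sc (induced_involution \<sigma> g)"
proof -
  interpret vector_space sc by fact
  interpret g: Vector_Spaces.linear sc sc g by fact
  show ?thesis
    using assms(2) unfolding induced_involution_def real_structure_def
    by unfold_locales (simp_all add: g.add g.scale)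
qed

lemma induced_involution_inverse:
  assumes s: "\<And>x. \<sigma> (\<sigma> x) = x" and "bij g"
  shows "bij (induced_involution \<sigma> g)"
    and "inv_into UNIV (induced_involution \<sigma> g) = induced_involution \<sigma> (inv_into UNIV g)"
proof -
  have b: "bij \<sigma>" by (rule o_bij[of \<sigma>]) (simp_all add: fun_eq_iff s)
  show "bij (induced_involution \<sigma> g)"
    unfolding induced_involution_def using b assms(2) by (simp add: bij_comp)
  show "inv_into UNIV (induced_involution \<sigma> g) = induced_involution \<sigma> (inv_into UNIV g)"
    by (rule inv_unique_comp)
       (use assms(2) in \<open>auto simp: induced_involution_def fun_eq_iff s bij_is_surj bij_is_inj surj_f_inv_f\<close>)
qed

lemma induced_involution_automorphism:
  assumes "complex_lie_algebra sc br" "real_structure sc br \<sigma>" "g \<in> lie_automorphisms sc br"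
  shows "induced_involution \<sigma> g \<in> lie_automorphisms sc br"
proof -
  have s: "\<sigma> (\<sigma> y) = y" "\<sigma> (br y z) = br (\<sigma> y) (\<sigma> z)" for y z
    using assms by (auto simp: real_structure_def)
  show ?thesis
    using assms induced_involution_linear[OF _ assms(2), of g] induced_involution_inverse(1)[of \<sigma> g]
    by (auto simp: lie_automorphisms_def general_linear_def complex_lie_algebra_def s
        induced_involution_def)
qed

lemma induced_involution_functional:
  assumes "vector_space sc" "real_structure sc br \<sigma>" "Vector_Spaces.linear sc (*) l"
  shows "Vector_Spaces.linear sc (*) (\<lambda>v. cnj (l (\<sigma> v)))"
proof -
  interpret vector_space sc by fact
  interpret l: Vector_Spaces.linear sc "(*)" l by fact
  show ?thesis
    using assms(2) unfolding real_structure_def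
    by unfold_locales (simp_all add: l.add l.scale algebra_simps)
qed

lemma induced_involution_regular:
  assumes "vector_space sc" "real_structure sc br \<sigma>"
    and H: "\<And>g. g \<in> H \<Longrightarrow> bij g \<and> induced_involution \<sigma> g \<in> H"
    and "f \<in> linear_regular sc H"
  shows "(\<lambda>g\<in>H. cnj (f (induced_involution \<sigma> g))) \<in> linear_regular sc H"
  using assms(4) unfolding linear_regular_def
proof (induction rule: generated_algebra.induct)
  case (gen f)
  have s: "\<sigma> (\<sigma> y) = y" for y using assms(2) by (auto simp: real_structure_def)
  from gen consider l v where "f = (\<lambda>g. l (g v))" "Vector_Spaces.linear sc (*) l"
    | l v where "f = (\<lambda>g. l (inv_into UNIV g v))" "Vector_Spaces.linear sc (*) l" by blast
  then show ?case
  proof cases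
    case 1
    let ?l = "\<lambda>v. cnj (l (\<sigma> v))"
    have "(\<lambda>g\<in>H. cnj (restrict f H (induced_involution \<sigma> g))) = restrict (\<lambda>g. ?l (g (\<sigma> v))) H"
      using H by (auto simp: 1 induced_involution_def fun_eq_iff restrict_def)
    then show ?thesis
      using induced_involution_functional[OF assms(1,2) 1(2)]
      by (simp only:) (intro generated_algebra.gen UnI1 CollectI exI[of _ ?l] exI[of _ "\<sigma> v"] conjI refl)
  next
    case 2
    let ?l = "\<lambda>v. cnj (l (\<sigma> v))"
    have i: "inv_into UNIV (induced_involution \<sigma> g) = induced_involution \<sigma> (inv_into UNIV g)"
      if "g \<in> H" for g using induced_involution_inverse(2)[of \<sigma> g] s H that by blast
    have "(\<lambda>g\<in>H. cnj (restrict f H (induced_involution \<sigma> g))) =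
        restrict (\<lambda>g. ?l (inv_into UNIV g (\<sigma> v))) H"
    proof
      fix g
      show "(\<lambda>g\<in>H. cnj (restrict f H (induced_involution \<sigma> g))) g =
        restrict (\<lambda>g. ?l (inv_into UNIV g (\<sigma> v))) H g"
        using H i[of g] by (cases "g \<in> H") (simp_all add: 2, simp add: induced_involution_def)
    qed
    then show ?thesis
      using induced_involution_functional[OF assms(1,2) 2(2)]
      by (simp only:) (intro generated_algebra.gen UnI2 CollectI exI[of _ ?l] exI[of _ "\<sigma> v"] conjI refl)
  qed
next
  case (const c)
  have "(\<lambda>g\<in>H. cnj ((\<lambda>g\<in>H. c) (induced_involution \<sigma> g))) = (\<lambda>g\<in>H. cnj c)"
    using H by (auto simp: fun_eq_iff restrict_def)
  then show ?case by (simp only: generated_algebra.const)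
next
  case (add f h)
  let ?t = "induced_involution \<sigma>"
  have "(\<lambda>g\<in>H. cnj ((\<lambda>g\<in>H. f g + h g) (?t g))) =
      (\<lambda>g\<in>H. (\<lambda>g\<in>H. cnj (f (?t g))) g + (\<lambda>g\<in>H. cnj (h (?t g))) g)"
    using H by (auto simp: fun_eq_iff restrict_def)
  then show ?case using generated_algebra.add[OF add.IH] by (simp only:)
next
  case (mult f h)
  let ?t = "induced_involution \<sigma>"
  have "(\<lambda>g\<in>H. cnj ((\<lambda>g\<in>H. f g * h g) (?t g))) =
      (\<lambda>g\<in>H. (\<lambda>g\<in>H. cnj (f (?t g))) g * (\<lambda>g\<in>H. cnj (h (?t g))) g)"
    using H by (auto simp: fun_eq_iff restrict_def)
  then show ?case using generated_algebra.mult[OF mult.IH] by (simp only:)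
qed

lemma topspace_zariski_linear: "topspace (zariski H (linear_regular sc H)) = H"
proof -
  have "(\<lambda>g\<in>H. 1) \<in> linear_regular sc H"
    unfolding linear_regular_def by (rule generated_algebra.const)
  moreover have "H = {x \<in> H. (\<lambda>g\<in>H. 1::complex) x \<noteq> 0}" by auto
  ultimately show ?thesis
    unfolding zariski_def topology_generated_by_topspace by blast
qed

lemma induced_involution_inner_group:
  assumes L: "complex_lie_algebra sc br" and R: "real_structure sc br \<sigma>"
    and g: "g \<in> inner_group sc br"
  shows "induced_involution \<sigma> g \<in> inner_group sc br"
proof -
  let ?A = "lie_automorphisms sc br" and ?t = "induced_involution \<sigma>"
  let ?X = "zariski ?A (linear_regular sc ?A)"
  have V: "vector_space sc" using L by (simp add: complex_lie_algebra_def)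
  have A: "bij h \<and> ?t h \<in> ?A" if "h \<in> ?A" for h
    using that induced_involution_automorphism[OF L R that]
    by (simp add: lie_automorphisms_def general_linear_def)
  have "continuous_map ?X ?X ?t"
    unfolding zariski_def[of ?A "linear_regular sc ?A"]
  proof (rule continuous_on_generated_topo)
    fix U assume "U \<in> {{x \<in> ?A. f x \<noteq> 0} |f. f \<in> linear_regular sc ?A}"
    then obtain f where U: "U = {x \<in> ?A. f x \<noteq> 0}" and f: "f \<in> linear_regular sc ?A" by blast
    let ?f = "\<lambda>g\<in>?A. cnj (f (?t g))"
    have "?f \<in> linear_regular sc ?A"
      by (rule induced_involution_regular[OF V R A f])
    then have "openin ?X {x \<in> ?A. ?f x \<noteq> 0}"
      unfolding zariski_def by (intro topology_generated_by_Basis) blast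
    moreover have "?t -` U \<inter> topspace ?X = {x \<in> ?A. ?f x \<noteq> 0}"
      using A by (auto simp: U topspace_zariski_linear)
    ultimately show "openin (topology_generated_by {{x \<in> ?A. f x \<noteq> 0} |f. f \<in> linear_regular sc ?A})
       (?t -` U \<inter> topspace (topology_generated_by {{x \<in> ?A. f x \<noteq> 0} |f. f \<in> linear_regular sc ?A}))"
      by (simp add: zariski_def)
  next
    show "?t ` topspace (topology_generated_by {{x \<in> ?A. f x \<noteq> 0} |f. f \<in> linear_regular sc ?A})
      \<subseteq> \<Union> {{x \<in> ?A. f x \<noteq> 0} |f. f \<in> linear_regular sc ?A}"
      using A topspace_zariski_linear[of ?A sc]
      unfolding zariski_def topology_generated_by_topspace by auto
  qed
  moreover have "connectedin ?X (inner_group sc br)"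
    unfolding inner_group_def by (rule connectedin_connected_component_of)
  ultimately have c: "connectedin ?X (?t ` inner_group sc br)"
    by (rule connectedin_continuous_map_image)
  have "id \<in> inner_group sc br"
    using g unfolding inner_group_def
    by (metis connected_component_of_refl connected_component_of_equiv mem_Collect_eq)
  moreover have "?t id = id"
    using R by (auto simp: induced_involution_def real_structure_def)
  ultimately have "id \<in> ?t ` inner_group sc br" by (metis imageI)
  then have "?t ` inner_group sc br \<subseteq> inner_group sc br"
    using connected_component_of_maximal[OF c] unfolding inner_group_def by blast
  then show ?thesis using g by blast
qed

lemma induced_involution_antiregular:
  assumes L: "complex_lie_algebra sc br" and R: "real_structure sc br \<sigma>"
  shows "antiregular_involution (general_linear sc\<lparr>carrier := inner_group sc br\<rparr>)
    (linear_regular sc (inner_group sc br)) (induced_involution \<sigma>)"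
proof -
  have V: "vector_space sc" using L by (simp add: complex_lie_algebra_def)
  have s: "\<sigma> (\<sigma> y) = y" for y using R by (auto simp: real_structure_def)
  have "inner_group sc br \<subseteq> lie_automorphisms sc br"
    using connected_component_of_subset_topspace[of _ id] topspace_zariski_linear
    unfolding inner_group_def by blast
  then have "bij g \<and> induced_involution \<sigma> g \<in> inner_group sc br" if "g \<in> inner_group sc br" for g
    using that induced_involution_inner_group[OF L R that]
    by (auto simp: lie_automorphisms_def general_linear_def)
  then show ?thesis
    using induced_involution_regular[OF V R, of "inner_group sc br"]
    unfolding antiregular_involution_def
    by (auto simp: hom_def general_linear_def induced_involution_def s fun_eq_iff)
qed

end

theory Submission
  imports Defs "HOL-Library.Function_Algebras" "HOL-Analysis.Continuum_Not_Denumerable"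
    "HOL-Computational_Algebra.Fundamental_Theorem_Algebra"
begin

text \<open>
  Two Cartan subspaces of the complex degree-one part are conjugate under \<open>G0\<close> by Vinberg's argument:
  for a Cartan subspace \<open>c\<close>, the orbit map from \<open>Gh\<close> times the regular elements of the slice
  \<open>gr 1 \<inter> centralizer c\<close> is dominant, since the ideal of polynomials vanishing on its image is closed
  under the derivatives along \<open>br y\<close> for \<open>y \<in> gr 0\<close> and along the slice, hence under all derivatives.
  Two dominant maps into the same space share an image point, and a regular element of a slice determines
  the Cartan subspace. That the elements of \<open>G0\<close> preserve the grading is not part of the definition:
  it follows because \<open>g \<mapsto> killing (g a) (\<theta> (g b))\<close> has vanishing derivatives on \<open>G0\<close>, so takes finitely
  many values, so is constant by connectedness.

  A real Cartan subspace spans a complex one, as nilpotency of \<open>ad (a + t b)\<close> for all real \<open>t\<close> persists for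
  complex \<open>t\<close>. If \<open>g\<close> moves \<open>span \<h>\<close> to the span of another real Cartan subspace, then \<open>inv g \<otimes> \<tau> g\<close> is a
  cocycle of the normalizer which is trivial in \<open>Gh\<close>, and its class classifies the Cartan subspace.
\<close>

section \<open>Finitely generated algebras of functions\<close>

text \<open>All geometry is done with algebras of functions and their characters; neither dimension
  theory nor an exponential map occurs. Two obstacles shape the proof. The coordinate ring of
  \<open>Gh\<close> is not known to be a domain, so two dominant orbit maps cannot be compared
  through irreducible sources. In \<open>common_image_point\<close> each map is replaced near a
  general point of the target by a linear functional on finitely many functions of the source, and
  only the target, the vector space \<open>gr 1\<close>, has to be irreducible. Secondly, a regular
  function whose derivatives all vanish must take finitely many values, although nothing is known
  about smoothness or components. \<open>exists_point_derivation\<close> therefore exhibits, for a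
  function of infinite range, a point and a derivation there that does not kill it. Both rest on a
  Nullstellensatz that exploits the uncountability of the complex numbers. The Killing form is
  needed twice: its nondegeneracy makes semisimple parts of elements available inside the Lie
  algebra, and it detects that an element of \<open>G0\<close> commutes with \<theta>.\<close>

interpretation funs: vector_space "\<lambda>c (f :: 'x \<Rightarrow> complex). (\<lambda>_. c) * f"
  by unfold_locales (auto simp: fun_eq_iff algebra_simps)

lemma sum_fun_apply: "(\<Sum>i\<in>I. f i) x = (\<Sum>i\<in>I. f i x)"
  for f :: "'i \<Rightarrow> 'x \<Rightarrow> 'a::comm_monoid_add"
  by (induction I rule: infinite_finite_induct) auto

lemma prod_fun_apply: "(\<Prod>i\<in>I. f i) x = (\<Prod>i\<in>I. f i x)"
  for f :: "'i \<Rightarrow> 'x \<Rightarrow> 'a::comm_monoid_mult"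
  by (induction I rule: infinite_finite_induct) auto

text \<open>The numerator left when the partial fractions \<open>\<alpha> c / (t - c)\<close> are
  put over a common denominator. At \<open>c0\<close> only its own summand survives.\<close>

definition lagrange_sum :: "('a::field \<Rightarrow> 'a) \<Rightarrow> 'a set \<Rightarrow> 'a poly" where
  "lagrange_sum \<alpha> C = (\<Sum>c\<in>C. smult (\<alpha> c) (\<Prod>d\<in>C - {c}. [:- d, 1:]))"

lemma lagrange_sum_nonzero:
  assumes "finite C" "c0 \<in> C" "\<alpha> c0 \<noteq> 0"
  shows "lagrange_sum \<alpha> C \<noteq> 0"
proof -
  have "poly (lagrange_sum \<alpha> C) c0 = (\<Sum>c\<in>C. \<alpha> c * (\<Prod>d\<in>C - {c}. c0 - d))"
    by (simp add: lagrange_sum_def poly_sum poly_prod)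
  also have "\<dots> = (\<Sum>c\<in>C. if c = c0 then \<alpha> c * (\<Prod>d\<in>C - {c}. c0 - d) else 0)"
    using assms by (intro sum.cong refl) auto
  also have "\<dots> = \<alpha> c0 * (\<Prod>d\<in>C - {c0}. c0 - d)" using assms by simp
  also have "\<dots> \<noteq> 0" using assms by auto
  finally show ?thesis by auto
qed

lemma poly_lagrange_sum:
  "(\<lambda>x. poly (lagrange_sum \<alpha> C) (f x)) = (\<Sum>c\<in>C. (\<lambda>_. \<alpha> c) * 1 * (\<Prod>d\<in>C - {c}. f - (\<lambda>_. d)))"
  by (auto simp: lagrange_sum_def poly_sum poly_prod sum_fun_apply prod_fun_apply)

definition alg_ideal :: "('x \<Rightarrow> complex) set \<Rightarrow> ('x \<Rightarrow> complex) set \<Rightarrow> bool" where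
  "alg_ideal R I \<longleftrightarrow> I \<subseteq> R \<and> 0 \<in> I \<and> (\<forall>f\<in>I. \<forall>g\<in>I. f + g \<in> I) \<and> (\<forall>f\<in>R. \<forall>g\<in>I. f * g \<in> I)"

text \<open>The conditions of \<open>tangent_space\<close> for functions on the whole type, where
  additivity and the Leibniz rule become ring identities.\<close>

definition point_derivation :: "('x \<Rightarrow> complex) set \<Rightarrow> 'x \<Rightarrow> (('x \<Rightarrow> complex) \<Rightarrow> complex) \<Rightarrow> bool" where
  "point_derivation R p D \<longleftrightarrow> (\<forall>c. D (\<lambda>_. c) = 0) \<and> (\<forall>f\<in>R. \<forall>g\<in>R. D (f + g) = D f + D g) \<and>
     (\<forall>f\<in>R. \<forall>g\<in>R. D (f * g) = D f * g p + f p * D g)"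

lemma restrict_UNIV_eq: "restrict f UNIV = f"
  by (simp add: restrict_def)

lemma algebra_character_UNIV:
  "algebra_character UNIV R \<xi> \<longleftrightarrow> (\<forall>c. \<xi> (\<lambda>_. c) = c) \<and> (\<forall>f\<in>R. \<forall>g\<in>R. \<xi> (f + g) = \<xi> f + \<xi> g) \<and>
     (\<forall>f\<in>R. \<forall>g\<in>R. \<xi> (f * g) = \<xi> f * \<xi> g)"
  unfolding algebra_character_def by (simp add: plus_fun_def times_fun_def restrict_UNIV_eq)

text \<open>The functions live on the whole type, so that they form a ring under the pointwise
  operations. Varieties that are proper subsets enter later through a retraction of the type onto
  them.\<close>

locale function_algebra =
  fixes F :: "('x \<Rightarrow> complex) set"
begin

abbreviation R where "R \<equiv> generated_algebra UNIV F"

lemma alg_gen: "f \<in> F \<Longrightarrow> f \<in> R"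
  using generated_algebra.gen[of f F UNIV] by (simp add: restrict_UNIV_eq)

lemma alg_const: "(\<lambda>_. c) \<in> R"
  using generated_algebra.const[where X = UNIV and S = F and c = c] by (simp add: restrict_UNIV_eq)

lemma alg_add: "f \<in> R \<Longrightarrow> g \<in> R \<Longrightarrow> f + g \<in> R"
  using generated_algebra.add[of f UNIV F g] by (simp add: plus_fun_def restrict_UNIV_eq)

lemma alg_mult: "f \<in> R \<Longrightarrow> g \<in> R \<Longrightarrow> f * g \<in> R"
  using generated_algebra.mult[of f UNIV F g] by (simp add: times_fun_def restrict_UNIV_eq)

lemma alg_0: "0 \<in> R" using alg_const[of 0] by (simp add: zero_fun_def)
lemma alg_1: "1 \<in> R" using alg_const[of 1] by (simp add: one_fun_def)

lemma alg_induct [consumes 1, case_names gen const add mult]: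
  assumes "f \<in> R" "\<And>f. f \<in> F \<Longrightarrow> P f" "\<And>c. P (\<lambda>_. c)"
    "\<And>f g. f \<in> R \<Longrightarrow> g \<in> R \<Longrightarrow> P f \<Longrightarrow> P g \<Longrightarrow> P (f + g)"
    "\<And>f g. f \<in> R \<Longrightarrow> g \<in> R \<Longrightarrow> P f \<Longrightarrow> P g \<Longrightarrow> P (f * g)"
  shows "P f"
  using assms(1) by (induction rule: generated_algebra.induct)
    (use assms(2-) in \<open>simp_all add: plus_fun_def times_fun_def restrict_UNIV_eq\<close>)

lemma alg_uminus: "f \<in> R \<Longrightarrow> - f \<in> R"
  using alg_mult[OF alg_const[of "-1"], of f] by (simp add: times_fun_def fun_Compl_def)

lemma alg_diff: "f \<in> R \<Longrightarrow> g \<in> R \<Longrightarrow> f - g \<in> R"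
  using alg_add[of f "- g"] alg_uminus[of g] by simp

lemma alg_sum: "(\<And>i. i \<in> I \<Longrightarrow> f i \<in> R) \<Longrightarrow> (\<Sum>i\<in>I. f i) \<in> R"
  by (induction I rule: infinite_finite_induct) (auto intro: alg_add alg_0)

lemma alg_prod: "(\<And>i. i \<in> I \<Longrightarrow> f i \<in> R) \<Longrightarrow> (\<Prod>i\<in>I. f i) \<in> R"
  by (induction I rule: infinite_finite_induct) (auto intro: alg_mult alg_1)

lemma alg_poly: "f \<in> R \<Longrightarrow> (\<lambda>x. poly p (f x)) \<in> R"
proof (induction p)
  case 0
  then show ?case using alg_const[of 0] by simp
next
  case (pCons a p)
  have "(\<lambda>x. poly (pCons a p) (f x)) = (\<lambda>_. a) + f * (\<lambda>x. poly p (f x))"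
    by (auto simp: fun_eq_iff)
  then show ?case using pCons by (auto intro: alg_add alg_mult alg_const)
qed

text \<open>Here \<open>p\<close> is a polynomial in two variables: the outer one is replaced by
  \<open>f\<close>, through the constant polynomial \<open>[:f x:]\<close>, and the inner one by
  \<open>u\<close>.\<close>

lemma alg_poly_poly: "f \<in> R \<Longrightarrow> u \<in> R \<Longrightarrow> (\<lambda>x. poly (poly p [:f x:]) (u x)) \<in> R"
proof (induction p)
  case 0
  then show ?case using alg_const[of 0] by simp
next
  case (pCons a p)
  have "(\<lambda>x. poly (poly (pCons a p) [:f x:]) (u x)) =
      (\<lambda>x. poly a (u x)) + f * (\<lambda>x. poly (poly p [:f x:]) (u x))"
    by (auto simp: fun_eq_iff)
  then show ?case using pCons by (auto intro!: alg_add alg_mult alg_poly)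
qed

lemma ideal_mult: "alg_ideal R I \<Longrightarrow> f \<in> R \<Longrightarrow> g \<in> I \<Longrightarrow> f * g \<in> I"
  and ideal_add: "alg_ideal R I \<Longrightarrow> f \<in> I \<Longrightarrow> g \<in> I \<Longrightarrow> f + g \<in> I"
  and ideal_0: "alg_ideal R I \<Longrightarrow> 0 \<in> I"
  and ideal_in: "alg_ideal R I \<Longrightarrow> f \<in> I \<Longrightarrow> f \<in> R"
  by (auto simp: alg_ideal_def)

lemma ideal_mult2: "alg_ideal R I \<Longrightarrow> f \<in> R \<Longrightarrow> g \<in> I \<Longrightarrow> g * f \<in> I"
  using ideal_mult[of I f g] by (simp add: mult.commute)

lemma ideal_uminus: "alg_ideal R I \<Longrightarrow> g \<in> I \<Longrightarrow> - g \<in> I"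
  using ideal_mult[OF _ alg_const[of "-1"], of I g] by (simp add: times_fun_def fun_Compl_def)

lemma ideal_diff: "alg_ideal R I \<Longrightarrow> f \<in> I \<Longrightarrow> g \<in> I \<Longrightarrow> f - g \<in> I"
  using ideal_add[of I f "- g"] ideal_uminus[of I g] by simp

lemma ideal_sum: "alg_ideal R I \<Longrightarrow> (\<And>i. i \<in> A \<Longrightarrow> f i \<in> I) \<Longrightarrow> (\<Sum>i\<in>A. f i) \<in> I"
  by (induction A rule: infinite_finite_induct) (auto intro: ideal_add ideal_0)

lemma ideal_adjoin:
  assumes P: "alg_ideal R P" and a: "a \<in> R"
  shows "alg_ideal R {p + a * r | p r. p \<in> P \<and> r \<in> R}" (is "alg_ideal R ?Q")
  unfolding alg_ideal_def
proof (intro conjI ballI)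
  show "?Q \<subseteq> R" using a ideal_in[OF P] by (auto intro!: alg_add alg_mult)
  show "0 \<in> ?Q" using ideal_0[OF P] alg_0 by (auto intro!: exI[of _ 0])
next
  fix f g assume "f \<in> ?Q" "g \<in> ?Q"
  then obtain p r p' r' where "f = p + a * r" "g = p' + a * r'" "p \<in> P" "r \<in> R" "p' \<in> P" "r' \<in> R"
    by blast
  then have "f + g = (p + p') + a * (r + r')" "p + p' \<in> P" "r + r' \<in> R"
    by (auto simp: algebra_simps intro: ideal_add[OF P] alg_add)
  then show "f + g \<in> ?Q" by blast
next
  fix f g assume f: "f \<in> R" and "g \<in> ?Q"
  then obtain p r where "g = p + a * r" "p \<in> P" "r \<in> R" by blast
  then have "f * g = f * p + a * (f * r)" "f * p \<in> P" "f * r \<in> R"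
    using f by (auto simp: algebra_simps intro: ideal_mult[OF P] alg_mult)
  then show "f * g \<in> ?Q" by blast
qed

text \<open>Zorn's lemma for ideals that avoid the multiplicative set \<open>M\<close>. Adjoining an
  \<open>a\<close> outside a maximal such \<open>P\<close> must meet \<open>M\<close>, which makes
  \<open>a\<close> invertible modulo \<open>P\<close> up to an element of \<open>M\<close>. The
  Nullstellensatz takes \<open>M = {1}\<close>; the nonzero polynomials in a function
  \<open>u\<close> as \<open>M\<close> give a curve.\<close>

lemma exists_maximal_ideal:
  assumes I: "alg_ideal R I" and IM: "I \<inter> M = {}"
    and M: "M \<subseteq> R" "\<And>a b. a \<in> M \<Longrightarrow> b \<in> M \<Longrightarrow> a * b \<in> M"
  obtains P where "alg_ideal R P" "I \<subseteq> P" "P \<inter> M = {}"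
    "\<forall>a\<in>R. a \<notin> P \<longrightarrow> (\<exists>r\<in>R. \<exists>m\<in>M. a * r - m \<in> P)"
    "\<forall>a\<in>R. \<forall>b\<in>R. a * b \<in> P \<longrightarrow> a \<in> P \<or> b \<in> P"
proof -
  let ?A = "{P. alg_ideal R P \<and> I \<subseteq> P \<and> P \<inter> M = {}}"
  have "\<exists>P\<in>?A. \<forall>Q\<in>?A. P \<subseteq> Q \<longrightarrow> Q = P"
  proof (rule subset_Zorn_nonempty)
    show "?A \<noteq> {}" using I IM by blast
  next
    fix C assume C: "C \<noteq> {}" "subset.chain ?A C"
    have CA: "X \<in> ?A" if "X \<in> C" for X using C(2) that by (auto simp: subset.chain_def)
    have chain: "X \<subseteq> Y \<or> Y \<subseteq> X" if "X \<in> C" "Y \<in> C" for X Y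
      using C(2) that unfolding subset_chain_def by blast
    have "alg_ideal R (\<Union>C)"
      unfolding alg_ideal_def
    proof (intro conjI ballI)
      show "\<Union>C \<subseteq> R" using CA ideal_in by blast
      obtain Z where Z: "Z \<in> C" using C(1) by blast
      then have "alg_ideal R Z" using CA by blast
      then show "0 \<in> \<Union>C" using Z ideal_0 by blast
    next
      fix f g assume "f \<in> \<Union>C" "g \<in> \<Union>C"
      then obtain X Y where XY: "X \<in> C" "f \<in> X" "Y \<in> C" "g \<in> Y" by blast
      obtain Z where Z: "Z \<in> C" "f \<in> Z" "g \<in> Z" using chain[OF XY(1,3)] XY by blast
      then have "alg_ideal R Z" using CA by blast
      then show "f + g \<in> \<Union>C" using ideal_add Z by blast
    next
      fix f g assume f: "f \<in> R" and "g \<in> \<Union>C"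
      then obtain Z where Z: "Z \<in> C" "g \<in> Z" by blast
      then have "alg_ideal R Z" using CA by blast
      then show "f * g \<in> \<Union>C" using ideal_mult f Z by blast
    qed
    then show "\<Union>C \<in> ?A" using CA C(1) by blast
  qed
  then obtain P where PA: "P \<in> ?A" and max': "\<forall>Q\<in>?A. P \<subseteq> Q \<longrightarrow> Q = P" by (rule bexE)
  have P: "alg_ideal R P" "I \<subseteq> P" "P \<inter> M = {}" using PA by simp_all
  have max: "Q = P" if "alg_ideal R Q" "I \<subseteq> Q" "Q \<inter> M = {}" "P \<subseteq> Q" for Q
    using max' that by simp
  have meet: "\<exists>r\<in>R. \<exists>m\<in>M. a * r - m \<in> P" if a: "a \<in> R" "a \<notin> P" for a
  proof -
    let ?Q = "{p + a * r | p r. p \<in> P \<and> r \<in> R}"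
    have "alg_ideal R ?Q" by (rule ideal_adjoin[OF P(1) a(1)])
    moreover have PQ: "P \<subseteq> ?Q"
    proof
      fix p assume "p \<in> P"
      moreover have "p = p + a * 0" by simp
      ultimately show "p \<in> ?Q" using alg_0 by blast
    qed
    moreover have "a = 0 + a * 1" by simp
    then have "a \<in> ?Q" using ideal_0[OF P(1)] alg_1 by blast
    ultimately have "?Q \<inter> M \<noteq> {}" using max[of ?Q] P(2) a(2) by blast
    then obtain p r where "p + a * r \<in> M" "p \<in> P" "r \<in> R" by blast
    moreover have "a * r - (p + a * r) = - p" by simp
    ultimately show ?thesis using ideal_uminus[OF P(1)] by metis
  qed
  have "a \<in> P \<or> b \<in> P" if ab: "a \<in> R" "b \<in> R" "a * b \<in> P" for a b
  proof (rule ccontr)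
    assume "\<not> ?thesis"
    then obtain r m s n where r: "r \<in> R" "m \<in> M" "a * r - m \<in> P" "s \<in> R" "n \<in> M" "b * s - n \<in> P"
      using meet ab by meson
    \<comment> \<open>If \<open>a * r\<close> is congruent to \<open>m\<close> and
      \<open>b * s\<close> to \<open>n\<close>, then \<open>a * b\<close> in \<open>P\<close> forces
      \<open>m * n\<close> into \<open>P\<close>.\<close>
    have "m * n = (a * b) * (r * s) - (a * r - m) * (b * s) - m * (b * s - n)"
      by (simp add: algebra_simps)
    also have "\<dots> \<in> P"
      by (intro ideal_diff[OF P(1)] ideal_mult2[OF P(1) alg_mult[OF r(1,4)] ab(3)]
          ideal_mult2[OF P(1) _ r(3)] ideal_mult[OF P(1) _ r(6)] alg_diff alg_mult ab r(4))
        (use r M(1) in auto)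
    finally show False using P(3) M(2)[OF r(2,5)] by blast
  qed
  then show thesis using that P meet by blast
qed

end

section \<open>The Nullstellensatz over an uncountable field\<close>

locale fg_function_algebra = function_algebra F for F :: "('x \<Rightarrow> complex) set" +
  assumes finite_F: "finite F"
begin

text \<open>The monomials in the finitely many generators, one for each list over \<open>F\<close>,
  form a spanning set.\<close>

lemma countable_spanning: obtains S where "countable S" "R \<subseteq> funs.span S"
proof -
  let ?S = "prod_list ` lists F"
  have c: "countable ?S" using finite_F by (intro countable_image)
    (simp add: uncountable_infinite countable_finite)
  have m: "a * b \<in> funs.span ?S" if "a \<in> funs.span ?S" "b \<in> funs.span ?S" for a b
  proof -
    have 1: "s * b \<in> funs.span ?S" if s: "s \<in> ?S" for s
      using \<open>b \<in> _\<close>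
    proof (induction rule: funs.span_induct_alt)
      case base
      then show ?case by (simp only: mult_zero_left mult_zero_right funs.span_zero)
    next
      case (step c x y)
      obtain xs ys where xy: "s = prod_list xs" "x = prod_list ys" "xs \<in> lists F" "ys \<in> lists F"
        using s step by blast
      then have "s * x = prod_list (xs @ ys)" "xs @ ys \<in> lists F" by auto
      then have "s * x \<in> funs.span ?S" by (metis funs.span_base imageI)
      moreover have "s * ((\<lambda>_. c) * x + y) = (\<lambda>_. c) * (s * x) + s * y" by (simp add: algebra_simps)
      ultimately show ?case using step by (metis funs.span_add funs.span_scale)
    qed
    show ?thesis using \<open>a \<in> _\<close>
    proof (induction rule: funs.span_induct_alt)
      case base
      then show ?case by (simp only: mult_zero_left mult_zero_right funs.span_zero)
    next
      case (step c x y)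
      have "((\<lambda>_. c) * x + y) * b = (\<lambda>_. c) * (x * b) + y * b" by (simp add: algebra_simps)
      then show ?case using step 1 by (metis funs.span_add funs.span_scale)
    qed
  qed
  have "f \<in> funs.span ?S" if "f \<in> R" for f
    using that
  proof (induction rule: alg_induct)
    case (gen f)
    then have "f = prod_list [f]" "[f] \<in> lists F" by auto
    then show ?case by (metis funs.span_base imageI)
  next
    case (const c)
    have "(1 :: 'x \<Rightarrow> complex) = prod_list []" by simp
    then have "1 \<in> funs.span ?S" by (metis funs.span_base imageI lists.Nil)
    moreover have "(\<lambda>_. c) = (\<lambda>_. c) * (1 :: 'x \<Rightarrow> complex)" by simp
    ultimately show ?case by (metis funs.span_scale)
  next
    case (add f g)
    show ?case by (rule funs.span_add[OF add(3,4)])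
  next
    case (mult f g)
    show ?case by (rule m[OF mult(3,4)])
  qed
  then show thesis using that[OF c] by blast
qed

text \<open>The Nullstellensatz is proved by the uncountability of the complex numbers: the algebra has
  countable dimension, so uncountably many inverses of \<open>f - c\<close> satisfy a linear relation.\<close>

lemma uncountable_family_dependent:
  assumes U: "uncountable U" and g: "\<And>c. c \<in> U \<Longrightarrow> g c \<in> R"
  obtains C \<alpha> c0 where "finite C" "C \<subseteq> U" "c0 \<in> C" "\<alpha> c0 \<noteq> 0" "(\<Sum>c\<in>C. (\<lambda>_. \<alpha> c) * g c) = 0"
proof -
  obtain S where S: "countable S" "R \<subseteq> funs.span S" by (rule countable_spanning)
  let ?S = "\<lambda>n::nat. from_nat_into S ` {..<n}"
  have ex: "\<exists>n. v \<in> funs.span (?S n)" if "v \<in> funs.span S" for v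
    using that
  proof (induction rule: funs.span_induct_alt)
    case base
    then show ?case using funs.span_zero by blast
  next
    case (step c x y)
    then obtain n where n: "y \<in> funs.span (?S n)" by blast
    obtain k where k: "x = from_nat_into S k" using step S(1) by (metis from_nat_into_surj)
    have "x \<in> funs.span (?S (max n (Suc k)))" by (rule funs.span_base) (auto simp: k)
    moreover have "y \<in> funs.span (?S (max n (Suc k)))"
      by (rule subsetD[OF funs.span_mono n]) auto
    ultimately show ?case by (metis funs.span_add funs.span_scale)
  qed
  \<comment> \<open>Each \<open>g c\<close> lies in the span of finitely many of the spanning
    functions. By pigeonhole uncountably many lie in the span of the same first \<open>n\<close>,
    where any \<open>n + 1\<close> are dependent.\<close>
  let ?U = "\<lambda>n. {c \<in> U. g c \<in> funs.span (?S n)}"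
  have "c \<in> (\<Union>n. ?U n)" if "c \<in> U" for c
    using ex[OF subsetD[OF S(2) g[OF that]]] that by simp
  then have UU: "U = (\<Union>n. ?U n)" by (intro equalityI subsetI) auto
  have "\<exists>n. uncountable (?U n)"
  proof (rule ccontr)
    assume "\<not> ?thesis"
    then have "countable (\<Union>n. ?U n)" by (intro countable_UN) auto
    then have "countable U" by (rule back_subst[OF _ UU[symmetric]])
    then show False using U by blast
  qed
  then obtain n where n: "uncountable (?U n)" ..
  show thesis
  proof (cases "inj_on g (?U n)")
    case True
    obtain C where C: "finite C" "C \<subseteq> ?U n" "card C = Suc n"
      using n by (meson infinite_arbitrarily_large uncountable_infinite)
    have inj: "inj_on g C" using True C(2) inj_on_subset by blast
    have "g ` C \<subseteq> funs.span (?S n)" using C by blast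
    moreover have "card (?S n) \<le> n" using card_image_le[of "{..<n}" "from_nat_into S"] by simp
    ultimately have "funs.dependent (g ` C)"
      using funs.independent_span_bound[of "?S n" "g ` C"] C(3) card_image[OF inj] by auto
    then obtain \<beta> where \<beta>: "\<exists>v\<in>g ` C. \<beta> v \<noteq> 0" "(\<Sum>v\<in>g ` C. (\<lambda>_. \<beta> v) * v) = 0"
      using funs.dependent_finite[of "g ` C"] C(1) by auto
    then obtain c0 where c0: "c0 \<in> C" "\<beta> (g c0) \<noteq> 0" by blast
    have "(\<Sum>c\<in>C. (\<lambda>_. \<beta> (g c)) * g c) = 0" using \<beta>(2) by (simp add: sum.reindex[OF inj])
    then show thesis using that[of C c0 "\<beta> \<circ> g"] C c0 by auto
  next
    \<comment> \<open>Two equal members already satisfy a relation with coefficients 1 and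
      -1.\<close>
    case False
    then obtain c d where cd: "c \<in> U" "d \<in> U" "c \<noteq> d" "g c = g d" unfolding inj_on_def by blast
    show thesis
      by (rule that[of "{c, d}" c "\<lambda>x. if x = c then 1 else - 1"])
        (use cd in \<open>auto simp: fun_eq_iff\<close>)
  qed
qed

text \<open>Multiply a linear relation among the chosen \<open>g c\<close> by the product of all
  \<open>f - c\<close>: modulo \<open>P\<close> each \<open>(f - c) * g c\<close> becomes
  \<open>q c\<close>, and a relation in \<open>f\<close> and the \<open>q c\<close> alone
  remains.\<close>

lemma relation_from_inverses:
  assumes P: "alg_ideal R P" and U: "uncountable U" and f: "f \<in> R"
    and inv: "\<And>c. c \<in> U \<Longrightarrow> \<exists>g\<in>R. (f - (\<lambda>_. c)) * g - q c \<in> P"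
  obtains C \<alpha> c0 where "finite C" "C \<subseteq> U" "c0 \<in> C" "\<alpha> c0 \<noteq> 0"
    "(\<Sum>c\<in>C. (\<lambda>_. \<alpha> c) * q c * (\<Prod>d\<in>C - {c}. f - (\<lambda>_. d))) \<in> P"
proof -
  obtain g where g: "\<And>c. c \<in> U \<Longrightarrow> g c \<in> R" "\<And>c. c \<in> U \<Longrightarrow> (f - (\<lambda>_. c)) * g c - q c \<in> P"
    using inv by metis
  obtain C \<alpha> c0 where C: "finite C" "C \<subseteq> U" "c0 \<in> C" "\<alpha> c0 \<noteq> 0" "(\<Sum>c\<in>C. (\<lambda>_. \<alpha> c) * g c) = 0"
    by (rule uncountable_family_dependent[OF U g(1)])
  let ?m = "\<lambda>c. \<Prod>d\<in>C - {c}. f - (\<lambda>_. d)"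
  have "(\<Sum>c\<in>C. (\<lambda>_. \<alpha> c) * q c * ?m c)
      = (\<Prod>d\<in>C. f - (\<lambda>_. d)) * (\<Sum>c\<in>C. (\<lambda>_. \<alpha> c) * g c)
        - (\<Sum>c\<in>C. ((\<lambda>_. \<alpha> c) * ?m c) * ((f - (\<lambda>_. c)) * g c - q c))"
    unfolding sum_distrib_left sum_subtractf[symmetric]
  proof (intro sum.cong refl)
    fix c assume "c \<in> C"
    then have "(\<Prod>d\<in>C. f - (\<lambda>_. d)) = (f - (\<lambda>_. c)) * ?m c" using C(1) by (rule prod.remove[rotated])
    moreover have "a * q * m = (y * m) * (a * g) - (a * m) * (y * g - q)" for a q m y g :: "'x \<Rightarrow> complex"
      by (simp add: algebra_simps)
    ultimately show "(\<lambda>_. \<alpha> c) * q c * ?m c = (\<Prod>d\<in>C. f - (\<lambda>_. d)) * ((\<lambda>_. \<alpha> c) * g c)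
        - ((\<lambda>_. \<alpha> c) * ?m c) * ((f - (\<lambda>_. c)) * g c - q c)"
      by (simp only:)
  qed
  also have "\<dots> \<in> P"
    unfolding C(5) mult_zero_right using C(2) f
    by (intro ideal_diff[OF P] ideal_0[OF P] ideal_sum[OF P] ideal_mult[OF P] alg_mult alg_prod
        alg_diff alg_const g(2)) auto
  finally show thesis using that C by blast
qed

text \<open>Over the complex numbers the polynomial splits, and a prime ideal contains one of the
  linear factors at \<open>f\<close>.\<close>

lemma root_mod_prime:
  assumes P: "alg_ideal R P" "1 \<notin> P"
    and prime: "\<And>a b. a \<in> R \<Longrightarrow> b \<in> R \<Longrightarrow> a * b \<in> P \<Longrightarrow> a \<in> P \<or> b \<in> P"
    and f: "f \<in> R" and p: "p \<noteq> 0" "(\<lambda>x. poly p (f x)) \<in> P"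
  shows "\<exists>c. f - (\<lambda>_. c) \<in> P"
  using p
proof (induction "degree p" arbitrary: p rule: less_induct)
  case less
  show ?case
  proof (cases "degree p = 0")
    case True
    then obtain a where a: "p = [:a:]" by (rule degree_eq_zeroE)
    then have "(\<lambda>_. 1 / a) * (\<lambda>x. poly p (f x)) = 1" using less.prems by (auto simp: fun_eq_iff)
    then have "1 \<in> P" using ideal_mult[OF P(1) alg_const less.prems(2)] by metis
    then show ?thesis using P by blast
  next
    case False
    then obtain z where "poly p z = 0" using fundamental_theorem_of_algebra[of p]
      by (auto simp: constant_degree)
    then obtain r where r: "p = [:- z, 1:] * r" using poly_eq_0_iff_dvd[of p z] by (auto elim: dvdE)
    have r0: "r \<noteq> 0" using less.prems r by auto
    then have d: "degree r < degree p" unfolding r by (subst degree_mult_eq) auto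
    have "(\<lambda>x. poly p (f x)) = (f - (\<lambda>_. z)) * (\<lambda>x. poly r (f x))"
      by (auto simp: r fun_eq_iff algebra_simps)
    then have "f - (\<lambda>_. z) \<in> P \<or> (\<lambda>x. poly r (f x)) \<in> P"
      using prime[of "f - (\<lambda>_. z)" "\<lambda>x. poly r (f x)"] less.prems f
      by (auto intro: alg_diff alg_const alg_poly)
    then show ?thesis using less.hyps[OF d r0] by blast
  qed
qed

theorem nullstellensatz:
  assumes J: "alg_ideal R J" "1 \<notin> J"
  obtains \<xi> where "algebra_character UNIV R \<xi>" "\<And>f. f \<in> J \<Longrightarrow> \<xi> f = 0"
proof -
  obtain P where P: "alg_ideal R P" "J \<subseteq> P" "P \<inter> {1} = {}"
    and inv: "\<forall>a\<in>R. a \<notin> P \<longrightarrow> (\<exists>r\<in>R. \<exists>m\<in>{1}. a * r - m \<in> P)"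
    and prime: "\<forall>a\<in>R. \<forall>b\<in>R. a * b \<in> P \<longrightarrow> a \<in> P \<or> b \<in> P"
    by (rule exists_maximal_ideal[OF J(1), of "{1}"]) (use J alg_1 in auto)
  note prime = prime[rule_format] and inv = inv[rule_format]
  have P1: "1 \<notin> P" using P by auto
  \<comment> \<open>The residue field is no larger than the complex numbers: if no
    \<open>f - c\<close> lay in \<open>P\<close>, all would be invertible modulo \<open>P\<close>,
    and the relation among the inverses would put a nonzero polynomial in \<open>f\<close> into
    \<open>P\<close>.\<close>
  have ex: "\<exists>c. f - (\<lambda>_. c) \<in> P" if f: "f \<in> R" for f
  proof (rule ccontr)
    assume no: "\<not> ?thesis"
    have i: "\<exists>g\<in>R. (f - (\<lambda>_. c)) * g - 1 \<in> P" for c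
      using inv[of "f - (\<lambda>_. c)"] f no by (auto intro: alg_diff alg_const)
    obtain C \<alpha> c0 where C: "finite C" "C \<subseteq> UNIV" "c0 \<in> C" "\<alpha> c0 \<noteq> 0"
      "(\<Sum>c\<in>C. (\<lambda>_. \<alpha> c) * 1 * (\<Prod>d\<in>C - {c}. f - (\<lambda>_. d))) \<in> P"
      by (rule relation_from_inverses[OF P(1) uncountable_UNIV_complex f i])
    have "(\<lambda>x. poly (lagrange_sum \<alpha> C) (f x)) \<in> P"
      unfolding poly_lagrange_sum[of \<alpha> C f] by (rule C(5))
    then show False
      using root_mod_prime[OF P(1) P1 prime f lagrange_sum_nonzero[of C c0 \<alpha>, OF C(1,3,4)]] no by blast
  qed
  have uniq: "c = d" if "f - (\<lambda>_. c) \<in> P" "f - (\<lambda>_. d) \<in> P" for f c d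
  proof (rule ccontr)
    assume "c \<noteq> d"
    then have "(\<lambda>_. 1 / (d - c)) * ((f - (\<lambda>_. c)) - (f - (\<lambda>_. d))) = 1" by (auto simp: fun_eq_iff)
    then show False using P1 ideal_mult[OF P(1) alg_const ideal_diff[OF P(1) that]] by metis
  qed
  \<comment> \<open>The character sends \<open>f\<close> to its residue modulo
    \<open>P\<close>.\<close>
  define \<xi> where "\<xi> f = (THE c. f - (\<lambda>_. c) \<in> P)" for f
  have eq: "\<xi> f = c" if "f - (\<lambda>_. c) \<in> P" for f c
    unfolding \<xi>_def using that uniq by blast
  have mem: "f - (\<lambda>_. \<xi> f) \<in> P" if "f \<in> R" for f using ex[OF that] eq by blast
  show thesis
  proof
    show "algebra_character UNIV R \<xi>"
      unfolding algebra_character_UNIV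
    proof (intro conjI allI ballI)
      fix c
      have "(\<lambda>_. c) - (\<lambda>_. c) = (0 :: 'x \<Rightarrow> complex)" by simp
      then show "\<xi> (\<lambda>_. c) = c" using eq ideal_0[OF P(1)] by metis
    next
      fix f g assume fg: "f \<in> R" "g \<in> R"
      have "f + g - (\<lambda>_. \<xi> f + \<xi> g) = (f - (\<lambda>_. \<xi> f)) + (g - (\<lambda>_. \<xi> g))" by (auto simp: fun_eq_iff)
      then show "\<xi> (f + g) = \<xi> f + \<xi> g" using eq mem fg ideal_add[OF P(1)] by metis
      have "f * g - (\<lambda>_. \<xi> f * \<xi> g) = (f - (\<lambda>_. \<xi> f)) * g + (\<lambda>_. \<xi> f) * (g - (\<lambda>_. \<xi> g))"
        by (auto simp: fun_eq_iff algebra_simps)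
      also have "\<dots> \<in> P" using mem fg
        by (intro ideal_add[OF P(1)] ideal_mult[OF P(1)] ideal_mult2[OF P(1)] alg_const)
      finally show "\<xi> (f * g) = \<xi> f * \<xi> g" using eq by blast
    qed
    show "\<xi> f = 0" if "f \<in> J" for f
    proof (rule eq)
      have "f - (\<lambda>_. 0) = f" by (auto simp: fun_eq_iff)
      then show "f - (\<lambda>_. 0) \<in> P" using that P by auto
    qed
  qed
qed

end

section \<open>Nakayama's lemma and point derivations on curves\<close>

lemma separating_functional:
  fixes sc :: "complex \<Rightarrow> 'v::ab_group_add \<Rightarrow> 'v"
  assumes "vector_space sc" "module.subspace sc Q" "v \<notin> Q"
  obtains \<phi> where "Vector_Spaces.linear sc (*) \<phi>" "\<forall>x\<in>Q. \<phi> x = 0" "\<phi> v = 1"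
proof -
  interpret vector_space sc by fact
  interpret C: vector_space "(*) :: complex \<Rightarrow> complex \<Rightarrow> complex"
    by unfold_locales (auto simp: algebra_simps)
  interpret P: vector_space_pair sc "(*) :: complex \<Rightarrow> complex \<Rightarrow> complex" ..
  obtain B where B: "B \<subseteq> Q" "independent B" "Q \<subseteq> span B"
    by (rule maximal_independent_subset)
  have sB: "span B = Q" using B assms(2) span_minimal by blast
  then have "independent (insert v B)" using assms(3) B(2) by (intro independent_insertI) auto
  from P.linear_independent_extend[OF this, of "\<lambda>x. if x = v then 1 else 0"]
  obtain \<phi> where \<phi>: "Vector_Spaces.linear sc (*) \<phi>"
    "\<And>x. x \<in> insert v B \<Longrightarrow> \<phi> x = (if x = v then 1 else 0)" by blast
  have "\<phi> x = 0" if "x \<in> B" for x using \<phi>(2)[of x] that B(1) assms(3) by auto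
  then have "\<phi> x = 0" if "x \<in> Q" for x
    using P.linear_eq_0_on_span[OF \<phi>(1), of B x] that sB by blast
  moreover have "\<phi> v = 1" using \<phi>(2)[of v] by simp
  ultimately show thesis using that \<phi>(1) by blast
qed

context function_algebra
begin

lemma point_derivation_add: "point_derivation R p D \<Longrightarrow> f \<in> R \<Longrightarrow> g \<in> R \<Longrightarrow> D (f + g) = D f + D g"
  and point_derivation_mult: "point_derivation R p D \<Longrightarrow> f \<in> R \<Longrightarrow> g \<in> R \<Longrightarrow> D (f * g) = D f * g p + f p * D g"
  and point_derivation_const: "point_derivation R p D \<Longrightarrow> D (\<lambda>_. c) = 0"
  by (auto simp: point_derivation_def)

lemma point_derivation_poly_zero:
  assumes D: "point_derivation R p D" and u: "u \<in> R" "D u = 0"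
  shows "D (\<lambda>x. poly q (u x)) = 0"
proof (induction q)
  case 0
  then show ?case using point_derivation_const[OF D, of 0] by simp
next
  case (pCons a q)
  have "(\<lambda>x. poly (pCons a q) (u x)) = (\<lambda>_. a) + u * (\<lambda>x. poly q (u x))" by (auto simp: fun_eq_iff)
  then have "D (\<lambda>x. poly (pCons a q) (u x)) = D (\<lambda>_. a) + (D u * poly q (u p) + u p * D (\<lambda>x. poly q (u x)))"
    using point_derivation_add[OF D alg_const alg_mult[OF u(1) alg_poly[OF u(1)]]]
      point_derivation_mult[OF D u(1) alg_poly[OF u(1)]] by metis
  then show ?case using pCons u(2) point_derivation_const[OF D] by simp
qed

text \<open>The chain rule for a derivation that kills \<open>u\<close>: only the outer variable
  contributes, so \<open>pderiv\<close> is taken in that variable alone.\<close>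

lemma point_derivation_poly_poly:
  assumes D: "point_derivation R p D" and u: "u \<in> R" "D u = 0" and f: "f \<in> R"
  shows "D (\<lambda>x. poly (poly q [:f x:]) (u x)) = poly (poly (pderiv q) [:f p:]) (u p) * D f"
proof (induction q)
  case 0
  then show ?case using point_derivation_const[OF D, of 0] by simp
next
  case (pCons a q)
  have "(\<lambda>x. poly (poly (pCons a q) [:f x:]) (u x)) =
      (\<lambda>x. poly a (u x)) + f * (\<lambda>x. poly (poly q [:f x:]) (u x))" by (auto simp: fun_eq_iff)
  then have "D (\<lambda>x. poly (poly (pCons a q) [:f x:]) (u x)) =
      D (\<lambda>x. poly a (u x)) + (D f * poly (poly q [:f p:]) (u p) + f p * D (\<lambda>x. poly (poly q [:f x:]) (u x)))"
    using point_derivation_add[OF D alg_poly[OF u(1)] alg_mult[OF f alg_poly_poly[OF f u(1)]]]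
      point_derivation_mult[OF D f alg_poly_poly[OF f u(1)]] by metis
  then show ?case using pCons point_derivation_poly_zero[OF D u]
    by (simp add: pderiv_pCons algebra_simps)
qed

end

context fg_function_algebra
begin

lemma maximal_ideal_at:
  assumes p: "m = {f \<in> R. f p = 0}"
  shows "alg_ideal R m"
  unfolding p alg_ideal_def by (auto intro: alg_0 alg_add alg_mult)

text \<open>Since \<open>m\<close> is contained in \<open>m^2 + P\<close>, the determinant trick
  applies to the finitely generated module \<open>m / P\<close>. It is carried out by eliminating
  one generator of \<open>m\<close> at a time, at the cost of changing \<open>e\<close>.\<close>

lemma nakayama:
  assumes P: "alg_ideal R P" and m: "m = {f \<in> R. f p = 0}" and Pm: "P \<subseteq> m"
    and mQ: "m \<subseteq> funs.span ({s * t | s t. s \<in> m \<and> t \<in> m} \<union> P)"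
  shows "\<exists>e\<in>m. \<forall>f\<in>m. (1 - e) * f \<in> P"
proof -
  have mi: "alg_ideal R m" by (rule maximal_ideal_at[OF m])
  \<comment> \<open>\<open>idl G\<close> is the ideal generated by \<open>P\<close> and
    \<open>G\<close>.\<close>
  define idl where "idl G = \<Inter>{I. alg_ideal R I \<and> P \<subseteq> I \<and> G \<subseteq> I}" for G
  have idl: "alg_ideal R (idl G)" if "G \<subseteq> m" for G
  proof -
    have "idl G \<subseteq> m" unfolding idl_def using mi Pm that by blast
    then show ?thesis unfolding alg_ideal_def
    proof (intro conjI ballI)
      show "idl G \<subseteq> R" if "idl G \<subseteq> m" using that m by blast
      show "0 \<in> idl G" unfolding idl_def using ideal_0 by blast
      show "f + g \<in> idl G" if "f \<in> idl G" "g \<in> idl G" for f g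
        using that unfolding idl_def by (auto intro: ideal_add)
      show "f * g \<in> idl G" if "f \<in> R" "g \<in> idl G" for f g
        using that unfolding idl_def by (auto intro: ideal_mult)
    qed
  qed
  have Pidl: "P \<subseteq> idl G" and Gidl: "G \<subseteq> idl G" for G unfolding idl_def by auto
  have step: "\<exists>e\<in>m. \<forall>f\<in>m. (1 - e) * f \<in> idl G"
    if gG: "insert g G \<subseteq> m" and ex: "\<exists>e\<in>m. \<forall>f\<in>m. (1 - e) * f \<in> idl (insert g G)" for g G
  proof -
    obtain e where e: "e \<in> m" "\<And>f. f \<in> m \<Longrightarrow> (1 - e) * f \<in> idl (insert g G)" using ex by blast
    have G: "alg_ideal R (idl G)" using idl gG by blast
    have gR: "g \<in> R" "e \<in> R" using gG e m by auto
    let ?Q = "{q + g * r | q r. q \<in> idl G \<and> r \<in> R}"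
    have "idl (insert g G) \<subseteq> ?Q"
    proof -
      have "q \<in> ?Q" if "q \<in> idl G" for q
      proof -
        have "q = q + g * 0" by simp
        then show ?thesis using that alg_0 by blast
      qed
      then have "P \<subseteq> ?Q" "G \<subseteq> ?Q" using Pidl Gidl by blast+
      moreover have "g = 0 + g * 1" by simp
      then have "g \<in> ?Q" using ideal_0[OF G] alg_1 by blast
      ultimately have "insert g G \<subseteq> ?Q" "P \<subseteq> ?Q" by (simp_all only: insert_subset simp_thms)
      then show ?thesis unfolding idl_def[of "insert g G"]
        by (intro Inter_lower CollectI conjI ideal_adjoin[OF G gR(1)])
    qed
    then have rep: "\<exists>q\<in>idl G. \<exists>r\<in>R. (1 - e) * f = q + g * r" if "f \<in> m" for f
      using e(2)[OF that] by blast
    \<comment> \<open>A product \<open>s * t\<close> of elements of \<open>m\<close> contributes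
      \<open>s * ((1 - e) * t)\<close>, which up to \<open>idl G\<close> is \<open>g\<close> times
      an element of \<open>m\<close>; elements of \<open>P\<close> contribute nothing.\<close>
    have "\<exists>\<mu>\<in>m. (1 - e) * y - g * \<mu> \<in> idl G" if "y \<in> funs.span ({s * t | s t. s \<in> m \<and> t \<in> m} \<union> P)" for y
      using that
    proof (induction rule: funs.span_induct_alt)
      case base
      have "(1 - e) * 0 - g * 0 = 0" by simp
      then show ?case using ideal_0[OF G] ideal_0[OF mi] by metis
    next
      case (step c x y)
      then obtain \<mu> where \<mu>: "\<mu> \<in> m" "(1 - e) * y - g * \<mu> \<in> idl G" by blast
      have "\<exists>\<nu>\<in>m. (1 - e) * x - g * \<nu> \<in> idl G"
      proof (cases "x \<in> P")
        case True
        have "(1 - e) * x - g * 0 = (1 - e) * x" by simp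
        also have "\<dots> \<in> idl G" using True Pidl gR by (intro ideal_mult[OF G] alg_diff alg_1) auto
        finally show ?thesis using ideal_0[OF mi] by blast
      next
        case False
        then obtain s t where st: "x = s * t" "s \<in> m" "t \<in> m" using step by blast
        obtain q r where qr: "q \<in> idl G" "r \<in> R" "(1 - e) * t = q + g * r" using rep st by blast
        have "(1 - e) * x - g * (s * r) = s * ((1 - e) * t) - g * (s * r)" by (simp add: st algebra_simps)
        also have "\<dots> = s * q" unfolding qr(3) by (simp add: algebra_simps)
        also have "\<dots> \<in> idl G" using st m qr by (intro ideal_mult[OF G]) auto
        finally show ?thesis using ideal_mult2[OF mi qr(2) st(2)] by blast
      qed
      then obtain \<nu> where \<nu>: "\<nu> \<in> m" "(1 - e) * x - g * \<nu> \<in> idl G" by blast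
      have "a * (c' * x + y) - g * (c' * \<nu> + \<mu>) = c' * (a * x - g * \<nu>) + (a * y - g * \<mu>)"
        for a c' :: "'x \<Rightarrow> complex" by (simp add: algebra_simps)
      then have "(1 - e) * ((\<lambda>_. c) * x + y) - g * ((\<lambda>_. c) * \<nu> + \<mu>) \<in> idl G"
        using ideal_add[OF G ideal_mult[OF G alg_const \<nu>(2)] \<mu>(2)] by (simp only:)
      moreover have "(\<lambda>_. c) * \<nu> + \<mu> \<in> m" using \<nu> \<mu> by (intro ideal_add[OF mi] ideal_mult[OF mi] alg_const)
      ultimately show ?case by blast
    qed
    then obtain \<mu> where \<mu>: "\<mu> \<in> m" "(1 - e) * g - g * \<mu> \<in> idl G" using gG mQ by blast
    \<comment> \<open>Chosen so that \<open>1 - e' = (1 - e) * (1 - e - \<mu>)\<close>; the second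
      factor multiplies \<open>g\<close> into \<open>idl G\<close>.\<close>
    define e' where "e' = e + (1 - e) * (e + \<mu>)"
    have e'm: "e' \<in> m" unfolding e'_def using \<mu> e gR
      by (intro ideal_add[OF mi] ideal_mult[OF mi] alg_diff alg_1)
    have "(1 - e') * f \<in> idl G" if f: "f \<in> m" for f
    proof -
      obtain q r where qr: "q \<in> idl G" "r \<in> R" "(1 - e) * f = q + g * r" using rep f by blast
      have "(1 - e') * f = (1 - e - \<mu>) * ((1 - e) * f)" by (simp add: e'_def algebra_simps)
      also have "\<dots> = (1 - e - \<mu>) * q + r * ((1 - e) * g - g * \<mu>)" unfolding qr(3) by (simp add: algebra_simps)
      also have "\<dots> \<in> idl G" using qr \<mu> m gR
        by (intro ideal_add[OF G] ideal_mult[OF G] alg_diff alg_1) auto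
      finally show ?thesis .
    qed
    then show ?thesis using e'm by blast
  qed
  have induct: "G \<subseteq> m \<Longrightarrow> \<exists>e\<in>m. \<forall>f\<in>m. (1 - e) * f \<in> idl G \<Longrightarrow> \<exists>e\<in>m. \<forall>f\<in>m. (1 - e) * f \<in> P" if "finite G" for G
    using that
  proof (induction G rule: finite_induct)
    case empty
    have "idl {} \<subseteq> P" unfolding idl_def using P by blast
    then show ?case using empty by blast
  next
    case (insert g G)
    show ?case using insert.IH step[OF insert.prems] insert.prems(1) by blast
  qed
  \<comment> \<open>The functions \<open>f - f p\<close> with \<open>f\<close> in \<open>F\<close>
    generate \<open>m\<close>, so the elimination starts from them with
    \<open>e = 0\<close>.\<close>
  let ?G = "(\<lambda>f. f - (\<lambda>_. f p)) ` F"
  have Gm: "?G \<subseteq> m" unfolding m using alg_diff[OF alg_gen alg_const] by auto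
  note I = idl[OF Gm]
  have "f - (\<lambda>_. f p) \<in> idl ?G" if "f \<in> R" for f
    using that
  proof (induction rule: alg_induct)
    case (gen f)
    show ?case by (rule subsetD[OF Gidl imageI[OF gen]])
  next
    case (const c)
    have "(\<lambda>_. c) - (\<lambda>_. c) = (0 :: 'x \<Rightarrow> complex)" by simp
    then show ?case using ideal_0[OF I] by metis
  next
    case (add f g)
    have "f + g - (\<lambda>_. (f + g) p) = (f - (\<lambda>_. f p)) + (g - (\<lambda>_. g p))" by (auto simp: fun_eq_iff)
    then show ?case using ideal_add[OF I add(3,4)] by (simp only:)
  next
    case (mult f g)
    have "f * g - (\<lambda>_. (f * g) p) = f * (g - (\<lambda>_. g p)) + (\<lambda>_. g p) * (f - (\<lambda>_. f p))"
      by (auto simp: fun_eq_iff algebra_simps)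
    then show ?case
      using ideal_add[OF I ideal_mult[OF I mult(1,4)] ideal_mult[OF I alg_const mult(3)]] by (simp only:)
  qed
  then have "(1 - 0) * f \<in> idl ?G" if "f \<in> m" for f
  proof -
    have "f - (\<lambda>_. f p) = (1 - 0) * f" using that m by (auto simp: fun_eq_iff)
    then show ?thesis using \<open>\<And>f. f \<in> R \<Longrightarrow> f - (\<lambda>_. f p) \<in> idl ?G\<close>[of f] that m by auto
  qed
  then show ?thesis using induct[OF _ Gm] finite_F ideal_0[OF mi] by blast
qed

text \<open>An ideal \<open>P\<close> maximal among those containing no nonzero polynomial in \<open>u\<close> is the ideal of a curve on
  which \<open>u\<close> is not constant, and the other functions are separable over \<open>u\<close> near some point \<open>p\<close> of it.
  If every derivation at \<open>p\<close> killed \<open>u\<close>, then derivations vanishing on \<open>P\<close> would be zero, and Nakayama's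
  lemma would make \<open>p\<close> an isolated point of the curve.\<close>

theorem exists_point_derivation:
  assumes pts: "\<And>\<xi>. algebra_character UNIV R \<xi> \<Longrightarrow> \<exists>x. \<forall>f\<in>R. \<xi> f = f x"
    and u: "u \<in> R" and inf: "infinite (range u)"
  obtains p D where "point_derivation R p D" "D u \<noteq> 0"
proof -
  define M where "M = {\<lambda>x. poly q (u x) | q. q \<noteq> 0}"
  have fin: "q = 0" if "\<And>x. poly q (u x) = 0" for q
  proof (rule ccontr)
    assume "q \<noteq> 0"
    then have "finite {z. poly q z = 0}" by (rule poly_roots_finite)
    moreover have "range u \<subseteq> {z. poly q z = 0}" using that by auto
    ultimately show False using inf finite_subset by blast
  qed
  have I0: "alg_ideal R {0}" by (auto simp: alg_ideal_def alg_0)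
  have "{0} \<inter> M = {}" using fin by (fastforce simp: M_def fun_eq_iff)
  moreover have "M \<subseteq> R" using u by (auto simp: M_def intro: alg_poly)
  moreover have "a * b \<in> M" if ab: "a \<in> M" "b \<in> M" for a b
  proof -
    obtain q r where "a = (\<lambda>x. poly q (u x))" "b = (\<lambda>x. poly r (u x))" "q \<noteq> 0" "r \<noteq> 0"
      using ab by (auto simp: M_def)
    then have "a * b = (\<lambda>x. poly (q * r) (u x))" "q * r \<noteq> 0" by (auto simp: fun_eq_iff)
    then show ?thesis unfolding M_def by blast
  qed
  ultimately obtain P where P: "alg_ideal R P" "{0} \<subseteq> P" "P \<inter> M = {}"
    and inv: "\<forall>a\<in>R. a \<notin> P \<longrightarrow> (\<exists>r\<in>R. \<exists>m\<in>M. a * r - m \<in> P)"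
    and prime: "\<forall>a\<in>R. \<forall>b\<in>R. a * b \<in> P \<longrightarrow> a \<in> P \<or> b \<in> P"
    by (rule exists_maximal_ideal[OF I0, of M])
  note prime = prime[rule_format] and inv = inv[rule_format]
  have notP: "(\<lambda>x. poly q (u x)) \<notin> P" if "q \<noteq> 0" for q using that P(3) M_def by blast
  have inv': "\<exists>r\<in>R. \<exists>q. q \<noteq> 0 \<and> a * r - (\<lambda>x. poly q (u x)) \<in> P" if "a \<in> R" "a \<notin> P" for a
    using inv[OF that] unfolding M_def by blast
  have P1: "1 \<notin> P" using notP[of 1] by (simp add: one_fun_def)
  \<comment> \<open>Every function is algebraic over \<open>u\<close> modulo \<open>P\<close>.
    Unless it is constant there, each \<open>f - c\<close> has an inverse up to a denominator
    \<open>q c\<close> in \<open>u\<close>, and uncountably many inverses satisfy a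
    relation.\<close>
  have algebraic: "\<exists>p. p \<noteq> 0 \<and> (\<lambda>x. poly (poly p [:f x:]) (u x)) \<in> P" if f: "f \<in> R" for f
  proof (cases "\<exists>c. f - (\<lambda>_. c) \<in> P")
    case True
    then obtain c where "f - (\<lambda>_. c) \<in> P" by blast
    moreover have "f - (\<lambda>_. c) = (\<lambda>x. poly (poly [:[:- c:], 1:] [:f x:]) (u x))" by (auto simp: fun_eq_iff)
    ultimately have "[:[:- c:], 1:] \<noteq> 0 \<and> (\<lambda>x. poly (poly [:[:- c:], 1:] [:f x:]) (u x)) \<in> P"
      by auto
    then show ?thesis by blast
  next
    case False
    then have "\<exists>q. \<exists>r\<in>R. q \<noteq> 0 \<and> (f - (\<lambda>_. c)) * r - (\<lambda>x. poly q (u x)) \<in> P" for c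
      using inv'[OF alg_diff[OF f alg_const]] by blast
    then obtain q where q: "\<And>c. \<exists>r\<in>R. q c \<noteq> 0 \<and> (f - (\<lambda>_. c)) * r - (\<lambda>x. poly (q c) (u x)) \<in> P"
      by metis
    then have q': "\<exists>r\<in>R. (f - (\<lambda>_. c)) * r - (\<lambda>x. poly (q c) (u x)) \<in> P" for c by blast
    obtain C \<alpha> c0 where C: "finite C" "C \<subseteq> UNIV" "c0 \<in> C" "\<alpha> c0 \<noteq> 0"
      "(\<Sum>c\<in>C. (\<lambda>_. \<alpha> c) * (\<lambda>x. poly (q c) (u x)) * (\<Prod>d\<in>C - {c}. f - (\<lambda>_. d))) \<in> P"
      by (rule relation_from_inverses[OF P(1) uncountable_UNIV_complex f q'])
    \<comment> \<open>The Lagrange sum with polynomials in \<open>u\<close> as coefficients; setting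
      the outer variable to \<open>c0\<close> again isolates one summand.\<close>
    define p where "p = (\<Sum>c\<in>C. smult (smult (\<alpha> c) (q c)) (\<Prod>d\<in>C - {c}. [:[:- d:], 1:]))"
    have "poly p [:c0:] = (\<Sum>c\<in>C. smult (\<alpha> c) (q c) * (\<Prod>d\<in>C - {c}. [:c0 - d:]))"
      by (simp add: p_def poly_sum poly_prod)
    also have "\<dots> = (\<Sum>c\<in>C. if c = c0 then smult (\<alpha> c) (q c) * (\<Prod>d\<in>C - {c}. [:c0 - d:]) else 0)"
    proof (intro sum.cong refl)
      fix c assume "c \<in> C"
      have "(\<Prod>d\<in>C - {c}. [:c0 - d:]) = 0" if "c \<noteq> c0"
        using C(1,3) that by (intro prod_zero) auto
      then show "smult (\<alpha> c) (q c) * (\<Prod>d\<in>C - {c}. [:c0 - d:]) =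
          (if c = c0 then smult (\<alpha> c) (q c) * (\<Prod>d\<in>C - {c}. [:c0 - d:]) else 0)" by simp
    qed
    also have "\<dots> = smult (\<alpha> c0) (q c0) * (\<Prod>d\<in>C - {c0}. [:c0 - d:])" using C by simp
    also have "\<dots> \<noteq> 0" using C q by (auto simp: prod_zero_iff)
    finally have "p \<noteq> 0" by auto
    moreover have "(\<lambda>x. poly (poly p [:f x:]) (u x)) =
        (\<Sum>c\<in>C. (\<lambda>_. \<alpha> c) * (\<lambda>x. poly (q c) (u x)) * (\<Prod>d\<in>C - {c}. f - (\<lambda>_. d)))"
      by (rule ext) (simp add: p_def poly_sum poly_prod sum_fun_apply prod_fun_apply mult.assoc)
    ultimately show ?thesis using C(5) by metis
  qed
  \<comment> \<open>In a relation of least degree in the outer variable, the derivative is nonzero,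
    by characteristic zero, and of smaller degree, so it cannot be a relation.\<close>
  have separable: "\<exists>p. (\<lambda>x. poly (poly p [:f x:]) (u x)) \<in> P \<and>
      (\<lambda>x. poly (poly (pderiv p) [:f x:]) (u x)) \<notin> P" if f: "f \<in> R" for f
  proof -
    let ?A = "\<lambda>p. p \<noteq> 0 \<and> (\<lambda>x. poly (poly p [:f x:]) (u x)) \<in> P"
    obtain p0 where "?A p0" using algebraic[OF f] by (rule exE)
    from ex_has_least_nat[of ?A p0 degree, OF this] obtain p
      where p: "?A p" "\<forall>q. ?A q \<longrightarrow> degree p \<le> degree q" by blast
    have "degree p \<noteq> 0"
    proof
      assume "degree p = 0"
      then obtain a where "p = [:a:]" by (rule degree_eq_zeroE)
      then show False using p(1) notP[of a] by simp
    qed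
    then have "pderiv p \<noteq> 0" "degree (pderiv p) < degree p"
      by (auto simp: pderiv_eq_0_iff degree_pderiv)
    then have "(\<lambda>x. poly (poly (pderiv p) [:f x:]) (u x)) \<notin> P" using p(2) not_le by blast
    then show ?thesis using p(1) by blast
  qed
  define pf where "pf f = (SOME p. (\<lambda>x. poly (poly p [:f x:]) (u x)) \<in> P \<and>
      (\<lambda>x. poly (poly (pderiv p) [:f x:]) (u x)) \<notin> P)" for f
  have pf: "(\<lambda>x. poly (poly (pf f) [:f x:]) (u x)) \<in> P"
      "(\<lambda>x. poly (poly (pderiv (pf f)) [:f x:]) (u x)) \<notin> P" if "f \<in> R" for f
    using someI_ex[OF separable[OF that]] unfolding pf_def by blast+
  let ?dp = "\<lambda>f x. poly (poly (pderiv (pf f)) [:f x:]) (u x)"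
  have wP: "(\<Prod>f\<in>G. ?dp f) \<notin> P" if "finite G" "G \<subseteq> R" for G
    using that
  proof (induction G rule: finite_induct)
    case empty
    show ?case unfolding prod.empty by (rule P1)
  next
    case (insert f G)
    have fG: "?dp f \<in> R" "(\<Prod>f\<in>G. ?dp f) \<in> R" using insert.prems u by (auto intro!: alg_poly_poly alg_prod)
    have eq: "(\<Prod>f\<in>insert f G. ?dp f) = ?dp f * (\<Prod>f\<in>G. ?dp f)" by (rule prod.insert[OF insert.hyps])
    have "?dp f \<notin> P" "(\<Prod>f\<in>G. ?dp f) \<notin> P" using insert.IH insert.prems pf(2) by blast+
    then show ?case unfolding eq using prime[OF fG] by blast
  qed
  \<comment> \<open>Where \<open>w\<close> does not vanish, all generators are separable over
    \<open>u\<close>. Modulo \<open>P\<close> it divides a polynomial \<open>q0\<close> in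
    \<open>u\<close>, so it suffices to avoid the roots of \<open>q0\<close>.\<close>
  define w where "w = (\<Prod>f\<in>F. ?dp f)"
  have FR: "F \<subseteq> R" using alg_gen by blast
  have w: "w \<in> R" "w \<notin> P" using wP[OF finite_F FR] u FR by (auto simp: w_def intro!: alg_prod alg_poly_poly)
  obtain r q0 where rq: "r \<in> R" "q0 \<noteq> 0" "w * r - (\<lambda>x. poly q0 (u x)) \<in> P" using inv'[OF w] by blast
  \<comment> \<open>If \<open>u - c\<close> were invertible modulo \<open>P\<close> for all
    \<open>c\<close> outside the roots of \<open>q0\<close>, the relation among the inverses would
    put a nonzero polynomial in \<open>u\<close> into \<open>P\<close>.\<close>
  have "\<exists>c. poly q0 c \<noteq> 0 \<and> \<not> (\<exists>g\<in>R. (u - (\<lambda>_. c)) * g - 1 \<in> P)"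
  proof (rule ccontr)
    assume no: "\<not> ?thesis"
    have "uncountable (UNIV - {c. poly q0 c = 0})"
      using rq(2) by (intro uncountable_minus_countable uncountable_UNIV_complex)
        (auto intro: countable_finite poly_roots_finite)
    moreover have i: "\<exists>g\<in>R. (u - (\<lambda>_. c)) * g - 1 \<in> P" if "c \<in> UNIV - {c. poly q0 c = 0}" for c
      using no that by blast
    ultimately obtain C \<alpha> c0 where C: "finite C" "C \<subseteq> UNIV - {c. poly q0 c = 0}" "c0 \<in> C" "\<alpha> c0 \<noteq> 0"
      "(\<Sum>c\<in>C. (\<lambda>_. \<alpha> c) * 1 * (\<Prod>d\<in>C - {c}. u - (\<lambda>_. d))) \<in> P"
      by (rule relation_from_inverses[OF P(1) _ u])
    have "(\<lambda>x. poly (lagrange_sum \<alpha> C) (u x)) \<in> P"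
      unfolding poly_lagrange_sum[of \<alpha> C u] by (rule C(5))
    then show False
      using notP[OF lagrange_sum_nonzero[of C c0 \<alpha>, OF C(1,3,4)]] by blast
  qed
  then obtain c where c: "poly q0 c \<noteq> 0" "\<And>g. g \<in> R \<Longrightarrow> (u - (\<lambda>_. c)) * g - 1 \<notin> P" by blast
  let ?J = "{p + (u - (\<lambda>_. c)) * r | p r. p \<in> P \<and> r \<in> R}"
  have J: "alg_ideal R ?J" by (rule ideal_adjoin[OF P(1) alg_diff[OF u alg_const]])
  have "1 \<notin> ?J"
  proof
    assume "1 \<in> ?J"
    then obtain p r where pr: "p \<in> P" "r \<in> R" "1 = p + (u - (\<lambda>_. c)) * r" by blast
    have "(u - (\<lambda>_. c)) * r - 1 = - p" by (subst pr(3))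
      (simp only: diff_add_eq_diff_diff_swap diff_self diff_0)
    then show False using c(2)[OF pr(2)] ideal_uminus[OF P(1) pr(1)] by metis
  qed
  then obtain \<xi> where \<xi>: "algebra_character UNIV R \<xi>" "\<And>f. f \<in> ?J \<Longrightarrow> \<xi> f = 0"
    using nullstellensatz[OF J] by blast
  obtain p where p: "\<And>f. f \<in> R \<Longrightarrow> \<xi> f = f p" using pts[OF \<xi>(1)] by blast
  have Jp: "f p = 0" if "f \<in> ?J" for f using \<xi>(2)[OF that] p ideal_in[OF J that] by simp
  have Pp: "f p = 0" if "f \<in> P" for f
  proof -
    have "f = f + (u - (\<lambda>_. c)) * 0" by simp
    then show ?thesis using Jp that alg_0 by blast
  qed
  have up: "u p = c"
  proof -
    have "u - (\<lambda>_. c) = 0 + (u - (\<lambda>_. c)) * 1" by simp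
    then have "(u - (\<lambda>_. c)) p = 0" using Jp ideal_0[OF P(1)] alg_1 by blast
    then show ?thesis by simp
  qed
  \<comment> \<open>The product \<open>w p * r p\<close> is the value of \<open>q0\<close> at
    \<open>c\<close>.\<close>
  have wp: "w p \<noteq> 0" using Pp[OF rq(3)] c(1) up by auto
  have dpp: "?dp f p \<noteq> 0" if "f \<in> F" for f
    using wp that finite_F unfolding w_def prod_fun_apply by (simp add: prod_zero_iff)
  note found = that
  show thesis
  proof (rule ccontr)
    assume "\<not> thesis"
    then have none: "D u = 0" if "point_derivation R p D" for D using that found by blast
    define m where "m = {f \<in> R. f p = 0}"
    let ?Q = "funs.span ({s * t | s t. s \<in> m \<and> t \<in> m} \<union> P)"
    have Pm: "P \<subseteq> m" using Pp ideal_in[OF P(1)] m_def by blast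
    \<comment> \<open>A functional killing \<open>m^2 + P\<close> but not all of \<open>m\<close>
      gives a derivation at \<open>p\<close> that vanishes on \<open>P\<close>. It kills
      \<open>u\<close> by assumption, and then every generator by the chain rule, as the factor
      \<open>?dp f p\<close> is nonzero.\<close>
    have "m \<subseteq> ?Q"
    proof (rule ccontr)
      assume "\<not> m \<subseteq> ?Q"
      then obtain f0 where f0: "f0 \<in> m" "f0 \<notin> ?Q" by blast
      obtain \<phi> where \<phi>: "Vector_Spaces.linear (\<lambda>c f. (\<lambda>_. c) * f) (*) \<phi>" "\<forall>x\<in>?Q. \<phi> x = 0" "\<phi> f0 = 1"
        by (rule separating_functional[OF funs.vector_space_axioms funs.subspace_span f0(2)])
      interpret \<phi>: Vector_Spaces.linear "\<lambda>c (f :: 'x \<Rightarrow> complex). (\<lambda>_. c) * f" "(*)" \<phi> by fact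
      define D where "D f = \<phi> (f - (\<lambda>_. f p))" for f
      have D: "point_derivation R p D"
        unfolding point_derivation_def
      proof (intro conjI allI ballI)
        fix c
        have "(\<lambda>_. c) - (\<lambda>_. c) = (0 :: 'x \<Rightarrow> complex)" by simp
        then show "D (\<lambda>_. c) = 0" unfolding D_def using \<phi>.zero by metis
      next
        fix f g assume fg: "f \<in> R" "g \<in> R"
        have "f + g - (\<lambda>_. (f + g) p) = (f - (\<lambda>_. f p)) + (g - (\<lambda>_. g p))" by (auto simp: fun_eq_iff)
        then show "D (f + g) = D f + D g" unfolding D_def using \<phi>.add by metis
        let ?f = "f - (\<lambda>_. f p)" and ?g = "g - (\<lambda>_. g p)"
        have "?f \<in> m" "?g \<in> m" using fg by (auto simp: m_def intro!: alg_diff alg_const)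
        then have "?f * ?g \<in> ?Q" by (intro funs.span_base) blast
        then have "\<phi> (?f * ?g) = 0" using \<phi>(2) by blast
        moreover have "f * g - (\<lambda>_. (f * g) p) = ?f * ?g + ((\<lambda>_. g p) * ?f + (\<lambda>_. f p) * ?g)"
          by (auto simp: fun_eq_iff algebra_simps)
        ultimately show "D (f * g) = D f * g p + f p * D g"
          unfolding D_def by (simp only: \<phi>.add \<phi>.scale) simp
      qed
      have DP: "D f = 0" if "f \<in> P" for f
      proof -
        have "f - (\<lambda>_. f p) = f" using Pp[OF that] by (auto simp: fun_eq_iff)
        then show ?thesis unfolding D_def using \<phi>(2) that by (auto intro: funs.span_base)
      qed
      have Du: "D u = 0" by (rule none[OF D])
      have DF: "D f = 0" if "f \<in> F" for f
        using point_derivation_poly_poly[OF D u Du, of f "pf f"] DP[OF pf(1)[of f]] dpp[OF that] FR that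
          by auto
      have "D f = 0" if "f \<in> R" for f
        using that
      proof (induction rule: alg_induct)
        case (gen f)
        then show ?case by (rule DF)
      next
        case (const c)
        then show ?case by (rule point_derivation_const[OF D])
      next
        case (add f g)
        show ?case unfolding point_derivation_add[OF D add(1,2)] using add(3,4) by simp
      next
        case (mult f g)
        show ?case unfolding point_derivation_mult[OF D mult(1,2)] using mult(3,4) by simp
      qed
      then have "D f0 = 0" using f0(1) m_def by blast
      moreover have "f0 - (\<lambda>_. f0 p) = f0" using f0(1) m_def by (auto simp: fun_eq_iff)
      ultimately show False unfolding D_def using \<phi>(3) by simp
    qed
    then obtain e where e: "e \<in> m" "\<And>f. f \<in> m \<Longrightarrow> (1 - e) * f \<in> P"
      using nakayama[OF P(1) m_def Pm] by blast
    \<comment> \<open>Since \<open>1 - e\<close> has value 1 at \<open>p\<close>, it is not in the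
      prime \<open>P\<close>, which would have to contain \<open>u - c\<close>, a nonzero polynomial
      in \<open>u\<close>.\<close>
    have "u - (\<lambda>_. c) \<in> m" using u up by (auto simp: m_def intro!: alg_diff alg_const)
    then have "(1 - e) * (u - (\<lambda>_. c)) \<in> P" by (rule e(2))
    then have "1 - e \<in> P \<or> u - (\<lambda>_. c) \<in> P"
      using prime[of "1 - e" "u - (\<lambda>_. c)"] e(1) u m_def by (auto intro: alg_diff alg_1 alg_const)
    moreover have "1 - e \<notin> P" using Pp[of "1 - e"] e(1) m_def by auto
    moreover have "u - (\<lambda>_. c) = (\<lambda>x. poly [:- c, 1:] (u x))" by (auto simp: fun_eq_iff)
    then have "u - (\<lambda>_. c) \<notin> P" using notP[of "[:- c, 1:]"] by auto
    ultimately show False by blast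
  qed
qed

end

section \<open>Dominant maps\<close>

definition function_domain :: "('x \<Rightarrow> complex) set \<Rightarrow> bool" where
  "function_domain B \<longleftrightarrow> (\<forall>f\<in>B. \<forall>g\<in>B. f * g = 0 \<longrightarrow> f = 0 \<or> g = 0)"

text \<open>The functional \<open>\<Lambda>\<close> replaces evaluation at a point of the fibre of \<open>\<beta>\<close> over \<open>p\<close>: on a maximal
  \<open>B\<close>-independent subset of \<open>E\<close> it is free, and \<open>q\<close> is a common denominator for the rest of \<open>E\<close>.\<close>

lemma generic_functional:
  fixes \<beta> :: "'x \<Rightarrow> 'w" and L :: "('w \<Rightarrow> complex) set"
  defines "B \<equiv> generated_algebra UNIV L"
  assumes dom: "function_domain B"
    and dominant: "\<And>f. f \<in> B \<Longrightarrow> (\<And>x. f (\<beta> x) = 0) \<Longrightarrow> f = 0"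
    and E: "finite E" "1 \<in> E"
  obtains q where "q \<in> B" "q \<noteq> 0"
    "\<forall>p. q p \<noteq> 0 \<longrightarrow> (\<exists>\<Lambda>. \<Lambda> 1 = (1::complex) \<and>
       (\<forall>b. (\<forall>e\<in>E. b e \<in> B) \<and> (\<forall>x. (\<Sum>e\<in>E. b e (\<beta> x) * e x) = 0) \<longrightarrow> (\<Sum>e\<in>E. b e p * \<Lambda> e) = 0))"
proof -
  interpret B: function_algebra L .
  \<comment> \<open>Linear independence over \<open>B\<close>, which acts on functions of
    \<open>x\<close> through \<open>\<beta>\<close>.\<close>
  define ind where "ind G \<longleftrightarrow> (\<forall>b. (\<forall>e\<in>G. b e \<in> B) \<and> (\<forall>x. (\<Sum>e\<in>G. b e (\<beta> x) * e x) = 0) \<longrightarrow> (\<forall>e\<in>G. b e = 0))"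
    for G :: "('x \<Rightarrow> complex) set"
  have "ind {1}" unfolding ind_def using dominant by auto
  \<comment> \<open>Only sets containing 1 compete, because \<open>\<Lambda>\<close> is read off
    from the coefficient of 1.\<close>
  moreover define Q where "Q G \<longleftrightarrow> G \<subseteq> E \<and> 1 \<in> G \<and> ind G" for G
  ultimately have "Q {1}" using E by simp
  moreover have "\<forall>G. Q G \<longrightarrow> card G < Suc (card E)" using E card_mono by (fastforce simp: Q_def less_Suc_eq_le)
  ultimately have "\<exists>G. Q G \<and> (\<forall>H. Q H \<longrightarrow> card H \<le> card G)" by (rule ex_has_greatest_nat)
  then obtain E0 where QE0: "Q E0" and max': "\<forall>H. Q H \<longrightarrow> card H \<le> card E0" by blast
  have E0: "E0 \<subseteq> E" "1 \<in> E0" "ind E0" using QE0 by (simp_all add: Q_def)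
  have max: "card G \<le> card E0" if "G \<subseteq> E" "1 \<in> G" "ind G" for G
    using max' that Q_def by blast
  have fE0: "finite E0" using E0 E finite_subset by blast
  have ex: "\<exists>q\<in>B. q \<noteq> 0 \<and> (\<exists>a. (\<forall>e'\<in>E0. a e' \<in> B) \<and> (\<forall>x. q (\<beta> x) * e x = (\<Sum>e'\<in>E0. a e' (\<beta> x) * e' x)))"
    if e: "e \<in> E" for e
  proof (cases "e \<in> E0")
    case True
    let ?a = "\<lambda>e'. if e' = e then 1 else (0 :: 'w \<Rightarrow> complex)"
    have "(\<Sum>e'\<in>E0. ?a e' (\<beta> x) * e' x) = (\<Sum>e'\<in>E0. if e' = e then e' x else 0)" for x
      by (intro sum.cong) auto
    then have "\<forall>x. 1 (\<beta> x) * e x = (\<Sum>e'\<in>E0. ?a e' (\<beta> x) * e' x)" using True fE0 by simp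
    moreover have "\<forall>e'\<in>E0. ?a e' \<in> B" using B.alg_1 B.alg_0 B_def by simp
    moreover have "1 \<in> B" "1 \<noteq> (0 :: 'w \<Rightarrow> complex)" using B.alg_1 B_def by (auto simp: fun_eq_iff)
    ultimately show ?thesis by (intro bexI[of _ 1] conjI exI[of _ ?a])
  next
    case False
    then have "card (insert e E0) > card E0" using fE0 by simp
    then have "\<not> ind (insert e E0)" using max[of "insert e E0"] E0 e by auto
    then obtain b where b: "\<And>e'. e' \<in> insert e E0 \<Longrightarrow> b e' \<in> B"
      "\<And>x. (\<Sum>e'\<in>insert e E0. b e' (\<beta> x) * e' x) = 0" "\<not> (\<forall>e'\<in>insert e E0. b e' = 0)"
      unfolding ind_def by blast
    have rel: "b e (\<beta> x) * e x + (\<Sum>e'\<in>E0. b e' (\<beta> x) * e' x) = 0" for x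
      using b(2)[of x] False fE0 by simp
    have "b e \<noteq> 0"
    proof
      assume "b e = 0"
      then have "(\<Sum>e'\<in>E0. b e' (\<beta> x) * e' x) = 0" for x using rel[of x] by simp
      then have "\<forall>e'\<in>E0. b e' = 0" using E0(3) b(1) unfolding ind_def by blast
      then show False using b(3) \<open>b e = 0\<close> by simp
    qed
    moreover have "\<forall>x. b e (\<beta> x) * e x = (\<Sum>e'\<in>E0. (- b e') (\<beta> x) * e' x)"
      using rel by (simp add: sum_negf eq_neg_iff_add_eq_0)
    moreover have "\<forall>e'\<in>E0. - b e' \<in> B" using b(1) B.alg_uminus B_def by simp
    moreover have "b e \<in> B" using b(1) by simp
    ultimately show ?thesis by (intro bexI[of _ "b e"] conjI exI[of _ "\<lambda>e'. - b e'"]) auto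
  qed
  define qf where "qf e = (SOME q. q \<in> B \<and> q \<noteq> 0 \<and>
    (\<exists>a. (\<forall>e'\<in>E0. a e' \<in> B) \<and> (\<forall>x. q (\<beta> x) * e x = (\<Sum>e'\<in>E0. a e' (\<beta> x) * e' x))))" for e
  have qf: "qf e \<in> B \<and> qf e \<noteq> 0 \<and>
    (\<exists>a. (\<forall>e'\<in>E0. a e' \<in> B) \<and> (\<forall>x. qf e (\<beta> x) * e x = (\<Sum>e'\<in>E0. a e' (\<beta> x) * e' x)))" if "e \<in> E" for e
    using someI_ex[OF ex[OF that, unfolded Bex_def]] unfolding qf_def .
  define q where "q = (\<Prod>e\<in>E. qf e)"
  have prodne: "(\<Prod>e\<in>G. qf e) \<noteq> 0 \<and> (\<Prod>e\<in>G. qf e) \<in> B" if "finite G" "G \<subseteq> E" for G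
    using that
  proof (induction G rule: finite_induct)
    case empty
    have "(1 :: 'w \<Rightarrow> complex) \<noteq> 0" by (simp add: fun_eq_iff)
    then show ?case unfolding prod.empty B_def using B.alg_1 by blast
  next
    case (insert e G)
    then have "qf e \<noteq> 0" "qf e \<in> B" "(\<Prod>e\<in>G. qf e) \<noteq> 0" "(\<Prod>e\<in>G. qf e) \<in> B" using qf by auto
    then have "qf e * (\<Prod>e\<in>G. qf e) \<noteq> 0" "qf e * (\<Prod>e\<in>G. qf e) \<in> B"
      using dom B.alg_mult B_def unfolding function_domain_def by blast+
    then show ?case unfolding prod.insert[OF insert.hyps] by blast
  qed
  have q: "q \<in> B" "q \<noteq> 0" using prodne[OF E(1)] q_def by auto
  have "\<exists>a. (\<forall>e'\<in>E0. a e' \<in> B) \<and> (\<forall>x. q (\<beta> x) * e x = (\<Sum>e'\<in>E0. a e' (\<beta> x) * e' x))" if e: "e \<in> E" for e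
  proof -
    obtain a where a: "\<forall>e'\<in>E0. a e' \<in> B" "\<forall>x. qf e (\<beta> x) * e x = (\<Sum>e'\<in>E0. a e' (\<beta> x) * e' x)"
      using qf[OF e] by blast
    let ?r = "\<Prod>e\<in>E - {e}. qf e"
    have "q = ?r * qf e" unfolding q_def using E(1) e by (simp add: prod.remove mult.commute)
    then have "q (\<beta> x) * e x = (\<Sum>e'\<in>E0. (?r * a e') (\<beta> x) * e' x)" for x
      using a(2) by (simp add: sum_distrib_left mult.assoc)
    moreover have "?r \<in> B" using prodne[of "E - {e}"] E by auto
    then have "\<forall>e'\<in>E0. ?r * a e' \<in> B" using a(1) B.alg_mult B_def by blast
    ultimately show ?thesis by (intro exI[of _ "\<lambda>e'. ?r * a e'"]) blast
  qed
  then obtain a where a: "\<And>e e'. e \<in> E \<Longrightarrow> e' \<in> E0 \<Longrightarrow> a e e' \<in> B"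
    "\<And>e x. e \<in> E \<Longrightarrow> q (\<beta> x) * e x = (\<Sum>e'\<in>E0. a e e' (\<beta> x) * e' x)" by metis
  \<comment> \<open>The expansion of \<open>q * 1\<close> over an independent set is unique.\<close>
  have a1: "a 1 1 = q"
  proof -
    let ?b = "\<lambda>e'. a 1 e' - (if e' = 1 then q else 0)"
    have "(\<Sum>e'\<in>E0. ?b e' (\<beta> x) * e' x) = 0" for x
    proof -
      have "(\<Sum>e'\<in>E0. ?b e' (\<beta> x) * e' x) =
          (\<Sum>e'\<in>E0. a 1 e' (\<beta> x) * e' x) - (\<Sum>e'\<in>E0. if e' = 1 then q (\<beta> x) * e' x else 0)"
        unfolding sum_subtractf[symmetric] by (intro sum.cong) (auto simp: algebra_simps)
      also have "\<dots> = 0" using a(2)[OF E(2), of x] E0(2) fE0 by simp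
      finally show ?thesis .
    qed
    moreover have "\<forall>e'\<in>E0. ?b e' \<in> B" using a(1)[OF E(2)] q B.alg_0 B.alg_diff B_def by auto
    ultimately have "\<forall>e'\<in>E0. ?b e' = 0"
      by (intro E0(3)[unfolded ind_def, THEN spec[of _ ?b], THEN mp] conjI allI)
    then show ?thesis using E0(2) by auto
  qed
  show thesis
  proof (rule that[OF q], intro allI impI)
    fix p assume p: "q p \<noteq> 0"
    show "\<exists>\<Lambda>. \<Lambda> 1 = (1::complex) \<and>
       (\<forall>b. (\<forall>e\<in>E. b e \<in> B) \<and> (\<forall>x. (\<Sum>e\<in>E. b e (\<beta> x) * e x) = 0) \<longrightarrow> (\<Sum>e\<in>E. b e p * \<Lambda> e) = 0)"
    \<comment> \<open>\<open>\<Lambda> e\<close> is the coefficient of 1 in the expansion of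
      \<open>e\<close> over \<open>E0\<close>, with its denominator, evaluated at \<open>p\<close>.
      A relation over \<open>E\<close> multiplied by \<open>q\<close> becomes one over
      \<open>E0\<close>, whose coefficient of 1 must vanish.\<close>
    proof (intro exI[of _ "\<lambda>e. a e 1 p / q p"] conjI allI impI)
      show "a 1 1 p / q p = 1" using p a1 by simp
    next
      fix b assume b: "(\<forall>e\<in>E. b e \<in> B) \<and> (\<forall>x. (\<Sum>e\<in>E. b e (\<beta> x) * e x) = 0)"
      let ?c = "\<lambda>e'. \<Sum>e\<in>E. b e * a e e'"
      have "(\<Sum>e'\<in>E0. ?c e' (\<beta> x) * e' x) = 0" for x
      proof -
        have "(\<Sum>e'\<in>E0. ?c e' (\<beta> x) * e' x) = (\<Sum>e'\<in>E0. \<Sum>e\<in>E. b e (\<beta> x) * (a e e' (\<beta> x) * e' x))"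
          by (simp add: sum_fun_apply sum_distrib_right mult.assoc)
        also have "\<dots> = (\<Sum>e\<in>E. b e (\<beta> x) * (\<Sum>e'\<in>E0. a e e' (\<beta> x) * e' x))"
          by (subst sum.swap) (simp add: sum_distrib_left)
        also have "\<dots> = (\<Sum>e\<in>E. b e (\<beta> x) * (q (\<beta> x) * e x))" using a(2) by (intro sum.cong) auto
        also have "\<dots> = q (\<beta> x) * (\<Sum>e\<in>E. b e (\<beta> x) * e x)" by (simp add: sum_distrib_left algebra_simps)
        finally show ?thesis using b by simp
      qed
      moreover have "\<forall>e'\<in>E0. ?c e' \<in> B"
        unfolding B_def using a(1) b by (intro ballI B.alg_sum B.alg_mult) (auto simp: B_def)
      ultimately have "\<forall>e'\<in>E0. ?c e' = 0"
        by (intro E0(3)[unfolded ind_def, THEN spec[of _ ?c], THEN mp] conjI allI)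
      then have "?c 1 = 0" using E0(2) by blast
      then have "?c 1 p = 0" by simp
      then show "(\<Sum>e\<in>E. b e p * (a e 1 p / q p)) = 0"
        by (simp add: sum_fun_apply flip: sum_divide_distrib)
    qed
  qed
qed

text \<open>An element of the tensor product is a finite sum of products. A summand is indexed by
  the pair of its factors, and \<open>\<gamma>\<close> is 0 outside \<open>K\<close>, so that
  \<open>K\<close> may later be enlarged to a rectangle.\<close>

lemma product_algebra_sums:
  assumes t: "t \<in> generated_algebra UNIV ((\<lambda>f p. f (fst p)) ` F1 \<union> (\<lambda>g p. g (snd p)) ` F2)"
  obtains K \<gamma> where "finite K" "\<And>k. k \<notin> K \<Longrightarrow> \<gamma> k = (0::complex)"
    "\<And>x y. t (x, y) = (\<Sum>k\<in>K. \<gamma> k * (fst k x * snd k y))"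
proof -
  interpret T: function_algebra "(\<lambda>f p. f (fst p)) ` F1 \<union> (\<lambda>g p. g (snd p)) ` F2" .
  define rep where "rep t \<longleftrightarrow> (\<exists>K \<gamma>. finite K \<and> (\<forall>k. k \<notin> K \<longrightarrow> \<gamma> k = (0::complex)) \<and>
    (\<forall>x y. t (x, y) = (\<Sum>k\<in>K. \<gamma> k * (fst k x * snd k y))))" for t :: "'a \<times> 'b \<Rightarrow> complex"
  have repI: "rep t" if "finite K" "\<And>x y. t (x, y) = (\<Sum>k\<in>K. \<gamma> k * (fst k x * snd k y))" for t K \<gamma>
    unfolding rep_def using that
    by (intro exI[of _ K] exI[of _ "\<lambda>k. if k \<in> K then \<gamma> k else 0"]) auto
  have rep1: "rep (\<lambda>p. c * (r (fst p) * s (snd p)))" for c r s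
    by (rule repI[of "{(r, s)}" _ "\<lambda>_. c"]) auto
  have rep_add: "rep (f + g)" if fg: "rep f" "rep g" for f g
  proof -
    obtain K \<gamma> where K: "finite K" "\<forall>k. k \<notin> K \<longrightarrow> \<gamma> k = 0" "\<forall>x y. f (x, y) = (\<Sum>k\<in>K. \<gamma> k * (fst k x * snd k y))"
      using fg(1) unfolding rep_def by (elim exE conjE)
    obtain K' \<gamma>' where K': "finite K'" "\<forall>k. k \<notin> K' \<longrightarrow> \<gamma>' k = 0"
      "\<forall>x y. g (x, y) = (\<Sum>k\<in>K'. \<gamma>' k * (fst k x * snd k y))"
      using fg(2) unfolding rep_def by (elim exE conjE)
    have "f (x, y) = (\<Sum>k\<in>K \<union> K'. \<gamma> k * (fst k x * snd k y))" for x y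
      unfolding K(3)[rule_format] using K K' by (intro sum.mono_neutral_left) auto
    moreover have "g (x, y) = (\<Sum>k\<in>K \<union> K'. \<gamma>' k * (fst k x * snd k y))" for x y
      unfolding K'(3)[rule_format] using K K' by (intro sum.mono_neutral_left) auto
    ultimately show ?thesis using K(1) K'(1)
      by (intro repI[of "K \<union> K'" _ "\<lambda>k. \<gamma> k + \<gamma>' k"]) (auto simp: sum.distrib algebra_simps)
  qed
  have rep_sum: "rep (\<Sum>i\<in>I. f i)" if "\<And>i. i \<in> I \<Longrightarrow> rep (f i)" "finite I" for f and I :: "'i set"
    using that(2,1)
  proof (induction I rule: finite_induct)
    case empty
    have "(\<Sum>i\<in>{}. f i) = (\<lambda>p. 0 * ((\<lambda>_. 0) (fst p) * (\<lambda>_. 0) (snd p)))" by (auto simp: fun_eq_iff)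
    then show ?case by (rule back_subst[of rep, OF rep1 sym])
  next
    case (insert i I)
    then show ?case using rep_add by (simp del: plus_fun_apply)
  qed
  have "rep t"
    using t
  proof (induction rule: T.alg_induct)
    case (gen f)
    then consider r where "f = (\<lambda>p. 1 * (r (fst p) * (\<lambda>_. 1) (snd p)))"
      | s where "f = (\<lambda>p. 1 * ((\<lambda>_. 1) (fst p) * s (snd p)))" by auto
    then show ?case using rep1 by cases (simp_all only:)
  next
    case (const c)
    have "(\<lambda>_. c) = (\<lambda>p. c * ((\<lambda>_. 1) (fst p) * (\<lambda>_. 1) (snd p)))" by auto
    then show ?case by (rule back_subst[of rep, OF rep1 sym])
  next
    case (add f g)
    show ?case by (rule rep_add[OF add(3,4)])
  next
    case (mult f g)
    obtain K \<gamma> where K: "finite K" "\<forall>x y. f (x, y) = (\<Sum>k\<in>K. \<gamma> k * (fst k x * snd k y))"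
      using mult(3) unfolding rep_def by (elim exE conjE)
    obtain K' \<gamma>' where K': "finite K'" "\<forall>x y. g (x, y) = (\<Sum>k\<in>K'. \<gamma>' k * (fst k x * snd k y))"
      using mult(4) unfolding rep_def by (elim exE conjE)
    have eq: "f * g = (\<Sum>(k, k')\<in>K \<times> K'. (\<lambda>p. (\<gamma> k * \<gamma>' k') * ((fst k * fst k') (fst p) * (snd k * snd k') (snd p))))"
      by (auto simp: fun_eq_iff K K' sum_fun_apply sum_product sum.cartesian_product intro!: sum.cong)
    show ?case unfolding eq using K K' rep1 by (intro rep_sum) (auto split: prod.splits)
  qed
  then show thesis using that unfolding rep_def by blast
qed

text \<open>If the fibre product were empty, the differences
  \<open>f (\<beta>1 x) - f (\<beta>2 y)\<close> would generate the unit ideal. Applying generic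
  functionals in \<open>x\<close> and then in \<open>y\<close> to this identity replaces both values
  by \<open>f p\<close>, giving 0 = 1. The auxiliary point \<open>p\<close> itself may lie outside
  both images.\<close>

theorem common_image_point:
  fixes \<beta>1 :: "'x \<Rightarrow> 'w" and \<beta>2 :: "'y \<Rightarrow> 'w"
  assumes fin: "finite F1" "finite F2" "finite L"
    and pts1: "\<And>\<xi>. algebra_character UNIV (generated_algebra UNIV F1) \<xi> \<Longrightarrow> \<exists>x. \<forall>f\<in>generated_algebra UNIV F1. \<xi> f = f x"
    and pts2: "\<And>\<xi>. algebra_character UNIV (generated_algebra UNIV F2) \<xi> \<Longrightarrow> \<exists>x. \<forall>f\<in>generated_algebra UNIV F2. \<xi> f = f x"
    and \<beta>1: "\<And>f. f \<in> L \<Longrightarrow> (\<lambda>x. f (\<beta>1 x)) \<in> generated_algebra UNIV F1"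
    and \<beta>2: "\<And>f. f \<in> L \<Longrightarrow> (\<lambda>x. f (\<beta>2 x)) \<in> generated_algebra UNIV F2"
    and dom: "function_domain (generated_algebra UNIV L)"
    and dom1: "\<And>f. f \<in> generated_algebra UNIV L \<Longrightarrow> (\<And>x. f (\<beta>1 x) = 0) \<Longrightarrow> f = 0"
    and dom2: "\<And>f. f \<in> generated_algebra UNIV L \<Longrightarrow> (\<And>x. f (\<beta>2 x) = 0) \<Longrightarrow> f = 0"
  obtains x y where "\<And>f. f \<in> L \<Longrightarrow> f (\<beta>1 x) = f (\<beta>2 y)"
proof -
  let ?F = "(\<lambda>f p. f (fst p)) ` F1 \<union> (\<lambda>g p. g (snd p)) ` F2 :: ('x \<times> 'y \<Rightarrow> complex) set"
  interpret A1: fg_function_algebra F1 by unfold_locales (rule fin)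
  interpret A2: fg_function_algebra F2 by unfold_locales (rule fin)
  interpret B: fg_function_algebra L by unfold_locales (rule fin)
  interpret T: fg_function_algebra ?F by unfold_locales (use fin in auto)
  have T1: "(\<lambda>p. r (fst p)) \<in> T.R" if "r \<in> A1.R" for r
    using that
  proof (induction rule: A1.alg_induct)
    case (add f g)
    have eq: "(\<lambda>p. (f + g) (fst p)) = (\<lambda>p. f (fst p)) + (\<lambda>p. g (fst p))" by (auto simp: fun_eq_iff)
    show ?case by (rule back_subst[of "\<lambda>h. h \<in> T.R", OF T.alg_add[OF add(3,4)] eq[symmetric]])
  next
    case (mult f g)
    have eq: "(\<lambda>p. (f * g) (fst p)) = (\<lambda>p. f (fst p)) * (\<lambda>p. g (fst p))" by (auto simp: fun_eq_iff)
    show ?case by (rule back_subst[of "\<lambda>h. h \<in> T.R", OF T.alg_mult[OF mult(3,4)] eq[symmetric]])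
  qed (auto intro: T.alg_gen T.alg_const)
  have T2: "(\<lambda>p. r (snd p)) \<in> T.R" if "r \<in> A2.R" for r
    using that
  proof (induction rule: A2.alg_induct)
    case (add f g)
    have eq: "(\<lambda>p. (f + g) (snd p)) = (\<lambda>p. f (snd p)) + (\<lambda>p. g (snd p))" by (auto simp: fun_eq_iff)
    show ?case by (rule back_subst[of "\<lambda>h. h \<in> T.R", OF T.alg_add[OF add(3,4)] eq[symmetric]])
  next
    case (mult f g)
    have eq: "(\<lambda>p. (f * g) (snd p)) = (\<lambda>p. f (snd p)) * (\<lambda>p. g (snd p))" by (auto simp: fun_eq_iff)
    show ?case by (rule back_subst[of "\<lambda>h. h \<in> T.R", OF T.alg_mult[OF mult(3,4)] eq[symmetric]])
  qed (auto intro: T.alg_gen T.alg_const)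
  let ?d = "\<lambda>f p. f (\<beta>1 (fst p)) - f (\<beta>2 (snd p))"
  have dT: "?d f \<in> T.R" if "f \<in> L" for f
  proof -
    have eq: "?d f = (\<lambda>p. f (\<beta>1 (fst p))) - (\<lambda>p. f (\<beta>2 (snd p)))" by (auto simp: fun_eq_iff)
    show ?thesis
      by (rule back_subst[of "\<lambda>h. h \<in> T.R", OF T.alg_diff[OF T1[OF \<beta>1[OF that]] T2[OF \<beta>2[OF that]]]
        eq[symmetric]])
  qed
  let ?J = "{\<Sum>f\<in>L. ?d f * t f | t. \<forall>f\<in>L. t f \<in> T.R}"
  have J: "alg_ideal T.R ?J"
    unfolding alg_ideal_def
  proof (intro conjI ballI)
    show "?J \<subseteq> T.R" using dT by (auto intro!: T.alg_sum T.alg_mult)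
    have "(\<Sum>f\<in>L. ?d f * (\<lambda>_. 0) f) = (0 :: 'x \<times> 'y \<Rightarrow> complex)" by (simp add: fun_eq_iff sum_fun_apply)
    moreover have "\<forall>f\<in>L. (\<lambda>_. 0) f \<in> T.R" using T.alg_0 by simp
    ultimately show "0 \<in> ?J" by (intro CollectI exI[of _ "\<lambda>_. 0"]) auto
  next
    fix g h assume "g \<in> ?J" "h \<in> ?J"
    then obtain t t' where t: "g = (\<Sum>f\<in>L. ?d f * t f)" "\<forall>f\<in>L. t f \<in> T.R"
      "h = (\<Sum>f\<in>L. ?d f * t' f)" "\<forall>f\<in>L. t' f \<in> T.R" by blast
    have "g + h = (\<Sum>f\<in>L. ?d f * (t f + t' f))"
      unfolding t by (simp only: distrib_left sum.distrib)
    moreover have "\<forall>f\<in>L. t f + t' f \<in> T.R" using t by (auto intro: T.alg_add)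
    ultimately show "g + h \<in> ?J" by (intro CollectI exI[of _ "\<lambda>f. t f + t' f"] conjI)
  next
    fix h g assume h: "h \<in> T.R" and "g \<in> ?J"
    then obtain t where t: "g = (\<Sum>f\<in>L. ?d f * t f)" "\<forall>f\<in>L. t f \<in> T.R" by blast
    have "h * g = (\<Sum>f\<in>L. ?d f * (h * t f))"
      unfolding t sum_distrib_left by (intro sum.cong refl mult.left_commute)
    moreover have "\<forall>f\<in>L. h * t f \<in> T.R" using t h by (auto intro: T.alg_mult)
    ultimately show "h * g \<in> ?J" by (intro CollectI exI[of _ "\<lambda>f. h * t f"] conjI)
  qed
  have "1 \<notin> ?J"
  proof
    assume "1 \<in> ?J"
    then obtain t where t: "(\<Sum>f\<in>L. ?d f * t f) = 1" "\<And>f. f \<in> L \<Longrightarrow> t f \<in> T.R" by force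
    define rp where "rp f K \<gamma> \<longleftrightarrow> finite K \<and> (\<forall>k. k \<notin> K \<longrightarrow> \<gamma> k = (0::complex)) \<and>
      (\<forall>x y. t f (x, y) = (\<Sum>k\<in>K. \<gamma> k * (fst k x * snd k y)))" for f K \<gamma>
    have "\<forall>f\<in>L. \<exists>K \<gamma>. rp f K \<gamma>"
    proof
      fix f assume f: "f \<in> L"
      show "\<exists>K \<gamma>. rp f K \<gamma>" by (rule product_algebra_sums[OF t(2)[OF f]]) (auto simp: rp_def)
    qed
    then obtain K \<gamma> where "\<forall>f\<in>L. rp f (K f) (\<gamma> f)" by metis
    then have K: "\<And>f. f \<in> L \<Longrightarrow> finite (K f)" "\<And>f k. f \<in> L \<Longrightarrow> k \<notin> K f \<Longrightarrow> \<gamma> f k = (0::complex)"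
      "\<And>f x y. f \<in> L \<Longrightarrow> t f (x, y) = (\<Sum>k\<in>K f. \<gamma> f k * (fst k x * snd k y))"
      unfolding rp_def by blast+
    \<comment> \<open>All first factors that occur, together with 1 for the right hand side of the
      identity.\<close>
    define E1 where "E1 = insert 1 (fst ` (\<Union>f\<in>L. K f))"
    define E2 where "E2 = insert 1 (snd ` (\<Union>f\<in>L. K f))"
    have E: "finite E1" "1 \<in> E1" "finite E2" "1 \<in> E2" using fin K(1) by (auto simp: E1_def E2_def)
    have tE: "t f (x, y) = (\<Sum>r\<in>E1. \<Sum>s\<in>E2. \<gamma> f (r, s) * (r x * s y))" if f: "f \<in> L" for f x y
    proof -
      have "K f \<subseteq> E1 \<times> E2"
        using f by (auto simp: E1_def E2_def) (metis UN_I fst_conv snd_conv image_eqI)+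
      then have "(\<Sum>k\<in>K f. \<gamma> f k * (fst k x * snd k y)) = (\<Sum>k\<in>E1 \<times> E2. \<gamma> f k * (fst k x * snd k y))"
        using E K(2)[OF f] by (intro sum.mono_neutral_left) auto
      then show ?thesis by (simp add: K(3)[OF f] sum.cartesian_product split_def)
    qed
    obtain q1 where q1: "q1 \<in> B.R" "q1 \<noteq> 0" and L1: "\<forall>p. q1 p \<noteq> 0 \<longrightarrow> (\<exists>\<Lambda>. \<Lambda> 1 = (1::complex) \<and>
       (\<forall>b. (\<forall>e\<in>E1. b e \<in> B.R) \<and> (\<forall>x. (\<Sum>e\<in>E1. b e (\<beta>1 x) * e x) = 0) \<longrightarrow> (\<Sum>e\<in>E1. b e p * \<Lambda> e) = 0))"
      by (rule generic_functional[OF dom dom1 E(1,2)])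
    obtain q2 where q2: "q2 \<in> B.R" "q2 \<noteq> 0" and L2: "\<forall>p. q2 p \<noteq> 0 \<longrightarrow> (\<exists>\<Lambda>. \<Lambda> 1 = (1::complex) \<and>
       (\<forall>b. (\<forall>e\<in>E2. b e \<in> B.R) \<and> (\<forall>x. (\<Sum>e\<in>E2. b e (\<beta>2 x) * e x) = 0) \<longrightarrow> (\<Sum>e\<in>E2. b e p * \<Lambda> e) = 0))"
      by (rule generic_functional[OF dom dom2 E(3,4)])
    \<comment> \<open>The target is irreducible, so one point avoids both exceptional sets.\<close>
    have "q1 * q2 \<noteq> 0" using dom q1 q2 unfolding function_domain_def by blast
    then obtain p where p: "q1 p \<noteq> 0" "q2 p \<noteq> 0" by (auto simp: fun_eq_iff)
    obtain \<Lambda>1 where \<Lambda>1': "\<Lambda>1 1 = (1::complex)" "\<forall>b. (\<forall>e\<in>E1. b e \<in> B.R) \<and>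
        (\<forall>x. (\<Sum>e\<in>E1. b e (\<beta>1 x) * e x) = 0) \<longrightarrow> (\<Sum>e\<in>E1. b e p * \<Lambda>1 e) = 0"
      using L1[rule_format, OF p(1)] by (elim exE conjE)
    have \<Lambda>1: "\<Lambda>1 1 = 1" "(\<Sum>e\<in>E1. b e p * \<Lambda>1 e) = 0" if "\<And>e. e \<in> E1 \<Longrightarrow> b e \<in> B.R"
        "\<And>x. (\<Sum>e\<in>E1. b e (\<beta>1 x) * e x) = 0" for b
      using \<Lambda>1' that by simp_all
    obtain \<Lambda>2 where \<Lambda>2': "\<Lambda>2 1 = (1::complex)" "\<forall>b. (\<forall>e\<in>E2. b e \<in> B.R) \<and>
        (\<forall>x. (\<Sum>e\<in>E2. b e (\<beta>2 x) * e x) = 0) \<longrightarrow> (\<Sum>e\<in>E2. b e p * \<Lambda>2 e) = 0"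
      using L2[rule_format, OF p(2)] by (elim exE conjE)
    have \<Lambda>2: "\<Lambda>2 1 = 1" "(\<Sum>e\<in>E2. b e p * \<Lambda>2 e) = 0" if "\<And>e. e \<in> E2 \<Longrightarrow> b e \<in> B.R"
        "\<And>x. (\<Sum>e\<in>E2. b e (\<beta>2 x) * e x) = 0" for b
      using \<Lambda>2' that by simp_all
    have one: "(\<Sum>f\<in>L. (f (\<beta>1 x) - f (\<beta>2 y)) * (\<Sum>r\<in>E1. \<Sum>s\<in>E2. \<gamma> f (r, s) * (r x * s y))) = 1" for x y
    proof -
      have "(\<Sum>f\<in>L. ?d f * t f) (x, y) = 1" unfolding t(1) by simp
      then show ?thesis using tE by (simp add: sum_fun_apply)
    qed
    \<comment> \<open>Fix \<open>y\<close> and read the identity as a relation over the target among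
      the functions in \<open>E1\<close>, the constant 1 being moved into the coefficient of the
      function 1. Then \<open>\<Lambda>1\<close> evaluates the coefficients at
      \<open>p\<close>.\<close>
    have step1: "(\<Sum>r\<in>E1. (\<Sum>f\<in>L. \<Sum>s\<in>E2. (f p - f (\<beta>2 y)) * (\<gamma> f (r, s) * s y)) * \<Lambda>1 r) = 1" for y
    proof -
      define b where "b r = (\<Sum>f\<in>L. \<Sum>s\<in>E2. (f - (\<lambda>_. f (\<beta>2 y))) * (\<lambda>_. \<gamma> f (r, s) * s y)) - (if r = 1 then 1 else 0)"
        for r :: "'x \<Rightarrow> complex"
      have ev: "b r z = (\<Sum>f\<in>L. \<Sum>s\<in>E2. (f z - f (\<beta>2 y)) * (\<gamma> f (r, s) * s y)) - (if r = 1 then 1 else 0)"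
        for r z
        by (simp add: b_def sum_fun_apply)
      have delta: "(\<Sum>r\<in>E1. (if r = 1 then 1 else 0) * g r) = g 1" for g :: "_ \<Rightarrow> complex"
      proof -
        have "(\<Sum>r\<in>E1. (if r = 1 then 1 else 0) * g r) = (\<Sum>r\<in>E1. if r = 1 then g r else 0)"
          by (intro sum.cong) auto
        then show ?thesis using E by simp
      qed
      have "(\<Sum>r\<in>E1. b r p * \<Lambda>1 r) = 0"
      proof (rule \<Lambda>1(2))
        show "b r \<in> B.R" if "r \<in> E1" for r
          unfolding b_def using B.alg_0 B.alg_1
          by (intro B.alg_diff[of "sum _ _"] B.alg_sum B.alg_mult B.alg_const B.alg_diff[OF B.alg_gen])
            (simp_all only: if_True if_False split: if_split, simp_all)
        fix x
        have "(\<Sum>r\<in>E1. b r (\<beta>1 x) * r x) =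
          (\<Sum>r\<in>E1. (\<Sum>f\<in>L. \<Sum>s\<in>E2. (f (\<beta>1 x) - f (\<beta>2 y)) * (\<gamma> f (r, s) * s y)) * r x) - 1"
          by (simp add: ev left_diff_distrib sum_subtractf delta)
        also have "(\<Sum>r\<in>E1. (\<Sum>f\<in>L. \<Sum>s\<in>E2. (f (\<beta>1 x) - f (\<beta>2 y)) * (\<gamma> f (r, s) * s y)) * r x) =
          (\<Sum>f\<in>L. (f (\<beta>1 x) - f (\<beta>2 y)) * (\<Sum>r\<in>E1. \<Sum>s\<in>E2. \<gamma> f (r, s) * (r x * s y)))"
          unfolding sum_distrib_right sum_distrib_left
          by (subst sum.swap) (intro sum.cong refl, simp add: algebra_simps)
        finally show "(\<Sum>r\<in>E1. b r (\<beta>1 x) * r x) = 0" using one by simp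
      qed
      then show ?thesis using \<Lambda>1'(1) by (simp add: ev left_diff_distrib sum_subtractf delta)
    qed
    \<comment> \<open>The same in \<open>y\<close>. Both occurrences of \<open>f\<close> are now
      evaluated at \<open>p\<close>, so the sum vanishes and only the normalization
      \<open>\<Lambda>2 1 = 1\<close> remains.\<close>
    define b where "b s = (\<Sum>r\<in>E1. \<Sum>f\<in>L. ((\<lambda>_. f p) - f) * (\<lambda>_. \<gamma> f (r, s) * \<Lambda>1 r)) - (if s = 1 then 1 else 0)"
      for s :: "'y \<Rightarrow> complex"
    have ev: "b s z = (\<Sum>r\<in>E1. \<Sum>f\<in>L. (f p - f z) * (\<gamma> f (r, s) * \<Lambda>1 r)) - (if s = 1 then 1 else 0)" for s z
      by (simp add: b_def sum_fun_apply)
    have delta: "(\<Sum>r\<in>E2. (if r = 1 then 1 else 0) * g r) = g 1" for g :: "_ \<Rightarrow> complex"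
    proof -
      have "(\<Sum>r\<in>E2. (if r = 1 then 1 else 0) * g r) = (\<Sum>r\<in>E2. if r = 1 then g r else 0)"
        by (intro sum.cong) auto
      then show ?thesis using E by simp
    qed
    have "(\<Sum>s\<in>E2. b s p * \<Lambda>2 s) = 0"
    proof (rule \<Lambda>2(2))
      show "b s \<in> B.R" if "s \<in> E2" for s
        unfolding b_def using B.alg_0 B.alg_1
        by (intro B.alg_diff[of "sum _ _"] B.alg_sum B.alg_mult B.alg_const B.alg_diff[OF B.alg_const
          B.alg_gen]) (simp_all only: if_True if_False split: if_split, simp_all)
      fix y
      have "(\<Sum>s\<in>E2. b s (\<beta>2 y) * s y) =
        (\<Sum>s\<in>E2. (\<Sum>r\<in>E1. \<Sum>f\<in>L. (f p - f (\<beta>2 y)) * (\<gamma> f (r, s) * \<Lambda>1 r)) * s y) - 1"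
        by (simp add: ev left_diff_distrib sum_subtractf delta)
      also have "(\<Sum>s\<in>E2. (\<Sum>r\<in>E1. \<Sum>f\<in>L. (f p - f (\<beta>2 y)) * (\<gamma> f (r, s) * \<Lambda>1 r)) * s y) =
        (\<Sum>r\<in>E1. \<Sum>s\<in>E2. \<Sum>f\<in>L. (f p - f (\<beta>2 y)) * (\<gamma> f (r, s) * \<Lambda>1 r) * s y)"
        unfolding sum_distrib_right by (rule sum.swap)
      also have "\<dots> = (\<Sum>r\<in>E1. (\<Sum>f\<in>L. \<Sum>s\<in>E2. (f p - f (\<beta>2 y)) * (\<gamma> f (r, s) * s y)) * \<Lambda>1 r)"
        unfolding sum_distrib_right
        by (intro sum.cong refl, subst sum.swap, intro sum.cong refl) (simp add: algebra_simps)
      finally show "(\<Sum>s\<in>E2. b s (\<beta>2 y) * s y) = 0" using step1 by simp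
    qed
    then show False using \<Lambda>2'(1) by (simp add: ev left_diff_distrib sum_subtractf sum_negf delta)
  qed
  then obtain \<xi> where \<xi>: "algebra_character UNIV T.R \<xi>" "\<And>f. f \<in> ?J \<Longrightarrow> \<xi> f = 0"
    using T.nullstellensatz[OF J] by blast
  note \<xi>c = \<xi>(1)[unfolded algebra_character_UNIV]
  \<comment> \<open>A character of the product restricts to characters of the factors, and these are
    points.\<close>
  have "algebra_character UNIV A1.R (\<lambda>r. \<xi> (\<lambda>p. r (fst p)))"
    unfolding algebra_character_UNIV using \<xi>c T1 by (simp add: plus_fun_def times_fun_def)
  then obtain x where x: "\<And>r. r \<in> A1.R \<Longrightarrow> \<xi> (\<lambda>p. r (fst p)) = r x" using pts1 by blast
  have "algebra_character UNIV A2.R (\<lambda>r. \<xi> (\<lambda>p. r (snd p)))"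
    unfolding algebra_character_UNIV using \<xi>c T2 by (simp add: plus_fun_def times_fun_def)
  then obtain y where y: "\<And>r. r \<in> A2.R \<Longrightarrow> \<xi> (\<lambda>p. r (snd p)) = r y" using pts2 by blast
  have "f (\<beta>1 x) = f (\<beta>2 y)" if f: "f \<in> L" for f
  proof -
    let ?t = "\<lambda>g. if g = f then 1 else (0 :: 'x \<times> 'y \<Rightarrow> complex)"
    have "?d f = (\<Sum>g\<in>L. ?d g * ?t g)"
    proof -
      have "(\<Sum>g\<in>L. ?d g * ?t g) = (\<Sum>g\<in>L. if g = f then ?d g else 0)" by (intro sum.cong) auto
      then show ?thesis using f fin by simp
    qed
    moreover have "\<forall>g\<in>L. ?t g \<in> T.R" using T.alg_0 T.alg_1 by simp
    ultimately have "?d f \<in> ?J" by (intro CollectI exI[of _ ?t] conjI)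
    then have 0: "\<xi> (?d f) = 0" by (rule \<xi>(2))
    have "\<xi> (\<lambda>p. f (\<beta>1 (fst p))) = \<xi> (?d f + (\<lambda>p. f (\<beta>2 (snd p))))" by (simp add: plus_fun_def)
    also have "\<dots> = \<xi> (?d f) + \<xi> (\<lambda>p. f (\<beta>2 (snd p)))" using \<xi>c dT[OF f] T2[OF \<beta>2[OF f]] by blast
    finally show ?thesis using 0 x[OF \<beta>1[OF f]] y[OF \<beta>2[OF f]] by simp
  qed
  then show thesis using that by blast
qed

section \<open>Generalized eigenspaces and traces\<close>

locale complex_fd = finite_dimensional_vector_space sc Basis
  for sc :: "complex \<Rightarrow> 'v::ab_group_add \<Rightarrow> 'v" and Basis :: "'v set"
begin

abbreviation lin where "lin \<equiv> Vector_Spaces.linear sc sc"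

lemma lin_iff: "lin f \<longleftrightarrow> (\<forall>x y. f (x + y) = f x + f y) \<and> (\<forall>c x. f (sc c x) = sc c (f x))"
  using vector_space_axioms by (auto simp: Vector_Spaces.linear_iff)

lemma linI: "(\<And>x y. f (x + y) = f x + f y) \<Longrightarrow> (\<And>c x. f (sc c x) = sc c (f x)) \<Longrightarrow> lin f"
  by (simp add: lin_iff)

lemma lin_add: "lin f \<Longrightarrow> f (x + y) = f x + f y"
  and lin_scale: "lin f \<Longrightarrow> f (sc c x) = sc c (f x)"
  by (simp_all add: lin_iff)

lemma lin_0: "lin f \<Longrightarrow> f 0 = 0"
  using lin_scale[of f 0 0] by simp

lemma lin_diff: "lin f \<Longrightarrow> f (x - y) = f x - f y"
  using lin_add[of f "x - y" y] by (simp add: algebra_simps)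

lemma lin_neg: "lin f \<Longrightarrow> f (- x) = - f x"
  using lin_diff[of f 0 x] by (simp add: lin_0)

lemma lin_sum: "lin f \<Longrightarrow> f (\<Sum>i\<in>I. g i) = (\<Sum>i\<in>I. f (g i))"
  by (induction I rule: infinite_finite_induct) (auto simp: lin_0 lin_add)

lemma lin_compose: "lin f \<Longrightarrow> lin g \<Longrightarrow> lin (\<lambda>x. f (g x))"
  by (simp add: lin_iff)

lemma lin_funpow: "lin f \<Longrightarrow> lin (f ^^ k)"
  by (induction k) (simp_all add: lin_iff)

lemma linear_eqI: "lin f \<Longrightarrow> lin g \<Longrightarrow> span B = UNIV \<Longrightarrow> (\<And>b. b \<in> B \<Longrightarrow> f b = g b) \<Longrightarrow> f v = g v"
proof -
  assume f: "lin f" and g: "lin g" and B: "span B = UNIV" "\<And>b. b \<in> B \<Longrightarrow> f b = g b"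
  have "v \<in> span B" using B by simp
  then show ?thesis
    by (induction rule: span_induct_alt) (simp_all add: lin_0 lin_add lin_scale f g B)
qed

definition shift :: "('v \<Rightarrow> 'v) \<Rightarrow> complex \<Rightarrow> 'v \<Rightarrow> 'v" where
  "shift T \<mu> w = T w - sc \<mu> w"

definition gen_eigenspace :: "('v \<Rightarrow> 'v) \<Rightarrow> complex \<Rightarrow> 'v set" where
  "gen_eigenspace T \<mu> = {v. \<exists>k. (shift T \<mu> ^^ k) v = 0}"

lemma lin_shift: "lin T \<Longrightarrow> lin (shift T \<mu>)"
  unfolding shift_def by (simp add: lin_iff algebra_simps scale_right_distrib scale_left_commute)

lemma funpow_zero_mono:
  assumes "lin f" "(f ^^ k) v = 0" "k \<le> n" shows "(f ^^ n) v = 0"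
proof -
  obtain j where "n = j + k" using assms(3) le_Suc_ex by (metis add.commute)
  then show ?thesis using assms lin_0[OF lin_funpow] by (simp add: funpow_add)
qed

lemma subspace_gen_eigenspace:
  assumes T: "lin T" shows "subspace (gen_eigenspace T \<mu>)"
  unfolding subspace_def gen_eigenspace_def
proof (intro conjI ballI allI)
  show "0 \<in> {v. \<exists>k. (shift T \<mu> ^^ k) v = 0}" by (auto intro!: exI[of _ 0])
next
  fix x y assume "x \<in> {v. \<exists>k. (shift T \<mu> ^^ k) v = 0}" "y \<in> {v. \<exists>k. (shift T \<mu> ^^ k) v = 0}"
  then obtain k l where "(shift T \<mu> ^^ k) x = 0" "(shift T \<mu> ^^ l) y = 0" by blast
  then have "(shift T \<mu> ^^ max k l) x = 0" "(shift T \<mu> ^^ max k l) y = 0"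
    using funpow_zero_mono[OF lin_shift[OF T]] by (meson max.cobounded1 max.cobounded2)+
  then have "(shift T \<mu> ^^ max k l) (x + y) = 0"
    using lin_add[OF lin_funpow[OF lin_shift[OF T]]] by simp
  then show "x + y \<in> {v. \<exists>k. (shift T \<mu> ^^ k) v = 0}" by blast
next
  fix c x assume "x \<in> {v. \<exists>k. (shift T \<mu> ^^ k) v = 0}"
  then show "sc c x \<in> {v. \<exists>k. (shift T \<mu> ^^ k) v = 0}"
    using lin_scale[OF lin_funpow[OF lin_shift[OF T]]] by force
qed

lemma gen_eigenspace_step: "shift T \<mu> v \<in> gen_eigenspace T \<mu> \<Longrightarrow> v \<in> gen_eigenspace T \<mu>"
proof -
  assume "shift T \<mu> v \<in> gen_eigenspace T \<mu>"
  then obtain k where "(shift T \<mu> ^^ k) (shift T \<mu> v) = 0" by (auto simp: gen_eigenspace_def)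
  then have "(shift T \<mu> ^^ Suc k) v = 0" by (simp add: funpow_swap1)
  then show ?thesis unfolding gen_eigenspace_def by blast
qed

lemma gen_eigenspace_eigenvector: "T v = sc \<mu> v \<Longrightarrow> v \<in> gen_eigenspace T \<mu>"
  unfolding gen_eigenspace_def shift_def by (auto intro!: exI[of _ 1])

text \<open>Stated for maps that intertwine the shifts and fix 0, so that it covers the antilinear
  conjugation \<open>\<sigma>\<close>; the factor \<open>c\<close> absorbs the rescaling of graded
  elements by \<theta>.\<close>

lemma gen_eigenspace_intertwine:
  assumes "\<And>w. shift T' \<nu> (U w) = sc c (U (shift T \<mu> w))" "lin T'" "U 0 = 0" "v \<in> gen_eigenspace T \<mu>"
  shows "U v \<in> gen_eigenspace T' \<nu>"
proof -
  have "(shift T' \<nu> ^^ k) (U w) = sc (c ^ k) (U ((shift T \<mu> ^^ k) w))" for k w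
    by (induction k) (simp_all add: assms(1) lin_scale[OF lin_shift[OF assms(2)]] mult.commute)
  moreover obtain k where "(shift T \<mu> ^^ k) v = 0" using assms(4) by (auto simp: gen_eigenspace_def)
  ultimately have "(shift T' \<nu> ^^ k) (U v) = 0" by (simp add: assms(3))
  then show ?thesis unfolding gen_eigenspace_def by blast
qed

lemma gen_eigenspace_commute:
  assumes "\<And>w. U (T w) = T (U w)" "lin U" "lin T" "v \<in> gen_eigenspace T \<mu>"
  shows "U v \<in> gen_eigenspace T \<mu>"
  by (rule gen_eigenspace_intertwine[of T \<mu> U 1, OF _ assms(3) lin_0[OF assms(2)] assms(4)])
    (simp add: shift_def assms(1) lin_diff[OF assms(2)] lin_scale[OF assms(2)])

text \<open>The last nonzero iterate of \<open>T - \<mu>\<close> on \<open>v\<close> is an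
  eigenvector for \<mu>, on which \<open>T - \<nu>\<close> acts as a nonzero scalar.\<close>

lemma gen_eigenspace_disjoint:
  assumes T: "lin T" and v: "v \<in> gen_eigenspace T \<mu>" "v \<in> gen_eigenspace T \<nu>" and "\<mu> \<noteq> \<nu>"
  shows "v = 0"
proof (rule ccontr)
  assume "v \<noteq> 0"
  define k where "k = (LEAST k. (shift T \<mu> ^^ k) v = 0)"
  have k: "(shift T \<mu> ^^ k) v = 0" unfolding k_def using v(1) unfolding gen_eigenspace_def
    by (auto intro: LeastI)
  then obtain j where j: "k = Suc j" using \<open>v \<noteq> 0\<close> by (cases k) auto
  define w where "w = (shift T \<mu> ^^ j) v"
  have w0: "w \<noteq> 0" using not_less_Least[of j "\<lambda>k. (shift T \<mu> ^^ k) v = 0"] j by (auto simp: k_def w_def)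
  have Tw: "T w = sc \<mu> w" using k by (simp add: j w_def shift_def)
  have comm: "shift T \<mu> (T x) = T (shift T \<mu> x)" for x
    by (simp add: shift_def lin_diff[OF T] lin_scale[OF T])
  have "(shift T \<mu> ^^ i) v \<in> gen_eigenspace T \<nu>" for i
    by (induction i) (use v(2) gen_eigenspace_commute[OF comm lin_shift[OF T] T] in auto)
  then have "w \<in> gen_eigenspace T \<nu>" by (simp add: w_def)
  then obtain l where l: "(shift T \<nu> ^^ l) w = 0" by (auto simp: gen_eigenspace_def)
  have "(shift T \<nu> ^^ l) w = sc ((\<mu> - \<nu>) ^ l) w" for l
    by (induction l) (simp_all add: lin_scale[OF lin_shift[OF T]] shift_def lin_scale[OF T] Tw
        scale_left_diff_distrib algebra_simps)
  then show False using l w0 assms(4) by simp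
qed

text \<open>A power of \<open>T - \<nu>\<close> removes the component at \<nu>; on the others it is
  injective, by disjointness.\<close>

lemma gen_eigenspace_direct:
  assumes T: "lin T" and "finite \<Lambda>" "\<And>\<mu>. \<mu> \<in> \<Lambda> \<Longrightarrow> u \<mu> \<in> gen_eigenspace T \<mu>" "(\<Sum>\<mu>\<in>\<Lambda>. u \<mu>) = 0" "\<mu> \<in> \<Lambda>"
  shows "u \<mu> = 0"
  using assms(2-)
proof (induction \<Lambda> arbitrary: u \<mu> rule: finite_induct)
  case empty
  then show ?case by simp
next
  case (insert \<nu> \<Lambda>)
  obtain k where k: "(shift T \<nu> ^^ k) (u \<nu>) = 0" using insert.prems(1)[of \<nu>]
    by (auto simp: gen_eigenspace_def)
  have comm: "shift T \<nu> (T x) = T (shift T \<nu> x)" for x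
    by (simp add: shift_def lin_diff[OF T] lin_scale[OF T])
  have mem: "(shift T \<nu> ^^ i) w \<in> gen_eigenspace T \<mu>" if "w \<in> gen_eigenspace T \<mu>" for w \<mu> i
    by (induction i) (use that gen_eigenspace_commute[OF comm lin_shift[OF T] T] in auto)
  have "(\<Sum>\<mu>\<in>\<Lambda>. (shift T \<nu> ^^ k) (u \<mu>)) = (shift T \<nu> ^^ k) (\<Sum>\<mu>\<in>insert \<nu> \<Lambda>. u \<mu>)"
    using insert.hyps by (simp add: lin_add[OF lin_funpow[OF lin_shift[OF T]]] k
        lin_sum[OF lin_funpow[OF lin_shift[OF T]]])
  also have "\<dots> = 0" by (simp only: insert.prems(2) lin_0[OF lin_funpow[OF lin_shift[OF T]]])
  finally have s0: "(\<Sum>\<mu>\<in>\<Lambda>. (shift T \<nu> ^^ k) (u \<mu>)) = 0" .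
  have z: "(shift T \<nu> ^^ k) (u \<mu>) = 0" if "\<mu> \<in> \<Lambda>" for \<mu>
    by (rule insert.IH[OF _ s0 that]) (intro mem insert.prems(1) insertI2)
  have 0: "u \<mu> = 0" if "\<mu> \<in> \<Lambda>" for \<mu>
  proof (rule gen_eigenspace_disjoint[OF T])
    show "u \<mu> \<in> gen_eigenspace T \<mu>" by (intro insert.prems(1) insertI2 that)
    show "u \<mu> \<in> gen_eigenspace T \<nu>" using z[OF that] unfolding gen_eigenspace_def by blast
    show "\<mu> \<noteq> \<nu>" using insert.hyps(2) that by blast
  qed
  then have "u \<nu> = 0" using insert.prems(2) insert.hyps by simp
  then show ?case using 0 insert.prems(3) by auto
qed

text \<open>On the generalized eigenspace of \<mu>, \<open>T - \<nu>\<close> is a nonzero scalar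
  plus a nilpotent; a preimage is built by induction on the order of nilpotency.\<close>

lemma gen_eigenspace_shift_surj:
  assumes T: "lin T" and "\<mu> \<noteq> \<nu>" "u \<in> gen_eigenspace T \<mu>"
  shows "\<exists>w\<in>gen_eigenspace T \<mu>. shift T \<nu> w = u"
proof -
  obtain k where "(shift T \<mu> ^^ k) u = 0" using assms(3) by (auto simp: gen_eigenspace_def)
  then show ?thesis
  proof (induction k arbitrary: u)
    case 0
    then show ?case using subspace_0[OF subspace_gen_eigenspace[OF T]] lin_0[OF lin_shift[OF T]]
      by (intro bexI[of _ 0]) auto
  next
    case (Suc k)
    then have "(shift T \<mu> ^^ k) (shift T \<mu> u) = 0" by (simp add: funpow_swap1)
    then obtain w where w: "w \<in> gen_eigenspace T \<mu>" "shift T \<nu> w = shift T \<mu> u" using Suc.IH by blast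
    have u: "u \<in> gen_eigenspace T \<mu>" using Suc.prems unfolding gen_eigenspace_def by blast
    have "shift T \<nu> u - shift T \<mu> u = sc (\<mu> - \<nu>) u" by (simp add: shift_def scale_left_diff_distrib)
    then have "shift T \<nu> (sc (1 / (\<mu> - \<nu>)) (u - w)) = u"
      using assms(2) w(2) by (simp add: lin_scale[OF lin_shift[OF T]] lin_diff[OF lin_shift[OF T]])
    then show ?case using u w(1) subspace_gen_eigenspace[OF T]
      by (intro bexI[of _ "sc (1 / (\<mu> - \<nu>)) (u - w)"]) (auto intro: subspace_scale subspace_diff)
  qed
qed

text \<open>Some nonzero polynomial in \<open>T\<close> takes \<open>w\<close> into
  \<open>W\<close>. Its linear factors are stripped off one at a time until one of them crosses into
  \<open>W\<close>.\<close>

lemma eigenvector_modulo: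
  assumes T: "lin T" and W: "subspace W" and w: "w \<notin> W"
  shows "\<exists>\<mu> v. v \<notin> W \<and> shift T \<mu> v \<in> W"
proof -
  \<comment> \<open>\<open>pe p v\<close> is \<open>p(T) v\<close>.\<close>
  define pe where "pe p v = (\<Sum>i\<le>degree p. sc (coeff p i) ((T ^^ i) v))" for p v
  have pe_n: "pe p v = (\<Sum>i\<le>n. sc (coeff p i) ((T ^^ i) v))" if "degree p \<le> n" for p v n
    unfolding pe_def using that by (intro sum.mono_neutral_left) (auto simp: coeff_eq_0)
  have pe_factor: "pe ([:- z, 1:] * r) v = pe r (shift T z v)" for z r v
  proof -
    define n where "n = Suc (degree r)"
    have d: "degree ([:- z, 1:] * r) \<le> Suc (degree r)" by (rule order.trans[OF degree_mult_le]) simp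
    have "pe ([:- z, 1:] * r) v = (\<Sum>i\<le>Suc (degree r). sc (coeff ([:- z, 1:] * r) i) ((T ^^ i) v))"
      by (rule pe_n[OF d])
    also have "\<dots> = (\<Sum>i\<le>Suc (degree r). sc (coeff (pCons 0 r) i) ((T ^^ i) v)) -
        (\<Sum>i\<le>Suc (degree r). sc (z * coeff r i) ((T ^^ i) v))"
      by (simp del: sum.atMost_Suc add: sum_subtractf[symmetric] scale_left_diff_distrib)
    also have "(\<Sum>i\<le>Suc (degree r). sc (coeff (pCons 0 r) i) ((T ^^ i) v)) =
        (\<Sum>i\<le>degree r. sc (coeff r i) ((T ^^ i) (T v)))"
      by (subst sum.atMost_Suc_shift) (simp add: funpow_swap1)
    also have "(\<Sum>i\<le>Suc (degree r). sc (z * coeff r i) ((T ^^ i) v)) =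
        (\<Sum>i\<le>degree r. sc (coeff r i) ((T ^^ i) (sc z v)))"
      by (simp add: coeff_eq_0 lin_scale[OF lin_funpow[OF T]] mult.commute)
    also have "(\<Sum>i\<le>degree r. sc (coeff r i) ((T ^^ i) (T v))) - (\<Sum>i\<le>degree r. sc (coeff r i) ((T ^^ i) (sc z v)))
        = pe r (shift T z v)"
      by (simp add: pe_def shift_def lin_diff[OF lin_funpow[OF T]] sum_subtractf scale_right_diff_distrib)
    finally show ?thesis .
  qed
  \<comment> \<open>The \<open>card Basis + 1\<close> first iterates of \<open>w\<close> are
    dependent; if two of them coincide, the relation is a difference of monomials.\<close>
  have "\<exists>p. p \<noteq> 0 \<and> pe p w = 0"
  proof -
    let ?n = "card Basis"
    let ?g = "\<lambda>i. (T ^^ i) w"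
    show ?thesis
    proof (cases "inj_on ?g {..?n}")
      case True
      then have "card (?g ` {..?n}) = Suc ?n" by (simp add: card_image)
      then have "dependent (?g ` {..?n})"
        using dependent_biggerset_general[of "?g ` {..?n}"] dim_subset_UNIV[of "?g ` {..?n}"]
        by (simp add: dimension_def)
      then obtain c where c: "\<exists>v\<in>?g ` {..?n}. c v \<noteq> 0" "(\<Sum>v\<in>?g ` {..?n}. sc (c v) v) = 0"
        using dependent_finite[of "?g ` {..?n}"] by auto
      define p where "p = (\<Sum>i\<le>?n. monom (c (?g i)) i)"
      have co: "coeff p i = (if i \<le> ?n then c (?g i) else 0)" for i
        by (simp add: p_def coeff_sum)
      have "degree p \<le> ?n" by (rule degree_le) (simp add: co)
      then have "pe p w = (\<Sum>i\<le>?n. sc (c (?g i)) (?g i))" by (simp add: pe_n co)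
      also have "\<dots> = 0" using c(2) by (simp add: sum.reindex[OF True])
      finally have "pe p w = 0" .
      moreover obtain i where "i \<le> ?n" "c (?g i) \<noteq> 0" using c(1) by auto
      then have "coeff p i \<noteq> 0" by (simp add: co)
      then have "p \<noteq> 0" by auto
      ultimately show ?thesis by blast
    next
      case False
      then obtain i j where ij: "i \<noteq> j" "?g i = ?g j" by (auto simp: inj_on_def)
      let ?p = "monom 1 i - monom 1 j :: complex poly"
      have "degree ?p \<le> max i j" by (rule order.trans[OF degree_diff_le_max]) (simp add: degree_monom_eq)
      then have "pe ?p w = (\<Sum>k\<le>max i j. sc (coeff ?p k) (?g k))" by (rule pe_n)
      also have "\<dots> = (\<Sum>k\<le>max i j. (if k = i then ?g k else 0)) - (\<Sum>k\<le>max i j. (if k = j then ?g k else 0))"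
        unfolding sum_subtractf[symmetric] by (intro sum.cong) (auto simp: scale_left_diff_distrib)
      also have "\<dots> = 0" using ij by simp
      finally have "pe ?p w = 0" .
      moreover have "coeff ?p i \<noteq> 0" using ij by simp
      then have "?p \<noteq> 0" by (metis coeff_0)
      ultimately show ?thesis by blast
    qed
  qed
  then obtain p where "p \<noteq> 0" "pe p w \<in> W" using subspace_0[OF W] by auto
  then show ?thesis using w
  proof (induction "degree p" arbitrary: p w rule: less_induct)
    case less
    show ?case
    proof (cases "degree p = 0")
      case True
      then obtain a where a: "p = [:a:]" by (rule degree_eq_zeroE)
      then have "sc a w \<in> W" "a \<noteq> 0" using less.prems by (auto simp: pe_def)
      then have "sc (1 / a) (sc a w) \<in> W" using subspace_scale[OF W] by blast
      then show ?thesis using \<open>a \<noteq> 0\<close> less.prems by simp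
    next
      case False
      then obtain z where "poly p z = 0" using fundamental_theorem_of_algebra[of p]
        by (auto simp: constant_degree)
      then obtain r where r: "p = [:- z, 1:] * r" using poly_eq_0_iff_dvd[of p z] by (auto elim: dvdE)
      have r0: "r \<noteq> 0" using less.prems r by auto
      then have d: "degree r < degree p" unfolding r by (subst degree_mult_eq) auto
      show ?thesis
      proof (cases "shift T z w \<in> W")
        case True
        then show ?thesis using less.prems by blast
      next
        case False
        then show ?thesis using less.hyps[OF d r0 _ False] less.prems(2) unfolding r pe_factor by blast
      qed
    qed
  qed
qed

text \<open>Let \<open>v\<close> be an eigenvector for \<nu> modulo the span. Inside the span
  \<open>T - \<nu>\<close> is onto up to the generalized eigenspace of \<nu>, so \<open>v\<close>
  can be corrected by an element of the span to one of that space.\<close>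

lemma span_gen_eigenspaces:
  assumes T: "lin T"
  shows "span (\<Union>\<mu>. gen_eigenspace T \<mu>) = UNIV"
proof (rule ccontr)
  let ?W = "span (\<Union>\<mu>. gen_eigenspace T \<mu>)"
  assume "?W \<noteq> UNIV"
  then obtain w where "w \<notin> ?W" by blast
  then obtain \<nu> v where v: "v \<notin> ?W" "shift T \<nu> v \<in> ?W"
    using eigenvector_modulo[OF T subspace_span] by blast
  have "\<exists>x\<in>?W. \<exists>y\<in>gen_eigenspace T \<nu>. u = shift T \<nu> x + y" if "u \<in> ?W" for u
    using that
  proof (induction rule: span_induct_alt)
    case base
    then show ?case using span_zero subspace_0[OF subspace_gen_eigenspace[OF T]] lin_0[OF lin_shift[OF T]]
      by (intro bexI[of _ 0]) auto
  next
    case (step c a b)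
    then obtain x y where xy: "x \<in> ?W" "y \<in> gen_eigenspace T \<nu>" "b = shift T \<nu> x + y" by blast
    obtain \<mu> where \<mu>: "a \<in> gen_eigenspace T \<mu>" using step by blast
    show ?case
    proof (cases "\<mu> = \<nu>")
      case True
      then show ?thesis using xy \<mu> subspace_gen_eigenspace[OF T]
        by (intro bexI[of _ x] bexI[of _ "sc c a + y"])
          (auto intro: subspace_add subspace_scale simp: algebra_simps)
    next
      case False
      then obtain a' where a': "a' \<in> gen_eigenspace T \<mu>" "shift T \<nu> a' = a"
        using gen_eigenspace_shift_surj[OF T False \<mu>] by blast
      then have "a' \<in> ?W" by (auto intro: span_base)
      then show ?thesis using xy a'
        by (intro bexI[of _ "sc c a' + x"] bexI[of _ y])
          (auto intro: span_add span_scale simp: lin_add[OF lin_shift[OF T]] lin_scale[OF lin_shift[OF T]])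
    qed
  qed
  then obtain x y where xy: "x \<in> ?W" "y \<in> gen_eigenspace T \<nu>" "shift T \<nu> v = shift T \<nu> x + y" using v(2)
    by blast
  then have "shift T \<nu> (v - x) = y" by (simp add: lin_diff[OF lin_shift[OF T]])
  then have "v - x \<in> gen_eigenspace T \<nu>" using xy(2) gen_eigenspace_step by metis
  then have "v - x \<in> ?W" by (auto intro: span_base)
  then have "v - x + x \<in> ?W" using xy(1) by (intro span_add)
  then show False using v(1) by simp
qed

text \<open>Group the expansion of \<open>v\<close> by eigenvalues: directness of the sum leaves
  only the group at \<nu>.\<close>

lemma representation_gen_eigenspace:
  assumes T: "lin T" and B: "independent B" "span B = UNIV" "\<And>b. b \<in> B \<Longrightarrow> b \<in> gen_eigenspace T (ev b)"
    and v: "v \<in> gen_eigenspace T \<nu>" and b: "b \<in> B" "representation B v b \<noteq> 0"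
  shows "ev b = \<nu>"
proof (rule ccontr)
  assume ne: "ev b \<noteq> \<nu>"
  have fB: "finite B" using B(1) by (rule finiteI_independent)
  let ?u = "\<lambda>\<mu>. \<Sum>b\<in>{b\<in>B. ev b = \<mu>}. sc (representation B v b) b"
  let ?w = "\<lambda>\<mu>. ?u \<mu> - (if \<mu> = \<nu> then v else 0)"
  have "(\<Sum>\<mu>\<in>insert \<nu> (ev ` B). ?u \<mu>) = (\<Sum>b\<in>B. sc (representation B v b) b)"
    by (rule sum.group) (use fB in auto)
  also have "\<dots> = v" by (rule sum_representation_eq) (use B fB in auto)
  finally have "(\<Sum>\<mu>\<in>insert \<nu> (ev ` B). ?w \<mu>) = 0"
    using fB by (simp add: sum_subtractf del: sum.insert)
  moreover have "?w \<mu> \<in> gen_eigenspace T \<mu>" for \<mu>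
    using v B(3) subspace_gen_eigenspace[OF T]
    by (intro subspace_diff subspace_sum subspace_scale) (auto intro: subspace_0)
  ultimately have "?w (ev b) = 0"
    using gen_eigenspace_direct[OF T, of "insert \<nu> (ev ` B)" ?w "ev b"] fB b by auto
  then have "(\<Sum>c\<in>{c\<in>B. ev c = ev b}. sc (representation B v c) c) = 0" using ne by simp
  then have "representation B v b = 0"
    using independentD[OF B(1), of "{c\<in>B. ev c = ev b}" "representation B v" b] fB b by auto
  then show False using b by simp
qed

section \<open>Functional calculus on generalized eigenspaces\<close>

definition spectral_basis :: "('v \<Rightarrow> 'v) \<Rightarrow> 'v set \<Rightarrow> ('v \<Rightarrow> complex) \<Rightarrow> bool" where
  "spectral_basis T B ev \<longleftrightarrow> independent B \<and> span B = UNIV \<and> (\<forall>b\<in>B. b \<in> gen_eigenspace T (ev b))"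

lemma spectral_basis_exists:
  assumes T: "lin T"
  shows "\<exists>B ev. spectral_basis T B ev"
proof -
  let ?G = "\<Union>\<mu>. gen_eigenspace T \<mu>"
  obtain B where B: "B \<subseteq> ?G" "independent B" "?G \<subseteq> span B" by (rule maximal_independent_subset)
  have "span B = UNIV" using span_gen_eigenspaces[OF T] B(3) span_mono[OF B(3)]
    by (simp add: span_span top.extremum_unique)
  moreover have "b \<in> gen_eigenspace T (SOME \<mu>. b \<in> gen_eigenspace T \<mu>)" if "b \<in> B" for b
    using B(1) that by (auto intro: someI)
  ultimately show ?thesis using B(2) unfolding spectral_basis_def
    by (intro exI[of _ B] exI[of _ "\<lambda>b. SOME \<mu>. b \<in> gen_eigenspace T \<mu>"]) blast
qed

definition sb :: "('v \<Rightarrow> 'v) \<Rightarrow> 'v set" where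
  "sb T = (SOME B. \<exists>ev. spectral_basis T B ev)"

definition sev :: "('v \<Rightarrow> 'v) \<Rightarrow> 'v \<Rightarrow> complex" where
  "sev T = (SOME ev. spectral_basis T (sb T) ev)"

text \<open>Functional calculus that ignores the nilpotent part: multiplication by
  \<open>\<phi> \<mu>\<close> on the whole generalized eigenspace of \<mu>. The identity gives the
  semisimple part, an indicator gives a projection, and \<open>cnj\<close> is the choice for
  Cartan's criterion.\<close>

definition spec :: "('v \<Rightarrow> 'v) \<Rightarrow> (complex \<Rightarrow> complex) \<Rightarrow> 'v \<Rightarrow> 'v" where
  "spec T \<phi> v = (\<Sum>b\<in>sb T. sc (\<phi> (sev T b) * representation (sb T) v b) b)"

lemma sb: assumes T: "lin T" shows "spectral_basis T (sb T) (sev T)"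
proof -
  have "\<exists>ev. spectral_basis T (sb T) ev"
    unfolding sb_def using spectral_basis_exists[OF T] by (rule someI_ex)
  then show ?thesis unfolding sev_def by (rule someI_ex)
qed

lemma sb_basis: assumes T: "lin T"
  shows "independent (sb T)" "span (sb T) = UNIV" "finite (sb T)"
    "\<And>b. b \<in> sb T \<Longrightarrow> b \<in> gen_eigenspace T (sev T b)"
  using sb[OF T] finiteI_independent unfolding spectral_basis_def by blast+

lemma spec_linear: assumes T: "lin T" shows "lin (spec T \<phi>)"
  using sb_basis[OF T]
  by (intro linI) (simp_all add: spec_def representation_add representation_scale algebra_simps
      scale_left_distrib sum.distrib scale_sum_right)

lemma spec_gen_eigenspace:
  assumes T: "lin T" and v: "v \<in> gen_eigenspace T \<mu>"
  shows "spec T \<phi> v = sc (\<phi> \<mu>) v"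
proof -
  note B = sb_basis[OF T]
  have "sc (\<phi> (sev T b) * representation (sb T) v b) b = sc (\<phi> \<mu>) (sc (representation (sb T) v b) b)"
    if "b \<in> sb T" for b
    using representation_gen_eigenspace[OF T B(1,2,4) v that] by (cases "representation (sb T) v b = 0") auto
  then have "spec T \<phi> v = (\<Sum>b\<in>sb T. sc (\<phi> \<mu>) (sc (representation (sb T) v b) b))" unfolding spec_def
    by (rule sum.cong[OF refl])
  also have "\<dots> = sc (\<phi> \<mu>) v"
    unfolding scale_sum_right[symmetric] using B by (subst sum_representation_eq) auto
  finally show ?thesis .
qed

lemma gen_eigenspace_induct [consumes 1, case_names zero add base]:
  assumes T: "lin T" and "P 0" "\<And>x y. P x \<Longrightarrow> P y \<Longrightarrow> P (x + y)" "\<And>\<mu> v. v \<in> gen_eigenspace T \<mu> \<Longrightarrow> P v"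
  shows "P v"
proof -
  have "v \<in> span (\<Union>\<mu>. gen_eigenspace T \<mu>)" using span_gen_eigenspaces[OF T] by simp
  then show ?thesis
  proof (induction rule: span_induct_alt)
    case base
    show ?case by fact
  next
    case (step c x y)
    then obtain \<mu> where "sc c x \<in> gen_eigenspace T \<mu>" using subspace_scale[OF subspace_gen_eigenspace[OF T]]
      by blast
    then show ?case using step assms by blast
  qed
qed

lemma spec_commute:
  assumes T: "lin T" and U: "lin U" and "\<And>w. U (T w) = T (U w)"
  shows "U (spec T \<phi> v) = spec T \<phi> (U v)"
  using T
proof (induction v rule: gen_eigenspace_induct)
  case zero
  then show ?case using lin_0[OF spec_linear[OF T]] lin_0[OF U] by simp
next
  case (add x y)
  then show ?case using lin_add[OF spec_linear[OF T]] lin_add[OF U] by simp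
next
  case (base \<mu> v)
  then show ?case using gen_eigenspace_commute[OF assms(3) U T base] spec_gen_eigenspace[OF T] lin_scale[OF U]
    by simp
qed

abbreviation eproj :: "('v \<Rightarrow> 'v) \<Rightarrow> complex \<Rightarrow> 'v \<Rightarrow> 'v" where
  "eproj T \<mu> \<equiv> spec T (\<lambda>\<nu>. if \<nu> = \<mu> then 1 else 0)"

definition eigenvalues :: "('v \<Rightarrow> 'v) \<Rightarrow> complex set" where
  "eigenvalues T = sev T ` sb T"

lemma finite_eigenvalues: "lin T \<Longrightarrow> finite (eigenvalues T)"
  unfolding eigenvalues_def using sb_basis(3) by blast

lemma sum_eproj:
  assumes T: "lin T"
  shows "(\<Sum>\<mu>\<in>eigenvalues T. eproj T \<mu> v) = v"
proof -
  note B = sb_basis[OF T]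
  have "(\<Sum>\<mu>\<in>eigenvalues T. eproj T \<mu> v) = (\<Sum>\<mu>\<in>sev T ` sb T. \<Sum>b\<in>sb T. if sev T b =
    \<mu> then sc (representation (sb T) v b) b else 0)"
    unfolding spec_def eigenvalues_def by (intro sum.cong) auto
  also have "\<dots> = (\<Sum>b\<in>sb T. sc (representation (sb T) v b) b)"
    by (subst sum.swap) (simp add: B)
  also have "\<dots> = v" using B by (intro sum_representation_eq) auto
  finally show ?thesis .
qed

lemma eproj_in: assumes T: "lin T" shows "eproj T \<mu> v \<in> gen_eigenspace T \<mu>"
  unfolding spec_def using sb_basis(4)[OF T]
  by (intro subspace_sum[OF subspace_gen_eigenspace[OF T]])
    (auto intro: subspace_scale[OF subspace_gen_eigenspace[OF T]] subspace_0[OF subspace_gen_eigenspace[OF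
      T]])

lemma eigenvalue_exists:
  assumes T: "lin T" and v: "v \<in> gen_eigenspace T \<mu>" "v \<noteq> 0" shows "\<mu> \<in> eigenvalues T"
proof (rule ccontr)
  assume "\<mu> \<notin> eigenvalues T"
  then have "(\<Sum>\<nu>\<in>eigenvalues T. eproj T \<nu> v) = 0"
    by (intro sum.neutral) (auto simp: spec_gen_eigenspace[OF T v(1)])
  then show False using sum_eproj[OF T] v by simp
qed

definition diagonalizable :: "('v \<Rightarrow> 'v) \<Rightarrow> bool" where
  "diagonalizable T \<longleftrightarrow> (\<exists>B. independent B \<and> span B = UNIV \<and> (\<forall>v\<in>B. \<exists>c. T v = sc c v))"

lemma diagonalizable_if_spanned:
  assumes "span {w. \<exists>c. T w = sc c w} = UNIV" shows "diagonalizable T"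
proof -
  let ?E = "{w. \<exists>c. T w = sc c w}"
  obtain B where B: "B \<subseteq> ?E" "independent B" "?E \<subseteq> span B" by (rule maximal_independent_subset)
  then have "span B = UNIV" using assms span_mono[OF B(3)] by (simp add: span_span top.extremum_unique)
  then show ?thesis unfolding diagonalizable_def using B by blast
qed

lemma diagonalizable_gen_eigenspace:
  assumes T: "lin T" and d: "diagonalizable T" and v: "v \<in> gen_eigenspace T \<mu>"
  shows "T v = sc \<mu> v"
proof -
  obtain B where B: "independent B" "span B = UNIV" "\<forall>v\<in>B. \<exists>c. T v = sc c v"
    using d unfolding diagonalizable_def by blast
  then obtain ev where ev: "\<And>b. b \<in> B \<Longrightarrow> T b = sc (ev b) b" by metis
  have fB: "finite B" using B(1) by (rule finiteI_independent)
  have g: "b \<in> gen_eigenspace T (ev b)" if "b \<in> B" for b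
    by (rule gen_eigenspace_eigenvector) (rule ev[OF that])
  have rep: "(\<Sum>b\<in>B. sc (representation B v b) b) = v" using B fB by (intro sum_representation_eq) auto
  have "T v = (\<Sum>b\<in>B. sc (representation B v b) (T b))"
    by (subst rep[symmetric]) (simp add: lin_sum[OF T] lin_scale[OF T])
  also have "\<dots> = (\<Sum>b\<in>B. sc \<mu> (sc (representation B v b) b))"
  proof (rule sum.cong[OF refl])
    fix b assume b: "b \<in> B"
    show "sc (representation B v b) (T b) = sc \<mu> (sc (representation B v b) b)"
      using representation_gen_eigenspace[OF T B(1,2) g v b] ev[OF b]
      by (cases "representation B v b = 0") (auto simp: mult.commute)
  qed
  also have "\<dots> = sc \<mu> v" unfolding scale_sum_right[symmetric] rep ..
  finally show ?thesis .
qed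

lemma diagonalizableI:
  assumes T: "lin T" and "\<And>\<mu> v. v \<in> gen_eigenspace T \<mu> \<Longrightarrow> T v = sc \<mu> v"
  shows "diagonalizable T"
  unfolding diagonalizable_def using sb_basis[OF T] assms(2) by blast

text \<open>The eigenprojections of \<open>U\<close> commute with \<open>T\<close>, so they split
  each eigenvector of \<open>T\<close> into joint eigenvectors.\<close>

lemma diagonalizable_combine:
  assumes T: "lin T" "diagonalizable T" and U: "lin U" "diagonalizable U" and comm: "\<And>w. U (T w) = T (U w)"
  shows "diagonalizable (\<lambda>x. sc a (T x) + sc b (U x))"
proof (rule diagonalizable_if_spanned)
  let ?E = "{w. \<exists>c. sc a (T w) + sc b (U w) = sc c w}"
  have "v \<in> span ?E" for v
    using T(1)
  proof (induction v rule: gen_eigenspace_induct)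
    case zero
    then show ?case by (rule span_zero)
  next
    case (add x y)
    then show ?case by (rule span_add)
  next
    case (base \<mu> v)
    have "eproj U \<nu> v \<in> ?E" for \<nu>
    proof -
      have "T (eproj U \<nu> v) = eproj U \<nu> (T v)" by (rule spec_commute[OF U(1) T(1)]) (simp add: comm)
      also have "\<dots> = sc \<mu> (eproj U \<nu> v)"
        by (simp add: diagonalizable_gen_eigenspace[OF T base] lin_scale[OF spec_linear[OF U(1)]])
      finally have "T (eproj U \<nu> v) = sc \<mu> (eproj U \<nu> v)" .
      moreover have "U (eproj U \<nu> v) = sc \<nu> (eproj U \<nu> v)"
        by (rule diagonalizable_gen_eigenspace[OF U eproj_in[OF U(1)]])
      ultimately show ?thesis by (auto simp: scale_left_distrib intro!: exI[of _ "a * \<mu> + b * \<nu>"])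
    qed
    then have "(\<Sum>\<nu>\<in>eigenvalues U. eproj U \<nu> v) \<in> span ?E" by (intro span_sum span_base)
    then show ?case by (simp only: sum_eproj[OF U(1)])
  qed
  then show "span ?E = UNIV" by blast
qed

section \<open>The trace\<close>

definition trace :: "('v \<Rightarrow> 'v) \<Rightarrow> complex" where
  "trace f = (\<Sum>b\<in>Basis. representation Basis (f b) b)"

lemma rep_sum_basis:
  assumes "independent C" "span C = UNIV"
  shows "(\<Sum>c\<in>C. sc (representation C v c) c) = v"
  using assms finiteI_independent by (intro sum_representation_eq) auto

lemma rep_lin:
  assumes B: "independent B" "span B = UNIV" and C: "independent C" "span C = UNIV" and f: "lin f"
  shows "representation B (f v) b = (\<Sum>c\<in>C. representation C v c * representation B (f c) b)"
proof -
  have "f v = (\<Sum>c\<in>C. sc (representation C v c) (f c))"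
    by (subst rep_sum_basis[OF C, symmetric]) (simp only: lin_sum[OF f] lin_scale[OF f])
  then show ?thesis using B by (simp add: representation_sum representation_scale)
qed

lemma trace_basis:
  assumes C: "independent C" "span C = UNIV" and f: "lin f"
  shows "trace f = (\<Sum>c\<in>C. representation C (f c) c)"
proof -
  note B = independent_Basis span_Basis
  have id: "lin (\<lambda>x. x)" by (simp add: lin_iff)
  have "(\<Sum>c\<in>C. representation C (f c) c) = (\<Sum>c\<in>C. \<Sum>b\<in>Basis. representation Basis (f c) b * representation C b c)"
    by (intro sum.cong refl rep_lin[OF C B id])
  also have "\<dots> = (\<Sum>b\<in>Basis. \<Sum>c\<in>C. representation C b c * representation Basis (f c) b)"
    by (subst sum.swap) (simp add: mult.commute)
  also have "\<dots> = (\<Sum>b\<in>Basis. representation Basis (f b) b)"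
    by (intro sum.cong refl rep_lin[OF B C f, symmetric])
  finally show ?thesis by (simp add: trace_def)
qed

lemma trace_commute:
  assumes f: "lin f" and g: "lin g"
  shows "trace (\<lambda>x. f (g x)) = trace (\<lambda>x. g (f x))"
proof -
  note B = independent_Basis span_Basis
  have "trace (\<lambda>x. f (g x)) = (\<Sum>b\<in>Basis. \<Sum>c\<in>Basis. representation Basis (g b) c * representation Basis (f c) b)"
    unfolding trace_def by (intro sum.cong refl rep_lin[OF B B f])
  also have "\<dots> = (\<Sum>c\<in>Basis. \<Sum>b\<in>Basis. representation Basis (f c) b * representation Basis (g b) c)"
    by (subst sum.swap) (simp add: mult.commute)
  also have "\<dots> = trace (\<lambda>x. g (f x))"
    unfolding trace_def by (intro sum.cong refl rep_lin[OF B B g, symmetric])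
  finally show ?thesis .
qed

lemma trace_add: "lin f \<Longrightarrow> lin g \<Longrightarrow> trace (\<lambda>x. f x + g x) = trace f + trace g"
  unfolding trace_def by (simp add: representation_add independent_Basis span_Basis sum.distrib)

lemma trace_diff: "lin f \<Longrightarrow> lin g \<Longrightarrow> trace (\<lambda>x. f x - g x) = trace f - trace g"
  unfolding trace_def by (simp add: representation_diff independent_Basis span_Basis sum_subtractf)

lemma trace_scale: "lin f \<Longrightarrow> trace (\<lambda>x. sc c (f x)) = c * trace f"
  unfolding trace_def by (simp add: representation_scale independent_Basis span_Basis sum_distrib_left)

lemma trace_spec:
  assumes T: "lin T" shows "trace (spec T \<phi>) = (\<Sum>b\<in>sb T. \<phi> (sev T b))"
proof -
  note B = sb_basis[OF T]
  have "representation (sb T) (spec T \<phi> b) b = \<phi> (sev T b)" if "b \<in> sb T" for b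
    using spec_gen_eigenspace[OF T B(4)[OF that]] B(1) that
    by (simp add: representation_scale span_base representation_basis)
  then show ?thesis unfolding trace_basis[OF B(1,2) spec_linear[OF T]] by simp
qed

text \<open>In a basis adapted to the chain of kernels of the powers of \<open>N\<close>, each
  kernel is mapped into the previous one, so the diagonal vanishes.\<close>

lemma trace_nilpotent:
  assumes N: "lin N" and nil: "\<And>v. \<exists>k. (N ^^ k) v = 0"
  shows "trace N = 0"
proof -
  have chain: "\<exists>C. independent C \<and> span C = {v. (N ^^ j) v = 0} \<and> (\<forall>b\<in>C. representation C (N b) b = 0)" for j
  proof (induction j)
    case 0
    show ?case by (intro exI[of _ "{}"]) (use independent_empty in auto)
  next
    case (Suc j)
    then obtain C where C: "independent C" "span C = {v. (N ^^ j) v = 0}"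
      "\<And>b. b \<in> C \<Longrightarrow> representation C (N b) b = 0" by blast
    let ?K = "{v. (N ^^ Suc j) v = 0}"
    have KN: "N v \<in> span C" if "v \<in> ?K" for v using that C(2) by (simp add: funpow_swap1)
    note L = lin_funpow[OF N, of "Suc j"]
    have sub: "subspace ?K"
      by (rule subspaceI)
        (simp_all only: mem_Collect_eq lin_0[OF L] lin_add[OF L] lin_scale[OF L] add_0 scale_zero_right)
    have "C \<subseteq> ?K" using C(2) span_superset[of C] lin_0[OF N] by auto
    then obtain D where D: "C \<subseteq> D" "D \<subseteq> ?K" "independent D" "?K \<subseteq> span D"
      using maximal_independent_subset_extend[OF _ C(1)] by blast
    have "span D = ?K" using D span_minimal[OF D(2) sub] by blast
    moreover have "representation D (N b) b = 0" if b: "b \<in> D" for b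
    proof -
      have *: "representation D (N b) = representation C (N b)"
        by (rule representation_extend[OF D(3) KN D(1)]) (use b D(2) in blast)
      show ?thesis
      proof (cases "b \<in> C")
        case True
        then show ?thesis using C(3) * by simp
      next
        case False
        then show ?thesis unfolding * using representation_ne_zero by blast
      qed
    qed
    ultimately show ?case using D(3) by blast
  qed
  obtain k where k: "\<And>v. (N ^^ k v) v = 0" using nil by metis
  \<comment> \<open>One exponent for all vectors: the sum of those for the basis vectors dominates
    each of them.\<close>
  have "(N ^^ (\<Sum>b\<in>Basis. k b)) v = 0" for v
  proof -
    have "(N ^^ (\<Sum>b\<in>Basis. k b)) v = (\<lambda>_. 0) v"
    proof (rule linear_eqI[OF lin_funpow[OF N] _ span_Basis])
      show "lin (\<lambda>_. 0)" by (simp add: lin_iff)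
      fix b assume "b \<in> Basis"
      then have "k b \<le> (\<Sum>b\<in>Basis. k b)" using finite_Basis by (intro member_le_sum) auto
      then show "(N ^^ (\<Sum>b\<in>Basis. k b)) b = 0" by (rule funpow_zero_mono[OF N k])
    qed
    then show ?thesis by simp
  qed
  then obtain C where C: "independent C" "span C = UNIV" "\<And>b. b \<in> C \<Longrightarrow> representation C (N b) b = 0"
    using chain[of "\<Sum>b\<in>Basis. k b"] by auto
  then show ?thesis by (simp add: trace_basis[OF C(1,2) N])
qed

text \<open>\<open>T\<close> differs from its semisimple part by a nilpotent, which stays nilpotent
  after \<open>spec T \<phi>\<close> and has trace 0; for the semisimple part the trace is read off
  the spectral basis.\<close>

lemma trace_spec_mult:
  assumes T: "lin T"
  shows "trace (\<lambda>x. spec T \<phi> (T x)) = (\<Sum>b\<in>sb T. \<phi> (sev T b) * sev T b)"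
proof -
  let ?N = "\<lambda>x. spec T \<phi> (T x - spec T (\<lambda>\<mu>. \<mu>) x)"
  have S: "lin (spec T f)" for f by (rule spec_linear[OF T])
  have N: "lin ?N" by (intro linI) (simp_all add: lin_add[OF S] lin_add[OF T] lin_diff[OF S] lin_scale[OF S]
    lin_scale[OF T] algebra_simps scale_right_diff_distrib)
  have "\<exists>k. (?N ^^ k) v = 0" for v
    using T
  proof (induction v rule: gen_eigenspace_induct)
    case zero
    then show ?case by (intro exI[of _ 0]) simp
  next
    case (add x y)
    then obtain k l where "(?N ^^ k) x = 0" "(?N ^^ l) y = 0" by blast
    then have "(?N ^^ max k l) x = 0" "(?N ^^ max k l) y = 0"
      using funpow_zero_mono[OF N] by (meson max.cobounded1 max.cobounded2)+
    then have "(?N ^^ max k l) (x + y) = 0" using lin_add[OF lin_funpow[OF N]] by simp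
    then show ?case by blast
  next
    case (base \<mu> v)
    have sh: "shift T \<mu> w \<in> gen_eigenspace T \<mu>" if "w \<in> gen_eigenspace T \<mu>" for w
      by (rule gen_eigenspace_commute[OF _ lin_shift[OF T] T that])
        (simp add: shift_def lin_diff[OF T] lin_scale[OF T])
    have 1: "?N w = sc (\<phi> \<mu>) (shift T \<mu> w)" if "w \<in> gen_eigenspace T \<mu>" for w
      using spec_gen_eigenspace[OF T that] spec_gen_eigenspace[OF T sh[OF that]] by (simp add: shift_def)
    have "(shift T \<mu> ^^ k) v \<in> gen_eigenspace T \<mu> \<and> (?N ^^ k) v = sc (\<phi> \<mu> ^ k) ((shift T \<mu> ^^ k) v)" for k
    proof (induction k)
      case 0
      then show ?case using base by simp
    next
      case (Suc k)
      let ?w = "(shift T \<mu> ^^ k) v"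
      have "(?N ^^ Suc k) v = ?N (sc (\<phi> \<mu> ^ k) ?w)" using Suc by simp
      also have "\<dots> = sc (\<phi> \<mu> ^ k) (?N ?w)" using lin_scale[OF N, of "\<phi> \<mu> ^ k" ?w] .
      also have "\<dots> = sc (\<phi> \<mu> ^ Suc k) ((shift T \<mu> ^^ Suc k) v)" using Suc by (simp add: 1 mult.commute)
      finally show ?case using Suc sh by simp
    qed
    moreover obtain k where "(shift T \<mu> ^^ k) v = 0" using base by (auto simp: gen_eigenspace_def)
    ultimately have "(?N ^^ k) v = 0" by simp
    then show ?case by blast
  qed
  then have 0: "trace ?N = 0" by (rule trace_nilpotent[OF N])
  have eq: "spec T \<phi> (T x) = ?N x + spec T (\<lambda>\<mu>. \<phi> \<mu> * \<mu>) x" for x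
  proof -
    have "spec T \<phi> (spec T (\<lambda>\<mu>. \<mu>) x) = spec T (\<lambda>\<mu>. \<phi> \<mu> * \<mu>) x"
      using T
    proof (induction x rule: gen_eigenspace_induct)
      case zero
      then show ?case by (simp add: lin_0[OF S])
    next
      case (add x y)
      then show ?case by (simp add: lin_add[OF S])
    next
      case (base \<mu> v)
      then show ?case by (simp add: spec_gen_eigenspace[OF T] lin_scale[OF S] mult.commute)
    qed
    then show ?thesis by (simp add: lin_diff[OF S])
  qed
  show ?thesis
    unfolding eq trace_add[OF N S] 0 trace_spec[OF T] by simp
qed

end

section \<open>The Killing form and the Jordan decomposition\<close>

locale semisimple_lie = complex_fd sc Basis
  for sc :: "complex \<Rightarrow> 'v::ab_group_add \<Rightarrow> 'v" and Basis :: "'v set" +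
  fixes br :: "'v \<Rightarrow> 'v \<Rightarrow> 'v"
  assumes semisimple: "semisimple_lie_algebra sc br"
begin

lemma lin_br: "lin (br x)" and lin_br': "lin (\<lambda>x. br x y)"
  and br_self: "br x x = 0"
  and jacobi0: "br x (br y z) + br y (br z x) + br z (br x y) = 0"
  using semisimple unfolding semisimple_lie_algebra_def complex_lie_algebra_def by blast+

lemmas br_add = lin_add[OF lin_br] and br_add' = lin_add[OF lin_br']
  and br_scale = lin_scale[OF lin_br] and br_scale' = lin_scale[OF lin_br']
  and br_diff = lin_diff[OF lin_br] and br_diff' = lin_diff[OF lin_br']
  and br_0 = lin_0[OF lin_br] and br_0' = lin_0[OF lin_br']
  and br_neg = lin_neg[OF lin_br] and br_neg' = lin_neg[OF lin_br']

lemma br_anti: "br x y = - br y x"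
proof -
  have "br x y + br y x = br (x + y) (x + y)"
    unfolding br_add br_add' by (simp add: br_self add.commute)
  also have "\<dots> = 0" by (rule br_self)
  finally show ?thesis by (simp only: eq_neg_iff_add_eq_0)
qed

lemma jacobi: "br x (br y z) = br (br x y) z + br y (br x z)"
proof -
  have "br x (br y z) = - br y (br z x) - br z (br x y)"
    using jacobi0[of x y z] by (simp add: eq_neg_iff_add_eq_0 algebra_simps)
  moreover have "br y (br z x) = - br y (br x z)" by (subst br_anti[of z x]) (rule br_neg)
  moreover have "br z (br x y) = - br (br x y) z" by (rule br_anti)
  ultimately show ?thesis by simp
qed

lemma jacobi': "br (br x y) z = br x (br y z) - br y (br x z)"
  by (simp add: jacobi[of x y z])

lemma solvable_ideal_zero: "lie_ideal sc br I \<Longrightarrow> solvable_algebra sc br I \<Longrightarrow> I = {0}"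
  using semisimple unfolding semisimple_lie_algebra_def by blast

text \<open>The centre is an abelian, hence solvable, ideal.\<close>

lemma center_zero:
  assumes "\<And>y. br x y = 0" shows "x = 0"
proof -
  let ?I = "{x. \<forall>y. br x y = 0}"
  have "lie_ideal sc br ?I"
    unfolding lie_ideal_def
  proof (intro conjI allI ballI)
    show "subspace ?I" by (rule subspaceI) (auto simp: br_0' br_add' br_scale')
    fix x y assume "y \<in> ?I"
    then have "br x y = 0" by (subst br_anti) simp
    then show "br x y \<in> ?I" by (simp add: br_0')
  qed
  moreover have "derived_algebra sc br ?I = {0}"
  proof -
    have "{br x y |x y. x \<in> ?I \<and> y \<in> ?I} \<subseteq> {0}" by auto
    then show ?thesis unfolding derived_algebra_def
      using span_mono[of "{br x y |x y. x \<in> ?I \<and> y \<in> ?I}" "{0}"] span_zero by auto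
  qed
  then have "(derived_algebra sc br ^^ 1) ?I = {0}" by simp
  then have "solvable_algebra sc br ?I" unfolding solvable_algebra_def by blast
  ultimately show ?thesis using solvable_ideal_zero[of ?I] assms by blast
qed

lemma br_eqI: "(\<And>v. br x v = br y v) \<Longrightarrow> x = y"
  using center_zero[of "x - y"] by (simp add: br_diff')

definition killing :: "'v \<Rightarrow> 'v \<Rightarrow> complex" where
  "killing x y = trace (\<lambda>v. br x (br y v))"

lemma lin_br_br: "lin (\<lambda>v. br x (br y v))"
  by (rule lin_compose[OF lin_br lin_br])

lemma killing_sym: "killing x y = killing y x"
  unfolding killing_def by (rule trace_commute[OF lin_br lin_br])

lemma killing_add: "killing (x + y) z = killing x z + killing y z"
  unfolding killing_def by (simp add: br_add' trace_add[OF lin_br_br lin_br_br])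

lemma killing_scale: "killing (sc c x) z = c * killing x z"
  unfolding killing_def by (simp add: br_scale' trace_scale[OF lin_br_br])

lemma killing_add': "killing z (x + y) = killing z x + killing z y"
  using killing_add killing_sym by metis

lemma killing_scale': "killing z (sc c x) = c * killing z x"
  using killing_scale killing_sym by metis

lemma killing_diff': "killing z (x - y) = killing z x - killing z y"
  using killing_add'[of z "x - y" y] by simp

lemma linear_killing: "Vector_Spaces.linear sc (*) (killing z)"
  using vector_space_axioms
  by (auto simp: Vector_Spaces.linear_iff killing_add' killing_scale' vector_space_def algebra_simps)

text \<open>The commutator of \<open>D\<close> with \<open>ad a\<close> is \<open>ad (D a)\<close>,
  and the trace is cyclic. With \<open>D = ad z\<close> this gives invariance of the Killing form,
  with the conjugated semisimple part Cartan's criterion, and with a derivation orthogonal to all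
  \<open>ad y\<close> that derivations are inner.\<close>

lemma killing_derivation:
  assumes D: "lin D" "\<And>a b. D (br a b) = br (D a) b + br a (D b)"
  shows "trace (\<lambda>v. D (br (br a b) v)) = killing (D a) b"
proof -
  note L = lin_compose[OF D(1) lin_br_br] lin_compose[OF lin_br lin_compose[OF D(1) lin_br]]
  have "trace (\<lambda>v. D (br (br a b) v)) = trace (\<lambda>v. D (br a (br b v))) - trace (\<lambda>v. D (br b (br a v)))"
    by (simp add: jacobi' lin_diff[OF D(1)] trace_diff[OF L(1) L(1)])
  also have "trace (\<lambda>v. D (br b (br a v))) = trace (\<lambda>v. br a (D (br b v)))"
    by (rule trace_commute[OF lin_compose[OF D(1) lin_br] lin_br])
  also have "trace (\<lambda>v. D (br a (br b v))) - trace (\<lambda>v. br a (D (br b v))) = killing (D a) b"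
    unfolding trace_diff[OF L, symmetric] killing_def by (simp add: D(2))
  finally show ?thesis .
qed

lemma killing_invariant: "killing (br z x) y = - killing x (br z y)"
proof -
  have "killing (br z x) y = trace (\<lambda>v. br z (br (br x y) v))"
    by (rule killing_derivation[symmetric]) (auto intro: lin_br jacobi)
  also have "\<dots> = trace (\<lambda>v. br (br x y) (br z v))" by (rule trace_commute[OF lin_br lin_br])
  also have "\<dots> = killing (br x y) z" by (simp add: killing_def)
  also have "\<dots> = trace (\<lambda>v. br x (br (br y z) v))"
    by (rule killing_derivation[symmetric]) (auto intro: lin_br jacobi)
  also have "\<dots> = killing x (br y z)" by (simp add: killing_def)
  also have "\<dots> = killing x (sc (- 1) (br z y))" using br_anti[of y z] by simp
  finally show ?thesis unfolding killing_scale' by simp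
qed

text \<open>The shift of \<open>ad x\<close> by \<open>\<mu> + \<nu>\<close> obeys a Leibniz rule
  with the shifts by \<mu> and \<nu>; the induction is on the sum of the two orders of
  nilpotency.\<close>

lemma gen_eigenspace_br:
  assumes "a \<in> gen_eigenspace (br x) \<mu>" "b \<in> gen_eigenspace (br x) \<nu>"
  shows "br a b \<in> gen_eigenspace (br x) (\<mu> + \<nu>)"
proof -
  obtain k l where "(shift (br x) \<mu> ^^ k) a = 0" "(shift (br x) \<nu> ^^ l) b = 0"
    using assms by (auto simp: gen_eigenspace_def)
  then show ?thesis
  proof (induction "k + l" arbitrary: k l a b rule: less_induct)
    case less
    note z = subspace_0[OF subspace_gen_eigenspace[OF lin_br]]
    show ?case
    proof (cases "k = 0 \<or> l = 0")
      case True
      then show ?thesis using less.prems z by (auto simp: br_0 br_0')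
    next
      case False
      then obtain k' l' where kl: "k = Suc k'" "l = Suc l'" by (meson not0_implies_Suc)
      have "br (shift (br x) \<mu> a) b \<in> gen_eigenspace (br x) (\<mu> + \<nu>)"
        by (rule less.hyps[of k' l]) (use less.prems kl in \<open>simp_all add: funpow_swap1\<close>)
      moreover have "br a (shift (br x) \<nu> b) \<in> gen_eigenspace (br x) (\<mu> + \<nu>)"
        by (rule less.hyps[of k l']) (use less.prems kl in \<open>simp_all add: funpow_swap1\<close>)
      moreover have "shift (br x) (\<mu> + \<nu>) (br a b) = br (shift (br x) \<mu> a) b + br a (shift (br x) \<nu> b)"
        by (simp add: shift_def jacobi[of x a b] br_diff br_diff' br_scale br_scale' scale_left_distrib
          algebra_simps)
      ultimately have "shift (br x) (\<mu> + \<nu>) (br a b) \<in> gen_eigenspace (br x) (\<mu> + \<nu>)"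
        using subspace_add[OF subspace_gen_eigenspace[OF lin_br]] by simp
      then show ?thesis by (rule gen_eigenspace_step)
    qed
  qed
qed

text \<open>Eigenvalues add under the bracket, so an additive \<open>\<phi>\<close> satisfies the
  Leibniz rule on generalized eigenvectors.\<close>

lemma spec_derivation:
  assumes \<phi>: "\<And>\<mu> \<nu>. \<phi> (\<mu> + \<nu>) = \<phi> \<mu> + \<phi> \<nu>"
  shows "spec (br x) \<phi> (br a b) = br (spec (br x) \<phi> a) b + br a (spec (br x) \<phi> b)"
proof -
  note S = spec_linear[OF lin_br, of x \<phi>]
  note S_simps = lin_add[OF S] lin_0[OF S] br_add br_add' br_0 br_0'
  show ?thesis
    using lin_br[of x]
  proof (induction a rule: gen_eigenspace_induct)
    case zero
    then show ?case by (simp add: S_simps)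
  next
    case (add a a')
    then show ?case by (simp add: S_simps)
  next
    case (base \<mu> a)
    show ?case
      using lin_br[of x]
    proof (induction b rule: gen_eigenspace_induct)
      case zero
      then show ?case by (simp add: S_simps)
    next
      case (add b b')
      then show ?case by (simp add: S_simps)
    next
      case (base \<nu> b)
      show ?case
        using spec_gen_eigenspace[OF lin_br gen_eigenspace_br[OF \<open>a \<in> _\<close> base]]
          spec_gen_eigenspace[OF lin_br \<open>a \<in> _\<close>] spec_gen_eigenspace[OF lin_br base]
        by (simp add: \<phi> br_scale br_scale' scale_left_distrib)
    qed
  qed
qed

definition killing_radical :: "'v set" where
  "killing_radical = {x. \<forall>y. killing x y = 0}"

text \<open>The operator acting as the complex conjugate of the eigenvalue on each generalized eigenspace
  of \<open>ad x\<close> is a derivation, and its trace against \<open>ad x\<close> is the sum of the \<open>|\<mu>|\<^sup>2\<close>.\<close>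

lemma derived_radical_nilpotent:
  assumes x: "x \<in> span {br a b | a b. a \<in> killing_radical \<and> b \<in> killing_radical}"
  shows "\<exists>k. (br x ^^ k) v = 0"
proof -
  note S = spec_linear[OF lin_br, of x cnj]
  have der: "spec (br x) cnj (br a b) = br (spec (br x) cnj a) b + br a (spec (br x) cnj b)" for a b
    by (rule spec_derivation) simp
  have "trace (\<lambda>v. spec (br x) cnj (br y v)) = 0"
    if "y \<in> span {br a b | a b. a \<in> killing_radical \<and> b \<in> killing_radical}" for y
    using that
  proof (induction rule: span_induct_alt)
    case base
    have "trace (\<lambda>v. sc 0 (br 0 v)) = 0" unfolding trace_scale[OF lin_br] by simp
    then show ?case by (simp add: br_0' lin_0[OF S])
  next
    case (step c y z)
    then obtain a b where ab: "y = br a b" "a \<in> killing_radical" "b \<in> killing_radical" by blast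
    have "trace (\<lambda>v. spec (br x) cnj (br y v)) = killing (spec (br x) cnj a) b"
      unfolding ab(1) by (rule killing_derivation[OF S der])
    also have "\<dots> = 0" using ab(3) killing_sym[of _ b] by (simp add: killing_radical_def)
    finally have y: "trace (\<lambda>v. spec (br x) cnj (br y v)) = 0" .
    have "trace (\<lambda>v. spec (br x) cnj (br (sc c y + z) v)) =
      trace (\<lambda>v. sc c (spec (br x) cnj (br y v)) + spec (br x) cnj (br z v))"
      by (simp add: br_add' br_scale' lin_add[OF S] lin_scale[OF S])
    also have "\<dots> = trace (\<lambda>v. sc c (spec (br x) cnj (br y v))) + trace (\<lambda>v. spec (br x) cnj (br z v))"
      by (rule trace_add) (auto intro!: linI simp: lin_add[OF S] lin_scale[OF S] br_add br_scale
        scale_right_distrib mult.commute)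
    finally show ?case using y step.IH by (simp add: trace_scale[OF lin_compose[OF S lin_br]])
  qed
  from this[OF x] have 0: "(\<Sum>b\<in>sb (br x). cnj (sev (br x) b) * sev (br x) b) = 0"
    unfolding trace_spec_mult[OF lin_br] .
  have "cnj z * z = of_real ((cmod z)\<^sup>2)" for z
    using complex_norm_square[of z] by (simp only: mult.commute[of "cnj z"])
  then have "complex_of_real (\<Sum>b\<in>sb (br x). (cmod (sev (br x) b))\<^sup>2) = 0" using 0 by simp
  then have "(\<Sum>b\<in>sb (br x). (cmod (sev (br x) b))\<^sup>2) = 0" by (simp only: of_real_eq_0_iff)
  then have "sev (br x) b = 0" if "b \<in> sb (br x)" for b
    using sum_nonneg_eq_0_iff[of "sb (br x)" "\<lambda>b. (cmod (sev (br x) b))\<^sup>2"] sb_basis(3)[OF lin_br] that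
      by simp
  then have "sb (br x) \<subseteq> gen_eigenspace (br x) 0" using sb_basis(4)[OF lin_br] by fastforce
  then have "v \<in> gen_eigenspace (br x) 0"
    using span_minimal[OF _ subspace_gen_eigenspace[OF lin_br]] sb_basis(2)[OF lin_br] by blast
  moreover have "shift (br x) 0 = br x" by (auto simp: shift_def)
  ultimately show ?thesis by (simp add: gen_eigenspace_def)
qed

section \<open>Engel's theorem and nondegeneracy of the Killing form\<close>

lemma exists_subspace_max_dim:
  assumes "Q S0"
  obtains S where "Q S" "\<And>T. Q T \<Longrightarrow> dim T \<le> dim S"
proof -
  have "\<exists>S. Q S \<and> (\<forall>T. Q T \<longrightarrow> dim T \<le> dim S)"
    by (rule ex_has_greatest_nat[of Q S0 dim "Suc dimension", OF assms])
      (use dim_subset_UNIV in \<open>auto simp: less_Suc_eq_le\<close>)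
  then show thesis using that by blast
qed

lemma adjoin_subspace:
  assumes K: "subspace K" and w: "w \<notin> K"
  shows "subspace {k + sc c w | k c. k \<in> K}" "K \<subseteq> {k + sc c w | k c. k \<in> K}"
    "w \<in> {k + sc c w | k c. k \<in> K}" "dim K < dim {k + sc c w | k c. k \<in> K}"
proof -
  let ?K = "{k + sc c w | k c. k \<in> K}"
  show 1: "subspace ?K"
  proof (rule subspaceI)
    have "0 = 0 + sc 0 w" by simp
    then show "0 \<in> ?K" using subspace_0[OF K] by blast
  next
    fix x y assume "x \<in> ?K" "y \<in> ?K"
    then obtain k c k' c' where "x = k + sc c w" "y = k' + sc c' w" "k \<in> K" "k' \<in> K" by blast
    then have "x + y = (k + k') + sc (c + c') w" "k + k' \<in> K"
      using subspace_add[OF K] by (auto simp: scale_left_distrib algebra_simps)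
    then show "x + y \<in> ?K" by blast
  next
    fix d x assume "x \<in> ?K"
    then obtain k c where "x = k + sc c w" "k \<in> K" by blast
    then have "sc d x = sc d k + sc (d * c) w" "sc d k \<in> K"
      using subspace_scale[OF K] by (auto simp: scale_right_distrib)
    then show "sc d x \<in> ?K" by blast
  qed
  show 2: "K \<subseteq> ?K"
  proof
    fix k assume "k \<in> K"
    moreover have "k = k + sc 0 w" by simp
    ultimately show "k \<in> ?K" by blast
  qed
  have "w = 0 + sc 1 w" by simp
  then show 3: "w \<in> ?K" using subspace_0[OF K] by blast
  then have "span K \<subset> span ?K" using 1 2 K w by (auto simp: span_eq_iff[THEN iffD2])
  then show "dim K < dim ?K" by (rule dim_psubset)
qed

text \<open>The nonzero vector killed by \<open>K\<close> is sought in a quotient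
  \<open>W / U\<close> of stable subspaces. This includes the quotient of an algebra by a
  subalgebra, on which the induction in Engel's theorem relies.\<close>

definition engel :: "'v set \<Rightarrow> bool" where
  "engel K \<longleftrightarrow> (\<forall>U W. subspace U \<and> subspace W \<and> U \<subset> W \<and> (\<forall>x\<in>K. \<forall>u\<in>U. br x u \<in> U) \<and>
     (\<forall>x\<in>K. \<forall>u\<in>W. br x u \<in> W) \<longrightarrow> (\<exists>w\<in>W - U. \<forall>x\<in>K. br x w \<in> U))"

text \<open>The vectors of \<open>W\<close> that \<open>K\<close> sends into \<open>U\<close> are
  stable under \<open>ad w\<close>, because \<open>w\<close> normalizes \<open>K\<close>. As
  \<open>ad w\<close> is nilpotent, the last of its iterates outside \<open>U\<close> works for the
  larger algebra.\<close>

lemma engel_adjoin: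
  assumes K: "subspace K" "\<And>x y. x \<in> K \<Longrightarrow> y \<in> K \<Longrightarrow> br x y \<in> K" "engel K"
    and w: "\<And>x. x \<in> K \<Longrightarrow> br x w \<in> K" "\<And>v. \<exists>k. (br w ^^ k) v = 0"
  shows "engel {k + sc c w | k c. k \<in> K}"
  unfolding engel_def
proof (intro allI impI, elim conjE)
  fix U W
  let ?K = "{k + sc c w | k c. k \<in> K}"
  assume U: "subspace U" and W: "subspace W" and UW: "U \<subset> W"
    and sU: "\<forall>x\<in>?K. \<forall>u\<in>U. br x u \<in> U" and sW: "\<forall>x\<in>?K. \<forall>u\<in>W. br x u \<in> W"
  have KK: "k \<in> ?K" if "k \<in> K" for k
  proof -
    have "k = k + sc 0 w" by simp
    then show ?thesis using that by blast
  qed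
  have "w = 0 + sc 1 w" by simp
  then have wK: "w \<in> ?K" using subspace_0[OF K(1)] by blast
  have "\<forall>x\<in>K. \<forall>u\<in>U. br x u \<in> U" "\<forall>x\<in>K. \<forall>u\<in>W. br x u \<in> W"
    using bspec[OF sU KK] bspec[OF sW KK] by blast+
  then have "\<exists>v0\<in>W - U. \<forall>x\<in>K. br x v0 \<in> U"
    using K(3)[unfolded engel_def, THEN spec[of _ U], THEN spec[of _ W]] U W UW by blast
  then obtain v0 where v0: "v0 \<in> W - U" "\<forall>x\<in>K. br x v0 \<in> U" ..
  have step: "br w v \<in> W" "br x (br w v) \<in> U" if v: "v \<in> W" "\<forall>x\<in>K. br x v \<in> U" and "x \<in> K" for v x
  proof -
    show "br w v \<in> W" using sW wK v by blast
    have "br x (br w v) = br (br x w) v + br w (br x v)" by (rule jacobi)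
    then show "br x (br w v) \<in> U" using v w(1)[OF \<open>x \<in> K\<close>] sU wK \<open>x \<in> K\<close> subspace_add[OF U] by simp
  qed
  have iter: "(br w ^^ k) v0 \<in> W \<and> (\<forall>x\<in>K. br x ((br w ^^ k) v0) \<in> U)" for k
  proof (induction k)
    case 0
    then show ?case using v0 by simp
  next
    case (Suc k)
    then show ?case using step[of "(br w ^^ k) v0"] sW wK by simp
  qed
  have ex: "\<exists>k. (br w ^^ k) v0 \<in> U" using w(2)[of v0] subspace_0[OF U] by metis
  define k where "k = (LEAST k. (br w ^^ k) v0 \<in> U)"
  have k: "(br w ^^ k) v0 \<in> U" unfolding k_def using ex by (rule LeastI_ex)
  then obtain j where j: "k = Suc j" using v0 by (cases k) auto
  have notU: "(br w ^^ j) v0 \<notin> U" using not_less_Least[of j "\<lambda>k. (br w ^^ k) v0 \<in> U"] j by (simp add: k_def)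
  let ?v = "(br w ^^ j) v0"
  have "br (k' + sc c w) ?v \<in> U" if "k' \<in> K" for k' c
    using iter[of j] k that subspace_add[OF U] subspace_scale[OF U] by (simp add: j br_add' br_scale')
  then have "\<forall>x\<in>?K. br x ?v \<in> U" by blast
  then show "\<exists>v\<in>W - U. \<forall>x\<in>?K. br x v \<in> U" using iter[of j] notU by blast
qed

text \<open>Take a subalgebra of largest dimension with the property. Applied to the pair
  \<open>K\<close>, \<open>P\<close>, the property itself yields an element outside \<open>K\<close>
  that normalizes \<open>K\<close> and can be adjoined.\<close>

lemma engel_theorem:
  assumes P: "subspace P" "\<And>x y. x \<in> P \<Longrightarrow> y \<in> P \<Longrightarrow> br x y \<in> P"
    and nil: "\<And>x v. x \<in> P \<Longrightarrow> \<exists>k. (br x ^^ k) v = 0"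
  shows "engel P"
proof -
  define Q where "Q K \<longleftrightarrow> subspace K \<and> K \<subseteq> P \<and> (\<forall>x\<in>K. \<forall>y\<in>K. br x y \<in> K) \<and> engel K" for K
  have "engel {0}" unfolding engel_def using subspace_0 by (auto simp: br_0')
  then have "Q {0}" using subspace_0[OF P(1)] by (simp add: Q_def br_0)
  then obtain K where QK: "Q K" and max: "\<And>T. Q T \<Longrightarrow> dim T \<le> dim K" by (rule exists_subspace_max_dim) blast
  then have K: "subspace K" "K \<subseteq> P" "\<And>x y. x \<in> K \<Longrightarrow> y \<in> K \<Longrightarrow> br x y \<in> K" "engel K" by (auto simp: Q_def)
  have "K = P"
  proof (rule ccontr)
    assume "K \<noteq> P"
    then have "K \<subset> P" using K(2) by blast
    then obtain w where w: "w \<in> P - K" "\<forall>x\<in>K. br x w \<in> K"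
      using K(4)[unfolded engel_def, THEN spec[of _ K], THEN spec[of _ P]] K(1-3) P by blast
    let ?K = "{k + sc c w | k c. k \<in> K}"
    have "engel ?K" by (rule engel_adjoin[OF K(1,3,4)]) (use w nil in auto)
    moreover have "subspace ?K" by (rule adjoin_subspace(1)[OF K(1)]) (use w in blast)
    moreover have "?K \<subseteq> P" using w K(2) subspace_add[OF P(1)] subspace_scale[OF P(1)] by auto
    moreover have "br x y \<in> ?K" if xyK: "x \<in> ?K" "y \<in> ?K" for x y
    proof -
      obtain k c k' c' where xy: "x = k + sc c w" "y = k' + sc c' w" "k \<in> K" "k' \<in> K" using xyK by blast
      have "br x y = br k k' + (sc c' (br k w) - sc c (br k' w))"
        unfolding xy br_add br_add' br_scale br_scale' br_self br_anti[of w k'] by (simp add: algebra_simps)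
      also have "\<dots> \<in> K" using xy w(2) K
        by (intro subspace_add[OF K(1)] subspace_diff[OF K(1)] subspace_scale[OF K(1)]) auto
      finally show ?thesis using adjoin_subspace(2)[OF K(1)] w by blast
    qed
    ultimately have "Q ?K" unfolding Q_def by blast
    then have "dim ?K \<le> dim K" by (rule max)
    moreover have "dim K < dim ?K" by (rule adjoin_subspace(4)[OF K(1)]) (use w in blast)
    ultimately show False by simp
  qed
  then show ?thesis using K by simp
qed

text \<open>For a proper stable subspace \<open>U\<close> of largest dimension, Engel's theorem on
  \<open>P / U\<close> shows that \<open>U\<close> has codimension one and that every bracket lies
  in \<open>U\<close>.\<close>

lemma derived_proper:
  assumes P: "subspace P" "\<And>x y. x \<in> P \<Longrightarrow> y \<in> P \<Longrightarrow> br x y \<in> P" "P \<noteq> {0}"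
    and nil: "\<And>x v. x \<in> P \<Longrightarrow> \<exists>k. (br x ^^ k) v = 0"
  shows "span {br x y | x y. x \<in> P \<and> y \<in> P} \<noteq> P"
proof -
  define Q where "Q U \<longleftrightarrow> subspace U \<and> U \<subset> P \<and> (\<forall>x\<in>P. \<forall>y\<in>U. br x y \<in> U)" for U
  have "Q {0}" using subspace_0[OF P(1)] P(3) by (auto simp: Q_def br_0)
  then obtain U where QU: "Q U" and max: "\<And>T. Q T \<Longrightarrow> dim T \<le> dim U" by (rule exists_subspace_max_dim) blast
  then have U: "subspace U" "U \<subset> P" "\<forall>x\<in>P. \<forall>y\<in>U. br x y \<in> U" by (auto simp: Q_def)
  obtain w where w: "w \<in> P - U" "\<forall>x\<in>P. br x w \<in> U"
    using engel_theorem[OF P(1,2) nil, unfolded engel_def, THEN spec[of _ U], THEN spec[of _ P]] U P by blast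
  let ?U = "{k + sc c w | k c. k \<in> U}"
  have wU: "w \<notin> U" using w by blast
  have brU: "br x y \<in> U" if "x \<in> P" "y \<in> ?U" for x y
    using that U w subspace_add[OF U(1)] subspace_scale[OF U(1)] by (auto simp: br_add br_scale)
  have "?U \<subseteq> P" using w U subspace_add[OF P(1)] subspace_scale[OF P(1)] by auto
  moreover have "\<not> Q ?U" using max[of ?U] adjoin_subspace(4)[OF U(1) wU] by linarith
  ultimately have "?U = P" using adjoin_subspace(1,2)[OF U(1) wU] brU unfolding Q_def by blast
  then have "{br x y | x y. x \<in> P \<and> y \<in> P} \<subseteq> U" using brU by blast
  then have "span {br x y | x y. x \<in> P \<and> y \<in> P} \<subseteq> U" by (rule span_minimal[OF _ U(1)])
  then show ?thesis using U(2) by blast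
qed

text \<open>A nonzero radical is an ideal that is not solvable, so its derived series stops at a
  nonzero perfect \<open>P\<close>. Cartan's trace computation makes \<open>ad x\<close> nilpotent
  for \<open>x\<close> in \<open>P\<close>, and a nonzero algebra of such elements is never
  perfect.\<close>

lemma killing_radical_zero: "killing_radical = {0}"
proof (rule ccontr)
  assume nz: "killing_radical \<noteq> {0}"
  let ?D = "derived_algebra sc br"
  have sub: "subspace killing_radical"
  proof (rule subspaceI)
    have "killing (sc 0 0) y = 0" for y unfolding killing_scale by simp
    then show "0 \<in> killing_radical" by (simp add: killing_radical_def)
  qed (auto simp: killing_radical_def killing_add killing_scale)
  have ideal: "br x y \<in> killing_radical" if "y \<in> killing_radical" for x y
    using that by (simp add: killing_radical_def killing_invariant)
  then have "lie_ideal sc br killing_radical" using sub by (simp add: lie_ideal_def)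
  then have ns: "(?D ^^ n) killing_radical \<noteq> {0}" for n
    using solvable_ideal_zero nz unfolding solvable_algebra_def by blast
  have DI: "?D I \<subseteq> I" if "subspace I" "\<And>x y. x \<in> I \<Longrightarrow> y \<in> I \<Longrightarrow> br x y \<in> I" for I
    unfolding derived_algebra_def using that by (intro span_minimal) auto
  have props: "subspace ((?D ^^ n) killing_radical) \<and> (\<forall>x\<in>(?D ^^ n) killing_radical. \<forall>y\<in>(?D ^^ n) killing_radical.
      br x y \<in> (?D ^^ n) killing_radical) \<and> (?D ^^ n) killing_radical \<subseteq> killing_radical" for n
  proof (induction n)
    case 0
    then show ?case using sub ideal by simp
  next
    case (Suc n)
    let ?I = "(?D ^^ n) killing_radical"
    have DI: "?D ?I \<subseteq> ?I" using DI[of ?I] Suc by blast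
    have "br x y \<in> ?D ?I" if "x \<in> ?D ?I" "y \<in> ?D ?I" for x y
      unfolding derived_algebra_def[of sc br ?I] using subsetD[OF DI] that by (intro span_base) blast
    moreover have "subspace (?D ?I)" unfolding derived_algebra_def[of sc br ?I] by (rule subspace_span)
    ultimately show ?case using DI Suc by auto
  qed
  \<comment> \<open>The derived series decreases, so a term of least dimension equals its own
    derived algebra.\<close>
  obtain n where n: "\<And>k. dim ((?D ^^ n) killing_radical) \<le> dim ((?D ^^ k) killing_radical)"
    using ex_has_least_nat[of "\<lambda>_. True" 0 "\<lambda>n. dim ((?D ^^ n) killing_radical)"] by blast
  let ?P = "(?D ^^ n) killing_radical"
  have P: "subspace ?P" "\<And>x y. x \<in> ?P \<Longrightarrow> y \<in> ?P \<Longrightarrow> br x y \<in> ?P" "?P \<noteq> {0}" "?P \<subseteq> killing_radical"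
    using props[of n] ns[of n] by auto
  have DP: "?D ?P \<subseteq> ?P" using DI[of ?P] P by blast
  have "?D ?P = ?P"
    by (rule subspace_dim_equal[OF _ P(1) DP])
      (use n[of "Suc n"] in \<open>simp_all add: derived_algebra_def[of sc br ?P]\<close>)
  then have eq: "span {br x y | x y. x \<in> ?P \<and> y \<in> ?P} = ?P" unfolding derived_algebra_def[of sc br ?P] .
  have "\<exists>k. (br x ^^ k) v = 0" if "x \<in> ?P" for x v
  proof (rule derived_radical_nilpotent)
    have "{br x y | x y. x \<in> ?P \<and> y \<in> ?P} \<subseteq> {br a b |a b. a \<in> killing_radical \<and> b \<in> killing_radical}"
      using P(4) by blast
    from span_mono[OF this] show "x \<in> span {br a b |a b. a \<in> killing_radical \<and> b \<in> killing_radical}"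
      using that eq by blast
  qed
  then show False using derived_proper[OF P(1,2,3)] eq by blast
qed

section \<open>Inner derivations and the Jordan decomposition\<close>

lemma killing_nondegenerate: "(\<And>y. killing x y = 0) \<Longrightarrow> x = 0"
  using killing_radical_zero by (auto simp: killing_radical_def)

text \<open>Nondegeneracy provides \<open>x\<close> such that \<open>killing x y\<close> is the
  trace of \<open>D\<close> composed with \<open>ad y\<close>. The derivation
  \<open>E = D - ad x\<close> has trace 0 against every \<open>ad y\<close>, in particular against
  \<open>ad (br a b)\<close>, so \<open>killing (E a) b\<close> vanishes.\<close>

lemma derivation_inner:
  assumes D: "lin D" "\<And>a b. D (br a b) = br (D a) b + br a (D b)"
  obtains x where "\<And>v. D v = br x v"
proof -
  \<comment> \<open>The functional \<open>killing x\<close> is recorded by its values on the basis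
    as a vector of the same space, so that injectivity gives surjectivity.\<close>
  let ?\<kappa> = "\<lambda>x. \<Sum>b\<in>Basis. sc (killing x b) b"
  have \<kappa>: "lin ?\<kappa>"
    by (intro linI) (simp_all add: killing_add killing_scale scale_left_distrib sum.distrib scale_sum_right)
  have coef: "f b = g b" if "(\<Sum>b\<in>Basis. sc (f b) b) = (\<Sum>b\<in>Basis. sc (g b) b)" "b \<in> Basis" for f g b
  proof -
    have "(\<Sum>b\<in>Basis. sc (f b - g b) b) = 0" using that(1) by (simp add: scale_left_diff_distrib sum_subtractf)
    then have "f b - g b = 0"
      using independentD[OF independent_Basis finite_Basis order_refl, of "\<lambda>b. f b - g b" b] that(2) by blast
    then show ?thesis by simp
  qed
  have ext: "\<phi> v = 0" if \<phi>: "Vector_Spaces.linear sc (*) \<phi>" "\<And>b. b \<in> Basis \<Longrightarrow> \<phi> b = 0" for \<phi> v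
  proof -
    have "v \<in> span Basis" using span_Basis by blast
    then show ?thesis
      by (induction rule: span_induct_alt) (use \<phi> in \<open>auto simp: Vector_Spaces.linear_iff\<close>, metis
        add_cancel_right_right)
  qed
  have "inj ?\<kappa>"
  proof (rule injI)
    fix x y assume "?\<kappa> x = ?\<kappa> y"
    then have k: "killing x b = killing y b" if "b \<in> Basis" for b using coef[of "killing x" "killing y"] that
      by blast
    have "killing (x - y) b = 0" if "b \<in> Basis" for b
      using k[OF that] killing_sym[of "x - y" b] killing_sym[of x b] killing_sym[of y b]
        by (simp add: killing_diff')
    then have "killing (x - y) v = 0" for v by (rule ext[OF linear_killing])
    then have "x - y = 0" by (rule killing_nondegenerate)
    then show "x = y" by simp
  qed
  then have "surj ?\<kappa>" using linear_inj_imp_surj[OF \<kappa>] by blast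
  then have "\<exists>x. (\<Sum>b\<in>Basis. sc (trace (\<lambda>v. D (br b v))) b) = ?\<kappa> x" unfolding surj_def by (rule spec)
  then obtain x where "(\<Sum>b\<in>Basis. sc (trace (\<lambda>v. D (br b v))) b) = ?\<kappa> x" by (rule exE)
  note x = this[symmetric]
  have x': "killing x b = trace (\<lambda>v. D (br b v))" if "b \<in> Basis" for b
    using coef[OF x] that by blast
  define E where "E v = D v - br x v" for v
  have E: "lin E" unfolding E_def by (intro linI)
    (simp_all add: lin_add[OF D(1)] lin_scale[OF D(1)] br_add br_scale scale_right_diff_distrib)
  have Ed: "E (br a b) = br (E a) b + br a (E b)" for a b
    by (simp add: E_def D(2) jacobi[of x a b] br_diff br_diff')
  have LD: "lin (\<lambda>v. D (br y v))" for y by (rule lin_compose[OF D(1) lin_br])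
  have tr: "trace (\<lambda>v. E (br y v)) = trace (\<lambda>v. D (br y v)) - killing x y" for y
    unfolding E_def killing_def by (rule trace_diff[OF LD lin_br_br])
  have LE: "lin (\<lambda>v. E (br y v))" for y by (rule lin_compose[OF E lin_br])
  have "Vector_Spaces.linear sc (*) (\<lambda>y. trace (\<lambda>v. E (br y v)))"
    using vector_space_axioms
    by (auto simp: Vector_Spaces.linear_iff vector_space_def algebra_simps br_add' br_scale' lin_add[OF E]
      lin_scale[OF E]
      trace_add[OF LE LE] trace_scale[OF LE])
  then have 0: "trace (\<lambda>v. E (br y v)) = 0" for y by (rule ext) (simp add: tr x')
  have "E a = 0" for a
  proof (rule killing_nondegenerate)
    fix b show "killing (E a) b = 0" using killing_derivation[OF E Ed, of a b] 0 by simp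
  qed
  then show thesis using that[of x] by (simp add: E_def)
qed

text \<open>The semisimple part of \<open>x\<close>, taken inside the Lie algebra; it exists because
  the semisimple part of \<open>ad x\<close> is a derivation and derivations are inner.\<close>

definition sspart :: "'v \<Rightarrow> 'v" where
  "sspart x = (SOME s. \<forall>\<mu>. \<forall>v\<in>gen_eigenspace (br x) \<mu>. br s v = sc \<mu> v)"

lemma sspart: "v \<in> gen_eigenspace (br x) \<mu> \<Longrightarrow> br (sspart x) v = sc \<mu> v"
proof -
  obtain s where s: "\<And>v. spec (br x) (\<lambda>\<mu>. \<mu>) v = br s v"
    by (rule derivation_inner[OF spec_linear[OF lin_br] spec_derivation[of "\<lambda>\<mu>. \<mu>"]]) auto
  have "\<forall>\<mu>. \<forall>v\<in>gen_eigenspace (br x) \<mu>. br s v = sc \<mu> v"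
    using spec_gen_eigenspace[OF lin_br, where \<phi> = "\<lambda>\<mu>. \<mu>"] s by metis
  from someI[of "\<lambda>s. \<forall>\<mu>. \<forall>v\<in>gen_eigenspace (br x) \<mu>. br s v = sc \<mu> v", OF this]
  show "v \<in> gen_eigenspace (br x) \<mu> \<Longrightarrow> br (sspart x) v = sc \<mu> v" unfolding sspart_def by blast
qed

lemma semisimple_iff: "semisimple_element sc br x \<longleftrightarrow> diagonalizable (br x)"
  unfolding semisimple_element_def diagonalizable_def by (rule refl)

lemma sspart_semisimple: "semisimple_element sc br (sspart x)"
  unfolding semisimple_iff diagonalizable_def using sb_basis[OF lin_br] sspart by blast

lemma sspart_unique:
  assumes "\<And>\<mu> v. v \<in> gen_eigenspace (br x) \<mu> \<Longrightarrow> br s v = sc \<mu> v"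
  shows "s = sspart x"
proof (rule br_eqI)
  fix v show "br s v = br (sspart x) v"
    using lin_br[of x] by (induction v rule: gen_eigenspace_induct) (auto simp: br_0 br_add assms sspart)
qed

text \<open>An element commuting with \<open>x\<close> preserves the generalized eigenspaces of
  \<open>ad x\<close>, on which \<open>ad (sspart x)\<close> is scalar.\<close>

lemma sspart_commute:
  assumes xy: "br x y = 0" shows "br (sspart x) y = 0"
proof (rule center_zero)
  fix v
  show "br (br (sspart x) y) v = 0"
    using lin_br[of x]
  proof (induction v rule: gen_eigenspace_induct)
    case zero
    then show ?case by (simp add: br_0)
  next
    case (add a b)
    then show ?case by (simp add: br_add)
  next
    case (base \<mu> v)
    have "br y v \<in> gen_eigenspace (br x) \<mu>"
      by (rule gen_eigenspace_commute[OF _ lin_br lin_br base]) (simp add: jacobi[of x y] xy br_0')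
    then show ?case by (simp add: jacobi'[of "sspart x" y] sspart[OF base] sspart[of "br y v"] br_scale)
  qed
qed

text \<open>Split \<open>v\<close> into generalized eigenvectors of \<open>ad x\<close>: the
  semisimple part scales each by its own eigenvalue, so directness kills all components but the one
  at \<mu>.\<close>

lemma sspart_eigen:
  assumes "br (sspart x) v = sc \<mu> v" shows "v \<in> gen_eigenspace (br x) \<mu>"
proof -
  let ?p = "\<lambda>\<nu>. eproj (br x) \<nu> v"
  have p: "?p \<nu> \<in> gen_eigenspace (br x) \<nu>" for \<nu> by (rule eproj_in[OF lin_br])
  have v: "(\<Sum>\<nu>\<in>eigenvalues (br x). ?p \<nu>) = v" by (rule sum_eproj[OF lin_br])
  have "(\<Sum>\<nu>\<in>eigenvalues (br x). sc (\<nu> - \<mu>) (?p \<nu>)) =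
      (\<Sum>\<nu>\<in>eigenvalues (br x). br (sspart x) (?p \<nu>)) - sc \<mu> (\<Sum>\<nu>\<in>eigenvalues (br x). ?p \<nu>)"
    unfolding scale_sum_right sum_subtractf[symmetric]
    by (intro sum.cong refl) (simp only: sspart[OF p] scale_left_diff_distrib)
  also have "\<dots> = 0" by (simp only: lin_sum[OF lin_br, symmetric] v assms diff_self)
  finally have "sc (\<nu> - \<mu>) (?p \<nu>) = 0" if "\<nu> \<in> eigenvalues (br x)" for \<nu>
    using gen_eigenspace_direct[OF lin_br[of x] finite_eigenvalues[OF lin_br[of x]], of
      "\<lambda>\<nu>. sc (\<nu> - \<mu>) (?p \<nu>)" \<nu>] that
      subspace_scale[OF subspace_gen_eigenspace[OF lin_br] p] by blast
  then have "?p \<nu> \<in> gen_eigenspace (br x) \<mu>" if "\<nu> \<in> eigenvalues (br x)" for \<nu>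
    using that p[of \<mu>] subspace_0[OF subspace_gen_eigenspace[OF lin_br]] by (cases "\<nu> = \<mu>") fastforce+
  then have "(\<Sum>\<nu>\<in>eigenvalues (br x). ?p \<nu>) \<in> gen_eigenspace (br x) \<mu>"
    by (intro subspace_sum[OF subspace_gen_eigenspace[OF lin_br]])
  then show ?thesis by (simp only: v)
qed

lemma sspart_kernel: "br (sspart x) v = 0 \<Longrightarrow> v \<in> gen_eigenspace (br x) 0"
  by (rule sspart_eigen) simp

lemma semisimple_combine:
  assumes "semisimple_element sc br x" "semisimple_element sc br y" "br x y = 0"
  shows "semisimple_element sc br (sc a x + sc b y)"
proof -
  have "diagonalizable (\<lambda>v. sc a (br x v) + sc b (br y v))"
    using assms jacobi[of x y] by (intro diagonalizable_combine lin_br) (simp_all add: semisimple_iff br_0')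
  moreover have "br (sc a x + sc b y) = (\<lambda>v. sc a (br x v) + sc b (br y v))"
    by (auto simp: br_add' br_scale')
  ultimately show ?thesis by (simp add: semisimple_iff)
qed

end

section \<open>Cartan subspaces of graded semisimple Lie algebras\<close>

locale graded_lie = semisimple_lie sc Basis br
  for sc :: "complex \<Rightarrow> 'v::ab_group_add \<Rightarrow> 'v" and Basis :: "'v set" and br :: "'v \<Rightarrow> 'v \<Rightarrow> 'v" +
  fixes m :: nat and gr :: "int \<Rightarrow> 'v set" and \<omega> :: complex and \<theta> :: "'v \<Rightarrow> 'v"
  assumes grading: "cyclic_grading sc br m gr" and theta: "grading_automorphism sc br m gr \<omega> \<theta>"
begin

lemma subspace_gr: "subspace (gr i)" and m_pos: "0 < m"
  and gr_periodic: "gr (i + int m) = gr i"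
  and br_gr: "x \<in> gr i \<Longrightarrow> y \<in> gr j \<Longrightarrow> br x y \<in> gr (i + j)"
  and decomposition: "\<exists>!c. c \<in> (\<Pi>\<^sub>E i\<in>{0..<int m}. gr i) \<and> x = (\<Sum>i\<in>{0..<int m}. c i)"
  using grading unfolding cyclic_grading_def by blast+

lemma omega_power: "\<omega> ^ m = 1" and omega_primitive: "0 < k \<Longrightarrow> k < m \<Longrightarrow> \<omega> ^ k \<noteq> 1"
  and theta_gr: "x \<in> gr i \<Longrightarrow> \<theta> x = sc (\<omega> powi i) x"
  and theta_aut: "\<theta> \<in> lie_automorphisms sc br"
  using theta unfolding grading_automorphism_def by blast+

lemma omega_nonzero: "\<omega> \<noteq> 0"
  using omega_power m_pos by (metis power_0_left zero_neq_one not_gr_zero)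

lemma lin_theta: "lin \<theta>" and bij_theta: "bij \<theta>" and theta_br: "\<theta> (br x y) = br (\<theta> x) (\<theta> y)"
  using theta_aut by (auto simp: lie_automorphisms_def general_linear_def)

lemma gr_mod: "gr (i mod int m) = gr i"
proof -
  have 1: "gr (j + int m * int k) = gr j" for j k
  proof (induction k)
    case (Suc k)
    have "gr (j + int m * int (Suc k)) = gr ((j + int m * int k) + int m)" by (simp add: algebra_simps)
    then show ?case using Suc gr_periodic by metis
  qed simp
  show ?thesis
  proof (cases "i div int m \<ge> 0")
    case True
    then have "gr (i mod int m + int m * int (nat (i div int m))) = gr (i mod int m)" by (intro 1)
    then show ?thesis using True by simp
  next
    case False
    then have "gr (i + int m * int (nat (- (i div int m)))) = gr i" by (intro 1)
    moreover have "i + int m * int (nat (- (i div int m))) = i mod int m" using False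
      by (simp add: minus_mult_div_eq_mod[symmetric])
    ultimately show ?thesis by simp
  qed
qed

lemma omega_powi_mod: "\<omega> powi (i mod int m) = \<omega> powi i"
proof -
  have "\<omega> powi i = \<omega> powi (int m * (i div int m) + i mod int m)" by simp
  also have "\<dots> = \<omega> powi (int m * (i div int m)) * \<omega> powi (i mod int m)"
    by (rule power_int_add) (use omega_nonzero in blast)
  also have "\<omega> powi (int m * (i div int m)) = (\<omega> powi int m) powi (i div int m)" by (rule power_int_mult)
  also have "(\<omega> powi int m) powi (i div int m) * \<omega> powi (i mod int m) = \<omega> powi (i mod int m)"
    by (simp add: omega_power)
  finally show ?thesis by simp
qed

lemma omega_powi_inj:
  assumes "0 \<le> i" "i < int m" "0 \<le> j" "j < int m" "\<omega> powi i = \<omega> powi j"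
  shows "i = j"
proof -
  have *: False if "0 \<le> i" "i < j" "j < int m" "\<omega> powi i = \<omega> powi j" for i j
  proof -
    have "\<omega> powi (j - i) = 1" using that omega_nonzero by (simp add: power_int_diff)
    then have "\<omega> ^ nat (j - i) = 1" using that by (simp add: power_int_def)
    then show False using omega_primitive[of "nat (j - i)"] that by simp
  qed
  show ?thesis using *[of i j] *[of j i] assms by (metis linorder_neqE)
qed

text \<open>The powers of the primitive root \<omega> separate the degrees, so an eigenvector of
  \<theta> has a component in one degree only.\<close>

lemma mem_gr_iff: "x \<in> gr i \<longleftrightarrow> \<theta> x = sc (\<omega> powi i) x"
proof
  assume x: "\<theta> x = sc (\<omega> powi i) x"
  obtain c where c: "c \<in> (\<Pi>\<^sub>E i\<in>{0..<int m}. gr i)" "x = (\<Sum>i\<in>{0..<int m}. c i)" using decomposition[of x]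
    by blast
  let ?I = "{0..<int m}"
  let ?d = "\<lambda>j\<in>?I. sc (\<omega> powi j - \<omega> powi i) (c j)"
  have cj: "c j \<in> gr j" if "j \<in> ?I" for j using c(1) that by (rule PiE_mem)
  have d: "?d \<in> (\<Pi>\<^sub>E i\<in>?I. gr i)" using cj subspace_scale[OF subspace_gr] by auto
  have "(\<Sum>j\<in>?I. ?d j) = (\<Sum>j\<in>?I. \<theta> (c j)) - sc (\<omega> powi i) (\<Sum>j\<in>?I. c j)"
    unfolding scale_sum_right sum_subtractf[symmetric]
    by (intro sum.cong refl) (simp add: theta_gr[OF cj] scale_left_diff_distrib)
  also have "\<dots> = 0" using x c(2) by (simp add: lin_sum[OF lin_theta])
  finally have d0: "0 = (\<Sum>j\<in>?I. ?d j)" by simp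
  have z: "(\<lambda>j\<in>?I. 0) \<in> (\<Pi>\<^sub>E i\<in>?I. gr i)" "0 = (\<Sum>j\<in>?I. (\<lambda>j\<in>?I. 0::'v) j)"
    using subspace_0[OF subspace_gr] by auto
  have "?d = (\<lambda>j\<in>?I. 0)" using decomposition[of 0] d d0 z by blast
  then have zero: "c j = 0" if "j \<in> ?I" "\<omega> powi j \<noteq> \<omega> powi i" for j
  proof -
    have "?d j = (\<lambda>j\<in>?I. 0) j" using \<open>?d = _\<close> by (rule fun_cong)
    then show ?thesis using that by (simp only: restrict_apply if_True if_P[OF that(1)]) simp
  qed
  let ?j = "i mod int m"
  have j: "?j \<in> ?I" using m_pos by simp
  have "c k = 0" if "k \<in> ?I - {?j}" for k
    using zero[of k] omega_powi_inj[of k ?j] omega_powi_mod[of i] that j by force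
  then have "x = c ?j" unfolding c(2) using j by (subst sum.remove[OF _ j]) auto
  then show "x \<in> gr i" using cj[OF j] gr_mod by simp
qed (rule theta_gr)

lemma theta_diagonalizable: "diagonalizable \<theta>"
proof (rule diagonalizable_if_spanned)
  let ?E = "{w. \<exists>c. \<theta> w = sc c w}"
  have "x \<in> span ?E" for x
  proof -
    obtain c where c: "c \<in> (\<Pi>\<^sub>E i\<in>{0..<int m}. gr i)" "x = (\<Sum>i\<in>{0..<int m}. c i)" using decomposition[of x]
      by blast
    have "c j \<in> ?E" if "j \<in> {0..<int m}" for j using theta_gr[OF PiE_mem[OF c(1) that]] by blast
    then show ?thesis unfolding c(2) by (intro span_sum span_base)
  qed
  then show "span ?E = UNIV" by blast
qed

lemma eproj_theta_gr: "eproj \<theta> (\<omega> powi i) v \<in> gr i"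
  unfolding mem_gr_iff
  by (rule diagonalizable_gen_eigenspace[OF lin_theta theta_diagonalizable eproj_in[OF lin_theta]])

lemma eproj_theta_id: "x \<in> gr i \<Longrightarrow> eproj \<theta> (\<omega> powi i) x = x"
  using spec_gen_eigenspace[OF lin_theta gen_eigenspace_eigenvector[OF theta_gr]] by simp

text \<open>Bracketing with an element of degree one multiplies \<theta>-eigenvalues by
  \<omega>.\<close>

lemma eproj_theta_br:
  assumes x: "x \<in> gr 1"
  shows "eproj \<theta> (\<omega> * \<mu>) (br x w) = br x (eproj \<theta> \<mu> w)"
  using lin_theta
proof (induction w rule: gen_eigenspace_induct)
  case zero
  then show ?case by (simp add: br_0 lin_0[OF spec_linear[OF lin_theta]])
next
  case (add w w')
  then show ?case by (simp add: br_add lin_add[OF spec_linear[OF lin_theta]])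
next
  case (base \<nu> w)
  have "\<theta> w = sc \<nu> w" by (rule diagonalizable_gen_eigenspace[OF lin_theta theta_diagonalizable base])
  then have "\<theta> (br x w) = sc (\<omega> * \<nu>) (br x w)" using theta_gr[OF x] by (simp add: theta_br br_scale br_scale')
  then have "br x w \<in> gen_eigenspace \<theta> (\<omega> * \<nu>)" by (rule gen_eigenspace_eigenvector)
  then show ?case using spec_gen_eigenspace[OF lin_theta base] spec_gen_eigenspace[OF lin_theta, of "br x w"]
    omega_nonzero
    by (auto simp: br_0)
qed

text \<open>The inverse of \<theta> maps the generalized eigenspace of \<open>ad x\<close> for \<mu>
  into the one for \<open>\<omega> powi i * \<mu>\<close>. So the rescaled
  \<open>\<theta> (sspart x)\<close> has the property that characterizes
  \<open>sspart x\<close>.\<close>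

lemma sspart_gr:
  assumes x: "x \<in> gr i" shows "sspart x \<in> gr i"
proof -
  let ?w = "\<omega> powi i"
  have w0: "?w \<noteq> 0" using omega_nonzero by (rule power_int_not_zero[OF disjI1])
  let ?U = "inv_into UNIV \<theta>"
  have U: "\<theta> (?U v) = v" "?U (\<theta> v) = v" for v
    using bij_theta by (simp_all add: bij_is_surj bij_is_inj surj_f_inv_f)
  have Uscale: "?U (sc c v) = sc c (?U v)" for c v by (metis U lin_scale[OF lin_theta])
  have Udiff: "?U (v - w) = ?U v - ?U w" for v w by (metis U lin_diff[OF lin_theta])
  have U0: "?U 0 = 0" by (metis U lin_0[OF lin_theta])
  have brU: "br x (?U v) = sc ?w (?U (br x v))" for v
  proof -
    have "\<theta> (br x (?U v)) = sc ?w (br x v)" by (simp add: theta_br theta_gr[OF x] U br_scale')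
    then show ?thesis by (metis U(2) Uscale)
  qed
  have "sc (1 / ?w) (\<theta> (sspart x)) = sspart x"
  proof (rule sspart_unique)
    fix \<mu> v assume v: "v \<in> gen_eigenspace (br x) \<mu>"
    have "?U v \<in> gen_eigenspace (br x) (?w * \<mu>)"
      by (rule gen_eigenspace_intertwine[of "br x" _ ?U ?w, OF _ lin_br U0 v])
        (simp add: shift_def brU Udiff Uscale scale_right_diff_distrib)
    then have "br (sspart x) (?U v) = sc (?w * \<mu>) (?U v)" by (rule sspart)
    then have "\<theta> (br (sspart x) (?U v)) = sc (?w * \<mu>) v" by (simp add: lin_scale[OF lin_theta] U)
    then show "br (sc (1 / ?w) (\<theta> (sspart x))) v = sc \<mu> v"
      using w0 by (simp add: theta_br U br_scale')
  qed
  then have "sc ?w (sc (1 / ?w) (\<theta> (sspart x))) = sc ?w (sspart x)" by simp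
  moreover have "sc ?w (sc (1 / ?w) y) = y" for y using w0 by (simp del: power_int_eq_0_iff)
  ultimately show ?thesis unfolding mem_gr_iff by metis
qed

section \<open>Complex Cartan subspaces, generic and regular elements\<close>

definition centralizer :: "'v set \<Rightarrow> 'v set" where
  "centralizer c = {v. \<forall>x\<in>c. br x v = 0}"

text \<open>A complex Cartan subspace, with maximality stated elementwise: adjoining a commuting
  semisimple element keeps all elements commuting and semisimple, so none may exist outside
  \<open>c\<close>.\<close>

definition cartan :: "'v set \<Rightarrow> bool" where
  "cartan c \<longleftrightarrow> subspace c \<and> c \<subseteq> gr 1 \<and> (\<forall>x\<in>c. semisimple_element sc br x) \<and> (\<forall>x\<in>c. \<forall>y\<in>c. br x y = 0) \<and>
     (\<forall>y\<in>gr 1. semisimple_element sc br y \<longrightarrow> y \<in> centralizer c \<longrightarrow> y \<in> c)"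

lemma cartanD:
  assumes "cartan c"
  shows "subspace c" "c \<subseteq> gr 1" "\<And>x. x \<in> c \<Longrightarrow> semisimple_element sc br x"
    "\<And>x y. x \<in> c \<Longrightarrow> y \<in> c \<Longrightarrow> br x y = 0"
    "\<And>y. y \<in> gr 1 \<Longrightarrow> semisimple_element sc br y \<Longrightarrow> y \<in> centralizer c \<Longrightarrow> y \<in> c"
  using assms unfolding cartan_def by blast+

lemma cartan_eq: "cartan c \<Longrightarrow> c = {y \<in> gr 1. semisimple_element sc br y \<and> y \<in> centralizer c}"
  using cartanD[of c] by (auto simp: centralizer_def)

lemma subspace_centralizer: "subspace (centralizer c)"
  by (rule subspaceI) (auto simp: centralizer_def br_0 br_add br_scale)

lemma sspart_cartan:
  assumes c: "cartan c" and x: "x \<in> gr 1" "x \<in> centralizer c"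
  shows "sspart x \<in> c"
proof (rule cartanD(5)[OF c sspart_gr[OF x(1)] sspart_semisimple])
  have "br y (sspart x) = 0" if "y \<in> c" for y
  proof -
    have "br x y = 0" using x(2) that br_anti[of x y] by (simp add: centralizer_def)
    then show ?thesis using sspart_commute br_anti[of y] by simp
  qed
  then show "sspart x \<in> centralizer c" by (simp add: centralizer_def)
qed

text \<open>The semisimple part of \<open>x\<close> lies in \<open>c\<close> by maximality, hence
  kills the centralizer.\<close>

lemma centralizer_nilpotent:
  assumes c: "cartan c" and x: "x \<in> gr 1" "x \<in> centralizer c" and v: "v \<in> centralizer c"
  shows "v \<in> gen_eigenspace (br x) 0"
  using sspart_kernel[of x v] sspart_cartan[OF c x] v by (simp add: centralizer_def)

lemma eigenvalues_iff: "lin T \<Longrightarrow> \<mu> \<in> eigenvalues T \<longleftrightarrow> (\<exists>v. v \<noteq> 0 \<and> v \<in> gen_eigenspace T \<mu>)"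
proof
  assume T: "lin T" "\<mu> \<in> eigenvalues T"
  then obtain b where "b \<in> sb T" "sev T b = \<mu>" by (auto simp: eigenvalues_def)
  then show "\<exists>v. v \<noteq> 0 \<and> v \<in> gen_eigenspace T \<mu>"
    using sb_basis(1,4)[OF T(1)] dependent_zero[of "sb T"] by (intro exI[of _ b]) auto
qed (auto intro: eigenvalue_exists)

lemma semisimple_gen_eigenspace:
  assumes "semisimple_element sc br x" "v \<in> gen_eigenspace (br x) \<mu>"
  shows "br x v = sc \<mu> v"
  using assms diagonalizable_gen_eigenspace[OF lin_br] by (simp add: semisimple_iff)

text \<open>An element of a Cartan subspace with as many eigenvalues as possible separates the weights.\<close>

lemma exists_generic_element:
  assumes c: "cartan c"
  obtains x0 where "x0 \<in> c" "\<forall>y\<in>c. \<forall>\<mu>. \<exists>\<nu>. \<forall>v\<in>gen_eigenspace (br x0) \<mu>. br y v = sc \<nu> v"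
proof -
  let ?ev = "\<lambda>x. eigenvalues (br x)"
  have bound: "card (?ev x) < Suc dimension" for x
  proof -
    have "card (?ev x) \<le> card (sb (br x))" unfolding eigenvalues_def
      by (rule card_image_le) (rule sb_basis(3)[OF lin_br])
    also have "\<dots> \<le> dim UNIV" using sb_basis(1)[OF lin_br] by (intro independent_card_le_dim) auto
    finally show ?thesis by (simp add: dimension_def)
  qed
  have "0 \<in> c" by (rule subspace_0[OF cartanD(1)[OF c]])
  then have "\<exists>x. x \<in> c \<and> (\<forall>y. y \<in> c \<longrightarrow> card (?ev y) \<le> card (?ev x))"
    by (rule ex_has_greatest_nat[of "\<lambda>x. x \<in> c" 0 "\<lambda>x. card (?ev x)" "Suc dimension"]) (use bound in blast)
  then obtain x0 where x0: "x0 \<in> c" and max: "\<And>y. y \<in> c \<Longrightarrow> card (?ev y) \<le> card (?ev x0)" by blast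
  have "\<exists>\<nu>. \<forall>v\<in>gen_eigenspace (br x0) \<mu>. br y v = sc \<nu> v" if y: "y \<in> c" for y \<mu>
  proof -
    have ss: "semisimple_element sc br x0" "semisimple_element sc br y" using cartanD(3)[OF c] x0 y by auto
    have comm: "br x0 (br y v) = br y (br x0 v)" for v
      using jacobi[of x0 y v] cartanD(4)[OF c x0 y] by (simp add: br_0')
    \<comment> \<open>The joint eigenvalues of \<open>ad x0\<close> and \<open>ad y\<close>; the
      first is to determine the second.\<close>
    define Pairs where "Pairs = {(\<mu>, \<nu>). \<exists>v. v \<noteq> 0 \<and> v \<in> gen_eigenspace (br x0) \<mu> \<and> v \<in> gen_eigenspace (br y) \<nu>}"
    have "Pairs \<subseteq> ?ev x0 \<times> ?ev y" by (auto simp: Pairs_def eigenvalues_iff[OF lin_br])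
    then have fin: "finite Pairs" using finite_eigenvalues[OF lin_br] finite_subset by blast
    have ep: "eproj (br y) \<nu> v \<in> gen_eigenspace (br x0) \<mu>" if "v \<in> gen_eigenspace (br x0) \<mu>" for v \<mu> \<nu>
    proof (rule gen_eigenspace_commute[OF _ spec_linear[OF lin_br] lin_br that])
      show "eproj (br y) \<nu> (br x0 w) = br x0 (eproj (br y) \<nu> w)" for w
        by (rule spec_commute[OF lin_br lin_br, symmetric]) (rule comm)
    qed
    have ep2: "eproj (br y) \<nu> v \<in> gen_eigenspace (br y) \<nu>" for v \<nu> by (rule eproj_in[OF lin_br])
    have fst: "fst ` Pairs = ?ev x0"
    proof (intro equalityI subsetI)
      fix \<mu> assume "\<mu> \<in> ?ev x0"
      then obtain v where v: "v \<noteq> 0" "v \<in> gen_eigenspace (br x0) \<mu>" by (auto simp: eigenvalues_iff[OF lin_br])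
      have "\<exists>\<nu>\<in>?ev y. eproj (br y) \<nu> v \<noteq> 0"
        using sum_eproj[OF lin_br[of y], of v] v(1) by (metis (no_types, lifting) sum.neutral)
      then obtain \<nu> where "eproj (br y) \<nu> v \<noteq> 0" by blast
      then have "(\<mu>, \<nu>) \<in> Pairs" using ep[OF v(2)] ep2 by (auto simp: Pairs_def)
      then show "\<mu> \<in> fst ` Pairs" by force
    qed (use \<open>Pairs \<subseteq> _\<close> in auto)
    \<comment> \<open>The finitely many \<epsilon> for which two pairs give the same eigenvalue of
      \<open>x0 + \<epsilon> y\<close>.\<close>
    have "finite ((\<lambda>(p, q). (fst q - fst p) / (snd p - snd q)) ` (Pairs \<times> Pairs))" using fin by simp
    then obtain \<epsilon> where \<epsilon>: "\<epsilon> \<notin> (\<lambda>(p, q). (fst q - fst p) / (snd p - snd q)) ` (Pairs \<times> Pairs)"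
      using ex_new_if_finite[OF infinite_UNIV_char_0] by blast
    let ?f = "\<lambda>p. fst p + \<epsilon> * snd p"
    have inj: "inj_on ?f Pairs"
    proof (rule inj_onI)
      fix p q assume pq: "p \<in> Pairs" "q \<in> Pairs" "?f p = ?f q"
      show "p = q"
      proof (cases "snd p = snd q")
        case True
        then show ?thesis using pq(3) by (simp add: prod_eq_iff)
      next
        case False
        then have "\<epsilon> = (fst q - fst p) / (snd p - snd q)" using pq(3) by (simp add: field_simps)
        then show ?thesis using \<epsilon> pq by force
      qed
    qed
    let ?x = "sc 1 x0 + sc \<epsilon> y"
    have xc: "?x \<in> c" using x0 y cartanD(1)[OF c] by (intro subspace_add subspace_scale)
    have "?f ` Pairs \<subseteq> ?ev ?x"
    proof
      fix \<kappa> assume "\<kappa> \<in> ?f ` Pairs"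
      then obtain p where p: "p \<in> Pairs" "\<kappa> = fst p + \<epsilon> * snd p" by blast
      then obtain v where v: "v \<noteq> 0" "v \<in> gen_eigenspace (br x0) (fst p)" "v \<in> gen_eigenspace (br y) (snd p)"
        by (auto simp: Pairs_def)
      then have "br ?x v = sc \<kappa> v"
        using semisimple_gen_eigenspace[OF ss(1)] semisimple_gen_eigenspace[OF ss(2)] p(2)
        by (simp add: br_add' br_scale' scale_left_distrib)
      then have "v \<in> gen_eigenspace (br ?x) \<kappa>" by (rule gen_eigenspace_eigenvector)
      then show "\<kappa> \<in> ?ev ?x" using v(1) by (auto simp: eigenvalues_iff[OF lin_br])
    qed
    \<comment> \<open>\<open>x0 + \<epsilon> y\<close> has at least as many eigenvalues as there are
      pairs, and by maximality no more than \<open>x0\<close> has. So the first projection is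
      injective on the pairs.\<close>
    then have "card Pairs \<le> card (?ev ?x)" using card_image[OF inj]
      card_mono[OF finite_eigenvalues[OF lin_br]] by metis
    also have "\<dots> \<le> card (fst ` Pairs)" unfolding fst by (rule max[OF xc])
    finally have inj_fst: "inj_on fst Pairs" using fin card_image_le[OF fin, of fst]
      by (intro eq_card_imp_inj_on) auto
    show ?thesis
    proof (cases "\<exists>\<nu>. (\<mu>, \<nu>) \<in> Pairs")
      case True
      then obtain \<nu> where \<nu>: "(\<mu>, \<nu>) \<in> Pairs" by blast
      have "br y v = sc \<nu> v" if v: "v \<in> gen_eigenspace (br x0) \<mu>" for v
      proof -
        have 0: "eproj (br y) \<kappa> v = 0" if "\<kappa> \<noteq> \<nu>" for \<kappa>
        proof (rule ccontr)
          assume "eproj (br y) \<kappa> v \<noteq> 0"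
          then have "(\<mu>, \<kappa>) \<in> Pairs" using ep[OF v] ep2 by (auto simp: Pairs_def)
          then show False using inj_onD[OF inj_fst _ \<nu>, of "(\<mu>, \<kappa>)"] that by auto
        qed
        have "eproj (br y) \<kappa> v \<in> gen_eigenspace (br y) \<nu>" for \<kappa>
          using 0[of \<kappa>] ep2[of \<nu> v] subspace_0[OF subspace_gen_eigenspace[OF lin_br]]
            by (cases "\<kappa> = \<nu>") fastforce+
        then have "(\<Sum>\<kappa>\<in>?ev y. eproj (br y) \<kappa> v) \<in> gen_eigenspace (br y) \<nu>"
          by (intro subspace_sum[OF subspace_gen_eigenspace[OF lin_br]])
        then have "v \<in> gen_eigenspace (br y) \<nu>" by (simp only: sum_eproj[OF lin_br])
        then show ?thesis by (rule semisimple_gen_eigenspace[OF ss(2)])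
      qed
      then show ?thesis by blast
    next
      \<comment> \<open>Here \<mu> is not an eigenvalue, its space is zero and any scalar will
        do.\<close>
      case False
      have z: "v = 0" if v: "v \<in> gen_eigenspace (br x0) \<mu>" for v
      proof (rule ccontr)
        assume "v \<noteq> 0"
        then have "\<mu> \<in> fst ` Pairs" unfolding fst using v by (auto simp: eigenvalues_iff[OF lin_br])
        then show False using False by force
      qed
      have "\<forall>v\<in>gen_eigenspace (br x0) \<mu>. br y v = sc 0 v"
      proof
        fix v assume "v \<in> gen_eigenspace (br x0) \<mu>"
        then have "v = 0" by (rule z)
        then show "br y v = sc 0 v" by (simp add: br_0)
      qed
      then show ?thesis by blast
    qed
  qed
  then show thesis using that x0 by blast
qed

text \<open>The trace of \<open>ad x\<close> cut down to the generalized eigenspace of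
  \<open>ad x0\<close> for \<mu>. For generic \<open>x0\<close> and \<open>x\<close> in the Cartan
  subspace it is the weight times its multiplicity; being linear in \<open>x\<close>, it makes
  regularity a polynomial condition.\<close>

definition weight_trace :: "'v \<Rightarrow> complex \<Rightarrow> 'v \<Rightarrow> complex" where
  "weight_trace x0 \<mu> x = trace (\<lambda>v. br x (eproj (br x0) \<mu> v))"

lemma linear_weight_trace: "Vector_Spaces.linear sc (*) (weight_trace x0 \<mu>)"
proof -
  have L: "lin (\<lambda>v. br x (eproj (br x0) \<mu> v))" for x by (rule lin_compose[OF lin_br spec_linear[OF lin_br]])
  show ?thesis
    using vector_space_axioms
    by (auto simp: Vector_Spaces.linear_iff vector_space_def algebra_simps weight_trace_def br_add' br_scale'
        trace_add[OF L L] trace_scale[OF L])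
qed

text \<open>In terms of weights: distinct weights of \<open>c\<close> take distinct values at
  \<open>x0\<close>.\<close>

definition generic :: "'v set \<Rightarrow> 'v \<Rightarrow> bool" where
  "generic c x0 \<longleftrightarrow> x0 \<in> c \<and> (\<forall>y\<in>c. \<forall>\<mu>. \<exists>\<nu>. \<forall>v\<in>gen_eigenspace (br x0) \<mu>. br y v = sc \<nu> v)"

text \<open>A nonzero \<open>y\<close> in \<open>c\<close> itself lies in the zero eigenspace of
  \<open>ad x0\<close>, and \<open>br y y = 0\<close> forces the scalar by which \<open>y\<close>
  acts there to be 0.\<close>

lemma generic_kernel:
  assumes c: "cartan c" and x0: "generic c x0"
  shows "gen_eigenspace (br x0) 0 = centralizer c"
proof (intro equalityI subsetI)
  fix v assume v: "v \<in> gen_eigenspace (br x0) 0"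
  have "br y v = 0" if y: "y \<in> c" for y
  proof (cases "y = 0")
    case False
    obtain \<nu> where \<nu>: "\<forall>v\<in>gen_eigenspace (br x0) 0. br y v = sc \<nu> v" using x0 y unfolding generic_def by blast
    have "br x0 y = sc 0 y" using cartanD(4)[OF c _ y] x0 by (simp add: generic_def)
    then have "y \<in> gen_eigenspace (br x0) 0" by (rule gen_eigenspace_eigenvector)
    then have "sc \<nu> y = 0" using \<nu> br_self[of y] by metis
    then have "\<nu> = 0" using False by simp
    then show ?thesis using \<nu> v by simp
  qed (simp add: br_0')
  then show "v \<in> centralizer c" by (simp add: centralizer_def)
next
  fix v assume "v \<in> centralizer c"
  then have "br x0 v = sc 0 v" using x0 by (simp add: centralizer_def generic_def)
  then show "v \<in> gen_eigenspace (br x0) 0" by (rule gen_eigenspace_eigenvector)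
qed

definition regular :: "'v \<Rightarrow> 'v \<Rightarrow> bool" where
  "regular x0 x \<longleftrightarrow> (\<forall>\<mu>\<in>eigenvalues (br x0) - {0}. weight_trace x0 \<mu> x \<noteq> 0)"

lemma generic_regular:
  assumes c: "cartan c" and x0: "generic c x0" shows "regular x0 x0"
  unfolding regular_def
proof
  fix \<mu> assume \<mu>: "\<mu> \<in> eigenvalues (br x0) - {0}"
  have ss: "semisimple_element sc br x0" using cartanD(3)[OF c] x0 by (simp add: generic_def)
  have "weight_trace x0 \<mu> x0 = trace (\<lambda>v. sc \<mu> (eproj (br x0) \<mu> v))"
    unfolding weight_trace_def using semisimple_gen_eigenspace[OF ss eproj_in[OF lin_br]] by simp
  also have "\<dots> = \<mu> * (\<Sum>b\<in>sb (br x0). if sev (br x0) b = \<mu> then 1 else 0)"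
    by (simp add: trace_scale[OF spec_linear[OF lin_br]] trace_spec[OF lin_br])
  also have "(\<Sum>b\<in>sb (br x0). if sev (br x0) b = \<mu> then 1 else 0) = of_nat (card {b\<in>sb (br x0). sev (br x0) b = \<mu>})"
    using sb_basis(3)[OF lin_br] by (simp add: sum.If_cases Int_def)
  finally have eq: "weight_trace x0 \<mu> x0 = \<mu> * of_nat (card {b\<in>sb (br x0). sev (br x0) b = \<mu>})" .
  have "{b\<in>sb (br x0). sev (br x0) b = \<mu>} \<noteq> {}" using \<mu> by (auto simp: eigenvalues_def)
  then have "card {b\<in>sb (br x0). sev (br x0) b = \<mu>} \<noteq> 0" using sb_basis(3)[OF lin_br] by simp
  then show "weight_trace x0 \<mu> x0 \<noteq> 0" using \<mu> unfolding eq by simp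
qed

text \<open>The semisimple part of \<open>x\<close> lies in \<open>c\<close>, so on this weight
  space \<open>ad x\<close> has a single eigenvalue \<nu>. If it were 0, \<open>ad x\<close> would
  be nilpotent there and the weight trace would vanish.\<close>

lemma regular_weight:
  assumes c: "cartan c" and x0: "generic c x0" and x: "x \<in> gr 1" "x \<in> centralizer c" "regular x0 x"
    and \<mu>: "\<mu> \<in> eigenvalues (br x0) - {0}"
  obtains \<nu> where "\<nu> \<noteq> 0" "gen_eigenspace (br x0) \<mu> \<subseteq> gen_eigenspace (br x) \<nu>"
proof -
  obtain \<nu> where "\<forall>v\<in>gen_eigenspace (br x0) \<mu>. br (sspart x) v = sc \<nu> v"
    using x0 sspart_cartan[OF c x(1,2)] unfolding generic_def by blast
  then have sub: "gen_eigenspace (br x0) \<mu> \<subseteq> gen_eigenspace (br x) \<nu>" using sspart_eigen by blast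
  have "\<nu> \<noteq> 0"
  proof
    assume "\<nu> = 0"
    let ?e = "eproj (br x0) \<mu>"
    let ?M = "\<lambda>v. br x (?e v)"
    have M: "lin ?M" by (rule lin_compose[OF lin_br spec_linear[OF lin_br]])
    have comm0: "br x0 (br x w) = br x (br x0 w)" for w
      using jacobi[of x0 x w] x(2) x0 by (simp add: centralizer_def generic_def br_0')
    have comm: "br x (?e w) = ?e (br x w)" for w
      by (rule spec_commute[OF lin_br lin_br]) (rule comm0[symmetric])
    have idem: "?e (?e w) = ?e w" for w using spec_gen_eigenspace[OF lin_br eproj_in[OF lin_br]] by simp
    have it: "(?M ^^ Suc k) v = (br x ^^ Suc k) (?e v)" for k v
    proof (induction k)
      case (Suc k)
      have ej: "?e ((br x ^^ j) (?e v)) = (br x ^^ j) (?e v)" for j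
        by (induction j) (simp_all add: idem comm[symmetric])
      have "(?M ^^ Suc (Suc k)) v = ?M ((?M ^^ Suc k) v)" by simp
      also have "\<dots> = br x (?e ((br x ^^ Suc k) (?e v)))" by (simp only: Suc)
      also have "\<dots> = br x ((br x ^^ Suc k) (?e v))" by (simp only: ej)
      finally show ?case by simp
    qed simp
    have "\<exists>k. (?M ^^ k) v = 0" for v
    proof -
      have "?e v \<in> gen_eigenspace (br x) 0" using sub eproj_in[OF lin_br] \<open>\<nu> = 0\<close> by blast
      moreover have "shift (br x) 0 = br x" by (auto simp: shift_def)
      ultimately obtain k where "(br x ^^ k) (?e v) = 0" by (auto simp: gen_eigenspace_def)
      then have "(?M ^^ Suc k) v = 0" unfolding it by (simp add: br_0)
      then show ?thesis by blast
    qed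
    then have "trace ?M = 0" by (rule trace_nilpotent[OF M])
    then show False using x(3) \<mu> by (simp add: regular_def weight_trace_def)
  qed
  then show thesis using that sub by blast
qed

text \<open>Off the zero weight space \<open>ad x\<close> has only nonzero eigenvalues. Thus a
  regular point of the slice determines the centralizer of \<open>c\<close>, and through it
  \<open>c\<close>.\<close>

lemma regular_kernel:
  assumes c: "cartan c" and x0: "generic c x0" and x: "x \<in> gr 1" "x \<in> centralizer c" "regular x0 x"
  shows "gen_eigenspace (br x) 0 = centralizer c"
proof (intro equalityI subsetI)
  fix v assume v: "v \<in> gen_eigenspace (br x) 0"
  let ?e = "\<lambda>\<mu>. eproj (br x0) \<mu> v"
  have comm0: "br x0 (br x w) = br x (br x0 w)" for w
    using jacobi[of x0 x w] x(2) x0 by (simp add: centralizer_def generic_def br_0')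
  have comm: "eproj (br x0) \<mu> (br x w) = br x (eproj (br x0) \<mu> w)" for w \<mu>
    by (rule spec_commute[OF lin_br lin_br, symmetric]) (rule comm0[symmetric])
  have e: "?e \<mu> \<in> gen_eigenspace (br x) 0" for \<mu>
    by (rule gen_eigenspace_commute[OF comm spec_linear[OF lin_br] lin_br v])
  have "?e \<mu> = 0" if ev: "\<mu> \<in> eigenvalues (br x0) - {0}" for \<mu>
  proof -
    obtain \<nu> where \<nu>: "\<nu> \<noteq> 0" "gen_eigenspace (br x0) \<mu> \<subseteq> gen_eigenspace (br x) \<nu>"
      by (rule regular_weight[OF c x0 x ev])
    then have "?e \<mu> \<in> gen_eigenspace (br x) \<nu>" using eproj_in[OF lin_br] by blast
    then show ?thesis using gen_eigenspace_disjoint[OF lin_br e] \<nu>(1) by blast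
  qed
  then have "?e \<mu> \<in> centralizer c" if "\<mu> \<in> eigenvalues (br x0)" for \<mu>
    using that eproj_in[OF lin_br[of x0], of 0 v] generic_kernel[OF c x0] subspace_0[OF subspace_centralizer]
    by (cases "\<mu> = 0") fastforce+
  then have "(\<Sum>\<mu>\<in>eigenvalues (br x0). ?e \<mu>) \<in> centralizer c" by (intro subspace_sum[OF subspace_centralizer])
  then show "v \<in> centralizer c" by (simp only: sum_eproj[OF lin_br])
qed (rule centralizer_nilpotent[OF c x(1,2)])

text \<open>On the nonzero weight spaces \<open>ad x\<close> is invertible, so slice directions and
  orbit directions together fill \<open>gr 1\<close>. This is the infinitesimal form of
  dominance.\<close>

lemma regular_decomposition:
  assumes c: "cartan c" and x0: "generic c x0" and x: "x \<in> gr 1" "x \<in> centralizer c" "regular x0 x"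
    and v: "v \<in> gr 1"
  obtains k w where "k \<in> gr 1" "k \<in> centralizer c" "w \<in> gr 0" "v = k + br x w"
proof -
  let ?e = "\<lambda>\<mu>. eproj (br x0) \<mu> v"
  have "\<exists>k\<in>centralizer c. \<exists>w. ?e \<mu> = k + br x w" if \<mu>: "\<mu> \<in> eigenvalues (br x0)" for \<mu>
  proof (cases "\<mu> = 0")
    case True
    then have "?e \<mu> \<in> centralizer c" using eproj_in[OF lin_br[of x0], of 0 v] generic_kernel[OF c x0] by simp
    moreover have "?e \<mu> = ?e \<mu> + br x 0" by (simp add: br_0)
    ultimately show ?thesis by blast
  next
    case False
    then obtain \<nu> where \<nu>: "\<nu> \<noteq> 0" "gen_eigenspace (br x0) \<mu> \<subseteq> gen_eigenspace (br x) \<nu>"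
      using regular_weight[OF c x0 x, of \<mu>] \<mu> by blast
    then have "?e \<mu> \<in> gen_eigenspace (br x) \<nu>" using eproj_in[OF lin_br] by blast
    then obtain w where "shift (br x) 0 w = ?e \<mu>" using gen_eigenspace_shift_surj[OF lin_br \<nu>(1)] by blast
    then have "?e \<mu> = 0 + br x w" by (simp add: shift_def)
    then show ?thesis using subspace_0[OF subspace_centralizer] by blast
  qed
  then have "\<forall>\<mu>\<in>eigenvalues (br x0). \<exists>k w. k \<in> centralizer c \<and> ?e \<mu> = k + br x w" by blast
  then obtain k w where kw: "\<forall>\<mu>\<in>eigenvalues (br x0). k \<mu> \<in> centralizer c \<and> ?e \<mu> = k \<mu> + br x (w \<mu>)" by metis
  let ?k = "\<Sum>\<mu>\<in>eigenvalues (br x0). k \<mu>" and ?w = "\<Sum>\<mu>\<in>eigenvalues (br x0). w \<mu>"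
  have "v = (\<Sum>\<mu>\<in>eigenvalues (br x0). k \<mu> + br x (w \<mu>))"
    using sum_eproj[OF lin_br[of x0], of v] kw by (metis (no_types, lifting) sum.cong)
  then have vk: "v = ?k + br x ?w" by (simp add: sum.distrib lin_sum[OF lin_br])
  have kc: "?k \<in> centralizer c" using kw by (intro subspace_sum[OF subspace_centralizer]) blast
  \<comment> \<open>The projection to \<open>gr 1\<close>; it turns \<open>br x w\<close> into the
    bracket of \<open>x\<close> with the degree-0 part of \<open>w\<close>.\<close>
  let ?p = "eproj \<theta> (\<omega> * 1)"
  have "v = ?p v" using eproj_theta_id[OF v] by simp
  also have "\<dots> = ?p ?k + br x (eproj \<theta> 1 ?w)"
    by (subst vk) (simp only: lin_add[OF spec_linear[OF lin_theta]] eproj_theta_br[OF x(1)])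
  finally have "v = ?p ?k + br x (eproj \<theta> 1 ?w)" .
  moreover have "?p ?k \<in> gr 1" using eproj_theta_gr[of 1 ?k] by simp
  moreover have "eproj \<theta> 1 ?w \<in> gr 0" using eproj_theta_gr[of 0 ?w] by simp
  moreover have "?p ?k \<in> centralizer c"
  proof -
    have "br y (?p ?k) = 0" if y: "y \<in> c" for y
    proof -
      have "br y (?p ?k) = eproj \<theta> (\<omega> * (\<omega> * 1)) (br y ?k)"
        using eproj_theta_br[of y "\<omega> * 1" ?k] cartanD(2)[OF c] y by auto
      also have "br y ?k = 0" using kc y by (simp add: centralizer_def)
      finally show ?thesis by (simp add: lin_0[OF spec_linear[OF lin_theta]])
    qed
    then show ?thesis by (simp add: centralizer_def)
  qed
  ultimately show thesis using that by blast
qed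

end

section \<open>Real forms\<close>

locale real_graded_lie = graded_lie sc Basis br m gr \<omega> \<theta>
  for sc :: "complex \<Rightarrow> 'v::ab_group_add \<Rightarrow> 'v" and Basis :: "'v set" and br :: "'v \<Rightarrow> 'v \<Rightarrow> 'v"
    and m :: nat and gr :: "int \<Rightarrow> 'v set" and \<omega> :: complex and \<theta> :: "'v \<Rightarrow> 'v" +
  fixes \<sigma> :: "'v \<Rightarrow> 'v"
  assumes real: "real_structure sc br \<sigma>" and sigma_gr: "\<sigma> ` gr i \<subseteq> gr i"
begin

lemma sigma_add: "\<sigma> (x + y) = \<sigma> x + \<sigma> y" and sigma_scale: "\<sigma> (sc c x) = sc (cnj c) (\<sigma> x)"
  and sigma_sigma: "\<sigma> (\<sigma> x) = x" and sigma_br: "\<sigma> (br x y) = br (\<sigma> x) (\<sigma> y)"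
  using real unfolding real_structure_def by blast+

lemma sigma_0: "\<sigma> 0 = 0"
  using sigma_scale[of 0 0] by simp

lemma sigma_diff: "\<sigma> (x - y) = \<sigma> x - \<sigma> y"
  using sigma_add[of "x - y" y] by (simp add: algebra_simps)

lemma sigma_gr_mem: "x \<in> gr i \<Longrightarrow> \<sigma> x \<in> gr i"
  using sigma_gr by blast

lemma sigma_gen_eigenspace:
  assumes v: "v \<in> gen_eigenspace (br x) \<mu>"
  shows "\<sigma> v \<in> gen_eigenspace (br (\<sigma> x)) (cnj \<mu>)"
  by (rule gen_eigenspace_intertwine[of "br (\<sigma> x)" _ \<sigma> 1, OF _ lin_br sigma_0 v])
    (simp add: shift_def sigma_diff sigma_br sigma_scale)

lemma sspart_real:
  assumes x: "\<sigma> x = x" shows "\<sigma> (sspart x) = sspart x"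
proof (rule sspart_unique)
  fix \<mu> v assume "v \<in> gen_eigenspace (br x) \<mu>"
  then have "br (sspart x) (\<sigma> v) = sc (cnj \<mu>) (\<sigma> v)"
    using sspart sigma_gen_eigenspace[of v x \<mu>] x by simp
  then have "\<sigma> (br (sspart x) (\<sigma> v)) = sc \<mu> v" by (simp add: sigma_scale sigma_sigma)
  then show "br (\<sigma> (sspart x)) v = sc \<mu> v" by (simp add: sigma_br sigma_sigma)
qed

lemma semisimple_sigma:
  assumes x: "semisimple_element sc br x" shows "semisimple_element sc br (\<sigma> x)"
  unfolding semisimple_iff
proof (rule diagonalizableI[OF lin_br])
  fix \<mu> v assume "v \<in> gen_eigenspace (br (\<sigma> x)) \<mu>"
  then have "\<sigma> v \<in> gen_eigenspace (br x) (cnj \<mu>)" using sigma_gen_eigenspace sigma_sigma by metis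
  then have "br x (\<sigma> v) = sc (cnj \<mu>) (\<sigma> v)" by (rule semisimple_gen_eigenspace[OF x])
  then have "\<sigma> (br x (\<sigma> v)) = sc \<mu> v" by (simp add: sigma_scale sigma_sigma)
  then show "br (\<sigma> x) v = sc \<mu> v" by (simp add: sigma_br sigma_sigma)
qed

sublocale reals: vector_space "\<lambda>r::real. sc (complex_of_real r)"
  by unfold_locales (simp_all add: scale_right_distrib scale_left_distrib)

definition real_cartan :: "'v set \<Rightarrow> bool" where
  "real_cartan h \<longleftrightarrow> real_cartan_subspace sc br (real_points \<sigma> (gr 1)) h"

lemma real_cartanD:
  assumes "real_cartan h"
  shows "reals.subspace h" "h \<subseteq> gr 1" "\<And>x. x \<in> h \<Longrightarrow> \<sigma> x = x"
    "\<And>x. x \<in> h \<Longrightarrow> semisimple_element sc br x" "\<And>x y. x \<in> h \<Longrightarrow> y \<in> h \<Longrightarrow> br x y = 0"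
  using assms unfolding real_cartan_def real_cartan_subspace_def commuting_semisimple_subspace_def
    real_points_def
  by blast+

text \<open>Adjoining the real line through \<open>s\<close> gives another commuting semisimple
  subspace.\<close>

lemma real_cartan_maximal:
  assumes h: "real_cartan h" and s: "s \<in> gr 1" "\<sigma> s = s" "semisimple_element sc br s" "s \<in> centralizer h"
  shows "s \<in> h"
proof -
  note H = real_cartanD[OF h]
  let ?H = "{x + sc (complex_of_real r) s | x r. x \<in> h}"
  have comm: "br x s = 0" if "x \<in> h" for x using s(4) that by (simp add: centralizer_def)
  have comm': "br s x = 0" if "x \<in> h" for x using comm[OF that] br_anti[of s x] by simp
  have "reals.subspace ?H"
  proof (rule reals.subspaceI)
    have "0 = 0 + sc (complex_of_real 0) s" by simp
    then show "0 \<in> ?H" using reals.subspace_0[OF H(1)] by blast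
  next
    fix x y assume "x \<in> ?H" "y \<in> ?H"
    then obtain a r b q where "x = a + sc (complex_of_real r) s" "y = b + sc (complex_of_real q) s" "a \<in> h"
      "b \<in> h" by blast
    then have "x + y = (a + b) + sc (complex_of_real (r + q)) s" "a + b \<in> h"
      using reals.subspace_add[OF H(1)] by (auto simp: scale_left_distrib algebra_simps)
    then show "x + y \<in> ?H" by blast
  next
    fix c x assume "x \<in> ?H"
    then obtain a r where "x = a + sc (complex_of_real r) s" "a \<in> h" by blast
    then have "sc (complex_of_real c) x = sc (complex_of_real c) a + sc (complex_of_real (c * r)) s"
      "sc (complex_of_real c) a \<in> h"
      using reals.subspace_scale[OF H(1)] by (auto simp: scale_right_distrib)
    then show "sc (complex_of_real c) x \<in> ?H" by blast
  qed
  moreover have "?H \<subseteq> real_points \<sigma> (gr 1)"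
    using H(2,3) s(1,2) subspace_add[OF subspace_gr] subspace_scale[OF subspace_gr]
    by (auto simp: real_points_def sigma_add sigma_scale)
  moreover have "semisimple_element sc br y" if yH: "y \<in> ?H" for y
  proof -
    obtain x r where xr: "y = x + sc (complex_of_real r) s" "x \<in> h" using yH by blast
    then show ?thesis using semisimple_combine[OF H(4)[OF xr(2)] s(3) comm[OF xr(2)], of 1
      "complex_of_real r"] by simp
  qed
  moreover have "br x y = 0" if "x \<in> ?H" "y \<in> ?H" for x y
    using that H(5) comm comm' by (auto simp: br_add br_add' br_scale br_scale' br_self)
  ultimately have "commuting_semisimple_subspace sc br (real_points \<sigma> (gr 1)) ?H"
    unfolding commuting_semisimple_subspace_def by blast
  moreover have "h \<subseteq> ?H"
  proof
    fix x assume "x \<in> h"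
    moreover have "x = x + sc (complex_of_real 0) s" by simp
    ultimately show "x \<in> ?H" by blast
  qed
  ultimately have "?H = h" using h unfolding real_cartan_def real_cartan_subspace_def by blast
  moreover have "s = 0 + sc (complex_of_real 1) s" by simp
  then have "s \<in> ?H" using reals.subspace_0[OF H(1)] by blast
  ultimately show ?thesis by blast
qed

lemma span_real_subspace:
  assumes h: "reals.subspace h" shows "span h = {a + sc \<i> b | a b. a \<in> h \<and> b \<in> h}"
proof
  let ?S = "{a + sc \<i> b | a b. a \<in> h \<and> b \<in> h}"
  have hs: "sc (complex_of_real r) x \<in> h" if "x \<in> h" for r x using reals.subspace_scale[OF h that] .
  have "subspace ?S"
  proof (rule subspaceI)
    have "0 = 0 + sc \<i> 0" by simp
    then show "0 \<in> ?S" using reals.subspace_0[OF h] by blast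
  next
    fix x y assume "x \<in> ?S" "y \<in> ?S"
    then obtain a b a' b' where "x = a + sc \<i> b" "y = a' + sc \<i> b'" "a \<in> h" "b \<in> h" "a' \<in> h" "b' \<in> h" by blast
    then have "x + y = (a + a') + sc \<i> (b + b')" "a + a' \<in> h" "b + b' \<in> h"
      using reals.subspace_add[OF h] by (auto simp: scale_right_distrib algebra_simps)
    then show "x + y \<in> ?S" by blast
  next
    fix c x assume "x \<in> ?S"
    then obtain a b where ab: "x = a + sc \<i> b" "a \<in> h" "b \<in> h" by blast
    let ?r = "\<lambda>x. complex_of_real x"
    have c: "c = ?r (Re c) + \<i> * ?r (Im c)" by (rule complex_eq)
    have "sc c x = sc c a + sc (c * \<i>) b" by (simp add: ab scale_right_distrib)
    also have "sc c a = sc (?r (Re c)) a + sc \<i> (sc (?r (Im c)) a)"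
      by (subst c) (simp add: scale_left_distrib)
    also have "sc (c * \<i>) b = sc \<i> (sc (?r (Re c)) b) - sc (?r (Im c)) b"
      by (subst c) (simp add: scale_left_distrib algebra_simps scale_left_diff_distrib)
    finally have "sc c x = (sc (?r (Re c)) a - sc (?r (Im c)) b) + sc \<i> (sc (?r (Im c)) a + sc (?r (Re c)) b)"
      by (simp add: scale_right_distrib algebra_simps)
    moreover have "sc (?r (Re c)) a - sc (?r (Im c)) b \<in> h" "sc (?r (Im c)) a + sc (?r (Re c)) b \<in> h"
      by (rule reals.subspace_diff[OF h hs[OF ab(2)] hs[OF ab(3)]])
        (rule reals.subspace_add[OF h hs[OF ab(2)] hs[OF ab(3)]])
    ultimately show "sc c x \<in> ?S" by blast
  qed
  moreover have "h \<subseteq> ?S"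
  proof
    fix x assume "x \<in> h"
    moreover have "x = x + sc \<i> 0" by simp
    ultimately show "x \<in> ?S" using reals.subspace_0[OF h] by blast
  qed
  ultimately show "span h \<subseteq> ?S" by (intro span_minimal)
  show "?S \<subseteq> span h" by (auto intro: span_add span_scale span_base)
qed

lemma real_imaginary_parts:
  fixes y :: 'v
  defines "a \<equiv> sc (1/2) y + sc (1/2) (\<sigma> y)" and "b \<equiv> sc (- \<i>/2) y + sc (\<i>/2) (\<sigma> y)"
  shows "y = a + sc \<i> b" "\<sigma> a = a" "\<sigma> b = b"
proof -
  have "sc (1/2) y + sc (1/2) y = y" by (simp flip: scale_left_distrib)
  then show "y = a + sc \<i> b" unfolding a_def b_def by (simp add: scale_right_distrib algebra_simps)
  show "\<sigma> a = a" by (simp add: a_def sigma_add sigma_scale sigma_sigma add.commute)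
  show "\<sigma> b = b" by (simp add: b_def sigma_add sigma_diff sigma_scale sigma_sigma add.commute)
qed

lemma representation_pencil_poly:
  "\<exists>p. \<forall>t. representation Basis ((br (a + sc t b) ^^ n) v) d = poly p t"
proof (induction n arbitrary: d)
  case 0
  show ?case by (rule exI[of _ "[:representation Basis v d:]"]) simp
next
  case (Suc n)
  obtain p where p: "\<And>d t. representation Basis ((br (a + sc t b) ^^ n) v) d = poly (p d) t" using Suc
    by metis
  let ?R = "representation Basis"
  show ?case
  proof (intro exI allI)
    fix t
    have "?R ((br (a + sc t b) ^^ Suc n) v) d = (\<Sum>c\<in>Basis. ?R ((br (a + sc t b) ^^ n) v) c * ?R (br (a + sc t b) c) d)"
      unfolding funpow.simps o_apply
      by (rule rep_lin[OF independent_Basis span_Basis independent_Basis span_Basis lin_br])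
    also have "\<dots> = poly (\<Sum>c\<in>Basis. p c * [:?R (br a c) d, ?R (br b c) d:]) t"
      by (simp add: p poly_sum br_add' br_scale' representation_add representation_scale
          independent_Basis span_Basis algebra_simps)
    finally show "?R ((br (a + sc t b) ^^ Suc n) v) d = poly (\<Sum>c\<in>Basis. p c * [:?R (br a c) d, ?R (br b c) d:]) t" .
  qed
qed

text \<open>Nilpotency of \<open>ad (a + t b)\<close> on a vector is polynomial in \<open>t\<close>, hence passes from real to complex \<open>t\<close>.\<close>

lemma nilpotent_pencil:
  assumes "\<And>r::real. v \<in> gen_eigenspace (br (a + sc (complex_of_real r) b)) 0"
  shows "v \<in> gen_eigenspace (br (a + sc t b)) 0"
proof -
  have sh: "shift T 0 = T" for T by (auto simp: shift_def)
  have "\<exists>n. (br (a + sc (complex_of_real r) b) ^^ n) v = 0" for r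
    using assms[of r] by (simp add: gen_eigenspace_def sh)
  then have U: "UNIV = (\<Union>n. {r::real. (br (a + sc (complex_of_real r) b) ^^ n) v = 0})" by blast
  \<comment> \<open>The exponent may depend on \<open>r\<close>. By pigeonhole one exponent serves
    infinitely many \<open>r\<close>, enough to annihilate a polynomial in the parameter.\<close>
  have "\<exists>n. uncountable {r::real. (br (a + sc (complex_of_real r) b) ^^ n) v = 0}"
  proof (rule ccontr)
    assume "\<not> ?thesis"
    then have "countable (\<Union>n. {r::real. (br (a + sc (complex_of_real r) b) ^^ n) v = 0})"
      by (intro countable_UN) auto
    then show False using uncountable_UNIV_real U by metis
  qed
  then obtain n where n: "infinite {r::real. (br (a + sc (complex_of_real r) b) ^^ n) v = 0}"
    using uncountable_infinite by blast
  have "representation Basis ((br (a + sc t b) ^^ n) v) d = 0" for d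
  proof -
    obtain p where p: "\<And>t. representation Basis ((br (a + sc t b) ^^ n) v) d = poly p t"
      using representation_pencil_poly[where a = a and b = b and n = n and v = v and d = d] by blast
    have "complex_of_real ` {r::real. (br (a + sc (complex_of_real r) b) ^^ n) v = 0} \<subseteq> {t. poly p t = 0}"
      using p by (auto simp: representation_zero simp flip: p)
    moreover have "infinite (complex_of_real ` {r::real. (br (a + sc (complex_of_real r) b) ^^ n) v = 0})"
      using n finite_imageD[OF _ inj_on_subset[OF inj_of_real]] by blast
    ultimately have "p = 0" using poly_roots_finite finite_subset by blast
    then show ?thesis by (simp add: p)
  qed
  then have "(br (a + sc t b) ^^ n) v = 0"
    using rep_sum_basis[OF independent_Basis span_Basis, of "(br (a + sc t b) ^^ n) v"] by simp
  then show ?thesis unfolding gen_eigenspace_def sh by blast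
qed

text \<open>The difficulty is maximality: the real and imaginary parts of a semisimple
  \<open>y\<close> are seen to be semisimple only once \<open>y\<close> is known to commute with
  \<open>\<sigma> y\<close>. That is obtained from nilpotency on the centralizer, continued from
  real to complex parameters.\<close>

lemma complexification_cartan:
  assumes h: "real_cartan h" shows "cartan (span h)"
proof -
  note H = real_cartanD[OF h]
  note S = span_real_subspace[OF H(1)]
  have cent: "centralizer (span h) = centralizer h"
    unfolding centralizer_def S using reals.subspace_0[OF H(1)]
    by (auto simp: br_add' br_scale' br_0') (metis add.right_neutral scale_zero_right)
  have sub: "span h \<subseteq> gr 1" by (rule span_minimal[OF H(2) subspace_gr])
  \<comment> \<open>The semisimple part of a real \<open>x\<close> is again real, so it lies in
    \<open>h\<close> by maximality and kills the centralizer.\<close>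
  have nil: "v \<in> gen_eigenspace (br x) 0" if x: "x \<in> gr 1" "\<sigma> x = x" "x \<in> centralizer h" and v:
    "v \<in> centralizer h" for x v
  proof -
    have "br y (sspart x) = 0" if "y \<in> h" for y
    proof -
      have "br x y = 0" using x(3) that br_anti[of x y] by (simp add: centralizer_def)
      then show ?thesis using sspart_commute br_anti[of y] by simp
    qed
    then have "sspart x \<in> h"
      by (intro real_cartan_maximal[OF h] sspart_gr x sspart_real sspart_semisimple)
        (simp add: centralizer_def)
    then show ?thesis using v sspart_kernel by (simp add: centralizer_def)
  qed
  have max: "y \<in> span h" if y: "y \<in> gr 1" "semisimple_element sc br y" "y \<in> centralizer h" for y
  proof -
    let ?a = "sc (1/2) y + sc (1/2) (\<sigma> y)" and ?b = "sc (- \<i>/2) y + sc (\<i>/2) (\<sigma> y)"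
    note ab = real_imaginary_parts[of y]
    have \<sigma>y: "\<sigma> y \<in> centralizer h"
    proof -
      have "br x (\<sigma> y) = 0" if "x \<in> h" for x
        using y(3) that sigma_br[of x y] H(3)[OF that] by (simp add: centralizer_def sigma_0)
      then show ?thesis by (simp add: centralizer_def)
    qed
    have mem: "sc c y + sc d (\<sigma> y) \<in> centralizer h" "sc c y + sc d (\<sigma> y) \<in> gr 1" for c d
      using y \<sigma>y sigma_gr_mem subspace_centralizer subspace_gr
      by (auto intro!: subspace_add subspace_scale)
    \<comment> \<open>Real combinations \<open>?a + r ?b\<close> act nilpotently on
      \<open>\<sigma> y\<close>, hence so does \<open>y\<close>, the case of parameter
      \<open>\<i>\<close>. Being semisimple, \<open>y\<close> then kills
      \<open>\<sigma> y\<close>.\<close>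
    have "\<sigma> y \<in> gen_eigenspace (br (?a + sc \<i> ?b)) 0"
    proof (rule nilpotent_pencil, rule nil[OF _ _ _ \<sigma>y])
      fix r
      show "?a + sc (complex_of_real r) ?b \<in> gr 1" "?a + sc (complex_of_real r) ?b \<in> centralizer h"
        by (rule subspace_add[OF subspace_gr mem(2) subspace_scale[OF subspace_gr mem(2)]])
          (rule subspace_add[OF subspace_centralizer mem(1) subspace_scale[OF subspace_centralizer mem(1)]])
      show "\<sigma> (?a + sc (complex_of_real r) ?b) = ?a + sc (complex_of_real r) ?b"
        using ab(2,3) by (simp only: sigma_add[of ?a] sigma_scale[of _ ?b] complex_cnj_complex_of_real)
    qed
    then have "\<sigma> y \<in> gen_eigenspace (br y) 0" using ab(1) by simp
    then have comm: "br y (\<sigma> y) = 0" using semisimple_gen_eigenspace[OF y(2)] by fastforce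
    have "sc c y + sc d (\<sigma> y) \<in> h" if "\<sigma> (sc c y + sc d (\<sigma> y)) = sc c y + sc d (\<sigma> y)" for c d
      by (rule real_cartan_maximal[OF h mem(2) that semisimple_combine[OF y(2) semisimple_sigma[OF y(2)] comm]
        mem(1)])
    then have "?a \<in> h" "?b \<in> h" using ab(2,3) by blast+
    then have "?a + sc \<i> ?b \<in> span h" unfolding S by blast
    then show ?thesis using ab(1) by simp
  qed
  have ss: "semisimple_element sc br x" if x: "x \<in> span h" for x
  proof -
    obtain a b where ab: "x = a + sc \<i> b" "a \<in> h" "b \<in> h" using x S by blast
    then show ?thesis using semisimple_combine[OF H(4)[OF ab(2)] H(4)[OF ab(3)] H(5)[OF ab(2,3)], of 1 \<i>]
      by simp
  qed
  have comm: "br x y = 0" if "x \<in> span h" "y \<in> span h" for x y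
  proof -
    have "y \<in> centralizer h" using that(2) H(5) by (auto simp: S centralizer_def br_add br_scale)
    then show ?thesis using that(1) unfolding cent[symmetric] by (simp add: centralizer_def)
  qed
  show ?thesis unfolding cartan_def cent using sub ss comm max by blast
qed

lemma span_real_fixed:
  assumes h: "real_cartan h" shows "{x \<in> span h. \<sigma> x = x} = h" "\<sigma> ` span h = span h"
proof -
  note H = real_cartanD[OF h]
  note S = span_real_subspace[OF H(1)]
  have sig: "\<sigma> (a + sc \<i> b) = a + sc \<i> (- b)" if "a \<in> h" "b \<in> h" for a b
    using H(3) that by (simp add: sigma_add sigma_scale)
  show "{x \<in> span h. \<sigma> x = x} = h"
  proof (intro equalityI subsetI)
    fix x assume "x \<in> {x \<in> span h. \<sigma> x = x}"
    then obtain a b where ab: "x = a + sc \<i> b" "a \<in> h" "b \<in> h" "\<sigma> x = x" using S by blast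
    then have "sc \<i> (- b) = sc \<i> b" using sig by simp
    then have "sc (- \<i>) b = sc \<i> b" by simp
    then have "b = 0" unfolding scale_cancel_right by (simp add: complex_eq_iff)
    then show "x \<in> h" using ab by simp
  next
    fix x assume "x \<in> h"
    then show "x \<in> {x \<in> span h. \<sigma> x = x}" using H(3) span_base by simp
  qed
  have sub: "\<sigma> ` span h \<subseteq> span h"
  proof
    fix y assume "y \<in> \<sigma> ` span h"
    then obtain a b where ab: "y = a + sc \<i> (- b)" "a \<in> h" "b \<in> h" using S sig by auto
    then show "y \<in> span h" unfolding S using reals.subspace_neg[OF H(1)] by blast
  qed
  moreover have "span h \<subseteq> \<sigma> ` span h"
  proof
    fix x assume "x \<in> span h"
    then have "\<sigma> x \<in> span h" using sub by blast
    then show "x \<in> \<sigma> ` span h" using sigma_sigma[of x] by (metis imageI)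
  qed
  ultimately show "\<sigma> ` span h = span h" by blast
qed

text \<open>Real and imaginary parts of elements of \<open>c\<close> lie in \<open>c\<close> by
  stability, so the real points span \<open>c\<close>, and commuting with them amounts to commuting
  with \<open>c\<close>.\<close>

lemma real_cartan_of_stable:
  assumes c: "cartan c" and stable: "\<sigma> ` c \<subseteq> c"
  shows "real_cartan {x \<in> c. \<sigma> x = x}" "span {x \<in> c. \<sigma> x = x} = c"
proof -
  note C = cartanD[OF c]
  let ?h = "{x \<in> c. \<sigma> x = x}"
  show sp: "span ?h = c"
  proof
    show "span ?h \<subseteq> c" by (rule span_minimal[OF _ C(1)]) blast
    show "c \<subseteq> span ?h"
    proof
      fix y assume y: "y \<in> c"
      let ?a = "sc (1/2) y + sc (1/2) (\<sigma> y)" and ?b = "sc (- \<i>/2) y + sc (\<i>/2) (\<sigma> y)"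
      note ab = real_imaginary_parts[of y]
      have "sc d y + sc e (\<sigma> y) \<in> c" for d e
        using y stable C(1) by (auto intro!: subspace_add subspace_scale)
      then have "?a \<in> ?h" "?b \<in> ?h" using ab(2,3) by blast+
      then have "?a + sc \<i> ?b \<in> span ?h" by (intro span_add span_scale span_base)
      then show "y \<in> span ?h" using ab(1) by simp
    qed
  qed
  have "reals.subspace ?h"
    using subspace_0[OF C(1)] subspace_add[OF C(1)] subspace_scale[OF C(1)]
    by (intro reals.subspaceI) (auto simp: sigma_0 sigma_add sigma_scale)
  then have css: "commuting_semisimple_subspace sc br (real_points \<sigma> (gr 1)) ?h"
    unfolding commuting_semisimple_subspace_def real_points_def using C by blast
  have "H' = ?h" if H': "commuting_semisimple_subspace sc br (real_points \<sigma> (gr 1)) H'" "?h \<subseteq> H'" for H'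
  proof (intro equalityI subsetI)
    fix y assume y: "y \<in> H'"
    have "y \<in> gr 1" "\<sigma> y = y" "semisimple_element sc br y" "\<And>x. x \<in> ?h \<Longrightarrow> br x y = 0"
      using H' y unfolding commuting_semisimple_subspace_def real_points_def by blast+
    moreover have "br x y = 0" if "x \<in> c" for x
    proof -
      have "x \<in> span ?h" using sp that by simp
      then show ?thesis
        by (induction rule: span_induct_alt) (simp_all add: br_0' br_add' br_scale' \<open>\<And>x. x \<in> ?h \<Longrightarrow> br x y = 0\<close>)
    qed
    then have "y \<in> centralizer c" by (simp add: centralizer_def)
    ultimately show "y \<in> ?h" using C(5) by blast
  qed (use H'(2) in blast)
  then show "real_cartan ?h" using css unfolding real_cartan_def real_cartan_subspace_def by blast
qed

end

section \<open>Regular functions on the group\<close>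

text \<open>Composition with a retraction carries extensional functions on \<open>X\<close> to an
  algebra on the whole type, where the ring structure is available.\<close>

lemma generated_algebra_retract:
  assumes ret: "\<And>x. ret x \<in> X" and f: "f \<in> generated_algebra X F"
  shows "(\<lambda>x. f (ret x)) \<in> generated_algebra UNIV ((\<lambda>f x. f (ret x)) ` F)"
proof -
  interpret function_algebra "(\<lambda>f x. f (ret x)) ` F" .
  show ?thesis using f
  proof (induction rule: generated_algebra.induct)
    case (gen f)
    have "(\<lambda>x. restrict f X (ret x)) = (\<lambda>x. f (ret x))" using ret by simp
    then show ?case using alg_gen gen by auto
  next
    case (const c)
    have "(\<lambda>x. (\<lambda>x\<in>X. c) (ret x)) = (\<lambda>_. c)" using ret by simp
    then show ?case using alg_const by simp
  next
    case (add f g)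
    have "(\<lambda>x. (\<lambda>x\<in>X. f x + g x) (ret x)) = (\<lambda>x. f (ret x)) + (\<lambda>x. g (ret x))" using ret
      by (auto simp: fun_eq_iff)
    then show ?case by (rule ssubst[of _ _ "\<lambda>h. h \<in> R"]) (rule alg_add[OF add.IH])
  next
    case (mult f g)
    have "(\<lambda>x. (\<lambda>x\<in>X. f x * g x) (ret x)) = (\<lambda>x. f (ret x)) * (\<lambda>x. g (ret x))" using ret
      by (auto simp: fun_eq_iff)
    then show ?case by (rule ssubst[of _ _ "\<lambda>h. h \<in> R"]) (rule alg_mult[OF mult.IH])
  qed
qed

lemma generated_algebra_restrict:
  assumes f: "f \<in> generated_algebra UNIV F"
  shows "restrict f X \<in> generated_algebra X F"
proof -
  interpret function_algebra F .
  show ?thesis using f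
  proof (induction rule: alg_induct)
    case (gen f)
    then show ?case by (rule generated_algebra.gen)
  next
    case (const c)
    show ?case by (rule generated_algebra.const)
  next
    case (add f g)
    have "restrict (f + g) X = (\<lambda>x\<in>X. restrict f X x + restrict g X x)" by (auto simp: fun_eq_iff)
    then show ?case by (rule ssubst[of _ _ "\<lambda>h. h \<in> generated_algebra X F"])
      (rule generated_algebra.add[OF add(3,4)])
  next
    case (mult f g)
    have "restrict (f * g) X = (\<lambda>x\<in>X. restrict f X x * restrict g X x)" by (auto simp: fun_eq_iff)
    then show ?case by (rule ssubst[of _ _ "\<lambda>h. h \<in> generated_algebra X F"])
      (rule generated_algebra.mult[OF mult(3,4)])
  qed
qed

lemma generated_algebra_extensional: "f \<in> generated_algebra X F \<Longrightarrow> restrict f X = f"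
  by (induction rule: generated_algebra.induct) (auto simp: fun_eq_iff)

lemma retracted_character_point:
  assumes X: "affine_variety X A" "A = generated_algebra X F"
    and ret: "\<And>x. ret x \<in> X" "\<And>x. x \<in> X \<Longrightarrow> ret x = x"
    and \<xi>: "\<And>c. \<xi> (\<lambda>_. c) = (c::complex)"
    "\<And>f g. f \<in> A \<Longrightarrow> g \<in> A \<Longrightarrow> \<xi> ((\<lambda>x. f (\<rho> x)) + (\<lambda>x. g (\<rho> x))) = \<xi> (\<lambda>x. f (\<rho> x)) + \<xi> (\<lambda>x. g (\<rho> x))"
    "\<And>f g. f \<in> A \<Longrightarrow> g \<in> A \<Longrightarrow> \<xi> ((\<lambda>x. f (\<rho> x)) * (\<lambda>x. g (\<rho> x))) = \<xi> (\<lambda>x. f (\<rho> x)) * \<xi> (\<lambda>x. g (\<rho> x))"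
    and \<rho>: "\<And>x. \<rho> x \<in> X"
  obtains p where "p \<in> X" "\<forall>f\<in>A. \<xi> (\<lambda>x. f (\<rho> x)) = f p"
proof -
  have "algebra_character X A (\<lambda>f. \<xi> (\<lambda>x. f (\<rho> x)))"
    unfolding algebra_character_def using \<xi> \<rho> by (simp add: plus_fun_def times_fun_def)
  then show thesis using X(1) that unfolding affine_variety_def by blast
qed

lemma product_algebra_slice:
  assumes P: "P \<in> product_algebra X (generated_algebra X F) Y B" and q: "q \<in> Y"
  shows "(\<lambda>x\<in>X. P (x, q)) \<in> generated_algebra X F"
  using P unfolding product_algebra_def
proof (induction rule: generated_algebra.induct)
  case (gen f)
  then consider g where "f = (\<lambda>p. g (fst p))" "g \<in> generated_algebra X F" | g where "f = (\<lambda>p. g (snd p))"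
    by blast
  then show ?case
  proof cases
    case 1
    then have "(\<lambda>x\<in>X. restrict f (X \<times> Y) (x, q)) = restrict g X" using q by (auto simp: fun_eq_iff)
    then show ?thesis using generated_algebra_extensional[OF 1(2)] 1(2) by simp
  next
    case 2
    then have "(\<lambda>x\<in>X. restrict f (X \<times> Y) (x, q)) = (\<lambda>x\<in>X. g q)" using q by (auto simp: fun_eq_iff)
    then show ?thesis using generated_algebra.const by metis
  qed
next
  case (const c)
  have "(\<lambda>x\<in>X. (\<lambda>x\<in>X \<times> Y. c) (x, q)) = (\<lambda>x\<in>X. c)" using q by (auto simp: fun_eq_iff)
  then show ?case using generated_algebra.const by metis
next
  case (add f g)
  have "(\<lambda>x\<in>X. (\<lambda>x\<in>X \<times> Y. f x + g x) (x, q)) = (\<lambda>x\<in>X. (\<lambda>x\<in>X. f (x, q)) x + (\<lambda>x\<in>X. g (x, q)) x)"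
    using q by (auto simp: fun_eq_iff)
  then show ?case by (rule ssubst[of _ _ "\<lambda>h. h \<in> generated_algebra X F"])
    (rule generated_algebra.add[OF add.IH])
next
  case (mult f g)
  have "(\<lambda>x\<in>X. (\<lambda>x\<in>X \<times> Y. f x * g x) (x, q)) = (\<lambda>x\<in>X. (\<lambda>x\<in>X. f (x, q)) x * (\<lambda>x\<in>X. g (x, q)) x)"
    using q by (auto simp: fun_eq_iff)
  then show ?case by (rule ssubst[of _ _ "\<lambda>h. h \<in> generated_algebra X F"])
    (rule generated_algebra.mult[OF mult.IH])
qed

locale real_cover = real_graded_lie sc Basis br m gr \<omega> \<theta> \<sigma>
  for sc :: "complex \<Rightarrow> 'v::ab_group_add \<Rightarrow> 'v" and Basis :: "'v set" and br :: "'v \<Rightarrow> 'v \<Rightarrow> 'v"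
    and m :: nat and gr :: "int \<Rightarrow> 'v set" and \<omega> :: complex and \<theta> :: "'v \<Rightarrow> 'v" and \<sigma> :: "'v \<Rightarrow> 'v" +
  fixes G0 :: "('v \<Rightarrow> 'v) set" and Gh :: "'g monoid" and A :: "('g \<Rightarrow> complex) set"
    and \<tau> :: "'g \<Rightarrow> 'g" and \<psi> :: "'g \<Rightarrow> 'v \<Rightarrow> 'v" and FA :: "('g \<Rightarrow> complex) set"
  assumes G0: "connected_subgroup_with_lie_algebra sc br (gr 0) G0"
    and cover: "real_reductive_cover sc \<sigma> G0 Gh A \<tau> \<psi>"
    and FA: "finite FA" "A = generated_algebra (carrier Gh) FA"
begin

sublocale group Gh
  using cover unfolding real_reductive_cover_def reductive_group_def affine_algebraic_group_def by blast

abbreviation dual where "dual \<equiv> {l. Vector_Spaces.linear sc (*) l}"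

lemma linear_functional:
  assumes "l \<in> dual" shows "l (x + y) = l x + l y" "l (sc c x) = c * l x"
  using assms by (auto simp: Vector_Spaces.linear_iff)

lemma linear_functionalI:
  "(\<And>x y. l (x + y) = l x + l y) \<Longrightarrow> (\<And>c x. l (sc c x) = c * l x) \<Longrightarrow> l \<in> dual"
  using vector_space_axioms by (auto simp: Vector_Spaces.linear_iff vector_space_def algebra_simps)

lemma linear_functional_sum: "l \<in> dual \<Longrightarrow> l (\<Sum>i\<in>I. g i) = (\<Sum>i\<in>I. l (g i))"
proof (induction I rule: infinite_finite_induct)
  case (insert x F)
  then show ?case by (simp add: linear_functional)
qed (use linear_functional(2)[of l 0 0] in auto)

lemma representation_dual:
  assumes "independent B" "span B = UNIV" shows "(\<lambda>v. representation B v b) \<in> dual"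
  using assms by (intro linear_functionalI) (simp_all add: representation_add representation_scale)

abbreviation coord where "coord b v \<equiv> representation Basis v b"

lemma coord_dual: "coord b \<in> dual"
  using representation_dual[OF independent_Basis span_Basis] .

lemma functional_coord: "l \<in> dual \<Longrightarrow> l v = (\<Sum>b\<in>Basis. coord b v * l b)"
  by (subst rep_sum_basis[OF independent_Basis span_Basis, of v, symmetric])
    (simp add: linear_functional_sum linear_functional)

lemma compose_dual: "l \<in> dual \<Longrightarrow> lin f \<Longrightarrow> (\<lambda>v. l (f v)) \<in> dual"
  by (intro linear_functionalI) (simp_all add: linear_functional lin_add lin_scale)

lemma killing_dual: "killing x \<in> dual"
  using linear_killing by simp

lemma killing_coord: "killing x y = (\<Sum>b\<in>Basis. coord b x * killing b y)"
  using functional_coord[OF killing_dual, of y x] by (simp add: killing_sym[of y])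

lemma inner_group_aut: "g \<in> inner_group sc br \<Longrightarrow> g \<in> lie_automorphisms sc br"
  unfolding inner_group_def using connected_component_of_subset_topspace[of _ id] topspace_zariski_linear
    by blast

lemma G0_inner: "g \<in> G0 \<Longrightarrow> g \<in> inner_group sc br"
  and G0_subgroup: "subgroup G0 (general_linear sc)"
  and G0_connected: "connectedin (zariski (inner_group sc br) (linear_regular sc (inner_group sc br))) G0"
  and G0_lie: "linear_group_lie_algebra sc G0 = br ` gr 0"
  using G0 unfolding connected_subgroup_with_lie_algebra_def by blast+

lemma G0_lin: assumes "g \<in> G0" shows "lin g" "bij g" "g (br x y) = br (g x) (g y)"
  using inner_group_aut[OF G0_inner[OF assms]] by (auto simp: lie_automorphisms_def general_linear_def)

lemma id_G0: "id \<in> G0" and comp_G0: "g \<in> G0 \<Longrightarrow> h \<in> G0 \<Longrightarrow> g \<circ> h \<in> G0"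
  using subgroup.one_closed[OF G0_subgroup] subgroup.m_closed[OF G0_subgroup]
    by (auto simp: general_linear_def)

lemma psi_G0: "g \<in> carrier Gh \<Longrightarrow> \<psi> g \<in> G0" and psi_surj: "\<psi> ` carrier Gh = G0"
  and psi_mult: "g \<in> carrier Gh \<Longrightarrow> h \<in> carrier Gh \<Longrightarrow> \<psi> (g \<otimes>\<^bsub>Gh\<^esub> h) = \<psi> g \<circ> \<psi> h"
  using cover unfolding real_reductive_cover_def hom_def by (auto simp: general_linear_def)

lemma psi_one: "\<psi> \<one>\<^bsub>Gh\<^esub> = id"
proof -
  have "\<psi> \<one>\<^bsub>Gh\<^esub> \<circ> \<psi> \<one>\<^bsub>Gh\<^esub> = \<psi> \<one>\<^bsub>Gh\<^esub>" using psi_mult[of "\<one>\<^bsub>Gh\<^esub>" "\<one>\<^bsub>Gh\<^esub>"] by simp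
  then have "\<psi> \<one>\<^bsub>Gh\<^esub> (\<psi> \<one>\<^bsub>Gh\<^esub> v) = \<psi> \<one>\<^bsub>Gh\<^esub> v" for v by (simp add: fun_eq_iff)
  then show ?thesis using bij_is_inj[OF G0_lin(2)[OF psi_G0[of "\<one>\<^bsub>Gh\<^esub>"]]]
    by (auto simp: fun_eq_iff dest: injD)
qed

lemma psi_inv: "g \<in> carrier Gh \<Longrightarrow> \<psi> (inv\<^bsub>Gh\<^esub> g) (\<psi> g v) = v" "g \<in> carrier Gh \<Longrightarrow> \<psi> g (\<psi> (inv\<^bsub>Gh\<^esub> g) v) = v"
  using psi_mult[of "inv\<^bsub>Gh\<^esub> g" g] psi_mult[of g "inv\<^bsub>Gh\<^esub> g"] psi_one by (simp_all add: fun_eq_iff)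

lemma A_affine: "affine_variety (carrier Gh) A"
  using cover unfolding real_reductive_cover_def reductive_group_def affine_algebraic_group_def by blast

lemma A_pullback: "f \<in> linear_regular sc G0 \<Longrightarrow> (\<lambda>g\<in>carrier Gh. f (\<psi> g)) \<in> A"
  using cover unfolding real_reductive_cover_def regular_map_def by blast

lemma A_translate:
  assumes f: "f \<in> A" and q: "q \<in> carrier Gh" shows "(\<lambda>g\<in>carrier Gh. f (g \<otimes>\<^bsub>Gh\<^esub> q)) \<in> A"
proof -
  have "(\<lambda>p\<in>carrier Gh \<times> carrier Gh. f ((\<lambda>(x, y). x \<otimes>\<^bsub>Gh\<^esub> y) p)) \<in> product_algebra (carrier Gh) A (carrier Gh) A"
    using cover f unfolding real_reductive_cover_def reductive_group_def affine_algebraic_group_def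
      regular_map_def by blast
  then have "(\<lambda>g\<in>carrier Gh. (\<lambda>p\<in>carrier Gh \<times> carrier Gh. f ((\<lambda>(x, y). x \<otimes>\<^bsub>Gh\<^esub> y) p)) (g, q)) \<in> A"
    unfolding FA(2) by (rule product_algebra_slice[OF _ q])
  also have "(\<lambda>g\<in>carrier Gh. (\<lambda>p\<in>carrier Gh \<times> carrier Gh. f ((\<lambda>(x, y). x \<otimes>\<^bsub>Gh\<^esub> y) p)) (g, q)) =
    (\<lambda>g\<in>carrier Gh. f (g \<otimes>\<^bsub>Gh\<^esub> q))"
    using q by (auto simp: fun_eq_iff)
  finally show ?thesis .
qed

lemma coefficient_regular: "l \<in> dual \<Longrightarrow> (\<lambda>g\<in>H. l (g v)) \<in> linear_regular sc H"
  unfolding linear_regular_def by (intro generated_algebra.gen UnI1) blast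

lemma coefficient_A:
  assumes "l \<in> dual" shows "(\<lambda>g\<in>carrier Gh. l (\<psi> g v)) \<in> A"
proof -
  have "(\<lambda>g\<in>carrier Gh. (\<lambda>g\<in>G0. l (g v)) (\<psi> g)) \<in> A" by (rule A_pullback[OF coefficient_regular[OF assms]])
  also have "(\<lambda>g\<in>carrier Gh. (\<lambda>g\<in>G0. l (g v)) (\<psi> g)) = (\<lambda>g\<in>carrier Gh. l (\<psi> g v))" using psi_G0
    by (auto simp: fun_eq_iff)
  finally show ?thesis .
qed

text \<open>Regular functions on \<open>Gh\<close> are extensional; composed with \<open>ret\<close> they become an algebra of functions
  on the whole type.\<close>

definition ret :: "'g \<Rightarrow> 'g" where
  "ret g = (if g \<in> carrier Gh then g else \<one>\<^bsub>Gh\<^esub>)"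

lemma ret: "ret g \<in> carrier Gh" "g \<in> carrier Gh \<Longrightarrow> ret g = g"
  by (auto simp: ret_def)

sublocale RG: fg_function_algebra "(\<lambda>f x. f (ret x)) ` FA"
  by unfold_locales (use FA in simp)

lemma A_RG: "f \<in> A \<Longrightarrow> (\<lambda>x. f (ret x)) \<in> RG.R"
  unfolding FA(2) by (rule generated_algebra_retract[OF ret(1)])

lemma coefficient_RG: "l \<in> dual \<Longrightarrow> (\<lambda>h. l (\<psi> (ret h) v)) \<in> RG.R"
  using A_RG[OF coefficient_A[of l v]] ret by simp

text \<open>All these functions factor through \<open>ret\<close>, so a character of this algebra
  restricts to one of \<open>A\<close>, which is a point because \<open>Gh\<close> is
  affine.\<close>

lemma RG_points:
  assumes \<xi>: "algebra_character UNIV RG.R \<xi>" shows "\<exists>x. \<forall>f\<in>RG.R. \<xi> f = f x"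
proof -
  note \<xi>' = \<xi>[unfolded algebra_character_UNIV]
  obtain p where p: "p \<in> carrier Gh" "\<forall>f\<in>A. \<xi> (\<lambda>x. f (ret x)) = f p"
    by (rule retracted_character_point[OF A_affine FA(2) ret, of \<xi> ret]) (use \<xi>' A_RG ret in blast)+
  have "\<xi> f = f p" if "f \<in> RG.R" for f
    using that
  proof (induction rule: RG.alg_induct)
    case (gen f)
    then obtain f0 where f0: "f = (\<lambda>x. f0 (ret x))" "f0 \<in> FA" by blast
    then have "restrict f0 (carrier Gh) \<in> A" unfolding FA(2) by (intro generated_algebra.gen)
    then show ?case using p f0(1) ret by force
  next
    case (const c)
    then show ?case using \<xi>' by blast
  next
    case (add f g)
    have "\<xi> (f + g) = \<xi> f + \<xi> g" using \<xi>' add(1,2) by blast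
    then show ?case unfolding plus_fun_apply add(3,4) .
  next
    case (mult f g)
    have "\<xi> (f * g) = \<xi> f * \<xi> g" using \<xi>' mult(1,2) by blast
    then show ?case unfolding times_fun_apply mult(3,4) .
  qed
  then show ?thesis by blast
qed

section \<open>The group preserves the Killing form and the grading\<close>

lemma killing_aut:
  assumes g: "g \<in> G0" shows "killing (g x) (g y) = killing x y"
proof -
  note L = G0_lin[OF g]
  let ?i = "inv_into UNIV g"
  have i: "g (?i v) = v" "?i (g v) = v" for v using L(2)
    by (simp_all add: bij_is_surj bij_is_inj surj_f_inv_f)
  have li: "lin ?i" by (intro linI) (metis i lin_add[OF L(1)], metis i lin_scale[OF L(1)])
  have "killing (g x) (g y) = trace (\<lambda>v. g (br x (br y (?i v))))"
    unfolding killing_def using L(3) i by simp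
  also have "\<dots> = trace (\<lambda>v. ?i (g (br x (br y v))))"
    by (rule trace_commute[OF lin_compose[OF L(1) lin_br_br] li])
  finally show ?thesis by (simp add: i killing_def)
qed

text \<open>Right translation moves the derivation from \<open>p\<close> to the identity, and \<psi>
  pushes it forward to a tangent vector of \<open>G0\<close>, which by the description of the Lie
  algebra is some \<open>ad y\<close>.\<close>

lemma tangent_vector:
  assumes D: "point_derivation RG.R p D"
  obtains y where "y \<in> gr 0" "\<And>l v. l \<in> dual \<Longrightarrow> D (\<lambda>h. l (\<psi> (ret h \<otimes>\<^bsub>Gh\<^esub> inv\<^bsub>Gh\<^esub> ret p) v)) = l (br y v)"
proof -
  let ?q = "inv\<^bsub>Gh\<^esub> ret p"
  have q: "?q \<in> carrier Gh" using ret by simp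
  let ?k = "\<lambda>h. ret h \<otimes>\<^bsub>Gh\<^esub> ?q"
  have k: "?k h \<in> carrier Gh" for h using ret q by simp
  have kp: "\<psi> (?k p) = id" using ret psi_one by simp
  have reg: "(\<lambda>h. f (\<psi> (?k h))) \<in> RG.R" if "f \<in> linear_regular sc G0" for f
  proof -
    have "(\<lambda>h. (\<lambda>g\<in>carrier Gh. (\<lambda>g\<in>carrier Gh. f (\<psi> g)) (g \<otimes>\<^bsub>Gh\<^esub> ?q)) (ret h)) \<in> RG.R"
      by (rule A_RG[OF A_translate[OF A_pullback[OF that] q]])
    then show ?thesis using ret k by simp
  qed
  define D' where "D' = (\<lambda>f\<in>linear_regular sc G0. D (\<lambda>h. f (\<psi> (?k h))))"
  have lr: "(\<lambda>g\<in>G0. c) \<in> linear_regular sc G0" "f \<in> linear_regular sc G0 \<Longrightarrow> f' \<in> linear_regular sc G0 \<Longrightarrow>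
      (\<lambda>g\<in>G0. f g + f' g) \<in> linear_regular sc G0 \<and> (\<lambda>g\<in>G0. f g * f' g) \<in> linear_regular sc G0" for c f f'
    unfolding linear_regular_def by (auto intro: generated_algebra.intros)
  have D'T: "D' \<in> tangent_space G0 (linear_regular sc G0) id"
    unfolding tangent_space_def
  proof (intro CollectI conjI allI ballI)
    show "D' \<in> extensional (linear_regular sc G0)" by (simp add: D'_def)
    show "D' (\<lambda>g\<in>G0. c) = 0" for c
      using lr psi_G0[OF k] RG.point_derivation_const[OF D] by (simp add: D'_def)
  next
    fix f f' assume f: "f \<in> linear_regular sc G0" "f' \<in> linear_regular sc G0"
    have "D ((\<lambda>h. f (\<psi> (?k h))) + (\<lambda>h. f' (\<psi> (?k h)))) = D (\<lambda>h. f (\<psi> (?k h))) + D (\<lambda>h. f' (\<psi> (?k h)))"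
      by (rule RG.point_derivation_add[OF D reg[OF f(1)] reg[OF f(2)]])
    then show "D' (\<lambda>g\<in>G0. f g + f' g) = D' f + D' f'"
      using lr f psi_G0[OF k] by (simp add: D'_def plus_fun_def)
    have "D ((\<lambda>h. f (\<psi> (?k h))) * (\<lambda>h. f' (\<psi> (?k h)))) =
        D (\<lambda>h. f (\<psi> (?k h))) * f' (\<psi> (?k p)) + f (\<psi> (?k p)) * D (\<lambda>h. f' (\<psi> (?k h)))"
      by (rule RG.point_derivation_mult[OF D reg[OF f(1)] reg[OF f(2)]])
    then show "D' (\<lambda>g\<in>G0. f g * f' g) = D' f * f' id + f id * D' f'"
      using lr f psi_G0[OF k] by (simp add: D'_def times_fun_def kp)
  qed
  define \<delta> where "\<delta> l v = D (\<lambda>h. l (\<psi> (?k h) v))" for l v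
  have D'\<delta>: "D' (\<lambda>g\<in>G0. l (g v)) = \<delta> l v" if "l \<in> dual" for l v
    using coefficient_regular[OF that] psi_G0[OF k] by (simp add: D'_def \<delta>_def)
  have creg: "(\<lambda>h. l (\<psi> (?k h) v)) \<in> RG.R" if "l \<in> dual" for l v
    using reg[OF coefficient_regular[OF that]] psi_G0[OF k] by simp
  have Dc: "D (\<lambda>h. c * f h) = c * D f" if "f \<in> RG.R" for c f
    using RG.point_derivation_mult[OF D RG.alg_const[of c] that] RG.point_derivation_const[OF D, of c]
    by (simp add: times_fun_def)
  have \<psi>k: "lin (\<psi> (?k h))" for h using G0_lin psi_G0 k by blast
  have \<delta>_add: "\<delta> l (v + w) = \<delta> l v + \<delta> l w" if "l \<in> dual" for l v w
  proof -
    have "\<delta> l (v + w) = D ((\<lambda>h. l (\<psi> (?k h) v)) + (\<lambda>h. l (\<psi> (?k h) w)))"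
      unfolding \<delta>_def by (simp add: lin_add[OF \<psi>k] linear_functional[OF that] plus_fun_def)
    then show ?thesis unfolding \<delta>_def using RG.point_derivation_add[OF D creg[OF that] creg[OF that]] by simp
  qed
  have \<delta>_scale: "\<delta> l (sc c v) = c * \<delta> l v" if "l \<in> dual" for l c v
    unfolding \<delta>_def by (simp add: lin_scale[OF \<psi>k] linear_functional[OF that] Dc[OF creg[OF that]])
  \<comment> \<open>The endomorphism whose matrix coefficients are the derivatives of those of the
    group.\<close>
  define T where "T v = (\<Sum>b\<in>Basis. sc (\<delta> (coord b) v) b)" for v
  have T: "lin T"
    by (intro linI) (simp_all add: T_def \<delta>_add[OF coord_dual] \<delta>_scale[OF coord_dual] scale_left_distrib
      sum.distrib scale_sum_right)
  have Dsum: "D (\<lambda>h. \<Sum>b\<in>I. c b * f b h) = (\<Sum>b\<in>I. c b * D (f b))" if "finite I" "\<And>b. b \<in> I \<Longrightarrow> f b \<in> RG.R"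
    for I :: "'v set" and c f
    using that
  proof (induction I rule: finite_induct)
    case empty
    then show ?case using RG.point_derivation_const[OF D, of 0] by simp
  next
    case (insert b I)
    have 1: "(\<lambda>h. c b * f b h) \<in> RG.R" using RG.alg_mult[OF RG.alg_const[of "c b"], of "f b"] insert.prems
      by (simp add: times_fun_def)
    have "(\<lambda>h. \<Sum>b\<in>I. c b * f b h) = (\<Sum>b\<in>I. (\<lambda>_. c b) * f b)" by (auto simp: fun_eq_iff sum_fun_apply)
    also have "\<dots> \<in> RG.R" using insert.prems by (intro RG.alg_sum RG.alg_mult RG.alg_const) auto
    finally have 2: "(\<lambda>h. \<Sum>b\<in>I. c b * f b h) \<in> RG.R" .
    have "D (\<lambda>h. \<Sum>b\<in>insert b I. c b * f b h) = D ((\<lambda>h. c b * f b h) + (\<lambda>h. \<Sum>b\<in>I. c b * f b h))"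
      using insert.hyps by (simp add: plus_fun_def)
    then show ?case using RG.point_derivation_add[OF D 1 2] insert Dc by simp
  qed
  have \<delta>T: "\<delta> l v = l (T v)" if l: "l \<in> dual" for l v
  proof -
    have "\<delta> l v = D (\<lambda>h. \<Sum>b\<in>Basis. l b * coord b (\<psi> (?k h) v))"
      unfolding \<delta>_def by (subst functional_coord[OF l]) (simp add: mult.commute)
    also have "\<dots> = (\<Sum>b\<in>Basis. l b * \<delta> (coord b) v)"
      unfolding \<delta>_def by (rule Dsum[OF finite_Basis creg[OF coord_dual]])
    also have "\<dots> = l (T v)"
      unfolding T_def by (simp add: linear_functional_sum[OF l] linear_functional[OF l] mult.commute)
    finally show ?thesis .
  qed
  have "T \<in> linear_group_lie_algebra sc G0"
    unfolding linear_group_lie_algebra_def using T D'T D'\<delta> \<delta>T by auto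
  then obtain y where "y \<in> gr 0" "T = br y" unfolding G0_lie by blast
  then show thesis using that \<delta>T unfolding \<delta>_def by blast
qed

text \<open>If the range were infinite, some derivation would not kill the function. But a
  derivation acts as \<open>ad y\<close> with \<open>y\<close> in \<open>gr 0\<close>, which
  \<theta> fixes, and by invariance of the Killing form the two Leibniz terms cancel.\<close>

lemma killing_theta_finite:
  "finite ((\<lambda>g. killing (g a) (\<theta> (g b))) ` G0)"
proof -
  let ?u = "\<lambda>h. killing (\<psi> (ret h) a) (\<theta> (\<psi> (ret h) b))"
  have kt: "(\<lambda>v. killing c (\<theta> v)) \<in> dual" for c by (rule compose_dual[OF killing_dual lin_theta])
  have u_eq: "?u = (\<Sum>c\<in>Basis. (\<lambda>h. coord c (\<psi> (ret h) a)) * (\<lambda>h. killing c (\<theta> (\<psi> (ret h) b))))"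
    by (rule ext, subst killing_coord) (simp add: sum_fun_apply)
  have uR: "?u \<in> RG.R"
    unfolding u_eq by (intro RG.alg_sum RG.alg_mult coefficient_RG[OF coord_dual] coefficient_RG[OF kt])
  have "finite (range ?u)"
  proof (rule ccontr)
    assume "infinite (range ?u)"
    then obtain p D where D: "point_derivation RG.R p D" "D ?u \<noteq> 0"
      using RG.exists_point_derivation[OF RG_points uR] by blast
    obtain y where y: "y \<in> gr 0" "\<And>l v. l \<in> dual \<Longrightarrow> D (\<lambda>h. l (\<psi> (ret h \<otimes>\<^bsub>Gh\<^esub> inv\<^bsub>Gh\<^esub> ret p) v)) = l (br y v)"
      by (rule tangent_vector[OF D(1)]) blast
    \<comment> \<open>Writing \<open>h\<close> as \<open>?k h\<close> times \<open>p\<close> reduces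
      the derivative at \<open>p\<close> to one at the identity, applied to the translated vectors
      \<open>?a\<close> and \<open>?b\<close>.\<close>
    let ?k = "\<lambda>h. ret h \<otimes>\<^bsub>Gh\<^esub> inv\<^bsub>Gh\<^esub> ret p" and ?a = "\<psi> (ret p) a" and ?b = "\<psi> (ret p) b"
    have k: "\<psi> (ret h) v = \<psi> (?k h) (\<psi> (ret p) v)" for h v
    proof -
      have "\<psi> (?k h) \<circ> \<psi> (ret p) = \<psi> (?k h \<otimes>\<^bsub>Gh\<^esub> ret p)" using psi_mult[of "?k h" "ret p"] ret by simp
      also have "?k h \<otimes>\<^bsub>Gh\<^esub> ret p = ret h" using ret by (simp add: m_assoc)
      finally show ?thesis by (simp add: fun_eq_iff)
    qed
    have kp: "\<psi> (?k p) v = v" for v using ret psi_one by simp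
    let ?f = "\<lambda>c h. coord c (\<psi> (?k h) ?a)" and ?g = "\<lambda>c h. killing c (\<theta> (\<psi> (?k h) ?b))"
    have fR: "?f c \<in> RG.R" for c
      unfolding k[where v = a, symmetric] by (rule coefficient_RG[OF coord_dual])
    have gR: "?g c \<in> RG.R" for c
      unfolding k[where v = b, symmetric] by (rule coefficient_RG[OF kt])
    have u_eq': "?u = (\<Sum>c\<in>Basis. ?f c * ?g c)"
      unfolding k[where v = a, symmetric] k[where v = b, symmetric] by (rule u_eq)
    have "D (?f c * ?g c) = coord c (br y ?a) * killing c (\<theta> ?b) + coord c ?a * killing c (\<theta> (br y ?b))" for c
      using RG.point_derivation_mult[OF D(1) fR gR] y(2)[OF coord_dual] y(2)[OF kt] by (simp add: kp)
    moreover have "D (\<Sum>c\<in>I. ?f c * ?g c) = (\<Sum>c\<in>I. D (?f c * ?g c))" if "finite I" for I :: "'v set"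
      using that
    proof (induction I rule: finite_induct)
      case empty
      then show ?case using RG.point_derivation_const[OF D(1), of 0] by (simp add: zero_fun_def)
    next
      case (insert c I)
      have "(\<Sum>c\<in>I. ?f c * ?g c) \<in> RG.R" by (intro RG.alg_sum RG.alg_mult fR gR)
      from RG.point_derivation_add[OF D(1) RG.alg_mult[OF fR gR] this, of c]
      show ?case unfolding sum.insert[OF insert.hyps] insert.IH .
    qed
    ultimately have "D ?u = (\<Sum>c\<in>Basis. coord c (br y ?a) * killing c (\<theta> ?b)) +
      (\<Sum>c\<in>Basis. coord c ?a * killing c (\<theta> (br y ?b)))"
      unfolding u_eq' using finite_Basis by (simp only: sum.distrib)
    also have "\<dots> = killing (br y ?a) (\<theta> ?b) + killing ?a (\<theta> (br y ?b))"
      by (simp only: killing_coord[symmetric])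
    also have "\<theta> (br y ?b) = br y (\<theta> ?b)" using theta_gr[OF y(1)] by (simp add: theta_br)
    finally show False using D(2) killing_invariant[of y ?a "\<theta> ?b"] by simp
  qed
  moreover have "(\<lambda>g. killing (g a) (\<theta> (g b))) ` G0 \<subseteq> range ?u"
  proof
    fix z assume "z \<in> (\<lambda>g. killing (g a) (\<theta> (g b))) ` G0"
    then obtain g where g: "g \<in> carrier Gh" "z = killing (\<psi> g a) (\<theta> (\<psi> g b))" unfolding psi_surj[symmetric]
      by blast
    then have "z = ?u g" using ret by simp
    then show "z \<in> range ?u" by blast
  qed
  ultimately show ?thesis using finite_subset by blast
qed

lemma killing_theta_constant:
  assumes g: "g \<in> G0" shows "killing (g a) (\<theta> (g b)) = killing a (\<theta> b)"
proof -
  let ?F = "\<lambda>g. killing (g a) (\<theta> (g b))"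
  let ?I = "inner_group sc br"
  let ?S = "{\<lambda>g. l (g v) | l v. l \<in> dual} \<union> {\<lambda>g. l (inv_into UNIV g v) | l v. l \<in> dual} :: (('v \<Rightarrow> 'v) \<Rightarrow> complex) set"
  interpret S: function_algebra ?S .
  have kt: "(\<lambda>v. killing c (\<theta> v)) \<in> dual" for c by (rule compose_dual[OF killing_dual lin_theta])
  have co: "(\<lambda>g. l (g v)) \<in> S.R" if "l \<in> dual" for l v using that by (intro S.alg_gen) blast
  have "?F = (\<Sum>c\<in>Basis. (\<lambda>g. coord c (g a)) * (\<lambda>g. killing c (\<theta> (g b))))"
    by (rule ext, subst killing_coord) (simp add: sum_fun_apply)
  then have FR: "?F \<in> S.R" using co[OF coord_dual] co[OF kt] by (simp only:) (intro S.alg_sum S.alg_mult)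
  have op: "openin (zariski ?I (linear_regular sc ?I)) {g \<in> ?I. poly p (?F g) \<noteq> 0}" for p
  proof -
    have "restrict (\<lambda>g. poly p (?F g)) ?I \<in> linear_regular sc ?I"
      using generated_algebra_restrict[OF S.alg_poly[OF FR]] unfolding linear_regular_def by simp
    moreover have "{g \<in> ?I. poly p (?F g) \<noteq> 0} = {g \<in> ?I. restrict (\<lambda>g. poly p (?F g)) ?I g \<noteq> 0}" by auto
    ultimately show ?thesis unfolding zariski_def by (intro topology_generated_by_Basis) blast
  qed
  let ?c = "killing a (\<theta> b)"
  define V where "V = ?F ` G0 - {?c}"
  have fin: "finite V" unfolding V_def using killing_theta_finite by simp
  \<comment> \<open>\<open>?q\<close> vanishes exactly at the other values, so on \<open>G0\<close>
    both having the value \<open>?c\<close> and having a different value are open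
    conditions.\<close>
  let ?p = "[:- ?c, 1:]" and ?q = "\<Prod>v\<in>V. [:- v, 1:]"
  let ?E1 = "{g \<in> ?I. poly ?p (?F g) \<noteq> 0}" and ?E2 = "{g \<in> ?I. poly ?q (?F g) \<noteq> 0}"
  have E1: "g \<in> ?E1 \<longleftrightarrow> ?F g \<noteq> ?c" if "g \<in> G0" for g using that G0_inner by auto
  have E2: "g \<in> ?E2 \<longleftrightarrow> ?F g = ?c" if "g \<in> G0" for g
    using that G0_inner fin by (auto simp: poly_prod prod_zero_iff V_def)
  have "id \<in> ?E2" using E2[OF id_G0] by simp
  then have "?E2 \<inter> G0 \<noteq> {}" using id_G0 by blast
  moreover have "G0 \<subseteq> ?E1 \<union> ?E2" using E1 E2 by blast
  moreover have "?E1 \<inter> ?E2 \<inter> G0 = {}" using E1 E2 by blast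
  moreover have "\<nexists>E1 E2. openin (zariski ?I (linear_regular sc ?I)) E1 \<and> openin (zariski ?I (linear_regular sc ?I)) E2 \<and>
      G0 \<subseteq> E1 \<union> E2 \<and> E1 \<inter> E2 \<inter> G0 = {} \<and> E1 \<inter> G0 \<noteq> {} \<and> E2 \<inter> G0 \<noteq> {}"
    using G0_connected unfolding connectedin by (rule conjunct2)
  ultimately have "\<not> ?E1 \<inter> G0 \<noteq> {}" using op[of ?p] op[of ?q] by meson
  then show ?thesis using E1[OF g] g by blast
qed

text \<open>With \<open>y = g z\<close>, both \<open>\<theta> (g x)\<close> and
  \<open>g (\<theta> x)\<close> pair with \<open>y\<close> to
  \<open>killing z (\<theta> x)\<close>.\<close>

lemma theta_G0:
  assumes g: "g \<in> G0" shows "\<theta> (g x) = g (\<theta> x)"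
proof -
  note L = G0_lin[OF g]
  have "\<theta> (g x) - g (\<theta> x) = 0"
  proof (rule killing_nondegenerate)
    fix y
    obtain z where z: "y = g z" using bij_is_surj[OF L(2)] by (metis surjD)
    have "killing y (\<theta> (g x) - g (\<theta> x)) = killing (g z) (\<theta> (g x)) - killing (g z) (g (\<theta> x))"
      by (simp add: z killing_diff')
    also have "\<dots> = 0" by (simp add: killing_theta_constant[OF g] killing_aut[OF g])
    finally show "killing (\<theta> (g x) - g (\<theta> x)) y = 0" by (simp add: killing_sym)
  qed
  then show ?thesis by simp
qed

lemma gr_G0: assumes g: "g \<in> G0" and x: "x \<in> gr i" shows "g x \<in> gr i"
  using x unfolding mem_gr_iff by (simp add: theta_G0[OF g] lin_scale[OF G0_lin(1)[OF g]])

end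

section \<open>Conjugacy of complex Cartan subspaces\<close>

context real_cover
begin

section \<open>Polynomial functions and directional derivatives\<close>

sublocale Pol: function_algebra dual .

abbreviation "Pol \<equiv> Pol.R"

lemma pol_line:
  assumes "f \<in> Pol" shows "\<exists>p. \<forall>t. f (x + sc t u) = poly p t"
  using assms
proof (induction rule: Pol.alg_induct)
  case (gen l)
  then show ?case by (intro exI[of _ "[:l x, l u:]"]) (simp add: linear_functional)
next
  case (const c)
  show ?case by (rule exI[of _ "[:c:]"]) simp
next
  case (add f g)
  then obtain p q where "\<forall>t. f (x + sc t u) = poly p t" "\<forall>t. g (x + sc t u) = poly q t" by blast
  then show ?case by (intro exI[of _ "p + q"]) simp
next
  case (mult f g)
  then obtain p q where "\<forall>t. f (x + sc t u) = poly p t" "\<forall>t. g (x + sc t u) = poly q t" by blast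
  then show ?case by (intro exI[of _ "p * q"]) simp
qed

text \<open>Taken along a line, so that no coordinates are chosen; on polynomial functions it is the
  formal derivative of the restriction to the line.\<close>

definition dd :: "'v \<Rightarrow> ('v \<Rightarrow> complex) \<Rightarrow> 'v \<Rightarrow> complex" where
  "dd u f x = (THE D. ((\<lambda>t. f (x + sc t u)) has_field_derivative D) (at 0))"

lemma dd_eq: "((\<lambda>t. f (x + sc t u)) has_field_derivative D) (at 0) \<Longrightarrow> dd u f x = D"
  unfolding dd_def by (intro the_equality) (auto intro: DERIV_unique)

lemma dd_poly: "(\<And>t. f (x + sc t u) = poly p t) \<Longrightarrow> dd u f x = poly (pderiv p) 0"
  by (rule dd_eq) (simp add: poly_DERIV)

text \<open>The derivatives at all points of one line come from one polynomial, which allows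
  iteration along the line.\<close>

lemma dd_poly_shift:
  assumes "\<And>t. f (x + sc t u) = poly p t" shows "dd u f (x + sc s u) = poly (pderiv p) s"
proof (rule dd_eq)
  have "f (x + sc s u + sc t u) = poly p (s + t)" for t
    using assms[of "s + t"] by (simp add: scale_left_distrib add.assoc)
  moreover have "((\<lambda>t. poly p (s + t)) has_field_derivative poly (pderiv p) (s + 0) * 1) (at 0)"
    by (rule DERIV_chain'[where f = "\<lambda>t. s + t" and g = "poly p"])
      (auto intro!: derivative_eq_intros poly_DERIV)
  ultimately show "((\<lambda>t. f (x + sc s u + sc t u)) has_field_derivative poly (pderiv p) s) (at 0)" by simp
qed

lemma has_dd:
  assumes "f \<in> Pol" shows "((\<lambda>t. f (x + sc t u)) has_field_derivative dd u f x) (at 0)"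
proof -
  obtain p where "\<And>t. f (x + sc t u) = poly p t" using pol_line[OF assms, of x u] by blast
  then show ?thesis using dd_poly[of f x u p] poly_DERIV[of p 0] by simp
qed

lemma dd_const: "dd u (\<lambda>_. c) x = 0"
  by (rule dd_eq) simp

lemma dd_linear: "l \<in> dual \<Longrightarrow> dd u l x = l u"
  using dd_poly[of l x u "[:l x, l u:]"] by (simp add: linear_functional pderiv_pCons)

lemma dd_add: "f \<in> Pol \<Longrightarrow> g \<in> Pol \<Longrightarrow> dd u (f + g) x = dd u f x + dd u g x"
  by (rule dd_eq) (simp add: DERIV_add has_dd)

lemma dd_mult: "f \<in> Pol \<Longrightarrow> g \<in> Pol \<Longrightarrow> dd u (f * g) x = dd u f x * g x + f x * dd u g x"
  using DERIV_mult[OF has_dd has_dd, of f g x u x u] by (intro dd_eq) (simp add: algebra_simps)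

lemma dd_Pol:
  assumes "f \<in> Pol" shows "dd u f \<in> Pol"
  using assms
proof (induction rule: Pol.alg_induct)
  case (gen l)
  have "dd u l = (\<lambda>_. l u)" using dd_linear[OF gen] by blast
  then show ?case using Pol.alg_const by simp
next
  case (const c)
  have "dd u (\<lambda>_. c) = (\<lambda>_. 0)" using dd_const by blast
  then show ?case using Pol.alg_const by simp
next
  case (add f g)
  have "dd u (f + g) = dd u f + dd u g" using dd_add[OF add(1,2)] by (auto simp: fun_eq_iff)
  then show ?case by (rule ssubst[of _ _ "\<lambda>h. h \<in> Pol"]) (rule Pol.alg_add[OF add(3,4)])
next
  case (mult f g)
  have "dd u (f * g) = dd u f * g + f * dd u g" using dd_mult[OF mult(1,2)] by (auto simp: fun_eq_iff)
  then show ?case by (rule ssubst[of _ _ "\<lambda>h. h \<in> Pol"]) (intro Pol.alg_add Pol.alg_mult mult)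
qed

lemma dd_sum_direction:
  assumes "f \<in> Pol" shows "dd (u + w) f x = dd u f x + dd w f x"
  using assms
proof (induction rule: Pol.alg_induct)
  case (gen l)
  then show ?case using dd_linear linear_functional by simp
next
  case (const c)
  show ?case by (simp add: dd_const)
next
  case (add f g)
  show ?case unfolding dd_add[OF add(1,2)] add(3,4) by simp
next
  case (mult f g)
  show ?case unfolding dd_mult[OF mult(1,2)] mult(3,4) by (simp add: algebra_simps)
qed

lemma Pol_compose:
  assumes f: "f \<in> Pol" and g: "lin g" shows "(\<lambda>v. f (g v)) \<in> Pol"
  using f
proof (induction rule: Pol.alg_induct)
  case (gen l)
  show ?case by (rule Pol.alg_gen[OF compose_dual[OF gen g]])
next
  case (const c)
  show ?case by (rule Pol.alg_const)
next
  case (add f f')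
  have "(\<lambda>v. (f + f') (g v)) = (\<lambda>v. f (g v)) + (\<lambda>v. f' (g v))" by (auto simp: fun_eq_iff)
  then show ?case by (rule ssubst[of _ _ "\<lambda>h. h \<in> Pol"]) (rule Pol.alg_add[OF add(3,4)])
next
  case (mult f f')
  have "(\<lambda>v. (f * f') (g v)) = (\<lambda>v. f (g v)) * (\<lambda>v. f' (g v))" by (auto simp: fun_eq_iff)
  then show ?case by (rule ssubst[of _ _ "\<lambda>h. h \<in> Pol"]) (rule Pol.alg_mult[OF mult(3,4)])
qed

lemma dd_compose: "lin g \<Longrightarrow> dd u (\<lambda>v. f (g v)) x = dd (g u) f (g x)"
  by (simp add: dd_def lin_add lin_scale)

text \<open>A tangent vector of \<open>G0\<close> annihilates every function vanishing on the orbit of \<open>x\<close>.\<close>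

lemma dd_orbit_zero:
  assumes f: "f \<in> Pol" and y: "y \<in> gr 0" and zero: "\<And>g. g \<in> G0 \<Longrightarrow> f (g x) = 0"
  shows "dd (br y x) f x = 0"
proof -
  have "br y \<in> linear_group_lie_algebra sc G0" unfolding G0_lie using y by blast
  then obtain D where D: "D \<in> tangent_space G0 (linear_regular sc G0) id"
    and Dl: "\<forall>l v. Vector_Spaces.linear sc (*) l \<longrightarrow> D (\<lambda>g\<in>G0. l (g v)) = l (br y v)"
    unfolding linear_group_lie_algebra_def by blast
  note D' = D[unfolded tangent_space_def mem_Collect_eq]
  have "(\<lambda>g\<in>G0. f (g x)) \<in> linear_regular sc G0 \<and> D (\<lambda>g\<in>G0. f (g x)) = dd (br y x) f x"
    using f
  proof (induction rule: Pol.alg_induct)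
    case (gen l)
    have "D (\<lambda>g\<in>G0. l (g x)) = l (br y x)" using Dl gen by blast
    then show ?case unfolding dd_linear[OF gen] using coefficient_regular[OF gen] by blast
  next
    case (const c)
    have "D (\<lambda>g\<in>G0. c) = 0" using D' by blast
    then show ?case unfolding dd_const linear_regular_def by (intro conjI generated_algebra.const)
  next
    case (add f f')
    let ?f = "\<lambda>g\<in>G0. f (g x)" and ?f' = "\<lambda>g\<in>G0. f' (g x)"
    have eq: "(\<lambda>g\<in>G0. (f + f') (g x)) = (\<lambda>g\<in>G0. ?f g + ?f' g)" by (auto simp: fun_eq_iff)
    have "(\<lambda>g\<in>G0. ?f g + ?f' g) \<in> linear_regular sc G0"
      using add(3,4) unfolding linear_regular_def by (intro generated_algebra.add) blast+
    moreover have "D (\<lambda>g\<in>G0. ?f g + ?f' g) = D ?f + D ?f'" using D' add(3,4) by blast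
    ultimately show ?case unfolding eq dd_add[OF add(1,2)] using add(3,4) by argo
  next
    case (mult f f')
    let ?f = "\<lambda>g\<in>G0. f (g x)" and ?f' = "\<lambda>g\<in>G0. f' (g x)"
    have eq: "(\<lambda>g\<in>G0. (f * f') (g x)) = (\<lambda>g\<in>G0. ?f g * ?f' g)" by (auto simp: fun_eq_iff)
    have "(\<lambda>g\<in>G0. ?f g * ?f' g) \<in> linear_regular sc G0"
      using mult(3,4) unfolding linear_regular_def by (intro generated_algebra.mult) blast+
    moreover have "D (\<lambda>g\<in>G0. ?f g * ?f' g) = D ?f * ?f' id + ?f id * D ?f'" using D' mult(3,4) by blast
    moreover have "?f id = f x" "?f' id = f' x" using id_G0 by simp_all
    ultimately show ?case unfolding eq dd_mult[OF mult(1,2)] using mult(3,4) by argo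
  qed
  moreover have "(\<lambda>g\<in>G0. f (g x)) = (\<lambda>g\<in>G0. 0)" using zero by (auto simp: fun_eq_iff)
  ultimately show ?thesis using D' by simp
qed

text \<open>The part of the linear space \<open>gr 1 \<inter> centralizer c\<close> where no weight
  trace of a nonzero eigenvalue vanishes.\<close>

definition slice :: "'v set \<Rightarrow> 'v \<Rightarrow> 'v set" where
  "slice c x0 = {z \<in> gr 1. z \<in> centralizer c \<and> regular x0 z}"

lemma weight_trace_dual: "weight_trace x0 \<mu> \<in> dual"
  using linear_weight_trace by simp

lemma generic_slice: "cartan c \<Longrightarrow> generic c x0 \<Longrightarrow> x0 \<in> slice c x0"
  using generic_regular[of c x0] cartanD[of c] unfolding slice_def generic_def centralizer_def by blast

lemma slice_direction_zero:
  assumes z: "z \<in> slice c x0" and k: "k \<in> gr 1" "k \<in> centralizer c"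
    and f: "f \<in> Pol" "\<And>z. z \<in> slice c x0 \<Longrightarrow> f z = 0"
  shows "dd k f z = 0"
proof -
  obtain p where p: "\<And>t. f (z + sc t k) = poly p t" using pol_line[OF f(1), of z k] by blast
  let ?wt = "weight_trace x0"
  \<comment> \<open>The values of \<open>t\<close> at which some weight trace may vanish on the
    line. If \<open>?wt \<mu> k\<close> is 0, the quotient is 0 and merely excludes
    \<open>t = 0\<close>.\<close>
  let ?bad = "(\<lambda>\<mu>. - ?wt \<mu> z / ?wt \<mu> k) ` (eigenvalues (br x0))"
  have "finite ?bad" using finite_eigenvalues[OF lin_br] by blast
  then have inf: "infinite (UNIV - ?bad)" using infinite_UNIV_char_0 by (metis Diff_infinite_finite)
  have "z + sc t k \<in> slice c x0" if "t \<notin> ?bad" for t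
  proof -
    have "?wt \<mu> (z + sc t k) \<noteq> 0" if \<mu>: "\<mu> \<in> eigenvalues (br x0) - {0}" for \<mu>
    proof
      assume "?wt \<mu> (z + sc t k) = 0"
      then have 0: "?wt \<mu> z + t * ?wt \<mu> k = 0" using linear_functional[OF weight_trace_dual] by simp
      have "?wt \<mu> z \<noteq> 0" using z \<mu> by (simp add: slice_def regular_def)
      then have "?wt \<mu> k \<noteq> 0" using 0 by auto
      then have "t = - ?wt \<mu> z / ?wt \<mu> k" using 0 by (simp add: field_simps eq_neg_iff_add_eq_0 add.commute)
      then show False using \<open>t \<notin> ?bad\<close> \<mu> by blast
    qed
    moreover have "z + sc t k \<in> gr 1" "z + sc t k \<in> centralizer c"
      by (rule subspace_add[OF subspace_gr _ subspace_scale[OF subspace_gr k(1)]],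
          use z in \<open>simp add: slice_def\<close>)
        (rule subspace_add[OF subspace_centralizer _ subspace_scale[OF subspace_centralizer k(2)]],
          use z in \<open>simp add: slice_def\<close>)
    ultimately show ?thesis by (simp add: slice_def regular_def)
  qed
  then have "poly p t = 0" if "t \<notin> ?bad" for t using f(2)[of "z + sc t k"] that p[of t] by metis
  then have "UNIV - ?bad \<subseteq> {t. poly p t = 0}" by blast
  then have "infinite {t. poly p t = 0}" using inf infinite_super by blast
  then have "p = 0" using poly_roots_finite by blast
  then show ?thesis using dd_poly[OF p] by simp
qed

lemma dominant_slice:
  assumes c: "cartan c" and x0: "generic c x0"
    and f: "f \<in> Pol" "\<And>g z. g \<in> G0 \<Longrightarrow> z \<in> slice c x0 \<Longrightarrow> f (g z) = 0" and w: "w \<in> gr 1"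
  shows "f w = 0"
proof -
  define I where "I = {f \<in> Pol. \<forall>g\<in>G0. \<forall>z\<in>slice c x0. f (g z) = 0}"
  \<comment> \<open>At a point of the slice, \<open>u\<close> splits into a slice direction and an
    orbit direction, and the derivatives of \<open>f\<close> along both vanish.\<close>
  have base: "dd u f z = 0" if f: "f \<in> I" and z: "z \<in> slice c x0" and u: "u \<in> gr 1" for f z u
  proof -
    have z': "z \<in> gr 1" "z \<in> centralizer c" "regular x0 z" using z by (auto simp: slice_def)
    obtain k y where ky: "k \<in> gr 1" "k \<in> centralizer c" "y \<in> gr 0" "u = k + br z y"
      by (rule regular_decomposition[OF c x0 z' u])
    have fP: "f \<in> Pol" using f I_def by blast
    have f0: "f z = 0" if "z \<in> slice c x0" for z using f id_G0 that by (force simp: I_def)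
    have "br z y = br (- y) z" by (simp add: br_neg' br_anti[of y])
    then have "u = k + br (- y) z" using ky(4) by simp
    then have "dd u f z = dd k f z + dd (br (- y) z) f z" using dd_sum_direction[OF fP] by simp
    moreover have "dd k f z = 0" by (rule slice_direction_zero[OF z ky(1,2) fP f0])
    moreover have "dd (br (- y) z) f z = 0"
      by (rule dd_orbit_zero[OF fP]) (use ky(3) subspace_neg[OF subspace_gr] f z in \<open>auto simp: I_def\<close>)
    ultimately show ?thesis by simp
  qed
  \<comment> \<open>At \<open>g z\<close>, pull back by \<open>g\<close>: the composite is again in
    \<open>I\<close>, and the direction becomes the inverse of \<open>g\<close> applied to
    \<open>u\<close>, still in \<open>gr 1\<close>.\<close>
  have closed: "dd u f \<in> I" if f: "f \<in> I" and u: "u \<in> gr 1" for f u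
    unfolding I_def
  proof (intro CollectI conjI ballI)
    show "dd u f \<in> Pol" using f dd_Pol by (simp add: I_def)
    fix g z assume g: "g \<in> G0" and z: "z \<in> slice c x0"
    obtain h where h: "h \<in> carrier Gh" "g = \<psi> h" using g psi_surj by blast
    let ?g' = "\<psi> (inv\<^bsub>Gh\<^esub> h)"
    have g': "?g' \<in> G0" using h psi_G0 by simp
    have "(\<lambda>v. f (g v)) \<in> I" unfolding I_def
    proof (intro CollectI conjI ballI)
      show "(\<lambda>v. f (g v)) \<in> Pol"
        by (rule Pol_compose[OF _ G0_lin(1)[OF g]]) (use f in \<open>simp add: I_def\<close>)
      fix g1 z assume "g1 \<in> G0" "z \<in> slice c x0"
      then show "f (g (g1 z)) = 0" using f comp_G0[OF g, of g1] by (force simp: I_def)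
    qed
    then have "dd (?g' u) (\<lambda>v. f (g v)) z = 0" by (rule base[OF _ z gr_G0[OF g' u]])
    moreover have "dd (?g' u) (\<lambda>v. f (g v)) z = dd (g (?g' u)) f (g z)"
      by (rule dd_compose[OF G0_lin(1)[OF g]])
    moreover have "g (?g' u) = u" using psi_inv(2)[OF h(1)] h(2) by simp
    ultimately show "dd u f (g z) = 0" by simp
  qed
  have zero: "f x0 = 0" if "f \<in> I" for f
    using that id_G0 generic_slice[OF c x0] by (force simp: I_def)
  let ?u = "w - x0"
  have x01: "x0 \<in> gr 1" using generic_slice[OF c x0] by (simp add: slice_def)
  then have u: "?u \<in> gr 1" using w subspace_diff[OF subspace_gr] by blast
  \<comment> \<open>All iterated derivatives lie in \<open>I\<close> and so vanish at
    \<open>x0\<close>. This is Taylor's formula on the line from \<open>x0\<close> to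
    \<open>w\<close>, as an induction on the degree.\<close>
  have "p = 0" if "f \<in> I" "\<And>t. f (x0 + sc t ?u) = poly p t" for f p
    using that
  proof (induction "degree p" arbitrary: p f rule: less_induct)
    case less
    show ?case
    proof (cases "degree p = 0")
      case True
      then obtain a where a: "p = [:a:]" by (rule degree_eq_zeroE)
      then show ?thesis using less.prems(2)[of 0] zero[OF less.prems(1)] by simp
    next
      case False
      have "pderiv p = 0"
      proof (rule less.hyps[of "pderiv p" "dd ?u f"])
        show "degree (pderiv p) < degree p" using False by (simp add: degree_pderiv)
        show "dd ?u f \<in> I" by (rule closed[OF less.prems(1) u])
        show "dd ?u f (x0 + sc t ?u) = poly (pderiv p) t" for t by (rule dd_poly_shift[OF less.prems(2)])
      qed
      then show ?thesis using False by (simp add: pderiv_eq_0_iff)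
    qed
  qed
  moreover obtain p where p: "\<And>t. f (x0 + sc t ?u) = poly p t" using pol_line[OF f(1), of x0 ?u] by blast
  moreover have "f \<in> I" using f by (simp add: I_def)
  ultimately have "p = 0" by blast
  then show ?thesis using p[of 1] by simp
qed

text \<open>On the line through a point where \<open>f\<close> does not vanish and one where
  \<open>g\<close> does not, both restrict to nonzero polynomials in one variable.\<close>

lemma Pol_domain: "function_domain Pol"
  unfolding function_domain_def
proof (intro ballI impI, rule ccontr)
  fix f g assume f: "f \<in> Pol" and g: "g \<in> Pol" and fg: "f * g = 0" and "\<not> (f = 0 \<or> g = 0)"
  then obtain x y where xy: "f x \<noteq> 0" "g y \<noteq> 0" by (auto simp: fun_eq_iff)
  obtain p where p: "\<And>t. f (x + sc t (y - x)) = poly p t" using pol_line[OF f] by blast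
  obtain q where q: "\<And>t. g (x + sc t (y - x)) = poly q t" using pol_line[OF g] by blast
  have "p \<noteq> 0" using p[of 0] xy by auto
  moreover have "q \<noteq> 0" using q[of 1] xy by auto
  moreover have "poly (p * q) t = 0" for t using p[of t] q[of t] fun_cong[OF fg, of "x + sc t (y - x)"]
    by simp
  then have "p * q = 0" using poly_all_0_iff_0 by blast
  ultimately show False by simp
qed

lemma separating_linear_functional:
  assumes "subspace Q" "v \<notin> Q"
  obtains l where "l \<in> dual" "\<And>x. x \<in> Q \<Longrightarrow> l x = 0" "l v = 1"
  by (rule separating_functional[OF vector_space_axioms assms]) (use that in blast)

section \<open>The product of the group with the slice as an affine variety\<close>

definition slice_points :: "'v set \<Rightarrow> 'v \<Rightarrow> ('g \<times> 'v) set" where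
  "slice_points c x0 = carrier Gh \<times> slice c x0"

definition slice_ret :: "'v set \<Rightarrow> 'v \<Rightarrow> 'g \<times> 'v \<Rightarrow> 'g \<times> 'v" where
  "slice_ret c x0 p = (if p \<in> slice_points c x0 then p else (\<one>\<^bsub>Gh\<^esub>, x0))"

definition slice_discr :: "'v \<Rightarrow> 'v \<Rightarrow> complex" where
  "slice_discr x0 = (\<Prod>\<mu>\<in>eigenvalues (br x0) - {0}. weight_trace x0 \<mu>)"

text \<open>Adding the inverse of \<open>slice_discr\<close> makes the regular part of the linear
  slice affine, as in the Rabinowitsch trick.\<close>

definition slice_functions :: "'v set \<Rightarrow> 'v \<Rightarrow> ('g \<times> 'v \<Rightarrow> complex) set" where
  "slice_functions c x0 = (\<lambda>f p. f (fst (slice_ret c x0 p))) ` FA \<union>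
     (\<lambda>b p. coord b (snd (slice_ret c x0 p))) ` Basis \<union> {\<lambda>p. 1 / slice_discr x0 (snd (slice_ret c x0 p))}"

lemma regular_iff_discr: "regular x0 z \<longleftrightarrow> slice_discr x0 z \<noteq> 0"
  unfolding regular_def slice_discr_def prod_fun_apply
  using finite_eigenvalues[OF lin_br, of x0] by (simp add: prod_zero_iff)

lemma slice_ret:
  assumes "cartan c" "generic c x0"
  shows "fst (slice_ret c x0 p) \<in> carrier Gh" "snd (slice_ret c x0 p) \<in> slice c x0"
    "p \<in> slice_points c x0 \<Longrightarrow> slice_ret c x0 p = p"
  using generic_slice[OF assms] by (auto simp: slice_ret_def slice_points_def split: if_splits)

lemma slice_A:
  assumes c: "cartan c" "generic c x0" and f: "f \<in> A"
  shows "(\<lambda>p. f (fst (slice_ret c x0 p))) \<in> generated_algebra UNIV (slice_functions c x0)"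
proof -
  interpret S: function_algebra "slice_functions c x0" .
  note R = slice_ret(1)[OF c]
  show ?thesis using f unfolding FA(2)
  proof (induction rule: generated_algebra.induct)
    case (gen f)
    have "(\<lambda>p. restrict f (carrier Gh) (fst (slice_ret c x0 p))) = (\<lambda>p. f (fst (slice_ret c x0 p)))" using R
      by simp
    moreover have "(\<lambda>p. f (fst (slice_ret c x0 p))) \<in> S.R" using gen
      by (intro S.alg_gen) (auto simp: slice_functions_def)
    ultimately show ?case by simp
  next
    case (const k)
    then show ?case using R S.alg_const by simp
  next
    case (add f g)
    have "(\<lambda>p. (\<lambda>x\<in>carrier Gh. f x + g x) (fst (slice_ret c x0 p))) =
        (\<lambda>p. f (fst (slice_ret c x0 p))) + (\<lambda>p. g (fst (slice_ret c x0
          p)))" using R by (auto simp: fun_eq_iff)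
    then show ?case by (rule ssubst[of _ _ "\<lambda>h. h \<in> S.R"]) (rule S.alg_add[OF add.IH])
  next
    case (mult f g)
    have "(\<lambda>p. (\<lambda>x\<in>carrier Gh. f x * g x) (fst (slice_ret c x0 p))) =
        (\<lambda>p. f (fst (slice_ret c x0 p))) * (\<lambda>p. g (fst (slice_ret c x0
          p)))" using R by (auto simp: fun_eq_iff)
    then show ?case by (rule ssubst[of _ _ "\<lambda>h. h \<in> S.R"]) (rule S.alg_mult[OF mult.IH])
  qed
qed

text \<open>A character gives a point \<open>g\<close> of the group and, by its values on
  coordinates, a vector \<open>z\<close>. Functionals vanishing on the linear slice keep
  \<open>z\<close> inside it, and the inverse of the discriminant keeps \<open>z\<close>
  regular.\<close>

lemma slice_characters:
  assumes c: "cartan c" "generic c x0"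
    and \<xi>: "algebra_character UNIV (generated_algebra UNIV (slice_functions c x0)) \<xi>"
  shows "\<exists>x. \<forall>f\<in>generated_algebra UNIV (slice_functions c x0). \<xi> f = f x"
proof -
  interpret S: function_algebra "slice_functions c x0" .
  let ?r = "slice_ret c x0"
  note R = slice_ret[OF c]
  note \<xi>' = \<xi>[unfolded algebra_character_UNIV]
  have \<xi>c: "\<xi> (\<lambda>_. k) = k" for k using \<xi>' by blast
  have \<xi>a: "\<xi> (f + g) = \<xi> f + \<xi> g" and \<xi>m: "\<xi> (f * g) = \<xi> f * \<xi> g" if "f \<in> S.R" "g \<in> S.R" for f g
    using \<xi>' that by blast+
  obtain g where g: "g \<in> carrier Gh" "\<forall>f\<in>A. \<xi> (\<lambda>p. f (fst (?r p))) = f g"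
  proof -
    have "algebra_character (carrier Gh) A (\<lambda>f. \<xi> (\<lambda>p. f (fst (?r p))))"
      unfolding algebra_character_def
      using \<xi>c \<xi>a[OF slice_A[OF c] slice_A[OF c]] \<xi>m[OF slice_A[OF c] slice_A[OF c]] R(1)
      by (simp add: plus_fun_def times_fun_def)
    then show thesis using A_affine that unfolding affine_variety_def by blast
  qed
  define z where "z = (\<Sum>b\<in>Basis. sc (\<xi> (\<lambda>p. coord b (snd (?r p)))) b)"
  have coordR: "(\<lambda>p. coord b (snd (?r p))) \<in> S.R" if "b \<in> Basis" for b
    using that by (intro S.alg_gen) (auto simp: slice_functions_def)
  have lin_pol: "(\<lambda>p. l (snd (?r p))) \<in> S.R \<and> \<xi> (\<lambda>p. l (snd (?r p))) = l z" if l: "l \<in> dual" for l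
  proof -
    have eq: "(\<lambda>p. l (snd (?r p))) = (\<Sum>b\<in>Basis. (\<lambda>_. l b) * (\<lambda>p. coord b (snd (?r p))))"
      by (rule ext, subst functional_coord[OF l]) (simp add: sum_fun_apply mult.commute)
    have "(\<Sum>b\<in>I. (\<lambda>_. l b) * (\<lambda>p. coord b (snd (?r p)))) \<in> S.R \<and>
        \<xi> (\<Sum>b\<in>I. (\<lambda>_. l b) * (\<lambda>p. coord b (snd (?r p)))) = (\<Sum>b\<in>I. l b * \<xi> (\<lambda>p. coord b (snd (?r p))))"
      if "finite I" "I \<subseteq> Basis" for I
      using that
    proof (induction I rule: finite_induct)
      case empty
      then show ?case using \<xi>c[of 0] S.alg_0 by (simp add: zero_fun_def)
    next
      case (insert b I)
      have b: "(\<lambda>_. l b) * (\<lambda>p. coord b (snd (?r p))) \<in> S.R"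
        using insert.prems by (intro S.alg_mult S.alg_const coordR) simp
      have I: "(\<Sum>b\<in>I. (\<lambda>_. l b) * (\<lambda>p. coord b (snd (?r p)))) \<in> S.R"
        and I': "\<xi> (\<Sum>b\<in>I. (\<lambda>_. l b) * (\<lambda>p. coord b (snd (?r p)))) = (\<Sum>b\<in>I. l b * \<xi> (\<lambda>p. coord b (snd (?r p))))"
        using insert.IH insert.prems by blast+
      have hx: "\<xi> ((\<lambda>_. l b) * (\<lambda>p. coord b (snd (?r p)))) = \<xi> (\<lambda>_. l b) * \<xi> (\<lambda>p. coord b (snd (?r p)))"
        using insert.prems by (intro \<xi>m S.alg_const coordR) simp
      show ?case unfolding sum.insert[OF insert.hyps] \<xi>a[OF b I] I' hx \<xi>c
        by (intro conjI S.alg_add[OF b I] refl)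
    qed
    from this[OF finite_Basis order_refl] show ?thesis
      unfolding eq z_def by (simp add: linear_functional_sum[OF l] linear_functional[OF l] mult.commute)
  qed
  have pol: "(\<lambda>p. h (snd (?r p))) \<in> S.R \<and> \<xi> (\<lambda>p. h (snd (?r p))) = h z" if "h \<in> Pol" for h
    using that
  proof (induction rule: Pol.alg_induct)
    case (gen l)
    then show ?case by (rule lin_pol)
  next
    case (const k)
    then show ?case using \<xi>c S.alg_const by simp
  next
    case (add f h)
    have "(\<lambda>p. (f + h) (snd (?r p))) = (\<lambda>p. f (snd (?r p))) + (\<lambda>p. h (snd (?r p)))" by (auto simp: fun_eq_iff)
    moreover have "(\<lambda>p. f (snd (?r p))) + (\<lambda>p. h (snd (?r p))) \<in> S.R" using add by (intro S.alg_add) auto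
    moreover have "\<xi> ((\<lambda>p. f (snd (?r p))) + (\<lambda>p. h (snd (?r p)))) = f z + h z" using \<xi>a add by simp
    ultimately show ?case by (simp only: plus_fun_apply)
  next
    case (mult f h)
    have "(\<lambda>p. (f * h) (snd (?r p))) = (\<lambda>p. f (snd (?r p))) * (\<lambda>p. h (snd (?r p)))" by (auto simp: fun_eq_iff)
    moreover have "(\<lambda>p. f (snd (?r p))) * (\<lambda>p. h (snd (?r p))) \<in> S.R" using mult by (intro S.alg_mult) auto
    moreover have "\<xi> ((\<lambda>p. f (snd (?r p))) * (\<lambda>p. h (snd (?r p)))) = f z * h z" using \<xi>m mult by simp
    ultimately show ?case by (simp only: times_fun_apply)
  qed
  have "z \<in> gr 1 \<inter> centralizer c"
  proof (rule ccontr)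
    assume "z \<notin> gr 1 \<inter> centralizer c"
    then obtain l where l: "l \<in> dual" "\<And>x. x \<in> gr 1 \<inter> centralizer c \<Longrightarrow> l x = 0" "l z = 1"
      using separating_linear_functional[OF subspace_inter[OF subspace_gr subspace_centralizer]] by blast
    have "l (snd (?r p)) = 0" for p using l(2)[of "snd (?r p)"] R(2)[of p] by (simp add: slice_def)
    then have "(\<lambda>p. l (snd (?r p))) = (\<lambda>_. 0)" by simp
    then show False using lin_pol[OF l(1)] \<xi>c l(3) by simp
  qed
  moreover have "slice_discr x0 z \<noteq> 0"
  proof
    assume 0: "slice_discr x0 z = 0"
    have dP: "slice_discr x0 \<in> Pol" unfolding slice_discr_def
      by (intro Pol.alg_prod Pol.alg_gen weight_trace_dual)
    have "(\<lambda>p. slice_discr x0 (snd (?r p))) * (\<lambda>p. 1 / slice_discr x0 (snd (?r p))) = (\<lambda>_. 1)"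
      using R(2) by (auto simp: fun_eq_iff slice_def regular_iff_discr)
    moreover have "(\<lambda>p. 1 / slice_discr x0 (snd (?r p))) \<in> S.R"
      by (intro S.alg_gen) (simp add: slice_functions_def)
    ultimately have "\<xi> (\<lambda>_. 1) = slice_discr x0 z * \<xi> (\<lambda>p. 1 / slice_discr x0 (snd (?r p)))"
      using \<xi>m pol[OF dP] by metis
    then show False using 0 \<xi>c by simp
  qed
  ultimately have zs: "z \<in> slice c x0" by (simp add: slice_def regular_iff_discr)
  then have rp: "?r (g, z) = (g, z)" using g(1) by (intro R(3)) (simp add: slice_points_def)
  have "\<xi> f = f (g, z)" if "f \<in> S.R" for f
    using that
  proof (induction rule: S.alg_induct)
    case (gen f)
    then consider f0 where "f0 \<in> FA" "f = (\<lambda>p. f0 (fst (?r p)))" | b where "b \<in> Basis"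
      "f = (\<lambda>p. coord b (snd (?r p)))"
      | "f = (\<lambda>p. 1 / slice_discr x0 (snd (?r p)))" unfolding slice_functions_def by blast
    then show ?case
    proof cases
      case 1
      then have "restrict f0 (carrier Gh) \<in> A" unfolding FA(2) by (intro generated_algebra.gen)
      then have "\<xi> (\<lambda>p. restrict f0 (carrier Gh) (fst (?r p))) = restrict f0 (carrier Gh) g" using g(2)
        by blast
      then show ?thesis using 1(2) rp R(1) g(1) by simp
    next
      case 2
      then show ?thesis using lin_pol[OF coord_dual] rp by simp
    next
      case 3
      have dP: "slice_discr x0 \<in> Pol" unfolding slice_discr_def
        by (intro Pol.alg_prod Pol.alg_gen weight_trace_dual)
      have "(\<lambda>p. slice_discr x0 (snd (?r p))) * f = (\<lambda>_. 1)"
        unfolding 3 using R(2) by (auto simp: fun_eq_iff slice_def regular_iff_discr)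
      moreover have "f \<in> S.R" using gen by (rule S.alg_gen)
      ultimately have "\<xi> (\<lambda>_. 1) = slice_discr x0 z * \<xi> f" using \<xi>m pol[OF dP] by metis
      then show ?thesis using \<xi>c zs rp 3 by (simp add: slice_def regular_iff_discr field_simps)
    qed
  next
    case (const k)
    show ?case by (rule \<xi>c)
  next
    case (add f h)
    show ?case unfolding \<xi>a[OF add(1,2)] add(3,4) by simp
  next
    case (mult f h)
    show ?case unfolding \<xi>m[OF mult(1,2)] mult(3,4) by simp
  qed
  then show ?thesis by blast
qed

definition orbit_map :: "'v set \<Rightarrow> 'v \<Rightarrow> 'g \<times> 'v \<Rightarrow> 'v" where
  "orbit_map c x0 p = \<psi> (fst (slice_ret c x0 p)) (snd (slice_ret c x0 p))"

text \<open>Expanding the vector in the basis separates its coordinates from the matrix coefficients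
  of the group element.\<close>

lemma orbit_map_regular:
  assumes c: "cartan c" "generic c x0" and l: "l \<in> dual"
  shows "(\<lambda>p. l (orbit_map c x0 p)) \<in> generated_algebra UNIV (slice_functions c x0)"
proof -
  interpret S: function_algebra "slice_functions c x0" .
  let ?r = "slice_ret c x0"
  note R = slice_ret[OF c]
  have L: "lin (\<psi> (fst (?r p)))" for p using G0_lin(1) psi_G0 R(1) by blast
  have eq: "(\<lambda>p. l (orbit_map c x0 p)) =
      (\<Sum>b\<in>Basis. (\<lambda>p. coord b (snd (?r p))) * (\<lambda>p. l (\<psi> (fst (?r p)) b)))"
  proof
    fix p
    have "orbit_map c x0 p = (\<Sum>b\<in>Basis. sc (coord b (snd (?r p))) (\<psi> (fst (?r p)) b))"
      unfolding orbit_map_def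
      by (subst rep_sum_basis[OF independent_Basis span_Basis, of "snd (?r p)", symmetric])
        (simp only: lin_sum[OF L] lin_scale[OF L])
    then show "l (orbit_map c x0 p) = (\<Sum>b\<in>Basis. (\<lambda>p. coord b (snd (?r p))) * (\<lambda>p. l (\<psi> (fst (?r p)) b))) p"
      by (simp add: linear_functional_sum[OF l] linear_functional[OF l] sum_fun_apply)
  qed
  have "(\<lambda>p. l (\<psi> (fst (?r p)) b)) \<in> S.R" for b
  proof -
    have "(\<lambda>p. (\<lambda>g\<in>carrier Gh. l (\<psi> g b)) (fst (?r p))) \<in> S.R" by (rule slice_A[OF c coefficient_A[OF l]])
    then show ?thesis using R(1) by simp
  qed
  moreover have "(\<lambda>p. coord b (snd (?r p))) \<in> S.R" if "b \<in> Basis" for b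
    using that by (intro S.alg_gen) (auto simp: slice_functions_def)
  ultimately show ?thesis unfolding eq by (intro S.alg_sum S.alg_mult) auto
qed

lemma orbit_map_gr: "cartan c \<Longrightarrow> generic c x0 \<Longrightarrow> orbit_map c x0 p \<in> gr 1"
  unfolding orbit_map_def using slice_ret[of c x0 p] psi_G0 gr_G0 by (simp add: slice_def)

lemma semisimple_aut:
  assumes h: "lin h" "bij h" "\<And>x y. h (br x y) = br (h x) (h y)" and x: "semisimple_element sc br x"
  shows "semisimple_element sc br (h x)"
  unfolding semisimple_iff
proof (rule diagonalizable_if_spanned)
  let ?E = "{w. \<exists>c. br (h x) w = sc c w}"
  have hs: "h v \<in> span ?E" for v
    using lin_br[of x]
  proof (induction v rule: gen_eigenspace_induct)
    case zero
    then show ?case by (simp add: lin_0[OF h(1)] span_zero)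
  next
    case (add a b)
    then show ?case by (simp add: lin_add[OF h(1)] span_add)
  next
    case (base \<mu> v)
    then have "br (h x) (h v) = sc \<mu> (h v)"
      using semisimple_gen_eigenspace[OF x base] h(3)[of x v] lin_scale[OF h(1)] by simp
    then show ?case by (intro span_base) blast
  qed
  have "v \<in> span ?E" for v
  proof -
    obtain u where "v = h u" by (rule surjE[OF bij_is_surj[OF h(2)]])
    then show ?thesis using hs by simp
  qed
  then show "span ?E = UNIV" by blast
qed

text \<open>By \<open>cartan_eq\<close> a Cartan subspace is recovered from its centralizer as the
  set of semisimple elements of degree one in it.\<close>

lemma centralizer_aut:
  assumes g: "g \<in> G0" and eq: "g ` centralizer c = centralizer c'" and c: "cartan c" and c': "cartan c'"
  shows "g ` c = c'"
proof -
  note L = G0_lin[OF g]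
  let ?i = "inv_into UNIV g"
  have i: "g (?i v) = v" "?i (g v) = v" for v using L(2)
    by (simp_all add: bij_is_surj bij_is_inj surj_f_inv_f)
  have ss: "semisimple_element sc br (g x) \<longleftrightarrow> semisimple_element sc br x" for x
  proof -
    have "lin ?i" by (intro linI) (metis i lin_add[OF L(1)], metis i lin_scale[OF L(1)])
    moreover have "bij ?i" using L(2) by (rule bij_imp_bij_inv)
    moreover have "?i (br x y) = br (?i x) (?i y)" for x y by (metis i L(3))
    ultimately show ?thesis using semisimple_aut[OF L, of x] semisimple_aut[of ?i "g x"] i by metis
  qed
  have gr1: "g x \<in> gr 1 \<longleftrightarrow> x \<in> gr 1" for x
  proof
    assume gx: "g x \<in> gr 1"
    obtain h where h: "h \<in> carrier Gh" "g = \<psi> h" using g psi_surj by blast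
    then have "\<psi> (inv\<^bsub>Gh\<^esub> h) (g x) \<in> gr 1" by (intro gr_G0[OF psi_G0 gx]) simp
    then show "x \<in> gr 1" using psi_inv(1)[OF h(1)] h(2) by simp
  qed (rule gr_G0[OF g])
  have cent: "g x \<in> centralizer c' \<longleftrightarrow> x \<in> centralizer c" for x
    using eq i by (metis imageE image_eqI)
  show ?thesis
  proof (intro equalityI subsetI)
    fix y assume "y \<in> g ` c"
    then obtain x where "x \<in> c" "y = g x" by blast
    then show "y \<in> c'" using cartan_eq[OF c] cartan_eq[OF c'] ss gr1 cent by blast
  next
    fix y assume y: "y \<in> c'"
    have "g (?i y) = y" by (rule i)
    then have "?i y \<in> c" using y cartan_eq[OF c] cartan_eq[OF c'] ss[of "?i y"] gr1[of "?i y"] cent[of "?i y"]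
      by auto
    then show "y \<in> g ` c" using i by (metis imageI)
  qed
qed

theorem cartan_conjugate:
  assumes c: "cartan c" and c': "cartan c'"
  obtains g where "g \<in> carrier Gh" "\<psi> g ` c = c'"
proof -
  obtain x0 where "x0 \<in> c" "\<forall>y\<in>c. \<forall>\<mu>. \<exists>\<nu>. \<forall>v\<in>gen_eigenspace (br x0) \<mu>. br y v = sc \<nu> v"
    by (rule exists_generic_element[OF c])
  then have x0: "generic c x0" by (simp add: generic_def)
  obtain x1 where "x1 \<in> c'" "\<forall>y\<in>c'. \<forall>\<mu>. \<exists>\<nu>. \<forall>v\<in>gen_eigenspace (br x1) \<mu>. br y v = sc \<nu> v"
    by (rule exists_generic_element[OF c'])
  then have x1: "generic c' x1" by (simp add: generic_def)
  \<comment> \<open>The orbit maps land in \<open>gr 1\<close>, while functions live on the whole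
    type. The coordinates of a basis of \<open>gr 1\<close>, extended by 0 on a complement, generate
    polynomials determined by their restriction to \<open>gr 1\<close>.\<close>
  obtain BW where BW: "BW \<subseteq> gr 1" "independent BW" "gr 1 \<subseteq> span BW" by (rule maximal_independent_subset)
  obtain B where B: "BW \<subseteq> B" "B \<subseteq> UNIV" "independent B" "UNIV \<subseteq> span B"
    by (rule maximal_independent_subset_extend[OF subset_UNIV BW(2)])
  have sB: "span B = UNIV" using B(4) by blast
  have fBW: "finite BW" using BW(2) by (rule finiteI_independent)
  let ?L = "(\<lambda>b v. representation B v b) ` BW"
  have L: "?L \<subseteq> dual" using representation_dual[OF B(3) sB] by blast
  have rep: "(\<Sum>b\<in>BW. sc (representation B v b) b) = v" if v: "v \<in> gr 1" for v
  proof -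
    have vs: "v \<in> span BW" using v BW(3) by blast
    have "representation B v = representation BW v" by (rule representation_extend[OF B(3) vs B(1)])
    then show ?thesis using sum_representation_eq[OF BW(2) vs fBW order_refl] by simp
  qed
  interpret L: function_algebra ?L .
  have LP: "f \<in> Pol" if "f \<in> L.R" for f
    using that by (induction rule: L.alg_induct)
      (use L Pol.alg_gen Pol.alg_const Pol.alg_add Pol.alg_mult in blast)+
  \<comment> \<open>The projection to \<open>gr 1\<close> along the rest of the basis; the functions
    in \<open>L.R\<close> factor through it.\<close>
  let ?\<pi> = "\<lambda>v. \<Sum>b\<in>BW. sc (representation B v b) b"
  have \<pi>: "?\<pi> v \<in> gr 1" for v using BW(1) by
    (intro subspace_sum[OF subspace_gr] subspace_scale[OF subspace_gr]) blast
  have f\<pi>: "f (?\<pi> v) = f v" if "f \<in> L.R" for f v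
    using that
  proof (induction rule: L.alg_induct)
    case (gen f)
    then obtain b where b: "b \<in> BW" "f = (\<lambda>v. representation B v b)" by blast
    have "f (?\<pi> v) = (\<Sum>b'\<in>BW. representation B v b' * representation B b' b)"
      unfolding b(2) using B(3) sB by (simp add: representation_sum representation_scale)
    also have "\<dots> = (\<Sum>b'\<in>BW. if b' = b then representation B v b else 0)"
      using B(1) representation_basis[OF B(3)] by (intro sum.cong) auto
    finally show ?case using b fBW by simp
  qed simp_all
  have dom: "function_domain L.R" using Pol_domain LP unfolding function_domain_def by blast
  have dominant: "f = 0" if d: "cartan d" "generic d z" and f: "f \<in> L.R" "\<And>p. f (orbit_map d z p) = 0"
    for d z f
  proof -
    have "f (g y) = 0" if g: "g \<in> G0" and y: "y \<in> slice d z" for g y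
    proof -
      obtain h where h: "h \<in> carrier Gh" "g = \<psi> h" using g psi_surj by blast
      have "slice_ret d z (h, y) = (h, y)" using h y
        by (intro slice_ret(3)[OF d]) (simp add: slice_points_def)
      then show ?thesis using f(2)[of "(h, y)"] h by (simp add: orbit_map_def)
    qed
    then have "f w = 0" if "w \<in> gr 1" for w using dominant_slice[OF d LP[OF f(1)] _ that] by blast
    then have "f v = 0" for v using f\<pi>[OF f(1), of v] \<pi> by metis
    then show ?thesis by (simp add: fun_eq_iff)
  qed
  have fin: "finite (slice_functions d z)" for d z
    unfolding slice_functions_def using FA(1) finite_Basis by simp
  obtain p q where pq: "\<And>f. f \<in> ?L \<Longrightarrow> f (orbit_map c x0 p) = f (orbit_map c' x1 q)"
  proof (rule common_image_point[OF fin[of c x0] fin[of c' x1] finite_imageI[OF fBW]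
      slice_characters[OF c x0] slice_characters[OF c' x1] _ _ dom dominant[OF c x0] dominant[OF c' x1]])
    show "(\<lambda>x. f (orbit_map c x0 x)) \<in> generated_algebra UNIV (slice_functions c x0)" if "f \<in> ?L" for f
      using orbit_map_regular[OF c x0] L that by blast
    show "(\<lambda>x. f (orbit_map c' x1 x)) \<in> generated_algebra UNIV (slice_functions c' x1)" if "f \<in> ?L" for f
      using orbit_map_regular[OF c' x1] L that by blast
  qed (assumption | blast)+
  let ?g = "fst (slice_ret c x0 p)" and ?z = "snd (slice_ret c x0 p)"
  let ?g' = "fst (slice_ret c' x1 q)" and ?z' = "snd (slice_ret c' x1 q)"
  note r = slice_ret[OF c x0, of p] slice_ret[OF c' x1, of q]
  have "orbit_map c x0 p = (\<Sum>b\<in>BW. sc (representation B (orbit_map c x0 p) b) b)"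
    by (rule rep[OF orbit_map_gr[OF c x0], symmetric])
  also have "\<dots> = (\<Sum>b\<in>BW. sc (representation B (orbit_map c' x1 q) b) b)"
    using pq by (intro sum.cong refl) auto
  also have "\<dots> = orbit_map c' x1 q" by (rule rep[OF orbit_map_gr[OF c' x1]])
  finally have eq: "\<psi> ?g ?z = \<psi> ?g' ?z'" by (simp add: orbit_map_def)
  let ?h = "inv\<^bsub>Gh\<^esub> ?g' \<otimes>\<^bsub>Gh\<^esub> ?g"
  have h: "?h \<in> carrier Gh" using r by simp
  have hG: "\<psi> ?h \<in> G0" by (rule psi_G0[OF h])
  note Lh = G0_lin[OF hG]
  have "\<psi> ?h ?z = \<psi> (inv\<^bsub>Gh\<^esub> ?g') (\<psi> ?g ?z)" using psi_mult r by simp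
  also have "\<dots> = ?z'" unfolding eq using psi_inv(1) r by simp
  finally have hz: "\<psi> ?h ?z = ?z'" .
  \<comment> \<open>The zero generalized eigenspaces of the two regular points are the centralizers,
    and an automorphism carrying one point to the other carries these along.\<close>
  have K: "gen_eigenspace (br ?z) 0 = centralizer c" "gen_eigenspace (br ?z') 0 = centralizer c'"
    using regular_kernel[OF c x0, of ?z] regular_kernel[OF c' x1, of ?z'] r by (simp_all add: slice_def)
  let ?i = "\<psi> (inv\<^bsub>Gh\<^esub> ?h)"
  have i: "?i (\<psi> ?h v) = v" "\<psi> ?h (?i v) = v" for v using psi_inv[OF h] by auto
  note Li = G0_lin[OF psi_G0[of "inv\<^bsub>Gh\<^esub> ?h"]]
  have "\<psi> ?h v \<in> gen_eigenspace (br ?z') 0" if "v \<in> gen_eigenspace (br ?z) 0" for v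
    by (rule gen_eigenspace_intertwine[of "br ?z'" 0 "\<psi> ?h" 1, OF _ lin_br lin_0[OF Lh(1)] that])
      (simp add: shift_def Lh(3) hz)
  moreover have "?i v \<in> gen_eigenspace (br ?z) 0" if "v \<in> gen_eigenspace (br ?z') 0" for v
  proof (rule gen_eigenspace_intertwine[of "br ?z" 0 ?i 1, OF _ lin_br _ that])
    show "?i 0 = 0" using Li h lin_0 by simp
    have "?i (br ?z' w) = br ?z (?i w)" for w using Li(3)[of ?z' w] h i(1)[of ?z] hz by simp
    then show "shift (br ?z) 0 (?i w) = sc 1 (?i (shift (br ?z') 0 w))" for w by (simp add: shift_def)
  qed
  ultimately have "\<psi> ?h ` centralizer c = centralizer c'"
    unfolding K[symmetric] using i
      by (metis (no_types, lifting) image_eqI image_subsetI subsetI subset_antisym)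
  then have "\<psi> ?h ` c = c'" by (rule centralizer_aut[OF hG _ c c'])
  then show thesis using that h by blast
qed

end

section \<open>Galois cohomology\<close>

lemma bij_quotient_image:
  assumes R: "R \<subseteq> C \<times> C" and img: "f ` C = K"
    and eq: "\<And>x y. x \<in> C \<Longrightarrow> y \<in> C \<Longrightarrow> f x = f y \<longleftrightarrow> (x, y) \<in> R"
  shows "\<exists>F. bij_betw F (C // R) K"
proof -
  let ?F = "\<lambda>X. f (SOME x. x \<in> X)"
  have cls: "R `` {x} = {y \<in> C. f x = f y}" if "x \<in> C" for x using R eq that by auto
  have F: "?F (R `` {x}) = f x" if "x \<in> C" for x
  proof -
    have "(SOME y. y \<in> R `` {x}) \<in> R `` {x}" by (rule someI[of _ x]) (simp add: cls that)
    then show ?thesis unfolding cls[OF that] by simp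
  qed
  have "bij_betw ?F (C // R) K"
  proof (rule bij_betw_imageI)
    show "inj_on ?F (C // R)"
    proof (rule inj_onI)
      fix X Y assume "X \<in> C // R" "Y \<in> C // R" and e: "?F X = ?F Y"
      then obtain x y where xy: "x \<in> C" "X = R `` {x}" "y \<in> C" "Y = R `` {y}" by (auto elim!: quotientE)
      then have "f x = f y" using e F by simp
      then show "X = Y" using xy cls by simp
    qed
    have "?F ` (C // R) = f ` C" using F by (force simp: quotient_def)
    then show "?F ` (C // R) = K" using img by simp
  qed
  then show ?thesis by blast
qed

context real_cover
begin

lemma tau_closed: "g \<in> carrier Gh \<Longrightarrow> \<tau> g \<in> carrier Gh" and tau_tau: "g \<in> carrier Gh \<Longrightarrow> \<tau> (\<tau> g) = g"
  and tau_mult: "g \<in> carrier Gh \<Longrightarrow> h \<in> carrier Gh \<Longrightarrow> \<tau> (g \<otimes>\<^bsub>Gh\<^esub> h) = \<tau> g \<otimes>\<^bsub>Gh\<^esub> \<tau> h"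
  and psi_tau: "g \<in> carrier Gh \<Longrightarrow> \<psi> (\<tau> g) = induced_involution \<sigma> (\<psi> g)"
  using cover unfolding real_reductive_cover_def antiregular_involution_def hom_def by auto

lemma tau_hom: "group_hom Gh Gh \<tau>"
  by unfold_locales (auto simp: hom_def tau_closed tau_mult)

lemma tau_inv: "g \<in> carrier Gh \<Longrightarrow> \<tau> (inv\<^bsub>Gh\<^esub> g) = inv\<^bsub>Gh\<^esub> \<tau> g"
  by (rule group_hom.hom_inv[OF tau_hom])

lemma psi_image_inv: "g \<in> carrier Gh \<Longrightarrow> \<psi> (inv\<^bsub>Gh\<^esub> g) ` (\<psi> g ` H) = H"
  "g \<in> carrier Gh \<Longrightarrow> \<psi> g ` (\<psi> (inv\<^bsub>Gh\<^esub> g) ` H) = H"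
  using psi_inv by (auto simp: image_image)

lemma psi_image_mult: "g \<in> carrier Gh \<Longrightarrow> h \<in> carrier Gh \<Longrightarrow> \<psi> (g \<otimes>\<^bsub>Gh\<^esub> h) ` H = \<psi> g ` (\<psi> h ` H)"
  by (simp add: psi_mult image_comp)

lemma psi_tau_image: "g \<in> carrier Gh \<Longrightarrow> \<sigma> ` H = H \<Longrightarrow> \<psi> (\<tau> g) ` H = \<sigma> ` (\<psi> g ` H)"
  unfolding psi_tau induced_involution_def image_comp[symmetric] by simp

lemma normalizer_subgroup: "subgroup (subspace_normalizer Gh \<psi> H) Gh"
proof (rule subgroupI)
  show "subspace_normalizer Gh \<psi> H \<noteq> {}" using psi_one
    by (auto simp: subspace_normalizer_def intro!: exI[of _ "\<one>\<^bsub>Gh\<^esub>"])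
next
  fix g assume "g \<in> subspace_normalizer Gh \<psi> H"
  then show "inv\<^bsub>Gh\<^esub> g \<in> subspace_normalizer Gh \<psi> H"
    using psi_image_inv(1)[of g H] by (simp add: subspace_normalizer_def)
qed (auto simp: subspace_normalizer_def psi_image_mult)

lemma cartan_image:
  assumes c: "cartan c" and g: "g \<in> carrier Gh" shows "cartan (\<psi> g ` c)"
proof -
  note C = cartanD[OF c]
  note L = G0_lin[OF psi_G0[OF g]]
  have ss: "semisimple_element sc br (\<psi> h x)" if h: "h \<in> carrier Gh" and x: "semisimple_element sc br x"
    for h x
    by (rule semisimple_aut[OF G0_lin[OF psi_G0[OF h]] x])
  have "subspace (\<psi> g ` c)"
  proof (rule subspaceI)
    show "0 \<in> \<psi> g ` c" using subspace_0[OF C(1)] lin_0[OF L(1)] by (metis imageI)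
    fix x y assume "x \<in> \<psi> g ` c" "y \<in> \<psi> g ` c"
    then obtain a b where "x = \<psi> g a" "y = \<psi> g b" "a \<in> c" "b \<in> c" by blast
    then show "x + y \<in> \<psi> g ` c" using subspace_add[OF C(1)] lin_add[OF L(1)] by (metis imageI)
  next
    fix k x assume "x \<in> \<psi> g ` c"
    then obtain a where "x = \<psi> g a" "a \<in> c" by blast
    then show "sc k x \<in> \<psi> g ` c" using subspace_scale[OF C(1)] lin_scale[OF L(1)] by (metis imageI)
  qed
  moreover have "y \<in> \<psi> g ` c" if y: "y \<in> gr 1" "semisimple_element sc br y" "y \<in> centralizer (\<psi> g ` c)" for y
  proof -
    let ?i = "\<psi> (inv\<^bsub>Gh\<^esub> g)"
    have gi: "inv\<^bsub>Gh\<^esub> g \<in> carrier Gh" using g by simp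
    have "br x (?i y) = 0" if "x \<in> c" for x
    proof -
      have "br (\<psi> g x) y = 0" using y(3) that by (simp add: centralizer_def)
      then have "?i (br (\<psi> g x) y) = 0" using lin_0[OF G0_lin(1)[OF psi_G0[OF gi]]] by simp
      then show ?thesis using G0_lin(3)[OF psi_G0[OF gi]] psi_inv(1)[OF g] by simp
    qed
    then have "?i y \<in> c"
      by (intro C(5) gr_G0[OF psi_G0[OF gi] y(1)] ss[OF gi y(2)]) (simp add: centralizer_def)
    then show ?thesis using psi_inv(2)[OF g, of y] by (metis imageI)
  qed
  ultimately show ?thesis unfolding cartan_def
    using C(2-4) ss[OF g] gr_G0[OF psi_G0[OF g]] L(3) lin_0[OF L(1)] by (auto simp flip: L(3))
qed

lemma inv_cancel:
  assumes "g \<in> carrier Gh" "x \<in> carrier Gh"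
  shows "g \<otimes>\<^bsub>Gh\<^esub> (inv\<^bsub>Gh\<^esub> g \<otimes>\<^bsub>Gh\<^esub> x) = x" "inv\<^bsub>Gh\<^esub> g \<otimes>\<^bsub>Gh\<^esub> (g \<otimes>\<^bsub>Gh\<^esub> x) = x"
  using assms by (simp_all add: m_assoc[symmetric])

lemma cohomologous_iff:
  assumes N: "subgroup N Gh"
  shows "(a, b) \<in> cohomologous (Gh\<lparr>carrier := N\<rparr>) \<tau> \<longleftrightarrow> a \<in> N \<and> b \<in> N \<and> a \<otimes>\<^bsub>Gh\<^esub> \<tau> a = \<one>\<^bsub>Gh\<^esub> \<and> b \<otimes>\<^bsub>Gh\<^esub> \<tau> b = \<one>\<^bsub>Gh\<^esub> \<and>
    (\<exists>h\<in>N. a = inv\<^bsub>Gh\<^esub> h \<otimes>\<^bsub>Gh\<^esub> b \<otimes>\<^bsub>Gh\<^esub> \<tau> h)"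
  unfolding cohomologous_def galois_cocycles_def using m_inv_consistent[OF N] by auto

lemma cohomologous_trivial:
  assumes g: "g \<in> carrier Gh"
  shows "(inv\<^bsub>Gh\<^esub> g \<otimes>\<^bsub>Gh\<^esub> \<tau> g) \<otimes>\<^bsub>Gh\<^esub> \<tau> (inv\<^bsub>Gh\<^esub> g \<otimes>\<^bsub>Gh\<^esub> \<tau> g) = \<one>\<^bsub>Gh\<^esub>"
proof -
  have "\<tau> (inv\<^bsub>Gh\<^esub> g \<otimes>\<^bsub>Gh\<^esub> \<tau> g) = inv\<^bsub>Gh\<^esub> \<tau> g \<otimes>\<^bsub>Gh\<^esub> g"
    using g by (simp add: tau_mult tau_closed tau_inv tau_tau)
  then show ?thesis using g by (simp add: m_assoc inv_cancel tau_closed)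
qed

lemma equiv_cohomologous:
  assumes N: "subgroup N Gh" and stable: "\<And>n. n \<in> N \<Longrightarrow> \<tau> n \<in> N"
  shows "equiv (galois_cocycles (Gh\<lparr>carrier := N\<rparr>) \<tau>) (cohomologous (Gh\<lparr>carrier := N\<rparr>) \<tau>)"
proof (rule equivI)
  have NG: "n \<in> carrier Gh" if "n \<in> N" for n using N that by (rule subgroup.mem_carrier)
  show "cohomologous (Gh\<lparr>carrier := N\<rparr>) \<tau> \<subseteq> galois_cocycles (Gh\<lparr>carrier := N\<rparr>) \<tau> \<times> galois_cocycles (Gh\<lparr>carrier := N\<rparr>) \<tau>"
    by (auto simp: cohomologous_def)
  show "refl_on (galois_cocycles (Gh\<lparr>carrier := N\<rparr>) \<tau>) (cohomologous (Gh\<lparr>carrier := N\<rparr>) \<tau>)"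
  proof (rule refl_onI)
    fix a assume a: "a \<in> galois_cocycles (Gh\<lparr>carrier := N\<rparr>) \<tau>"
    have "a = inv\<^bsub>Gh\<^esub> \<one>\<^bsub>Gh\<^esub> \<otimes>\<^bsub>Gh\<^esub> a \<otimes>\<^bsub>Gh\<^esub> \<tau> \<one>\<^bsub>Gh\<^esub>"
      using a NG group_hom.hom_one[OF tau_hom] by (simp add: galois_cocycles_def)
    then show "(a, a) \<in> cohomologous (Gh\<lparr>carrier := N\<rparr>) \<tau>"
      unfolding cohomologous_iff[OF N]
      using a subgroup.one_closed[OF N] by (intro conjI bexI[of _ "\<one>\<^bsub>Gh\<^esub>"])
        (simp_all add: galois_cocycles_def)
  qed
  show "sym (cohomologous (Gh\<lparr>carrier := N\<rparr>) \<tau>)"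
  proof (rule symI)
    fix a b assume ab: "(a, b) \<in> cohomologous (Gh\<lparr>carrier := N\<rparr>) \<tau>"
    then obtain h where h: "h \<in> N" "a = inv\<^bsub>Gh\<^esub> h \<otimes>\<^bsub>Gh\<^esub> b \<otimes>\<^bsub>Gh\<^esub> \<tau> h" "b \<in> N" unfolding cohomologous_iff[OF N]
      by blast
    have hG: "h \<in> carrier Gh" "b \<in> carrier Gh" "\<tau> h \<in> carrier Gh" using NG h tau_closed by auto
    have "b = inv\<^bsub>Gh\<^esub> (inv\<^bsub>Gh\<^esub> h) \<otimes>\<^bsub>Gh\<^esub> a \<otimes>\<^bsub>Gh\<^esub> \<tau> (inv\<^bsub>Gh\<^esub> h)"
      using hG NG[OF h(1)] h(2) by (simp add: tau_inv m_assoc inv_cancel)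
    then show "(b, a) \<in> cohomologous (Gh\<lparr>carrier := N\<rparr>) \<tau>"
      using ab subgroup.m_inv_closed[OF N h(1)] unfolding cohomologous_iff[OF N] by metis
  qed
  show "trans (cohomologous (Gh\<lparr>carrier := N\<rparr>) \<tau>)"
  proof (rule transI)
    fix a b c assume ab: "(a, b) \<in> cohomologous (Gh\<lparr>carrier := N\<rparr>) \<tau>" and bc:
      "(b, c) \<in> cohomologous (Gh\<lparr>carrier := N\<rparr>) \<tau>"
    obtain h where h: "h \<in> N" "a = inv\<^bsub>Gh\<^esub> h \<otimes>\<^bsub>Gh\<^esub> b \<otimes>\<^bsub>Gh\<^esub> \<tau> h" using ab unfolding cohomologous_iff[OF N]
      by blast
    obtain k where k: "k \<in> N" "b = inv\<^bsub>Gh\<^esub> k \<otimes>\<^bsub>Gh\<^esub> c \<otimes>\<^bsub>Gh\<^esub> \<tau> k" "c \<in> N" using bc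
      unfolding cohomologous_iff[OF N] by blast
    have G: "h \<in> carrier Gh" "k \<in> carrier Gh" "c \<in> carrier Gh" "\<tau> h \<in> carrier Gh" "\<tau> k \<in> carrier Gh"
      using NG h k tau_closed by auto
    have "a = inv\<^bsub>Gh\<^esub> (k \<otimes>\<^bsub>Gh\<^esub> h) \<otimes>\<^bsub>Gh\<^esub> c \<otimes>\<^bsub>Gh\<^esub> \<tau> (k \<otimes>\<^bsub>Gh\<^esub> h)"
      using G h k by (simp add: tau_mult inv_mult_group m_assoc)
    then show "(a, c) \<in> cohomologous (Gh\<lparr>carrier := N\<rparr>) \<tau>"
      using ab bc subgroup.m_closed[OF N k(1) h(1)] unfolding cohomologous_iff[OF N] by metis
  qed
qed

text \<open>Cohomologous cocycles of \<open>N\<close> stay cohomologous in \<open>Gh\<close>, so a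
  class lies in the kernel exactly when one representative is cohomologous to 1 in
  \<open>Gh\<close>, that is, of the form \<open>inv g \<otimes> \<tau> g\<close>.\<close>

lemma kernel_characterization:
  assumes N: "subgroup N Gh" and stable: "\<And>n. n \<in> N \<Longrightarrow> \<tau> n \<in> N"
  shows "\<Gamma> \<in> H1_kernel Gh \<tau> N \<longleftrightarrow>
    (\<exists>a\<in>N. (\<exists>g\<in>carrier Gh. a = inv\<^bsub>Gh\<^esub> g \<otimes>\<^bsub>Gh\<^esub> \<tau> g) \<and> \<Gamma> = cohomologous (Gh\<lparr>carrier := N\<rparr>) \<tau> `` {a})"
proof -
  let ?c = "cohomologous (Gh\<lparr>carrier := N\<rparr>) \<tau>" and ?cG = "cohomologous Gh \<tau>"
  have full: "Gh\<lparr>carrier := carrier Gh\<rparr> = Gh" by simp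
  note eqN = equiv_cohomologous[OF N stable]
  note eqG = equiv_cohomologous[OF subgroup_self tau_closed, unfolded full]
  note iffG = cohomologous_iff[OF subgroup_self, unfolded full]
  have NG: "n \<in> carrier Gh" if "n \<in> N" for n using N that by (rule subgroup.mem_carrier)
  have sub: "(a, b) \<in> ?cG" if "(a, b) \<in> ?c" for a b
    using that NG unfolding cohomologous_iff[OF N] iffG by blast
  have one: "\<one>\<^bsub>Gh\<^esub> \<in> galois_cocycles Gh \<tau>"
    using group_hom.hom_one[OF tau_hom] by (simp add: galois_cocycles_def)
  have triv: "?cG `` (?c `` {a}) = ?cG `` {\<one>\<^bsub>Gh\<^esub>} \<longleftrightarrow> (\<exists>g\<in>carrier Gh. a = inv\<^bsub>Gh\<^esub> g \<otimes>\<^bsub>Gh\<^esub> \<tau> g)"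
    if a: "a \<in> galois_cocycles (Gh\<lparr>carrier := N\<rparr>) \<tau>" for a
  proof -
    have aG: "a \<in> galois_cocycles Gh \<tau>" using a NG by (auto simp: galois_cocycles_def)
    have "(a, a) \<in> ?c" using eqN a by (meson equiv_def refl_onD)
    moreover have "?cG `` {b} = ?cG `` {a}" if "b \<in> ?c `` {a}" for b
      using equiv_class_eq[OF eqG sub] that by blast
    ultimately have "?cG `` (?c `` {a}) = ?cG `` {a}" by blast
    then have "?cG `` (?c `` {a}) = ?cG `` {\<one>\<^bsub>Gh\<^esub>} \<longleftrightarrow> (a, \<one>\<^bsub>Gh\<^esub>) \<in> ?cG"
      using eq_equiv_class_iff[OF eqG aG one] by simp
    also have "\<dots> \<longleftrightarrow> (\<exists>g\<in>carrier Gh. a = inv\<^bsub>Gh\<^esub> g \<otimes>\<^bsub>Gh\<^esub> \<tau> g)"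
      using aG one unfolding iffG by (auto simp: galois_cocycles_def tau_closed)
    finally show ?thesis .
  qed
  have coc: "a \<in> galois_cocycles (Gh\<lparr>carrier := N\<rparr>) \<tau>" if "a \<in> N" "g \<in> carrier Gh" "a = inv\<^bsub>Gh\<^esub> g \<otimes>\<^bsub>Gh\<^esub> \<tau> g"
    for a g
    using that cohomologous_trivial[OF that(2)] by (simp add: galois_cocycles_def)
  show ?thesis
    unfolding H1_kernel_def H1_inclusion_def galois_H1_def mem_Collect_eq
  proof (rule iffI, elim conjE)
    assume "\<Gamma> \<in> galois_cocycles (Gh\<lparr>carrier := N\<rparr>) \<tau> // ?c" and G: "?cG `` \<Gamma> = ?cG `` {\<one>\<^bsub>Gh\<^esub>}"
    then obtain a where a: "a \<in> galois_cocycles (Gh\<lparr>carrier := N\<rparr>) \<tau>" "\<Gamma> = ?c `` {a}"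
      by (auto elim: quotientE)
    have "a \<in> N" using a(1) by (simp add: galois_cocycles_def)
    then show "\<exists>a\<in>N. (\<exists>g\<in>carrier Gh. a = inv\<^bsub>Gh\<^esub> g \<otimes>\<^bsub>Gh\<^esub> \<tau> g) \<and> \<Gamma> = ?c `` {a}"
      using triv[OF a(1)] G a(2) by blast
  next
    assume "\<exists>a\<in>N. (\<exists>g\<in>carrier Gh. a = inv\<^bsub>Gh\<^esub> g \<otimes>\<^bsub>Gh\<^esub> \<tau> g) \<and> \<Gamma> = ?c `` {a}"
    then obtain a g where a: "a \<in> N" "g \<in> carrier Gh" "a = inv\<^bsub>Gh\<^esub> g \<otimes>\<^bsub>Gh\<^esub> \<tau> g" "\<Gamma> = ?c `` {a}" by blast
    note c = coc[OF a(1-3)]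
    show "\<Gamma> \<in> galois_cocycles (Gh\<lparr>carrier := N\<rparr>) \<tau> // ?c \<and> ?cG `` \<Gamma> = ?cG `` {\<one>\<^bsub>Gh\<^esub>}"
      using triv[OF c] a quotientI[OF c] by blast
  qed
qed

text \<open>A class of the kernel is represented by \<open>inv g \<otimes> \<tau> g\<close>; it corresponds to the real points of
  the image of the complexified Cartan subspace under \<open>g\<close>.\<close>

theorem bij_classes_kernel:
  assumes h: "real_cartan h"
  defines "N \<equiv> subspace_normalizer Gh \<psi> (span h)"
  shows "\<exists>f. bij_betw f (real_conjugacy_classes Gh \<tau> \<psi> {c. real_cartan c}) (H1_kernel Gh \<tau> N)"
proof -
  let ?H = "span h" and ?GN = "Gh\<lparr>carrier := N\<rparr>"
  let ?coh = "cohomologous ?GN \<tau>"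
  let ?C = "{c. real_cartan c}"
  let ?R = "{(H, H'). H \<in> ?C \<and> H' \<in> ?C \<and> (\<exists>g\<in>real_points \<tau> (carrier Gh). H' = \<psi> g ` H)}"
  note N = normalizer_subgroup[of ?H, folded N_def]
  have NG: "n \<in> carrier Gh" if "n \<in> N" for n using that by (simp add: N_def subspace_normalizer_def)
  have Nimg: "\<psi> n ` ?H = ?H" if "n \<in> N" for n using that by (simp add: N_def subspace_normalizer_def)
  have NI: "n \<in> N" if "n \<in> carrier Gh" "\<psi> n ` ?H = ?H" for n using that
    by (simp add: N_def subspace_normalizer_def)
  have sH: "\<sigma> ` ?H = ?H" by (rule span_real_fixed(2)[OF h])
  have sig2: "\<sigma> ` \<sigma> ` X = X" for X by (simp add: image_image sigma_sigma)
  \<comment> \<open>The span of a real Cartan subspace is stable under \<sigma>, so its normalizer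
    is stable under \<tau>.\<close>
  have Nst: "\<tau> n \<in> N" if "n \<in> N" for n
    using psi_tau_image[OF NG[OF that] sH] Nimg[OF that] sH tau_closed[OF NG[OF that]]
      by (auto intro: NI simp del: image_image)
  note eqv = equiv_cohomologous[OF N Nst]
  let ?z = "\<lambda>g. inv\<^bsub>Gh\<^esub> g \<otimes>\<^bsub>Gh\<^esub> \<tau> g"
  have zG: "?z g \<in> carrier Gh" if "g \<in> carrier Gh" for g using that tau_closed by simp
  \<comment> \<open>\<open>g\<close> transports the fixed complex Cartan subspace to the span of
    \<open>c\<close>. The class of \<open>?z g\<close> will be the invariant of \<open>c\<close>: by
    \<open>zmult\<close>, changing \<open>g\<close> by an element of the normalizer gives a
    cohomologous cocycle.\<close>
  define T where "T g c \<longleftrightarrow> g \<in> carrier Gh \<and> \<psi> g ` ?H = span c" for g c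
  have T_ex: "\<exists>g. T g c" if c: "real_cartan c" for c
    using cartan_conjugate[OF complexification_cartan[OF h] complexification_cartan[OF c]] unfolding T_def
      by metis
  have T_zN: "?z g \<in> N" if c: "real_cartan c" and g: "T g c" for g c
  proof (rule NI)
    have gG: "g \<in> carrier Gh" and gi: "\<psi> g ` ?H = span c" using g by (auto simp: T_def)
    show "?z g \<in> carrier Gh" by (rule zG[OF gG])
    have "\<psi> (\<tau> g) ` ?H = span c"
      using psi_tau_image[OF gG sH] gi span_real_fixed(2)[OF c] by simp
    then have "\<psi> (?z g) ` ?H = \<psi> (inv\<^bsub>Gh\<^esub> g) ` (\<psi> g ` ?H)" using gG gi tau_closed
      by (simp add: psi_image_mult)
    then show "\<psi> (?z g) ` ?H = ?H" using psi_image_inv(1)[OF gG] by simp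
  qed
  have T_coc: "?z g \<in> galois_cocycles ?GN \<tau>" if "real_cartan c" "T g c" for g c
    using T_zN[OF that] cohomologous_trivial[of g] that(2) by (simp add: galois_cocycles_def T_def)
  have zmult: "?z (g \<otimes>\<^bsub>Gh\<^esub> n) = inv\<^bsub>Gh\<^esub> n \<otimes>\<^bsub>Gh\<^esub> ?z g \<otimes>\<^bsub>Gh\<^esub> \<tau> n" if "g \<in> carrier Gh" "n \<in> carrier Gh" for g n
    using that tau_closed by (simp add: tau_mult inv_mult_group m_assoc)
  \<comment> \<open>An element fixed by \<tau> acts by a map commuting with \<sigma>, so it takes
    the real points of one span to those of the other.\<close>
  have real_of_span: "\<psi> k ` c = c'" if c: "real_cartan c" and c': "real_cartan c'" and k: "k \<in> carrier Gh"
    "\<tau> k = k"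
    and kc: "\<psi> k ` span c = span c'" for k c c'
  proof -
    have comm: "\<sigma> (\<psi> k x) = \<psi> k (\<sigma> x)" for x
    proof -
      have "\<psi> k = induced_involution \<sigma> (\<psi> k)" using psi_tau[OF k(1)] k(2) by simp
      then have "\<psi> k (\<sigma> x) = \<sigma> (\<psi> k (\<sigma> (\<sigma> x)))" by (metis comp_apply induced_involution_def)
      then show ?thesis by (simp add: sigma_sigma)
    qed
    have inj: "\<psi> k x = \<psi> k y \<Longrightarrow> x = y" for x y using psi_inv(1)[OF k(1)] by metis
    have fixed: "\<sigma> (\<psi> k x) = \<psi> k x \<longleftrightarrow> \<sigma> x = x" for x unfolding comm using inj[of "\<sigma> x" x] by metis
    have "{y \<in> \<psi> k ` span c. \<sigma> y = y} = \<psi> k ` {x \<in> span c. \<sigma> (\<psi> k x) = \<psi> k x}" by fast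
    then have "\<psi> k ` {x \<in> span c. \<sigma> x = x} = {x \<in> span c'. \<sigma> x = x}" unfolding fixed kc by (rule sym)
    then show ?thesis using span_real_fixed(1)[OF c] span_real_fixed(1)[OF c'] by simp
  qed
  have span_image: "span (\<psi> k ` c) = \<psi> k ` span c" if "k \<in> carrier Gh" for k c
    using module_hom.span_image[of sc sc "\<psi> k" c] G0_lin(1)[OF psi_G0[OF that]]
    by (simp add: module_hom_iff_linear)
  have key: "(c, c') \<in> ?R \<longleftrightarrow> (?z g, ?z g') \<in> ?coh"
    if c: "real_cartan c" and g: "T g c" and c': "real_cartan c'" and g': "T g' c'" for c c' g g'
  proof
    have G: "g \<in> carrier Gh" "g' \<in> carrier Gh" "\<tau> g \<in> carrier Gh" "\<tau> g' \<in> carrier Gh"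
      using g g' tau_closed by (auto simp: T_def)
    have im: "\<psi> g ` ?H = span c" "\<psi> g' ` ?H = span c'" using g g' by (auto simp: T_def)
    {
      assume "(c, c') \<in> ?R"
      then obtain k where k: "k \<in> carrier Gh" "\<tau> k = k" "c' = \<psi> k ` c" by (auto simp: real_points_def)
      \<comment> \<open>Both \<open>k \<otimes> g\<close> and \<open>g'\<close> carry the fixed
        subspace to the span of \<open>c'\<close>, so they differ by an element of the normalizer;
        and since \<open>k\<close> is real, \<open>?z (k \<otimes> g) = ?z g\<close>.\<close>
      let ?n = "inv\<^bsub>Gh\<^esub> g' \<otimes>\<^bsub>Gh\<^esub> (k \<otimes>\<^bsub>Gh\<^esub> g)"
      have nG: "?n \<in> carrier Gh" using G k by simp
      have "\<psi> ?n ` ?H = \<psi> (inv\<^bsub>Gh\<^esub> g') ` (\<psi> k ` span c)" using G k im by (simp add: psi_image_mult)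
      also have "\<psi> k ` span c = \<psi> g' ` ?H" using span_image[OF k(1), of c] k(3) im by simp
      finally have n: "?n \<in> N" using psi_image_inv(1)[OF G(2)] by (intro NI[OF nG]) simp
      have kg: "k \<otimes>\<^bsub>Gh\<^esub> g = g' \<otimes>\<^bsub>Gh\<^esub> ?n" using G k by (simp add: m_assoc[symmetric])
      have "?z g = ?z (k \<otimes>\<^bsub>Gh\<^esub> g)"
        using zmult[OF k(1) G(1)] k G by simp
      also have "\<dots> = ?z (g' \<otimes>\<^bsub>Gh\<^esub> ?n)" by (rule arg_cong[OF kg, of ?z])
      also have "\<dots> = inv\<^bsub>Gh\<^esub> ?n \<otimes>\<^bsub>Gh\<^esub> ?z g' \<otimes>\<^bsub>Gh\<^esub> \<tau> ?n" by (rule zmult[OF G(2) nG])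
      finally have "?z g = inv\<^bsub>Gh\<^esub> ?n \<otimes>\<^bsub>Gh\<^esub> ?z g' \<otimes>\<^bsub>Gh\<^esub> \<tau> ?n" .
      then show "(?z g, ?z g') \<in> ?coh" unfolding cohomologous_iff[OF N]
        using T_zN[OF c g] T_zN[OF c' g'] cohomologous_trivial[OF G(1)] cohomologous_trivial[OF G(2)] n
          by blast
    next
      assume "(?z g, ?z g') \<in> ?coh"
      then obtain n where n: "n \<in> N" "?z g = inv\<^bsub>Gh\<^esub> n \<otimes>\<^bsub>Gh\<^esub> ?z g' \<otimes>\<^bsub>Gh\<^esub> \<tau> n" unfolding cohomologous_iff[OF N]
        by blast
      have nG: "n \<in> carrier Gh" "\<tau> n \<in> carrier Gh" using NG[OF n(1)] tau_closed by auto
      let ?m = "g' \<otimes>\<^bsub>Gh\<^esub> n"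
      have mG: "?m \<in> carrier Gh" "\<tau> ?m \<in> carrier Gh" using G nG tau_closed by auto
      have zz: "?z g = ?z ?m" using n(2) zmult[OF G(2) nG(1)] by simp
      \<comment> \<open>Since \<open>?z g = ?z ?m\<close>, the quotient of \<open>?m\<close> by
        \<open>g\<close> is fixed by \<tau>.\<close>
      let ?k = "?m \<otimes>\<^bsub>Gh\<^esub> inv\<^bsub>Gh\<^esub> g"
      have kG: "?k \<in> carrier Gh" using mG G by simp
      have "\<tau> ?k = \<tau> ?m \<otimes>\<^bsub>Gh\<^esub> inv\<^bsub>Gh\<^esub> \<tau> g" using mG G by (simp add: tau_mult tau_inv)
      also have "\<tau> ?m = ?m \<otimes>\<^bsub>Gh\<^esub> ?z ?m" using mG by (simp add: m_assoc[symmetric])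
      also have "?z ?m = ?z g" using zz by simp
      also have "?m \<otimes>\<^bsub>Gh\<^esub> ?z g \<otimes>\<^bsub>Gh\<^esub> inv\<^bsub>Gh\<^esub> \<tau> g = ?m \<otimes>\<^bsub>Gh\<^esub> inv\<^bsub>Gh\<^esub> g \<otimes>\<^bsub>Gh\<^esub> (\<tau> g \<otimes>\<^bsub>Gh\<^esub> inv\<^bsub>Gh\<^esub> \<tau> g)"
        using mG G by (simp add: m_assoc del: r_inv)
      also have "\<dots> = ?k" using mG G by simp
      finally have k: "\<tau> ?k = ?k" .
      have "\<psi> ?k ` span c = \<psi> ?m ` (\<psi> (inv\<^bsub>Gh\<^esub> g) ` (\<psi> g ` ?H))"
        unfolding im(1) using mG G by (intro psi_image_mult) simp_all
      also have "\<dots> = span c'"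
        unfolding psi_image_inv(1)[OF G(1)] psi_image_mult[OF G(2) nG(1)] Nimg[OF n(1)] by (rule im(2))
      finally have "\<psi> ?k ` c = c'" by (rule real_of_span[OF c c' kG k])
      then show "(c, c') \<in> ?R" using c c' kG k by (auto simp: real_points_def)
    }
  qed
  \<comment> \<open>\<open>\<tau> g = g \<otimes> a\<close> with \<open>a\<close> in the normalizer,
    so the image of the span under \<open>g\<close> is stable under \<sigma> and is spanned by a
    real Cartan subspace.\<close>
  have surj: "\<exists>c g. real_cartan c \<and> T g c \<and> ?z g = a"
    if a: "a \<in> N" "g \<in> carrier Gh" "a = ?z g" for a g
  proof -
    let ?c = "\<psi> g ` ?H"
    have cc: "cartan ?c" by (rule cartan_image[OF complexification_cartan[OF h] a(2)])
    have "\<tau> g = g \<otimes>\<^bsub>Gh\<^esub> a" using a tau_closed by (simp add: m_assoc[symmetric])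
    then have "\<psi> (\<tau> g) ` ?H = ?c" using psi_image_mult[OF a(2) NG[OF a(1)]] Nimg[OF a(1)] by simp
    then have st: "\<sigma> ` ?c = ?c" using psi_tau_image[OF a(2) sH] by simp
    have "real_cartan {x \<in> ?c. \<sigma> x = x}" "span {x \<in> ?c. \<sigma> x = x} = ?c"
      using real_cartan_of_stable[OF cc] st by blast+
    then show ?thesis using a unfolding T_def by blast
  qed
  have kernel_iff: "\<Gamma> \<in> H1_kernel Gh \<tau> N \<longleftrightarrow> (\<exists>a\<in>N. (\<exists>g\<in>carrier Gh. a = ?z g) \<and> \<Gamma> = ?coh `` {a})" for \<Gamma>
    by (rule kernel_characterization[OF N Nst])
  define f where "f c = ?coh `` {?z (SOME g. T g c)}" for c
  have f_eq: "f c = ?coh `` {?z g}" if c: "real_cartan c" and g: "T g c" for c g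
  proof -
    have s: "T (SOME g. T g c) c" using T_ex[OF c] by (rule someI_ex)
    \<comment> \<open>The class is independent of the transporting element: apply \<open>key\<close>
      to \<open>c\<close> and itself.\<close>
    have "(c, c) \<in> ?R" using c psi_one group_hom.hom_one[OF tau_hom]
      by (auto simp: real_points_def intro!: bexI[of _ "\<one>\<^bsub>Gh\<^esub>"])
    then have "(?z (SOME g. T g c), ?z g) \<in> ?coh" using key[OF c s c g] by blast
    from equiv_class_eq[OF eqv this] show ?thesis unfolding f_def .
  qed
  have f_iff: "f c = f c' \<longleftrightarrow> (c, c') \<in> ?R" if c: "real_cartan c" and c': "real_cartan c'" for c c'
  proof -
    obtain g g' where g: "T g c" "T g' c'" using T_ex c c' by blast
    have "f c = f c' \<longleftrightarrow> (?z g, ?z g') \<in> ?coh"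
      unfolding f_eq[OF c g(1)] f_eq[OF c' g(2)]
      by (rule eq_equiv_class_iff[OF eqv T_coc[OF c g(1)] T_coc[OF c' g(2)]])
    then show ?thesis using key[OF c g(1) c' g(2)] by blast
  qed
  have f_img: "f ` ?C = H1_kernel Gh \<tau> N"
  proof (intro equalityI subsetI)
    fix \<Gamma> assume "\<Gamma> \<in> f ` ?C"
    then obtain c where c: "real_cartan c" "\<Gamma> = f c" by blast
    obtain g where g: "T g c" using T_ex c by blast
    then show "\<Gamma> \<in> H1_kernel Gh \<tau> N"
      unfolding kernel_iff using f_eq[OF c(1) g] T_zN[OF c(1) g] c(2) by (auto simp: T_def)
  next
    fix \<Gamma> assume "\<Gamma> \<in> H1_kernel Gh \<tau> N"
    then obtain a g where a: "a \<in> N" "g \<in> carrier Gh" "a = ?z g" "\<Gamma> = ?coh `` {a}" unfolding kernel_iff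
      by blast
    obtain c g' where c: "real_cartan c" "T g' c" "?z g' = a" using surj[OF a(1-3)] by blast
    then have "\<Gamma> = f c" using f_eq[OF c(1,2)] a(4) by simp
    then show "\<Gamma> \<in> f ` ?C" using c(1) by blast
  qed
  have classes: "real_conjugacy_classes Gh \<tau> \<psi> ?C = ?C // ?R" by (simp add: real_conjugacy_classes_def)
  show ?thesis unfolding classes by (rule bij_quotient_image[OF _ f_img]) (use f_iff in auto)
qed

end

theorem theorem4p7:
  fixes sc :: "complex \<Rightarrow> 'v::ab_group_add \<Rightarrow> 'v"
    and br :: "'v \<Rightarrow> 'v \<Rightarrow> 'v"
    and m :: nat and gr :: "int \<Rightarrow> 'v set"
    and \<omega> :: complex and \<theta> :: "'v \<Rightarrow> 'v"
    and \<sigma> :: "'v \<Rightarrow> 'v"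
    and G0 :: "('v \<Rightarrow> 'v) set"
    and Gh :: "'g monoid" and A :: "('g \<Rightarrow> complex) set"
    and \<tau> :: "'g \<Rightarrow> 'g" and \<psi> :: "'g \<Rightarrow> 'v \<Rightarrow> 'v"
    and \<h> :: "'v set"
  assumes "semisimple_lie_algebra sc br"
    and "cyclic_grading sc br m gr"
    and "grading_automorphism sc br m gr \<omega> \<theta>"
    and "real_structure sc br \<sigma>"
    and "\<And>i. \<sigma> ` gr i \<subseteq> gr i"
    and "connected_subgroup_with_lie_algebra sc br (gr 0) G0"
    and "real_reductive_cover sc \<sigma> G0 Gh A \<tau> \<psi>"
    and "real_cartan_subspace sc br (real_points \<sigma> (gr 1)) \<h>"
  shows "\<exists>f. bij_betw f
      (real_conjugacy_classes Gh \<tau> \<psi> {\<c>. real_cartan_subspace sc br (real_points \<sigma> (gr 1)) \<c>})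
      (H1_kernel Gh \<tau> (subspace_normalizer Gh \<psi> (module.span sc \<h>)))"
proof -
  obtain B where V: "vector_space sc" and B: "finite B" "module.span sc B = UNIV"
    using assms(1) unfolding semisimple_lie_algebra_def complex_lie_algebra_def by blast
  interpret V: vector_space sc by fact
  \<comment> \<open>The locale works with a fixed basis and fixed generators of the coordinate ring;
    both are extracted here from the finiteness assumptions.\<close>
  obtain Basis where Basis: "Basis \<subseteq> B" "\<not> V.dependent Basis" "B \<subseteq> V.span Basis"
    using V.maximal_independent_subset by blast
  have "V.span Basis = UNIV" using V.span_mono[OF Basis(3)] B(2) V.span_span by auto
  moreover have "finite Basis" using Basis(1) B(1) by (rule finite_subset)
  moreover obtain FA where "finite FA" "A = generated_algebra (carrier Gh) FA"
    using assms(7)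
    unfolding real_reductive_cover_def reductive_group_def affine_algebraic_group_def affine_variety_def
    by blast
  ultimately interpret real_cover sc Basis br m gr \<omega> \<theta> \<sigma> G0 Gh A \<tau> \<psi> FA
    using Basis(2) assms by unfold_locales
  show ?thesis by (rule bij_classes_kernel[unfolded real_cartan_def, OF assms(8)])
qed

end
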